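(* Let $f\colon M\to \mathbb{Q}^4_c$ be a non-minimal simply-connected oriented surface with metric $ds^2$ on $M$, and fix a sign $\pm$. If $\bar{\mathcal{M}}^{\pm}(f)=\mathbb{S}^1$ and $\tau^{v}(G_{\pm})\neq 0$ everywhere on $M$, then the conformal metric $$d\hat{s}^2=\frac{\|\tau^{v}(G_{\pm})\|^2}{4\|\mathcal{H}^{\pm}\|^2}\, ds^2$$ has Gaussian curvature $\hat{K}=-1$.
   Context: **Setting.** $\mathbb{Q}^4_c$ is the complete simply-connected oriented 4-dimensional Riemannian manifold of constant sectional curvature $c$. $M$ is a connected, oriented 2-dimensional Riemannian manifold and a surface $f\colon M\to\mathbb{Q}^4_c$ is an isometric immersion. $N_fM$ is the normal bundle with induced metric and orientation, $\nabla^\perp$ the normal connection, $\alpha$ the second fundamental form, $H=\frac12\mathrm{trace}\,\alpha$ the mean curvature vector field (non-minimal: $H\not\equiv0$), $K$ the Gaussian curvature, $K_N=\langle R^\perp(e_1,e_2)e_4,e_3\rangle$ the normal curvature (positively oriented orthonormal frames of $TM$, $N_fM$), $J$, $J^\perp$ the rotations by $+\pi/2$ in $TM$, $N_fM$. Signs $\pm$ are taken consistently. $\|\mathcal{H}^\pm\|=\sqrt{\|H\|^2-(K-c)\mp K_N}$, with zero set denoted $M_0^\pm(f)$; under the hypotheses of the claim this function has no zeros on $M$. **Gauss lifts.** The twistor bundle of $\mathbb{Q}^4_c$ is the set of pairs $(p,\tilde J)$, $\tilde J$ an orthogonal complex structure on $T_p\mathbb{Q}^4_c$, with components $\mathcal{Z}_\pm$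 according to the induced orientation, endowed with the metric $g_1$ making the projection to $\mathbb{Q}^4_c$ a Riemannian submersion with horizontal distribution induced by the Levi-Civita connection and fibres round spheres with the canonical metric. The Gauss lift $G_\pm\colon M\to(\mathcal{Z}_\pm,g_1)$ is $G_\pm(p)=(f(p),\tilde J_\pm)$ with $\tilde J_\pm=f_*\circ J$ on $f_*T_pM$ and $\tilde J_\pm=\pm J^\perp$ on $N_fM(p)$. $\tau^v(G_\pm)$ is the vertical component of its tension field; its squared length is $\|\tau^v(G_\pm)\|^2=4\big((H^3_1\mp H^4_2)^2+(H^3_2\pm H^4_1)^2\big)$, where $H^a_j=\langle\nabla^\perp_{e_j}H,e_a\rangle$ for positively oriented orthonormal frames $\{e_1,e_2\}$, $\{e_3,e_4\}$ of $TM$, $N_fM$. **Moduli components.** Isometric immersions $f,\tilde f\colon M\to\mathbb{Q}^4_c$ have the same mean curvature if there is a parallel vector bundle isometry $T\colon N_fM\to N_{\tilde f}M$ with $TH=\tilde H$ (always taken orientation-preserving, after composing $\tilde f$ with an orientation-reversing isometry if necessary). $\mathcal{M}(f)$ is the set of all such $\tilde f$ modulo orientation-preserving isometries of $\mathbb{Q}^4_c$. With $\Phi=\alpha(\partial_z,\partial_z)dz^2$ the Hopf differential and $\Phi^\pm=\frac12(\Phi\pm iJ^\perp\Phi)$, let $Q^\pm_{f,\tilde f}=\Phi^\pm-T^{-1}\circ\tilde\Phi^\pm$ for non-minimal $f$. $\bar{\mathcal{M}}^\pm(f)$ is the set of classes $\tilde f\in\mathcal{M}(f)$ with $Q^\mp_{f,\tilde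 f}\equiv0$ (it contains $f$). If $\tilde f\in\bar{\mathcal{M}}^\pm(f)$ is not the class of $f$, then $T^{-1}\circ\tilde\Phi^\pm=e^{\mp i\theta^\pm}\Phi^\pm$ on $M\smallsetminus M_0^\pm(f)$ for a smooth $\theta^\pm$ with values in $(0,2\pi)$. $\bar{\mathcal{M}}^\pm(f)=\mathbb{S}^1$ means that there is a bijection $t\mapsto\tilde f_t$ from $\mathbb{S}^1\simeq\mathbb{R}/2\pi\mathbb{Z}$ onto $\bar{\mathcal{M}}^\pm(f)$, with $\tilde f_0=f$, for which $\theta^\pm_t$ mod $2\pi$ depends smoothly on $t$. *)

theory Defs
  imports "HOL-Analysis.Analysis"
begin

section \<open>Smooth maps\<close>

abbreviation dd :: "('a::real_normed_vector \<Rightarrow> 'b::real_normed_vector) \<Rightarrow> 'a \<Rightarrow> 'a \<Rightarrow> 'b" where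
  "dd F x u \<equiv> frechet_derivative F (at x) u"

primrec Ck_on :: "nat \<Rightarrow> 'a::real_normed_vector set \<Rightarrow> ('a \<Rightarrow> 'b::real_normed_vector) \<Rightarrow> bool" where
  "Ck_on 0 S F \<longleftrightarrow> continuous_on S F"
| "Ck_on (Suc k) S F \<longleftrightarrow> (\<forall>x\<in>S. F differentiable (at x)) \<and> (\<forall>v. Ck_on k S (\<lambda>x. dd F x v))"

text \<open>Used only for open \<open>S\<close> in finite-dimensional spaces.\<close>
definition smooth_on :: "'a::real_normed_vector set \<Rightarrow> ('a \<Rightarrow> 'b::real_normed_vector) \<Rightarrow> bool" where
  "smooth_on S F \<longleftrightarrow> (\<forall>k. Ck_on k S F)"


section \<open>Oriented Riemannian surfaces\<close>

text \<open>The surface \<open>M\<close> is a whole type \<open>'m\<close>; a chart is a pair of a domain and a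
  coordinate map.  Tangent vectors at \<open>p\<close> are given by their components in a chart around \<open>p\<close>.\<close>

type_synonym 'm chart = "'m set \<times> ('m \<Rightarrow> real^2)"

abbreviation chart_image :: "'m chart \<Rightarrow> (real^2) set" where
  "chart_image \<kappa> \<equiv> snd \<kappa> ` fst \<kappa>"

definition rep :: "'m chart \<Rightarrow> ('m \<Rightarrow> 'b) \<Rightarrow> real^2 \<Rightarrow> 'b" where
  "rep \<kappa> F = F \<circ> inv_into (fst \<kappa>) (snd \<kappa>)"

definition oriented_surface :: "('m::{t2_space,second_countable_topology}) chart set \<Rightarrow> bool" where
  "oriented_surface A \<longleftrightarrow>
     connected (UNIV :: 'm set) \<and>
     (\<Union>\<kappa>\<in>A. fst \<kappa>) = UNIV \<and>
     (\<forall>\<kappa>\<in>A. open (fst \<kappa>) \<and> open (chart_image \<kappa>) \<and>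
        homeomorphism (fst \<kappa>) (chart_image \<kappa>) (snd \<kappa>) (inv_into (fst \<kappa>) (snd \<kappa>))) \<and>
     (\<forall>\<kappa>\<in>A. \<forall>\<kappa>'\<in>A.
        smooth_on (snd \<kappa> ` (fst \<kappa> \<inter> fst \<kappa>')) (rep \<kappa> (snd \<kappa>')) \<and>
        (\<forall>x \<in> snd \<kappa> ` (fst \<kappa> \<inter> fst \<kappa>'). 0 < det (matrix (dd (rep \<kappa> (snd \<kappa>')) x))))"

type_synonym coord_metric = "real^2 \<Rightarrow> real^2 \<Rightarrow> real^2 \<Rightarrow> real"

text \<open>\<open>g \<kappa> x u v\<close> is the inner product, at the point with coordinates \<open>x\<close> in the chart \<open>\<kappa>\<close>,
  of the tangent vectors with components \<open>u\<close> and \<open>v\<close>.\<close>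
definition riemannian_metric :: "'m chart set \<Rightarrow> ('m chart \<Rightarrow> coord_metric) \<Rightarrow> bool" where
  "riemannian_metric A g \<longleftrightarrow>
     (\<forall>\<kappa>\<in>A.
        (\<forall>x\<in>chart_image \<kappa>. bilinear (g \<kappa> x) \<and> (\<forall>u v. g \<kappa> x u v = g \<kappa> x v u) \<and>
            (\<forall>u. u \<noteq> 0 \<longrightarrow> 0 < g \<kappa> x u u)) \<and>
        (\<forall>u v. smooth_on (chart_image \<kappa>) (\<lambda>x. g \<kappa> x u v))) \<and>
     (\<forall>\<kappa>\<in>A. \<forall>\<kappa>'\<in>A. \<forall>x \<in> snd \<kappa> ` (fst \<kappa> \<inter> fst \<kappa>'). \<forall>u v.
        g \<kappa> x u v =
        g \<kappa>' (rep \<kappa> (snd \<kappa>') x) (dd (rep \<kappa> (snd \<kappa>')) x u) (dd (rep \<kappa> (snd \<kappa>')) x v))"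

definition oframe :: "coord_metric \<Rightarrow> real^2 \<Rightarrow> real^2 \<Rightarrow> real^2 \<Rightarrow> bool" where
  "oframe g x e1 e2 \<longleftrightarrow>
     g x e1 e1 = 1 \<and> g x e2 e2 = 1 \<and> g x e1 e2 = 0 \<and> 0 < e1$1 * e2$2 - e1$2 * e2$1"

text \<open>Quantities expressed through the following frame do not depend on the choice made.\<close>
definition tframe :: "coord_metric \<Rightarrow> real^2 \<Rightarrow> (real^2) \<times> (real^2)" where
  "tframe g x = (SOME e. oframe g x (fst e) (snd e))"

definition mtrace :: "coord_metric \<Rightarrow> real^2 \<Rightarrow> (real^2 \<Rightarrow> real^2 \<Rightarrow> 'b::real_vector) \<Rightarrow> 'b" where
  "mtrace g x B = (case tframe g x of (e1, e2) \<Rightarrow> B e1 e1 + B e2 e2)"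

definition rotJ :: "coord_metric \<Rightarrow> real^2 \<Rightarrow> real^2 \<Rightarrow> real^2" where
  "rotJ g x u = (THE v. g x u v = 0 \<and> g x v v = g x u u \<and>
     (u \<noteq> 0 \<longrightarrow> 0 < u$1 * v$2 - u$2 * v$1))"

text \<open>\<open>christoffel g x u v\<close> is the Levi-Civita derivative \<open>\<nabla>\<^sub>u v\<close> of the constant
  coordinate field \<open>v\<close> (Koszul formula), and \<open>riem g x u v w\<close> is \<open>R(u,v)w\<close> with the convention
  \<open>R(X,Y) = [\<nabla>\<^sub>X, \<nabla>\<^sub>Y] - \<nabla>\<close> along \<open>[X,Y]\<close>.\<close>
definition christoffel :: "coord_metric \<Rightarrow> real^2 \<Rightarrow> real^2 \<Rightarrow> real^2 \<Rightarrow> real^2" where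
  "christoffel g x u v = (THE w. \<forall>z. g x w z =
     (dd (\<lambda>y. g y v z) x u + dd (\<lambda>y. g y u z) x v - dd (\<lambda>y. g y u v) x z) / 2)"

definition riem :: "coord_metric \<Rightarrow> real^2 \<Rightarrow> real^2 \<Rightarrow> real^2 \<Rightarrow> real^2 \<Rightarrow> real^2" where
  "riem g x u v w =
     dd (\<lambda>y. christoffel g y v w) x u - dd (\<lambda>y. christoffel g y u w) x v
     + christoffel g x u (christoffel g x v w) - christoffel g x v (christoffel g x u w)"

definition gauss_curvature :: "coord_metric \<Rightarrow> real^2 \<Rightarrow> real" where
  "gauss_curvature g x = (case tframe g x of (e1, e2) \<Rightarrow> g x (riem g x e1 e2 e2) e1)"


section \<open>The space form of dimension 4 and curvature c\<close>

text \<open>A model that is uniform in \<open>c\<close>: the points of \<open>\<real>\<^sup>5\<close> with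
  \<open>P\<^sub>5\<^sup>2 + c (P\<^sub>1\<^sup>2 + \<dots> + P\<^sub>4\<^sup>2) = 1\<close> (and \<open>P\<^sub>5 > 0\<close> if \<open>c \<le> 0\<close>), with the metric
  \<open>dP\<^sub>1\<^sup>2 + \<dots> + dP\<^sub>4\<^sup>2 + dP\<^sub>5\<^sup>2 / c\<close>.  For \<open>c \<noteq> 0\<close>, dividing the fifth coordinate by
  \<open>sqrt \<bar>c\<bar>\<close> gives the round sphere of radius \<open>1 / sqrt c\<close> in Euclidean space, respectively the
  upper sheet of the hyperboloid \<open>\<langle>P,P\<rangle> = 1/c\<close> in Minkowski space; for \<open>c = 0\<close> it is the
  affine hyperplane \<open>P\<^sub>5 = 1\<close> with its Euclidean metric (recall \<open>t / 0 = 0\<close>).\<close>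

definition amb :: "real \<Rightarrow> real^5 \<Rightarrow> real^5 \<Rightarrow> real" where
  "amb c v w = v$1 * w$1 + v$2 * w$2 + v$3 * w$3 + v$4 * w$4 + v$5 * w$5 / c"

definition ell :: "real \<Rightarrow> real^5 \<Rightarrow> real^5 \<Rightarrow> real" where
  "ell c P v = P$5 * v$5 + c * (P$1 * v$1 + P$2 * v$2 + P$3 * v$3 + P$4 * v$4)"

definition Q4 :: "real \<Rightarrow> (real^5) set" where
  "Q4 c = {P. ell c P P = 1 \<and> (c \<le> 0 \<longrightarrow> 0 < P$5)}"

definition TQ :: "real \<Rightarrow> real^5 \<Rightarrow> (real^5) set" where
  "TQ c P = {v. ell c P v = 0}"

text \<open>Projection onto the tangent space along the position vector.  The Levi-Civita connection
  of the space form is the flat derivative followed by this projection.\<close>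
definition tproj :: "real \<Rightarrow> real^5 \<Rightarrow> real^5 \<Rightarrow> real^5" where
  "tproj c P v = v - ell c P v *\<^sub>R P"

text \<open>On \<open>TQ c P\<close> this is the Riemannian volume form fixing the orientation of the space form.\<close>
definition vol :: "real^5 \<Rightarrow> real^5 \<Rightarrow> real^5 \<Rightarrow> real^5 \<Rightarrow> real^5 \<Rightarrow> real" where
  "vol P v1 v2 v3 v4 = det (vector [P, v1, v2, v3, v4] :: real^5^5)"

definition op_isometry :: "real \<Rightarrow> (real^5 \<Rightarrow> real^5) \<Rightarrow> bool" where
  "op_isometry c \<Psi> \<longleftrightarrow>
     bij_betw \<Psi> (Q4 c) (Q4 c) \<and>
     (\<exists>W. open W \<and> Q4 c \<subseteq> W \<and> smooth_on W \<Psi>) \<and>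
     (\<forall>P\<in>Q4 c. \<forall>v\<in>TQ c P. \<forall>w\<in>TQ c P. amb c (dd \<Psi> P v) (dd \<Psi> P w) = amb c v w) \<and>
     (\<forall>P\<in>Q4 c. \<forall>v1\<in>TQ c P. \<forall>v2\<in>TQ c P. \<forall>v3\<in>TQ c P. \<forall>v4\<in>TQ c P.
        0 < vol P v1 v2 v3 v4 \<longrightarrow>
        0 < vol (\<Psi> P) (dd \<Psi> P v1) (dd \<Psi> P v2) (dd \<Psi> P v3) (dd \<Psi> P v4))"


section \<open>Isometric immersions and their local invariants\<close>

definition isometric_immersion ::
  "real \<Rightarrow> 'm chart set \<Rightarrow> ('m chart \<Rightarrow> coord_metric) \<Rightarrow> ('m \<Rightarrow> real^5) \<Rightarrow> bool" where
  "isometric_immersion c A g f \<longleftrightarrow>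
     range f \<subseteq> Q4 c \<and>
     (\<forall>\<kappa>\<in>A. smooth_on (chart_image \<kappa>) (rep \<kappa> f) \<and>
        (\<forall>x\<in>chart_image \<kappa>. \<forall>u v. amb c (dd (rep \<kappa> f) x u) (dd (rep \<kappa> f) x v) = g \<kappa> x u v))"

text \<open>Below, \<open>F\<close> is the expression of an immersion in a positively oriented chart and \<open>g\<close> the
  metric in that chart.  \<open>\<real>\<^sup>5\<close> is the direct sum of the line of \<open>F x\<close>, the tangent plane of
  the surface and its normal space; \<open>nproj\<close> is the resulting projection onto the normal space.\<close>

definition nspace :: "real \<Rightarrow> (real^2 \<Rightarrow> real^5) \<Rightarrow> real^2 \<Rightarrow> (real^5) set" where
  "nspace c F x = {\<xi> \<in> TQ c (F x). \<forall>u. amb c \<xi> (dd F x u) = 0}"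

definition nproj :: "real \<Rightarrow> (real^2 \<Rightarrow> real^5) \<Rightarrow> real^2 \<Rightarrow> real^5 \<Rightarrow> real^5" where
  "nproj c F x v = (THE \<xi>. \<xi> \<in> nspace c F x \<and> (\<exists>a u. v = a *\<^sub>R F x + dd F x u + \<xi>))"

definition sff :: "real \<Rightarrow> (real^2 \<Rightarrow> real^5) \<Rightarrow> real^2 \<Rightarrow> real^2 \<Rightarrow> real^2 \<Rightarrow> real^5" where
  "sff c F x u v = nproj c F x (dd (\<lambda>y. dd F y v) x u)"

definition nconn :: "real \<Rightarrow> (real^2 \<Rightarrow> real^5) \<Rightarrow> (real^2 \<Rightarrow> real^5) \<Rightarrow> real^2 \<Rightarrow> real^2 \<Rightarrow> real^5" where
  "nconn c F \<xi> x u = nproj c F x (dd \<xi> x u)"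

definition mean_curv :: "real \<Rightarrow> coord_metric \<Rightarrow> (real^2 \<Rightarrow> real^5) \<Rightarrow> real^2 \<Rightarrow> real^5" where
  "mean_curv c g F x = (1/2) *\<^sub>R mtrace g x (sff c F x)"

text \<open>A normal pair is positive if it completes a positive tangent pair to a positive basis.\<close>
definition npositive :: "(real^2 \<Rightarrow> real^5) \<Rightarrow> real^2 \<Rightarrow> real^5 \<Rightarrow> real^5 \<Rightarrow> bool" where
  "npositive F x \<xi> \<eta> \<longleftrightarrow> 0 < vol (F x) (dd F x (axis 1 1)) (dd F x (axis 2 1)) \<xi> \<eta>"

definition Jperp :: "real \<Rightarrow> (real^2 \<Rightarrow> real^5) \<Rightarrow> real^2 \<Rightarrow> real^5 \<Rightarrow> real^5" where
  "Jperp c F x \<xi> = (THE \<eta>. \<eta> \<in> nspace c F x \<and> amb c \<xi> \<eta> = 0 \<and> amb c \<eta> \<eta> = amb c \<xi> \<xi> \<and>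
     (\<xi> \<noteq> 0 \<longrightarrow> npositive F x \<xi> \<eta>))"

definition nframe :: "real \<Rightarrow> (real^2 \<Rightarrow> real^5) \<Rightarrow> real^2 \<Rightarrow> (real^5) \<times> (real^5)" where
  "nframe c F x = (SOME e. fst e \<in> nspace c F x \<and> snd e \<in> nspace c F x \<and>
     amb c (fst e) (fst e) = 1 \<and> amb c (snd e) (snd e) = 1 \<and> amb c (fst e) (snd e) = 0 \<and>
     npositive F x (fst e) (snd e))"

text \<open>\<open>R\<^sup>\<bottom>(u,v)\<xi>\<close> for commuting constant fields \<open>u\<close>, \<open>v\<close>, where the normal vector \<open>\<xi>\<close> at \<open>x\<close> is
  extended to a normal field by projection.\<close>
definition nriem :: "real \<Rightarrow> (real^2 \<Rightarrow> real^5) \<Rightarrow> real^2 \<Rightarrow> real^2 \<Rightarrow> real^2 \<Rightarrow> real^5 \<Rightarrow> real^5" where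
  "nriem c F x u v \<xi> = (let X = (\<lambda>y. nproj c F y \<xi>) in
     nconn c F (\<lambda>y. nconn c F X y v) x u - nconn c F (\<lambda>y. nconn c F X y u) x v)"

definition normal_curv :: "real \<Rightarrow> coord_metric \<Rightarrow> (real^2 \<Rightarrow> real^5) \<Rightarrow> real^2 \<Rightarrow> real" where
  "normal_curv c g F x =
     (case tframe g x of (e1, e2) \<Rightarrow> case nframe c F x of (e3, e4) \<Rightarrow>
        amb c (nriem c F x e1 e2 e4) e3)"

text \<open>A sign \<open>\<plusminus>\<close> is represented by \<open>\<sigma> = 1\<close> or \<open>\<sigma> = -1\<close>.\<close>
definition calH_norm :: "real \<Rightarrow> coord_metric \<Rightarrow> real \<Rightarrow> (real^2 \<Rightarrow> real^5) \<Rightarrow> real^2 \<Rightarrow> real" where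
  "calH_norm c g \<sigma> F x =
     sqrt (amb c (mean_curv c g F x) (mean_curv c g F x) - (gauss_curvature g x - c)
           - \<sigma> * normal_curv c g F x)"

definition calH_zeros ::
  "real \<Rightarrow> 'm chart set \<Rightarrow> ('m chart \<Rightarrow> coord_metric) \<Rightarrow> real \<Rightarrow> ('m \<Rightarrow> real^5) \<Rightarrow> 'm set" where
  "calH_zeros c A g \<sigma> f =
     {p. \<exists>\<kappa>\<in>A. p \<in> fst \<kappa> \<and> calH_norm c (g \<kappa>) \<sigma> (rep \<kappa> f) (snd \<kappa> p) = 0}"

definition nonminimal ::
  "real \<Rightarrow> 'm chart set \<Rightarrow> ('m chart \<Rightarrow> coord_metric) \<Rightarrow> ('m \<Rightarrow> real^5) \<Rightarrow> bool" where
  "nonminimal c A g f \<longleftrightarrow> (\<exists>\<kappa>\<in>A. \<exists>x\<in>chart_image \<kappa>. mean_curv c (g \<kappa>) (rep \<kappa> f) x \<noteq> 0)"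


section \<open>Gauss lifts and the vertical part of their tension field\<close>

text \<open>A point of the twistor bundle is a pair \<open>(P, A)\<close>, the orthogonal complex structure on
  \<open>TQ c P\<close> being extended to a matrix \<open>A\<close> by \<open>A P = 0\<close>.\<close>

type_synonym tw = "(real^5) \<times> (real^5^5)"

text \<open>For an endomorphism field \<open>A\<close> along a curve in the space form, \<open>vert c P A'\<close> is its
  covariant derivative.\<close>
definition vert :: "real \<Rightarrow> real^5 \<Rightarrow> real^5^5 \<Rightarrow> real^5^5" where
  "vert c P B = matrix (tproj c P) ** B ** matrix (tproj c P)"

text \<open>The metric \<open>g\<^sub>1\<close>.  Vertical vectors \<open>B\<close> are skew, with squared length
  \<open>-1/4 trace (B B) = 1/4 trace (B\<^sup>T B)\<close>; so the fibre, which consists of \<open>A\<close> with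
  \<open>1/4 trace (A\<^sup>T A) = 1\<close> in a 3-dimensional space of skew endomorphisms, is a round unit sphere.\<close>
definition g1 :: "real \<Rightarrow> tw \<Rightarrow> tw \<Rightarrow> tw \<Rightarrow> real" where
  "g1 c Z V W = amb c (fst V) (fst W) - trace (vert c (fst Z) (snd V) ** vert c (fst Z) (snd W)) / 4"

text \<open>Tangent space of the fibre: skew endomorphisms of \<open>TQ c P\<close> anticommuting with \<open>A\<close>
  (linearise \<open>A\<^sup>T = -A\<close>, \<open>A\<^sup>2 = -1\<close>).\<close>
definition vspace :: "real \<Rightarrow> tw \<Rightarrow> tw set" where
  "vspace c Z = (case Z of (P, A) \<Rightarrow> {(0, B) | B.
     B *v P = 0 \<and> (\<forall>v. B *v v \<in> TQ c P) \<and>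
     (\<forall>v\<in>TQ c P. \<forall>w\<in>TQ c P. amb c (B *v v) w = - amb c v (B *v w)) \<and>
     A ** B + B ** A = 0})"

definition gauss_lift :: "real \<Rightarrow> coord_metric \<Rightarrow> real \<Rightarrow> (real^2 \<Rightarrow> real^5) \<Rightarrow> real^2 \<Rightarrow> tw" where
  "gauss_lift c g \<sigma> F x = (F x, THE A. A *v F x = 0 \<and>
     (\<forall>u. A *v dd F x u = dd F x (rotJ g x u)) \<and>
     (\<forall>\<xi>\<in>nspace c F x. A *v \<xi> = \<sigma> *\<^sub>R Jperp c F x \<xi>))"

text \<open>Let \<open>G\<close> be a map into a submanifold \<open>Z\<close> of a vector space, and \<open>h\<close> a smooth field of
  symmetric bilinear forms near \<open>Z\<close> that restricts to a Riemannian metric on \<open>Z\<close>.  For \<open>W\<close>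
  tangent to \<open>Z\<close> at \<open>G x\<close>, the following is \<open>h(\<tau>(G), W)\<close> with \<open>\<tau>(G)\<close> the tension field of
  \<open>G\<close>: by the Koszul formula the Levi-Civita connection of \<open>(Z, h)\<close> satisfies
  \<open>2 h(\<nabla>\<^sub>X Y, W) = 2 h(D\<^sub>X Y, W) + (D\<^sub>X h)(Y,W) + (D\<^sub>Y h)(X,W) - (D\<^sub>W h)(X,Y)\<close>
  with \<open>D\<close> the flat derivative.\<close>
definition tension_pairing ::
  "coord_metric \<Rightarrow> ('e \<Rightarrow> 'e \<Rightarrow> 'e \<Rightarrow> real) \<Rightarrow> (real^2 \<Rightarrow> 'e::real_normed_vector) \<Rightarrow>
   real^2 \<Rightarrow> 'e \<Rightarrow> real" where
  "tension_pairing g h G x W = mtrace g x (\<lambda>u v.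
     let X = dd G x u; Y = dd G x v in
     h (G x) (dd (\<lambda>y. dd G y v) x u - dd G x (christoffel g x u v)) W
     + (dd (\<lambda>z. h z Y W) (G x) X + dd (\<lambda>z. h z X W) (G x) Y - dd (\<lambda>z. h z X Y) (G x) W) / 2)"

text \<open>The \<open>g\<^sub>1\<close>-orthogonal projection of the tension field to the vertical space is the vertical
  vector with the same inner products with all vertical vectors.\<close>
definition vtension :: "real \<Rightarrow> coord_metric \<Rightarrow> real \<Rightarrow> (real^2 \<Rightarrow> real^5) \<Rightarrow> real^2 \<Rightarrow> tw" where
  "vtension c g \<sigma> F x = (let G = gauss_lift c g \<sigma> F in
     THE V. V \<in> vspace c (G x) \<and>
       (\<forall>W\<in>vspace c (G x). g1 c (G x) V W = tension_pairing g (g1 c) G x W))"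

definition vtension_sq :: "real \<Rightarrow> coord_metric \<Rightarrow> real \<Rightarrow> (real^2 \<Rightarrow> real^5) \<Rightarrow> real^2 \<Rightarrow> real" where
  "vtension_sq c g \<sigma> F x = (let V = vtension c g \<sigma> F x in g1 c (gauss_lift c g \<sigma> F x) V V)"


section \<open>Hopf differentials\<close>

text \<open>Complexified normal vectors are elements of \<open>\<complex>\<^sup>5\<close>; \<open>cext\<close> is complex-linear extension.\<close>

definition cvec :: "real^5 \<Rightarrow> real^5 \<Rightarrow> complex^5" where
  "cvec a b = (\<chi> k. Complex (a$k) (b$k))"

definition cext :: "(real^5 \<Rightarrow> real^5) \<Rightarrow> complex^5 \<Rightarrow> complex^5" where
  "cext L V = cvec (L (\<chi> k. Re (V$k))) (L (\<chi> k. Im (V$k)))"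

text \<open>In isothermal coordinates \<open>\<partial>\<^sub>z = (X - i J X) / 2\<close> with \<open>X = \<partial>\<^sub>x\<close>, and at a point every
  nonzero tangent vector \<open>X\<close> arises in this way.  Thus a quadratic differential \<open>\<phi> dz\<^sup>2\<close> is the
  function taking \<open>X\<close> to its value at \<open>((X - i J X) / 2, (X - i J X) / 2)\<close>.  For the Hopf
  differential this value is \<open>(\<alpha>(X,X) - \<alpha>(JX,JX)) / 4 - i \<alpha>(X,JX) / 2\<close>.\<close>
definition hopf :: "real \<Rightarrow> coord_metric \<Rightarrow> (real^2 \<Rightarrow> real^5) \<Rightarrow> real^2 \<Rightarrow> real^2 \<Rightarrow> complex^5" where
  "hopf c g F x X = (let Y = rotJ g x X in
     cvec ((1/4) *\<^sub>R (sff c F x X X - sff c F x Y Y)) ((-1/2) *\<^sub>R sff c F x X Y))"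

definition hopf_pm ::
  "real \<Rightarrow> coord_metric \<Rightarrow> real \<Rightarrow> (real^2 \<Rightarrow> real^5) \<Rightarrow> real^2 \<Rightarrow> real^2 \<Rightarrow> complex^5" where
  "hopf_pm c g \<sigma> F x X =
     (1/2) *s (hopf c g F x X + (of_real \<sigma> * \<i>) *s cext (Jperp c F x) (hopf c g F x X))"


section \<open>Surfaces with the same mean curvature\<close>

definition parallel_bundle_isometry ::
  "real \<Rightarrow> 'm chart set \<Rightarrow> ('m \<Rightarrow> real^5) \<Rightarrow> ('m \<Rightarrow> real^5) \<Rightarrow> ('m \<Rightarrow> real^5 \<Rightarrow> real^5) \<Rightarrow> bool" where
  "parallel_bundle_isometry c A f f' T \<longleftrightarrow> (\<forall>\<kappa>\<in>A.
     let F = rep \<kappa> f; F' = rep \<kappa> f'; S = rep \<kappa> T in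
     (\<forall>x\<in>chart_image \<kappa>.
        bij_betw (S x) (nspace c F x) (nspace c F' x) \<and>
        (\<forall>\<xi>\<in>nspace c F x. \<forall>\<eta>\<in>nspace c F x. S x (\<xi> + \<eta>) = S x \<xi> + S x \<eta>) \<and>
        (\<forall>\<xi>\<in>nspace c F x. \<forall>a. S x (a *\<^sub>R \<xi>) = a *\<^sub>R S x \<xi>) \<and>
        (\<forall>\<xi>\<in>nspace c F x. \<forall>\<eta>\<in>nspace c F x. amb c (S x \<xi>) (S x \<eta>) = amb c \<xi> \<eta>) \<and>
        (\<forall>\<xi>\<in>nspace c F x. \<forall>\<eta>\<in>nspace c F x.
           npositive F x \<xi> \<eta> \<longrightarrow> npositive F' x (S x \<xi>) (S x \<eta>))) \<and>
     (\<forall>V \<xi>. open V \<and> V \<subseteq> chart_image \<kappa> \<and> smooth_on V \<xi> \<and> (\<forall>y\<in>V. \<xi> y \<in> nspace c F y) \<longrightarrow>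
        smooth_on V (\<lambda>y. S y (\<xi> y)) \<and>
        (\<forall>x\<in>V. \<forall>u. nconn c F' (\<lambda>y. S y (\<xi> y)) x u = S x (nconn c F \<xi> x u))))"

text \<open>\<open>T\<close> is an orientation-preserving parallel bundle isometry taking \<open>H\<close> to \<open>H'\<close>.\<close>
definition same_mean_curv_via ::
  "real \<Rightarrow> 'm chart set \<Rightarrow> ('m chart \<Rightarrow> coord_metric) \<Rightarrow> ('m \<Rightarrow> real^5) \<Rightarrow> ('m \<Rightarrow> real^5) \<Rightarrow>
   ('m \<Rightarrow> real^5 \<Rightarrow> real^5) \<Rightarrow> bool" where
  "same_mean_curv_via c A g f f' T \<longleftrightarrow>
     parallel_bundle_isometry c A f f' T \<and>
     (\<forall>\<kappa>\<in>A. \<forall>x\<in>chart_image \<kappa>.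
        rep \<kappa> T x (mean_curv c (g \<kappa>) (rep \<kappa> f) x) = mean_curv c (g \<kappa>) (rep \<kappa> f') x)"

text \<open>\<open>T\<^sup>-\<^sup>1 \<circ> \<Phi>'\<^sup>\<plusminus>\<close> in a chart, for \<open>\<Phi>'\<close> the Hopf differential of \<open>f'\<close>.\<close>
definition pulled_hopf ::
  "real \<Rightarrow> ('m chart \<Rightarrow> coord_metric) \<Rightarrow> real \<Rightarrow> ('m \<Rightarrow> real^5) \<Rightarrow> ('m \<Rightarrow> real^5) \<Rightarrow>
   ('m \<Rightarrow> real^5 \<Rightarrow> real^5) \<Rightarrow> 'm chart \<Rightarrow> real^2 \<Rightarrow> real^2 \<Rightarrow> complex^5" where
  "pulled_hopf c g \<sigma> f f' T \<kappa> x X =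
     cext (inv_into (nspace c (rep \<kappa> f) x) (rep \<kappa> T x)) (hopf_pm c (g \<kappa>) \<sigma> (rep \<kappa> f') x X)"

definition Qdiff ::
  "real \<Rightarrow> ('m chart \<Rightarrow> coord_metric) \<Rightarrow> real \<Rightarrow> ('m \<Rightarrow> real^5) \<Rightarrow> ('m \<Rightarrow> real^5) \<Rightarrow>
   ('m \<Rightarrow> real^5 \<Rightarrow> real^5) \<Rightarrow> 'm chart \<Rightarrow> real^2 \<Rightarrow> real^2 \<Rightarrow> complex^5" where
  "Qdiff c g \<sigma> f f' T \<kappa> x X =
     hopf_pm c (g \<kappa>) \<sigma> (rep \<kappa> f) x X - pulled_hopf c g \<sigma> f f' T \<kappa> x X"

definition iso_class :: "real \<Rightarrow> ('m \<Rightarrow> real^5) \<Rightarrow> ('m \<Rightarrow> real^5) set" where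
  "iso_class c f = {\<Psi> \<circ> f | \<Psi>. op_isometry c \<Psi>}"

text \<open>The component of the moduli space for the sign \<open>\<sigma>\<close>: \<open>Q\<close> vanishes for the opposite sign.\<close>
definition moduli_pm ::
  "real \<Rightarrow> 'm chart set \<Rightarrow> ('m chart \<Rightarrow> coord_metric) \<Rightarrow> real \<Rightarrow> ('m \<Rightarrow> real^5) \<Rightarrow>
   ('m \<Rightarrow> real^5) set set" where
  "moduli_pm c A g \<sigma> f = iso_class c ` {f'. isometric_immersion c A g f' \<and>
     (\<exists>T. same_mean_curv_via c A g f f' T \<and>
        (\<forall>\<kappa>\<in>A. \<forall>x\<in>chart_image \<kappa>. \<forall>X. Qdiff c g (- \<sigma>) f f' T \<kappa> x X = 0))}"

definition phase_of ::
  "real \<Rightarrow> 'm chart set \<Rightarrow> ('m chart \<Rightarrow> coord_metric) \<Rightarrow> real \<Rightarrow> ('m \<Rightarrow> real^5) \<Rightarrow>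
   ('m \<Rightarrow> real^5) \<Rightarrow> ('m \<Rightarrow> real) \<Rightarrow> bool" where
  "phase_of c A g \<sigma> f f' \<theta> \<longleftrightarrow>
     (\<forall>p\<in>- calH_zeros c A g \<sigma> f. 0 < \<theta> p \<and> \<theta> p < 2 * pi) \<and>
     (\<forall>\<kappa>\<in>A. smooth_on (snd \<kappa> ` (fst \<kappa> - calH_zeros c A g \<sigma> f)) (rep \<kappa> \<theta>)) \<and>
     (\<exists>T. same_mean_curv_via c A g f f' T \<and>
        (\<forall>\<kappa>\<in>A. \<forall>x \<in> snd \<kappa> ` (fst \<kappa> - calH_zeros c A g \<sigma> f). \<forall>X.
           pulled_hopf c g \<sigma> f f' T \<kappa> x X
           = cis (- \<sigma> * rep \<kappa> \<theta> x) *s hopf_pm c (g \<kappa>) \<sigma> (rep \<kappa> f) x X))"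

text \<open>The component is a circle.  \<open>\<real> / 2\<pi>\<int>\<close> is represented by \<open>{0..<2*pi}\<close>; a representative
  \<open>F t\<close> of each class and its phase \<open>\<theta> t\<close> are extended \<open>2\<pi>\<close>-periodically to all real \<open>t\<close>,
  the phase of \<open>f\<close> itself being \<open>0\<close>.\<close>
definition moduli_is_circle ::
  "real \<Rightarrow> 'm chart set \<Rightarrow> ('m chart \<Rightarrow> coord_metric) \<Rightarrow> real \<Rightarrow> ('m \<Rightarrow> real^5) \<Rightarrow> bool" where
  "moduli_is_circle c A g \<sigma> f \<longleftrightarrow>
     (\<exists>(F :: real \<Rightarrow> 'm \<Rightarrow> real^5) (\<theta> :: real \<Rightarrow> 'm \<Rightarrow> real).
        (\<forall>t. F (t + 2 * pi) = F t \<and> \<theta> (t + 2 * pi) = \<theta> t) \<and>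
        bij_betw (\<lambda>t. iso_class c (F t)) {0..<2 * pi} (moduli_pm c A g \<sigma> f) \<and>
        F 0 = f \<and> \<theta> 0 = (\<lambda>_. 0) \<and>
        (\<forall>t\<in>{0<..<2 * pi}. phase_of c A g \<sigma> f (F t) (\<theta> t)) \<and>
        (\<forall>p\<in>- calH_zeros c A g \<sigma> f. smooth_on UNIV (\<lambda>t. cis (\<theta> t p))))"

definition hat_metric ::
  "real \<Rightarrow> ('m chart \<Rightarrow> coord_metric) \<Rightarrow> real \<Rightarrow> ('m \<Rightarrow> real^5) \<Rightarrow> 'm chart \<Rightarrow> coord_metric" where
  "hat_metric c g \<sigma> f \<kappa> x u v =
     vtension_sq c (g \<kappa>) \<sigma> (rep \<kappa> f) x / (4 * (calH_norm c (g \<kappa>) \<sigma> (rep \<kappa> f) x)\<^sup>2) * g \<kappa> x u v"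

end

theory Submission
  imports Defs
begin

text \<open>In isothermal coordinates the Codazzi equation reads
  \<open>2 \<nabla>\<^sub>z\<^sub>\<bar> \<Phi>\<^sup>\<plusminus> = \<lambda>\<^sup>2 \<nabla>\<^sub>z H\<^sup>\<plusminus>\<close>.  If \<open>\<Phi>\<^sup>\<plusminus>\<close> is rotated by the phase \<open>\<theta>\<close> without changing
  the right-hand side, and \<open>\<nabla>\<^sub>z\<^sub>\<bar> \<Phi>\<^sup>\<plusminus> = h \<Phi>\<^sup>\<plusminus>\<close>, then \<open>C = cot (\<theta>/2)\<close> satisfies the affine equation
  \<open>dC = C w\<^sub>1 - w\<^sub>2\<close>, where \<open>w\<^sub>1\<close> and \<open>w\<^sub>2\<close> are the real and (up to sign) the imaginary part of
  twice the conjugate of \<open>h\<close> times \<open>dz\<close>.  Its integrability condition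
  \<open>C dw\<^sub>1 = dw\<^sub>2 - w\<^sub>1 \<and> w\<^sub>2\<close> holds for at least two values of \<open>C\<close> at each point, so
  \<open>dw\<^sub>1 = 0\<close> and \<open>dw\<^sub>2 = w\<^sub>1 \<and> w\<^sub>2\<close>: these are the structure equations of a metric
  \<open>w\<^sub>1\<^sup>2 + w\<^sub>2\<^sup>2\<close> of curvature \<open>-1\<close>.  Since \<open>\<parallel>\<tau>\<^sup>v\<parallel>\<close> is twice the length of \<open>\<nabla>\<^sub>1 H \<plusminus> J\<^sup>\<bottom> \<nabla>\<^sub>2 H\<close>, this metric
  is the one in the claim.  All computations are made in orthonormal frames, which
  avoids isothermal coordinates.\<close>

section \<open>Smooth functions\<close>

text \<open>The circle is used only through two members with different phases at a given point: t
  \<mapsto> cis (\<theta> t p) is continuous, equals 1 at t = 0 and differs from 1 at t = 1, hence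
  takes two values inside the interval. The obstacle is the zero set of \<open>calH_norm\<close>.
  Phases and the affine equation exist only off it, while the claim concerns all of M; so the
  absence of zeros has to be derived. Read normal vectors as complex numbers, B for the Hopf
  differential and Z for the derivative of H. The forms w1, w2 are built from 2 Z / B, and the
  reciprocal B / Z stays smooth at a zero of B because the tension field does not vanish. At a zero,
  the Codazzi equation and the limit of the structure equations prescribe the first derivatives of B
  / Z in incompatible ways. That the new metric does not depend on the chart also comes from the
  phases: two values of cot (\<theta>/2) at a point determine w1 and w2 from the affine equation, so
  both are one-forms on M.\<close>

lemma dd_has_derivative:
  "F differentiable (at x) \<Longrightarrow> (F has_derivative dd F x) (at x)"
  by (rule iffD1[OF frechet_derivative_works])

lemma ddI: "(F has_derivative F') (at x) \<Longrightarrow> dd F x = F'"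
  using frechet_derivative_at by metis

lemma dd_linear: "F differentiable (at x) \<Longrightarrow> linear (dd F x)"
  by (rule linear_frechet_derivative)

lemma
  assumes "F differentiable (at x)"
  shows dd_add: "dd F x (u + v) = dd F x u + dd F x v"
    and dd_scaleR: "dd F x (r *\<^sub>R u) = r *\<^sub>R dd F x u"
    and dd_diff: "dd F x (u - v) = dd F x u - dd F x v"
    and dd_minus: "dd F x (- u) = - dd F x u"
    and dd_zero: "dd F x 0 = 0"
  using dd_linear[OF assms]
  by (simp_all add: linear_add linear_scale linear_diff linear_neg linear_0)

text \<open>\<open>dd\<close> is a choice made from the predicate of being a derivative at x, which
  depends only on the germ. So no differentiability is required.\<close>

lemma dd_cong_open:
  assumes "open S" "x \<in> S" "\<And>y. y \<in> S \<Longrightarrow> F y = G y"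
  shows "dd F x = dd G x"
proof -
  have "(F has_derivative F') (at x) \<longleftrightarrow> (G has_derivative F') (at x)" for F'
    using has_derivative_transform_within_open[of F F' x UNIV S G]
      has_derivative_transform_within_open[of G F' x UNIV S F] assms by auto
  then show ?thesis unfolding frechet_derivative_def by simp
qed

lemma differentiable_cong_open:
  assumes "open S" "x \<in> S" "\<And>y. y \<in> S \<Longrightarrow> F y = G y" "F differentiable (at x)"
  shows "G differentiable (at x)"
  using assms has_derivative_transform_within_open[of F _ x UNIV S G]
  unfolding differentiable_def by blast

lemma dd_bilinear:
  assumes "bounded_bilinear p" "F differentiable (at x)" "G differentiable (at x)"
  shows "dd (\<lambda>y. p (F y) (G y)) x u = p (F x) (dd G x u) + p (dd F x u) (G x)"
  using ddI[OF bounded_bilinear.FDERIV[OF assms(1) dd_has_derivative[OF assms(2)] dd_has_derivative[OF assms(3)]]]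
  by simp

lemma differentiable_bilinear:
  assumes "bounded_bilinear p" "F differentiable (at x)" "G differentiable (at x)"
  shows "(\<lambda>y. p (F y) (G y)) differentiable (at x)"
  using bounded_bilinear.FDERIV[OF assms(1) dd_has_derivative[OF assms(2)] dd_has_derivative[OF assms(3)]]
  unfolding differentiable_def by blast

lemma dd_bounded_linear:
  assumes "bounded_linear L" "F differentiable (at x)"
  shows "dd (\<lambda>y. L (F y)) x u = L (dd F x u)"
  using ddI[OF bounded_linear.has_derivative[OF assms(1) dd_has_derivative[OF assms(2)]]] by simp

lemma differentiable_bounded_linear:
  assumes "bounded_linear L" "F differentiable (at x)"
  shows "(\<lambda>y. L (F y)) differentiable (at x)"
  using bounded_linear.has_derivative[OF assms(1) dd_has_derivative[OF assms(2)]]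
  unfolding differentiable_def by blast

lemma
  assumes "F differentiable (at x)" "G differentiable (at x)"
  shows dd_plus: "dd (\<lambda>y. F y + G y) x u = dd F x u + dd G x u"
    and dd_minus_fun: "dd (\<lambda>y. F y - G y) x u = dd F x u - dd G x u"
  using ddI[OF has_derivative_add[OF dd_has_derivative dd_has_derivative, OF assms]]
    ddI[OF has_derivative_diff[OF dd_has_derivative dd_has_derivative, OF assms]]
  by simp_all

lemma dd_uminus: "F differentiable (at x) \<Longrightarrow> dd (\<lambda>y. - F y) x u = - dd F x u"
  using ddI[OF has_derivative_minus[OF dd_has_derivative, of F x]] by simp

lemma dd_sum:
  assumes "\<And>i. i \<in> I \<Longrightarrow> F i differentiable (at x)"
  shows "dd (\<lambda>y. \<Sum>i\<in>I. F i y) x u = (\<Sum>i\<in>I. dd (F i) x u)"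
  using ddI[OF has_derivative_sum[of I F "\<lambda>i. dd (F i) x" "at x"]] dd_has_derivative assms
  by fastforce

lemma dd_mult:
  fixes F G :: "_ \<Rightarrow> 'b::real_normed_algebra"
  assumes "F differentiable (at x)" "G differentiable (at x)"
  shows "dd (\<lambda>y. F y * G y) x u = F x * dd G x u + dd F x u * G x"
  using dd_bilinear[OF bounded_bilinear_mult assms] .

lemma dd_scaleR_fun:
  assumes "a differentiable (at x)" "G differentiable (at x)"
  shows "dd (\<lambda>y. a y *\<^sub>R G y) x u = a x *\<^sub>R dd G x u + dd a x u *\<^sub>R G x"
  using dd_bilinear[OF bounded_bilinear_scaleR assms] .

lemma dd_chain:
  assumes "\<tau> differentiable (at x)" "G differentiable (at (\<tau> x))"
  shows "dd (\<lambda>y. G (\<tau> y)) x u = dd G (\<tau> x) (dd \<tau> x u)" "(\<lambda>y. G (\<tau> y)) differentiable (at x)"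
proof -
  have "((\<lambda>y. G (\<tau> y)) has_derivative (\<lambda>u. dd G (\<tau> x) (dd \<tau> x u))) (at x)"
    by (rule has_derivative_compose[OF dd_has_derivative[OF assms(1)] dd_has_derivative[OF assms(2)]])
  then show "dd (\<lambda>y. G (\<tau> y)) x u = dd G (\<tau> x) (dd \<tau> x u)" "(\<lambda>y. G (\<tau> y)) differentiable (at x)"
    using ddI unfolding differentiable_def by fastforce+
qed

lemma Ck_on_continuous: "Ck_on k S F \<Longrightarrow> continuous_on S F"
  by (cases k) (auto intro!: continuous_at_imp_continuous_on differentiable_imp_continuous_within)

lemma Ck_on_Suc_imp: "Ck_on (Suc k) S F \<Longrightarrow> Ck_on k S F"
proof (induction k arbitrary: F)
  case 0
  then show ?case using Ck_on_continuous[of "Suc 0"] by simp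
next
  case (Suc k)
  then show ?case by (metis Ck_on.simps(2))
qed

lemma Ck_on_cong:
  assumes "open S" "\<And>x. x \<in> S \<Longrightarrow> F x = G x" "Ck_on k S F"
  shows "Ck_on k S G"
  using assms(2,3)
proof (induction k arbitrary: F G)
  case 0
  then show ?case by (metis Ck_on.simps(1) continuous_on_cong)
next
  case (Suc k)
  have "Ck_on k S (\<lambda>x. dd G x v)" for v
  proof (rule Suc.IH[of "\<lambda>x. dd F x v"])
    show "dd F x v = dd G x v" if "x \<in> S" for x
      using dd_cong_open[OF assms(1) that] Suc.prems(1) by metis
    show "Ck_on k S (\<lambda>x. dd F x v)" using Suc.prems by simp
  qed
  moreover have "\<forall>x\<in>S. G differentiable (at x)"
    using differentiable_cong_open[OF assms(1)] Suc.prems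
    by (metis Ck_on.simps(2))
  ultimately show ?case by simp
qed

lemma Ck_on_subset: "Ck_on k S F \<Longrightarrow> T \<subseteq> S \<Longrightarrow> Ck_on k T F"
  by (induction k arbitrary: F) (auto intro: continuous_on_subset)

lemma Ck_on_local:
  assumes "\<And>x. x \<in> S \<Longrightarrow> \<exists>V. open V \<and> x \<in> V \<and> Ck_on k V F"
  shows "Ck_on k S F"
  using assms
proof (induction k arbitrary: F)
  case 0
  then show ?case
    by (metis Ck_on.simps(1) continuous_at_imp_continuous_on continuous_on_eq_continuous_at)
next
  case (Suc k)
  have "\<exists>V. open V \<and> x \<in> V \<and> Ck_on k V (\<lambda>x. dd F x v)" if "x \<in> S" for x v
    using Suc.prems[OF that] by auto
  then have "Ck_on k S (\<lambda>x. dd F x v)" for v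
    by (rule Suc.IH)
  moreover have "F differentiable (at x)" if "x \<in> S" for x using Suc.prems[OF that] by auto
  ultimately show ?case by simp
qed

lemma Ck_on_const: "Ck_on k S (\<lambda>x. a)"
proof (induction k arbitrary: a)
  case (Suc k)
  then show ?case by simp
qed simp

lemma Ck_on_bounded_linear_fun:
  assumes "bounded_linear L"
  shows "Ck_on k S L"
proof (cases k)
  case 0
  then show ?thesis using assms by (simp add: linear_continuous_on)
next
  case (Suc n)
  have "dd L x = L" for x
    by (rule ddI) (rule bounded_linear_imp_has_derivative[OF assms])
  then show ?thesis
    using Suc assms by (auto simp: Ck_on_const bounded_linear_imp_differentiable)
qed

lemma Ck_on_add:
  assumes "open S" "Ck_on k S F" "Ck_on k S G"
  shows "Ck_on k S (\<lambda>x. F x + G x)"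
  using assms(2,3)
proof (induction k arbitrary: F G)
  case 0
  then show ?case by (simp add: continuous_on_add)
next
  case (Suc k)
  have "Ck_on k S (\<lambda>x. dd (\<lambda>y. F y + G y) x v)" for v
    by (rule Ck_on_cong[OF assms(1) _ Suc.IH[of "\<lambda>x. dd F x v" "\<lambda>x. dd G x v"]])
      (use Suc.prems in \<open>auto simp: dd_plus\<close>)
  then show ?case using Suc.prems by simp
qed

lemma Ck_on_bilinear:
  assumes p: "bounded_bilinear p" and "open S" "Ck_on k S F" "Ck_on k S G"
  shows "Ck_on k S (\<lambda>x. p (F x) (G x))"
  using assms(3,4)
proof (induction k arbitrary: F G)
  case 0
  then show ?case by (simp add: bounded_bilinear.continuous_on[OF p])
next
  case (Suc k)
  have "Ck_on k S (\<lambda>x. dd (\<lambda>y. p (F y) (G y)) x v)" for v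
    by (rule Ck_on_cong[OF assms(2) _ Ck_on_add[OF assms(2) Suc.IH[of F "\<lambda>x. dd G x v"] Suc.IH[of "\<lambda>x. dd F x v" G]]])
      (use Suc.prems Ck_on_Suc_imp[of k S F] Ck_on_Suc_imp[of k S G] in \<open>auto simp: dd_bilinear[OF p]\<close>)
  then show ?case using Suc.prems by (auto intro: differentiable_bilinear[OF p])
qed

lemma Ck_on_bounded_linear:
  assumes L: "bounded_linear L" and "open S" "Ck_on k S F"
  shows "Ck_on k S (\<lambda>x. L (F x))"
  using assms(3)
proof (induction k arbitrary: F)
  case 0
  then show ?case using L by (simp add: bounded_linear.continuous_on)
next
  case (Suc k)
  have "Ck_on k S (\<lambda>x. dd (\<lambda>y. L (F y)) x v)" for v
    by (rule Ck_on_cong[OF assms(2) _ Suc.IH[of "\<lambda>x. dd F x v"]])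
      (use Suc.prems in \<open>auto simp: dd_bounded_linear[OF L]\<close>)
  then show ?case using Suc.prems by (auto intro: differentiable_bounded_linear[OF L])
qed

lemma Ck_on_sum:
  assumes "open S" "\<And>i. i \<in> I \<Longrightarrow> Ck_on k S (F i)"
  shows "Ck_on k S (\<lambda>x. \<Sum>i\<in>I. F i x)"
proof (cases "finite I")
  case True
  then show ?thesis using assms(2)
    by (induction I rule: finite_induct) (auto intro!: Ck_on_const Ck_on_add assms(1))
qed (simp add: Ck_on_const)

text \<open>The derivative of 1/F contains only 1/F itself and the derivative of F, so the order can
  be raised one step at a time with F fixed.\<close>

lemma Ck_on_inverse:
  fixes F :: "_ \<Rightarrow> 'b::real_normed_field"
  assumes "open S" "Ck_on k S F" "\<And>x. x \<in> S \<Longrightarrow> F x \<noteq> 0"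
  shows "Ck_on k S (\<lambda>x. inverse (F x))"
  using assms(2)
proof (induction k)
  case 0
  then show ?case using assms by (simp add: continuous_on_inverse)
next
  case (Suc k)
  have F: "F differentiable (at x)" if "x \<in> S" for x using Suc.prems that by simp
  have IH: "Ck_on k S (\<lambda>x. inverse (F x))" using Suc Ck_on_Suc_imp by blast
  have d: "((\<lambda>y. inverse (F y)) has_derivative
      (\<lambda>v. - (inverse (F x) * dd F x v * inverse (F x)))) (at x)" if "x \<in> S" for x
    using Deriv.has_derivative_inverse[OF _ dd_has_derivative[OF F[OF that]]] assms(3)[OF that] by simp
  have "Ck_on k S (\<lambda>x. dd (\<lambda>y. inverse (F y)) x v)" for v
  proof (rule Ck_on_cong[OF assms(1)])
    show "- (inverse (F x) * dd F x v * inverse (F x)) = dd (\<lambda>y. inverse (F y)) x v"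
      if "x \<in> S" for x using ddI[OF d[OF that]] by simp
    show "Ck_on k S (\<lambda>x. - (inverse (F x) * dd F x v * inverse (F x)))"
      by (intro Ck_on_bounded_linear[OF bounded_linear_minus[OF bounded_linear_ident]]
          Ck_on_bilinear[OF bounded_bilinear_mult] assms(1) IH) (use Suc.prems in auto)
  qed
  then show ?case using d unfolding Ck_on.simps differentiable_def by blast
qed

lemma Ck_on_sqrt:
  assumes "open S" "Ck_on k S F" "\<And>x. x \<in> S \<Longrightarrow> F x > 0"
  shows "Ck_on k S (\<lambda>x. sqrt (F x))"
  using assms(2)
proof (induction k)
  case 0
  then show ?case using assms by (simp add: continuous_on_real_sqrt)
next
  case (Suc k)
  have F: "F differentiable (at x)" if "x \<in> S" for x using Suc.prems that by simp
  have IH: "Ck_on k S (\<lambda>x. sqrt (F x))" using Suc Ck_on_Suc_imp by blast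
  have d: "((\<lambda>y. sqrt (F y)) has_derivative (\<lambda>v. dd F x v * (inverse (sqrt (F x)) / 2))) (at x)"
    if "x \<in> S" for x
    using DERIV_real_sqrt[OF assms(3)[OF that]] dd_has_derivative[OF F[OF that]]
      DERIV_compose_FDERIV[of sqrt "inverse (sqrt (F x)) / 2" F x] by auto
  have "Ck_on k S (\<lambda>x. dd (\<lambda>y. sqrt (F y)) x v)" for v
  proof (rule Ck_on_cong[OF assms(1)])
    show "dd F x v * (inverse (sqrt (F x)) * (1/2)) = dd (\<lambda>y. sqrt (F y)) x v"
      if "x \<in> S" for x using ddI[OF d[OF that]] by simp
    have "sqrt (F x) \<noteq> 0" if "x \<in> S" for x using assms(3)[OF that] by simp
    then show "Ck_on k S (\<lambda>x. dd F x v * (inverse (sqrt (F x)) * (1/2)))"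
      by (intro Ck_on_bilinear[OF bounded_bilinear_mult] Ck_on_inverse assms(1) IH Ck_on_const)
        (use Suc.prems in auto)
  qed
  then show ?case using d unfolding Ck_on.simps differentiable_def by blast
qed

text \<open>\<open>Ck_on\<close> controls derivatives in constant directions, while the inner
  derivative is a moving direction. It is therefore expanded in the basis of the middle
  space.\<close>

lemma Ck_on_compose:
  fixes F :: "'a::real_normed_vector \<Rightarrow> 'b::euclidean_space"
  assumes "open S" "open W" "F ` S \<subseteq> W" "Ck_on k S F" "Ck_on k W G"
  shows "Ck_on k S (\<lambda>x. G (F x))"
  using assms(4,5)
proof (induction k arbitrary: G)
  case 0
  then show ?case using assms(3) by (auto intro: continuous_on_compose2)
next
  case (Suc k)
  have d: "((\<lambda>y. G (F y)) has_derivative (\<lambda>v. dd G (F x) (dd F x v))) (at x)" if "x \<in> S" for x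
  proof -
    have "F differentiable at x" "G differentiable at (F x)" using Suc.prems that assms(3) by auto
    then show ?thesis using diff_chain_at[OF dd_has_derivative dd_has_derivative] by (simp add: o_def)
  qed
  have "Ck_on k S (\<lambda>x. dd (\<lambda>y. G (F y)) x v)" for v
  proof (rule Ck_on_cong[OF assms(1)])
    show "(\<Sum>b\<in>Basis. (dd F x v \<bullet> b) *\<^sub>R dd G (F x) b) = dd (\<lambda>y. G (F y)) x v"
      if "x \<in> S" for x
    proof -
      have G: "G differentiable at (F x)" using Suc.prems that assms(3) by auto
      have "dd G (F x) (dd F x v) = dd G (F x) (\<Sum>b\<in>Basis. (dd F x v \<bullet> b) *\<^sub>R b)"
        by (simp add: euclidean_representation)
      also have "\<dots> = (\<Sum>b\<in>Basis. (dd F x v \<bullet> b) *\<^sub>R dd G (F x) b)"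
        using dd_linear[OF G] by (simp add: linear_sum linear_scale)
      finally show ?thesis using ddI[OF d[OF that]] by simp
    qed
    show "Ck_on k S (\<lambda>x. \<Sum>b\<in>Basis. (dd F x v \<bullet> b) *\<^sub>R dd G (F x) b)"
    proof (intro Ck_on_sum Ck_on_bilinear[OF bounded_bilinear_scaleR] assms(1)
          Ck_on_bilinear[OF bounded_bilinear_inner] Ck_on_const)
      show "Ck_on k S (\<lambda>x. dd F x v)" using Suc.prems by simp
      show "Ck_on k S (\<lambda>x. dd G (F x) b)" for b
        using Suc.IH[of "\<lambda>y. dd G y b"] Ck_on_Suc_imp[OF Suc.prems(1)] Suc.prems(2) by simp
    qed
  qed
  then show ?case using d unfolding Ck_on.simps differentiable_def by blast
qed

lemma smooth_on_differentiable: "smooth_on S F \<Longrightarrow> x \<in> S \<Longrightarrow> F differentiable (at x)"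
  unfolding smooth_on_def using Ck_on.simps(2)[of 0 S F] by blast

lemma smooth_on_continuous: "smooth_on S F \<Longrightarrow> continuous_on S F"
  unfolding smooth_on_def using Ck_on_continuous by blast

lemma smooth_on_dd: "smooth_on S F \<Longrightarrow> smooth_on S (\<lambda>x. dd F x v)"
  unfolding smooth_on_def using Ck_on.simps(2)[of _ S F] by blast

lemma smooth_on_cong: "open S \<Longrightarrow> (\<And>x. x \<in> S \<Longrightarrow> F x = G x) \<Longrightarrow> smooth_on S F \<Longrightarrow> smooth_on S G"
  unfolding smooth_on_def using Ck_on_cong[of S F G] by blast

lemma smooth_on_subset: "smooth_on S F \<Longrightarrow> T \<subseteq> S \<Longrightarrow> smooth_on T F"
  unfolding smooth_on_def using Ck_on_subset by metis

lemma smooth_on_local: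
  "(\<And>x. x \<in> S \<Longrightarrow> \<exists>V. open V \<and> x \<in> V \<and> smooth_on V F) \<Longrightarrow> smooth_on S F"
  unfolding smooth_on_def by (intro allI Ck_on_local) blast

lemma smooth_on_const: "smooth_on S (\<lambda>x. a)"
  unfolding smooth_on_def by (simp add: Ck_on_const)

lemma smooth_on_linear: "bounded_linear L \<Longrightarrow> smooth_on S L"
  unfolding smooth_on_def by (simp add: Ck_on_bounded_linear_fun)

lemma smooth_on_bounded_linear:
  "bounded_linear L \<Longrightarrow> open S \<Longrightarrow> smooth_on S F \<Longrightarrow> smooth_on S (\<lambda>x. L (F x))"
  unfolding smooth_on_def by (intro allI Ck_on_bounded_linear[of L]) auto

lemma smooth_on_bilinear:
  "bounded_bilinear p \<Longrightarrow> open S \<Longrightarrow> smooth_on S F \<Longrightarrow> smooth_on S G \<Longrightarrow> smooth_on S (\<lambda>x. p (F x) (G x))"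
  unfolding smooth_on_def by (intro allI Ck_on_bilinear[of p]) auto

lemma smooth_on_add:
  "open S \<Longrightarrow> smooth_on S F \<Longrightarrow> smooth_on S G \<Longrightarrow> smooth_on S (\<lambda>x. F x + G x)"
  unfolding smooth_on_def by (intro allI Ck_on_add) auto

lemma smooth_on_uminus: "open S \<Longrightarrow> smooth_on S F \<Longrightarrow> smooth_on S (\<lambda>x. - F x)"
  using smooth_on_bounded_linear[OF bounded_linear_minus[OF bounded_linear_ident], of S F] by simp

lemma smooth_on_diff:
  "open S \<Longrightarrow> smooth_on S F \<Longrightarrow> smooth_on S G \<Longrightarrow> smooth_on S (\<lambda>x. F x - G x)"
  using smooth_on_add[OF _ _ smooth_on_uminus, of S F G] by simp

lemmas smooth_on_scaleR = smooth_on_bilinear[OF bounded_bilinear_scaleR]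
  and smooth_on_mult = smooth_on_bilinear[OF bounded_bilinear_mult]

lemma smooth_on_inverse:
  fixes F :: "_ \<Rightarrow> 'b::real_normed_field"
  shows "open S \<Longrightarrow> smooth_on S F \<Longrightarrow> (\<And>x. x \<in> S \<Longrightarrow> F x \<noteq> 0) \<Longrightarrow> smooth_on S (\<lambda>x. inverse (F x))"
  unfolding smooth_on_def by (intro allI Ck_on_inverse) auto

lemma smooth_on_divide:
  fixes F :: "_ \<Rightarrow> 'b::real_normed_field"
  shows "open S \<Longrightarrow> smooth_on S F \<Longrightarrow> smooth_on S G \<Longrightarrow> (\<And>x. x \<in> S \<Longrightarrow> G x \<noteq> 0) \<Longrightarrow>
    smooth_on S (\<lambda>x. F x / G x)"
  using smooth_on_mult[OF _ _ smooth_on_inverse, of S F G] by (simp add: divide_inverse)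

lemma smooth_on_sqrt:
  "open S \<Longrightarrow> smooth_on S F \<Longrightarrow> (\<And>x. x \<in> S \<Longrightarrow> F x > 0) \<Longrightarrow> smooth_on S (\<lambda>x. sqrt (F x))"
  unfolding smooth_on_def by (intro allI Ck_on_sqrt) auto

lemma smooth_on_sum:
  "open S \<Longrightarrow> (\<And>i. i \<in> I \<Longrightarrow> smooth_on S (F i)) \<Longrightarrow> smooth_on S (\<lambda>x. \<Sum>i\<in>I. F i x)"
  unfolding smooth_on_def by (intro allI Ck_on_sum) auto

lemma smooth_on_compose:
  fixes F :: "'a::real_normed_vector \<Rightarrow> 'b::euclidean_space"
  shows "open S \<Longrightarrow> open W \<Longrightarrow> F ` S \<subseteq> W \<Longrightarrow> smooth_on S F \<Longrightarrow> smooth_on W G \<Longrightarrow>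
    smooth_on S (\<lambda>x. G (F x))"
  unfolding smooth_on_def using Ck_on_compose[of S W F _ G] by blast

lemma smooth_on_vec_nth: "open S \<Longrightarrow> smooth_on S F \<Longrightarrow> smooth_on S (\<lambda>x. F x $ i)"
  using smooth_on_bounded_linear[OF bounded_linear_vec_nth, of S F i] by simp

lemma bounded_linear_axis: "bounded_linear (axis i :: 'b::real_normed_vector \<Rightarrow> 'b^'n)"
proof (rule bounded_linear_intro[where K = 1])
  show "axis i (a + b) = axis i a + axis i (b::'b)" for a b
    by (simp add: vec_eq_iff axis_def)
  show "axis i (r *\<^sub>R b) = r *\<^sub>R axis i (b::'b)" for r b
    by (simp add: vec_eq_iff axis_def)
  show "norm (axis i b) \<le> norm (b::'b) * 1" for b
    by (simp add: norm_vec_def axis_def L2_set_def if_distrib if_distribR cong: if_cong)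
qed

lemma smooth_on_vec_lambda:
  assumes "open S" "\<And>i. smooth_on S (\<lambda>x. f x i)"
  shows "smooth_on S (\<lambda>x. \<chi> i. f x i :: 'b::real_normed_vector^'n)"
proof -
  have "(\<chi> i. f x i) = (\<Sum>i\<in>UNIV. axis i (f x i))" for x
    by (simp add: vec_eq_iff axis_def if_distrib cong: if_cong)
  then show ?thesis
    by (simp add: smooth_on_sum smooth_on_bounded_linear[OF bounded_linear_axis] assms)
qed

section \<open>Symmetry of second derivatives\<close>

lemma second_difference_bound:
  fixes f :: "'a::real_normed_vector \<Rightarrow> real"
  assumes S: "open S" "x \<in> S" and f: "\<And>y. y \<in> S \<Longrightarrow> f differentiable (at y)"
    and u: "(\<lambda>y. dd f y u) differentiable (at x)" and e: "e > 0"
  shows "\<exists>d>0. \<forall>t. 0 < t \<and> t < d \<longrightarrow>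
    \<bar>f (x + t *\<^sub>R u + t *\<^sub>R v) - f (x + t *\<^sub>R u) - f (x + t *\<^sub>R v) + f x
      - t\<^sup>2 * dd (\<lambda>y. dd f y u) x v\<bar> \<le> e * t\<^sup>2"
proof -
  define L where "L = dd (\<lambda>y. dd f y u) x"
  \<comment> \<open>Bounds the displacement p u + q v by t N for p, q in [0, t]; the summand 1 keeps
    it positive.\<close>
  define N where "N = norm u + norm v + 1"
  have N: "N > 0" unfolding N_def by (simp add: add_nonneg_pos)
  have lin: "linear L" unfolding L_def by (rule dd_linear[OF u])
  obtain r where r: "r > 0" "ball x r \<subseteq> S" using S openE by blast
  have "((\<lambda>y. dd f y u) has_derivative L) (at x)" unfolding L_def by (rule dd_has_derivative[OF u])
  then obtain s where s: "s > 0"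
    "\<And>y. norm (y - x) < s \<Longrightarrow> \<bar>dd f y u - dd f x u - L (y - x)\<bar> \<le> e / (2 * N) * norm (y - x)"
    unfolding has_derivative_at_alt using e N
    by (metis divide_pos_pos mult_pos_pos zero_less_numeral real_norm_def)
  define d where "d = min r s / N"
  have d: "d > 0" unfolding d_def using r s N by simp
  have "\<bar>f (x + t *\<^sub>R u + t *\<^sub>R v) - f (x + t *\<^sub>R u) - f (x + t *\<^sub>R v) + f x - t\<^sup>2 * L v\<bar> \<le> e * t\<^sup>2"
    if t: "0 < t" "t < d" for t
  proof -
    have small: "norm (p *\<^sub>R u + q *\<^sub>R v) \<le> t * N" "t * N < r" "t * N < s"
      if "0 \<le> p" "p \<le> t" "0 \<le> q" "q \<le> t" for p q
    proof -
      have "norm (p *\<^sub>R u + q *\<^sub>R v) \<le> p * norm u + q * norm v"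
        using norm_triangle_ineq[of "p *\<^sub>R u" "q *\<^sub>R v"] that by simp
      also have "\<dots> \<le> t * norm u + t * norm v" using that by (intro add_mono mult_right_mono) auto
      also have "\<dots> \<le> t * N" unfolding N_def using t by (simp add: algebra_simps)
      finally show "norm (p *\<^sub>R u + q *\<^sub>R v) \<le> t * N" .
      have "t * N < min r s" using t(2) N unfolding d_def by (simp add: field_simps)
      then show "t * N < r" "t * N < s" by auto
    qed
    have inS: "x + p *\<^sub>R u + q *\<^sub>R v \<in> S" if "0 \<le> p" "p \<le> t" "0 \<le> q" "q \<le> t" for p q
    proof -
      have "dist x (x + (p *\<^sub>R u + q *\<^sub>R v)) = norm (p *\<^sub>R u + q *\<^sub>R v)"
        using norm_minus_cancel[of "p *\<^sub>R u + q *\<^sub>R v"] by (simp add: dist_norm)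
      then have "x + (p *\<^sub>R u + q *\<^sub>R v) \<in> ball x r" using small[OF that] by simp
      then show ?thesis using r(2) by (auto simp: add.assoc)
    qed
    have est: "\<bar>dd f (x + p *\<^sub>R u + q *\<^sub>R v) u - dd f x u - L (p *\<^sub>R u + q *\<^sub>R v)\<bar> \<le> e / 2 * t"
      if "0 \<le> p" "p \<le> t" "0 \<le> q" "q \<le> t" for p q
    proof -
      have "norm ((x + p *\<^sub>R u + q *\<^sub>R v) - x) < s" using small[OF that] by (simp add: add.assoc)
      from s(2)[OF this]
      have "\<bar>dd f (x + p *\<^sub>R u + q *\<^sub>R v) u - dd f x u - L (p *\<^sub>R u + q *\<^sub>R v)\<bar>
        \<le> e / (2 * N) * norm (p *\<^sub>R u + q *\<^sub>R v)" by (simp add: add.assoc)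
      also have "\<dots> \<le> e / (2 * N) * (t * N)"
        using small(1)[OF that] e N by (intro mult_left_mono) auto
      finally show ?thesis using N by simp
    qed
    \<comment> \<open>The second difference is an increment of \<open>h\<close>, so the mean value
      theorem leaves a single difference of first derivatives along u.\<close>
    define h where "h = (\<lambda>q. f (x + q *\<^sub>R u + t *\<^sub>R v) - f (x + q *\<^sub>R u))"
    have curve: "((\<lambda>q. f (x + q *\<^sub>R u + w)) has_real_derivative dd f (x + p *\<^sub>R u + w) u) (at p)"
      if "x + p *\<^sub>R u + w \<in> S" for p w
    proof -
      have "((\<lambda>q. x + q *\<^sub>R u + w) has_derivative (\<lambda>q. q *\<^sub>R u)) (at p)"
        by (auto intro!: derivative_eq_intros)
      from has_derivative_compose[OF this dd_has_derivative[OF f[OF that]]]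
      have "((\<lambda>q. f (x + q *\<^sub>R u + w)) has_derivative (\<lambda>q. dd f (x + p *\<^sub>R u + w) (q *\<^sub>R u))) (at p)" .
      then show ?thesis
        by (simp add: has_field_derivative_def dd_scaleR[OF f[OF that]] mult_commute_abs)
    qed
    have dh: "(h has_real_derivative (dd f (x + p *\<^sub>R u + t *\<^sub>R v) u - dd f (x + p *\<^sub>R u) u)) (at p)"
      if "0 \<le> p" "p \<le> t" for p
      unfolding h_def
      using DERIV_diff[OF curve[of p "t *\<^sub>R v"] curve[of p 0]] inS[of p t] inS[of p 0] that t by simp
    obtain z where z: "0 < z" "z < t"
      "h t - h 0 = t * (dd f (x + z *\<^sub>R u + t *\<^sub>R v) u - dd f (x + z *\<^sub>R u) u)"
      using MVT2[OF t(1), of h "\<lambda>p. dd f (x + p *\<^sub>R u + t *\<^sub>R v) u - dd f (x + p *\<^sub>R u) u"] dh by auto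
    define A where "A = dd f (x + z *\<^sub>R u + t *\<^sub>R v) u - dd f x u - L (z *\<^sub>R u + t *\<^sub>R v)"
    define B where "B = dd f (x + z *\<^sub>R u) u - dd f x u - L (z *\<^sub>R u)"
    have AB: "\<bar>A\<bar> \<le> e / 2 * t" "\<bar>B\<bar> \<le> e / 2 * t"
      using est[of z t] est[of z 0] z t unfolding A_def B_def by auto
    have L: "L (z *\<^sub>R u + t *\<^sub>R v) = L (z *\<^sub>R u) + t * L v"
      using lin by (simp add: linear_add linear_scale)
    have "f (x + t *\<^sub>R u + t *\<^sub>R v) - f (x + t *\<^sub>R u) - f (x + t *\<^sub>R v) + f x = h t - h 0"
      unfolding h_def by simp
    also have "\<dots> = t\<^sup>2 * L v + t * (A - B)"
      unfolding z(3) A_def B_def L by (simp add: algebra_simps power2_eq_square)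
    finally have "\<bar>f (x + t *\<^sub>R u + t *\<^sub>R v) - f (x + t *\<^sub>R u) - f (x + t *\<^sub>R v) + f x - t\<^sup>2 * L v\<bar>
      = t * \<bar>A - B\<bar>" using t by (simp add: abs_mult)
    also have "\<dots> \<le> t * (e * t)" using AB t by (intro mult_left_mono) auto
    finally show ?thesis by (simp add: power2_eq_square algebra_simps)
  qed
  then show ?thesis using d unfolding L_def by blast
qed

text \<open>The second difference is symmetric in u and v, and up to o(t^2) it is t^2 times either
  mixed derivative. For this the first derivatives have to be differentiable only at x.\<close>

lemma dd_symmetric_real:
  fixes f :: "'a::real_normed_vector \<Rightarrow> real"
  assumes S: "open S" "x \<in> S" and f: "\<And>y. y \<in> S \<Longrightarrow> f differentiable (at y)"
    and u: "(\<lambda>y. dd f y u) differentiable (at x)" and v: "(\<lambda>y. dd f y v) differentiable (at x)"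
  shows "dd (\<lambda>y. dd f y u) x v = dd (\<lambda>y. dd f y v) x u"
proof (rule ccontr)
  let ?a = "dd (\<lambda>y. dd f y u) x v" and ?b = "dd (\<lambda>y. dd f y v) x u"
  assume "?a \<noteq> ?b"
  \<comment> \<open>A third of the gap, because the two error bounds add up to 2 e.\<close>
  define e where "e = \<bar>?a - ?b\<bar> / 3"
  have e: "e > 0" using \<open>?a \<noteq> ?b\<close> unfolding e_def by simp
  define D where "D t = f (x + t *\<^sub>R u + t *\<^sub>R v) - f (x + t *\<^sub>R u) - f (x + t *\<^sub>R v) + f x" for t
  obtain d where d: "d > 0" "\<And>t. 0 < t \<Longrightarrow> t < d \<Longrightarrow> \<bar>D t - t\<^sup>2 * ?a\<bar> \<le> e * t\<^sup>2"
    using second_difference_bound[OF S f u e, of v] unfolding D_def by blast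
  obtain d' where d': "d' > 0" "\<And>t. 0 < t \<Longrightarrow> t < d' \<Longrightarrow> \<bar>D t - t\<^sup>2 * ?b\<bar> \<le> e * t\<^sup>2"
    using second_difference_bound[OF S f v e, of u] unfolding D_def by (auto simp: algebra_simps)
  define t where "t = min d d' / 2"
  have t: "0 < t" "t < d" "t < d'" using d d' unfolding t_def by auto
  have "\<bar>t\<^sup>2 * ?a - t\<^sup>2 * ?b\<bar> \<le> 2 * e * t\<^sup>2"
    using d(2)[OF t(1,2)] d'(2)[OF t(1,3)] by linarith
  moreover have "\<bar>t\<^sup>2 * ?a - t\<^sup>2 * ?b\<bar> = t\<^sup>2 * \<bar>?a - ?b\<bar>"
    using abs_mult[of "t\<^sup>2" "?a - ?b"] by (simp add: right_diff_distrib)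
  ultimately have "t\<^sup>2 * \<bar>?a - ?b\<bar> \<le> t\<^sup>2 * (2 * e)" by (metis mult.commute)
  then have "\<bar>?a - ?b\<bar> \<le> 2 * e" using t(1) by (subst (asm) mult_le_cancel_left_pos) auto
  then show False using e unfolding e_def by simp
qed

lemma dd_symmetric:
  fixes F :: "'a::real_normed_vector \<Rightarrow> 'b::euclidean_space"
  assumes S: "open S" "x \<in> S" and F: "\<And>y. y \<in> S \<Longrightarrow> F differentiable (at y)"
    and u: "(\<lambda>y. dd F y u) differentiable (at x)" and v: "(\<lambda>y. dd F y v) differentiable (at x)"
  shows "dd (\<lambda>y. dd F y u) x v = dd (\<lambda>y. dd F y v) x u"
proof (rule euclidean_eqI)
  fix b :: 'b
  have bl: "bounded_linear (\<lambda>z::'b. z \<bullet> b)" by (rule bounded_linear_inner_left)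
  have 1: "dd (\<lambda>y. F y \<bullet> b) y w = dd F y w \<bullet> b" if "y \<in> S" for y w
    by (rule dd_bounded_linear[OF bl F[OF that]])
  have 2: "dd (\<lambda>y. dd (\<lambda>y. F y \<bullet> b) y w) x w' = dd (\<lambda>y. dd F y w) x w' \<bullet> b"
    "(\<lambda>y. dd (\<lambda>y. F y \<bullet> b) y w) differentiable (at x)"
    if "(\<lambda>y. dd F y w) differentiable (at x)" for w w'
    using dd_cong_open[OF S, of "\<lambda>y. dd (\<lambda>y. F y \<bullet> b) y w" "\<lambda>y. dd F y w \<bullet> b"] 1
      dd_bounded_linear[OF bl that]
      differentiable_cong_open[OF S _ differentiable_bounded_linear[OF bl that],
        of "\<lambda>y. dd (\<lambda>y. F y \<bullet> b) y w"] by auto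
  have "(\<lambda>y. F y \<bullet> b) differentiable (at y)" if "y \<in> S" for y
    by (rule differentiable_bounded_linear[OF bl F[OF that]])
  from dd_symmetric_real[OF S this 2(2)[OF u] 2(2)[OF v]]
  show "dd (\<lambda>y. dd F y u) x v \<bullet> b = dd (\<lambda>y. dd F y v) x u \<bullet> b"
    using 2(1)[OF u] 2(1)[OF v] by simp
qed

lemma smooth_on_dd_symmetric:
  fixes F :: "'a::real_normed_vector \<Rightarrow> 'b::euclidean_space"
  assumes "open S" "x \<in> S" "smooth_on S F"
  shows "dd (\<lambda>y. dd F y u) x v = dd (\<lambda>y. dd F y v) x u"
  using dd_symmetric[OF assms(1,2)] smooth_on_differentiable[OF assms(3)]
    smooth_on_differentiable[OF smooth_on_dd[OF assms(3)] assms(2)] by blast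

section \<open>One-forms with vector values, evaluated on moving vectors\<close>

definition smooth_form :: "'a::euclidean_space set \<Rightarrow> ('a \<Rightarrow> 'a \<Rightarrow> 'b::real_normed_vector) \<Rightarrow> bool" where
  "smooth_form V a \<longleftrightarrow> (\<forall>y\<in>V. linear (a y)) \<and> (\<forall>u. smooth_on V (\<lambda>y. a y u))"

lemma smooth_form_dd: "smooth_on V F \<Longrightarrow> smooth_form V (dd F)"
  unfolding smooth_form_def using smooth_on_differentiable dd_linear smooth_on_dd by blast

lemma smooth_form_linear: "smooth_form V a \<Longrightarrow> y \<in> V \<Longrightarrow> linear (a y)"
  unfolding smooth_form_def by blast

lemma smooth_form_smooth: "smooth_form V a \<Longrightarrow> smooth_on V (\<lambda>y. a y u)"
  unfolding smooth_form_def by blast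

lemma smooth_form_apply_eq:
  assumes "smooth_form V a" "y \<in> V"
  shows "a y X = (\<Sum>b\<in>Basis. (X \<bullet> b) *\<^sub>R a y b)"
proof -
  have "a y X = a y (\<Sum>b\<in>Basis. (X \<bullet> b) *\<^sub>R b)" by (simp add: euclidean_representation)
  also have "\<dots> = (\<Sum>b\<in>Basis. (X \<bullet> b) *\<^sub>R a y b)"
    using smooth_form_linear[OF assms] by (simp add: linear_sum linear_scale)
  finally show ?thesis .
qed

lemma smooth_form_apply:
  assumes "open V" "smooth_form V a" "smooth_on V X"
  shows "smooth_on V (\<lambda>y. a y (X y))"
proof (rule smooth_on_cong[OF assms(1)])
  show "(\<Sum>b\<in>Basis. (X y \<bullet> b) *\<^sub>R a y b) = a y (X y)" if "y \<in> V" for y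
    by (rule smooth_form_apply_eq[OF assms(2) that, symmetric])
  show "smooth_on V (\<lambda>y. \<Sum>b\<in>Basis. (X y \<bullet> b) *\<^sub>R a y b)"
    by (intro smooth_on_sum smooth_on_scaleR smooth_on_bilinear[OF bounded_bilinear_inner]
        assms smooth_on_const smooth_form_smooth[OF assms(2)])
qed

text \<open>The product rule for a form on a moving vector: first the vector is frozen, then the
  form. It is the bridge between moving frames and the constant coordinate fields in which the
  notions are defined.\<close>

lemma dd_form:
  assumes V: "open V" "x \<in> V" and a: "smooth_form V a" and X: "X differentiable (at x)"
  shows "dd (\<lambda>y. a y (X y)) x u = dd (\<lambda>y. a y (X x)) x u + a x (dd X x u)"
proof -
  have d: "(\<lambda>y. a y b) differentiable (at x)" for b
    using smooth_on_differentiable[OF smooth_form_smooth[OF a] V(2)] .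
  have e: "(\<lambda>y. X y \<bullet> b) differentiable (at x)" for b
    by (rule differentiable_bounded_linear[OF bounded_linear_inner_left X])
  have term1: "dd (\<lambda>y. (X y \<bullet> b) *\<^sub>R a y b) x u
      = (X x \<bullet> b) *\<^sub>R dd (\<lambda>y. a y b) x u + (dd X x u \<bullet> b) *\<^sub>R a x b" for b
    using dd_scaleR_fun[OF e d, of b b u] dd_bounded_linear[OF bounded_linear_inner_left X, of b u] by simp
  have 1: "dd (\<lambda>y. a y (X y)) x u
      = (\<Sum>b\<in>Basis. (X x \<bullet> b) *\<^sub>R dd (\<lambda>y. a y b) x u + (dd X x u \<bullet> b) *\<^sub>R a x b)"
  proof -
    have "dd (\<lambda>y. a y (X y)) x u = dd (\<lambda>y. \<Sum>b\<in>Basis. (X y \<bullet> b) *\<^sub>R a y b) x u"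
      by (rule arg_cong[OF dd_cong_open[OF V], where f = "\<lambda>h. h u"]) (rule smooth_form_apply_eq[OF a])
    also have "\<dots> = (\<Sum>b\<in>Basis. dd (\<lambda>y. (X y \<bullet> b) *\<^sub>R a y b) x u)"
      by (rule dd_sum) (intro differentiable_bilinear[OF bounded_bilinear_scaleR] d e)
    finally show ?thesis using term1 by simp
  qed
  have 2: "dd (\<lambda>y. a y (X x)) x u = (\<Sum>b\<in>Basis. (X x \<bullet> b) *\<^sub>R dd (\<lambda>y. a y b) x u)"
  proof -
    have "dd (\<lambda>y. a y (X x)) x u = dd (\<lambda>y. \<Sum>b\<in>Basis. (X x \<bullet> b) *\<^sub>R a y b) x u"
      by (rule arg_cong[OF dd_cong_open[OF V], where f = "\<lambda>h. h u"]) (rule smooth_form_apply_eq[OF a])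
    also have "\<dots> = (\<Sum>b\<in>Basis. dd (\<lambda>y. (X x \<bullet> b) *\<^sub>R a y b) x u)"
      by (rule dd_sum) (intro differentiable_bilinear[OF bounded_bilinear_scaleR] d differentiable_const)
    finally show ?thesis using dd_bounded_linear[OF bounded_linear_scaleR_right d] by simp
  qed
  show "dd (\<lambda>y. a y (X y)) x u = dd (\<lambda>y. a y (X x)) x u + a x (dd X x u)"
    unfolding 1 2 smooth_form_apply_eq[OF a V(2), of "dd X x u"] by (simp add: sum.distrib)
qed

text \<open>Linearity in u is that of a derivative; linearity in v follows from it by the symmetry
  of second derivatives.\<close>

lemma second_dd_bilinear:
  fixes F :: "'a::euclidean_space \<Rightarrow> 'b::euclidean_space"
  assumes "open S" "x \<in> S" "smooth_on S F"
  shows "bilinear (\<lambda>u v. dd (\<lambda>y. dd F y v) x u)"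
proof -
  have d: "(\<lambda>y. dd F y v) differentiable (at x)" for v
    using smooth_on_differentiable[OF smooth_on_dd[OF assms(3)] assms(2)] .
  have l: "linear (\<lambda>u. dd (\<lambda>y. dd F y v) x u)" for v using dd_linear[OF d] .
  then show ?thesis
    unfolding bilinear_def using smooth_on_dd_symmetric[OF assms] by simp
qed

section \<open>Plane metrics\<close>

definition inner_product_at :: "coord_metric \<Rightarrow> real^2 \<Rightarrow> bool" where
  "inner_product_at g x \<longleftrightarrow> bilinear (g x) \<and> (\<forall>u v. g x u v = g x v u) \<and> (\<forall>u. u \<noteq> 0 \<longrightarrow> 0 < g x u u)"

lemma vec2_eq_axis: "(u :: real^2) = u$1 *\<^sub>R axis 1 1 + u$2 *\<^sub>R axis 2 1"
  by (simp add: vec_eq_iff forall_2 axis_def)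

lemma axis2_nth [simp]:
  "(axis 1 1 :: real^2)$1 = 1" "(axis 1 1 :: real^2)$2 = 0"
  "(axis 2 1 :: real^2)$1 = 0" "(axis 2 1 :: real^2)$2 = 1"
  by (simp_all add: axis_def)

lemma axis2_neq_0: "(axis 1 1 :: real^2) \<noteq> 0" "(axis 2 1 :: real^2) \<noteq> 0"
  by (simp_all add: axis_eq_0_iff)

lemma linear_vec2:
  assumes "linear a"
  shows "a (u :: real^2) = u$1 *\<^sub>R a (axis 1 1) + u$2 *\<^sub>R a (axis 2 1)"
  by (subst vec2_eq_axis[of u]) (simp add: linear_add[OF assms] linear_scale[OF assms])

lemma
  assumes "inner_product_at g x"
  shows inner_product_at_sym: "g x u v = g x v u"
    and inner_product_at_add: "g x (u + w) v = g x u v + g x w v" "g x u (v + w) = g x u v + g x u w"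
    and inner_product_at_scaleR: "g x (r *\<^sub>R u) v = r * g x u v" "g x u (r *\<^sub>R v) = r * g x u v"
    and inner_product_at_diff: "g x (u - w) v = g x u v - g x w v" "g x u (v - w) = g x u v - g x u w"
    and inner_product_at_minus: "g x (- u) v = - g x u v" "g x u (- v) = - g x u v"
    and inner_product_at_pos: "u \<noteq> 0 \<Longrightarrow> 0 < g x u u"
    and inner_product_at_zero: "g x 0 v = 0" "g x u 0 = 0"
  using assms unfolding inner_product_at_def
  by (auto simp: bilinear_ladd bilinear_radd bilinear_lmul bilinear_rmul bilinear_lsub bilinear_rsub
      bilinear_lneg bilinear_rneg bilinear_lzero bilinear_rzero)

lemmas inner_product_at_simps = inner_product_at_add inner_product_at_scaleR inner_product_at_diff
  inner_product_at_minus inner_product_at_zero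

lemma oframe_expand:
  assumes g: "inner_product_at g x" and e: "oframe g x e1 e2"
  shows "u = g x u e1 *\<^sub>R e1 + g x u e2 *\<^sub>R e2"
proof -
  define d where "d = e1$1 * e2$2 - e1$2 * e2$1"
  have d: "d \<noteq> 0" using e unfolding oframe_def d_def by simp
  define s where "s = (u$1 * e2$2 - u$2 * e2$1) / d"
  define t where "t = (e1$1 * u$2 - e1$2 * u$1) / d"
  have u: "u = s *\<^sub>R e1 + t *\<^sub>R e2"
    using d unfolding s_def t_def
    by (simp add: vec_eq_iff forall_2 field_simps) (simp add: d_def algebra_simps)
  have "g x e2 e1 = 0" using e inner_product_at_sym[OF g] unfolding oframe_def by metis
  then have "g x u e1 = s" "g x u e2 = t"
    using e unfolding u oframe_def by (simp_all add: inner_product_at_simps[OF g])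
  then show ?thesis using u by simp
qed

text \<open>By Lagrange's identity the determinant squares to 1, by its sign it is 1, and the rest
  is linear: a positive orthogonal matrix is a rotation.\<close>

lemma rotation_coefficients:
  fixes p q r s :: real
  assumes "p * p + q * q = 1" "r * r + s * s = 1" "p * r + q * s = 0" "0 < p * s - q * r"
  shows "r = - q" "s = p"
proof -
  have "(p * s - q * r)\<^sup>2 = 1" using assms by algebra
  then have d1: "p * s - q * r = 1" using assms(4) by (simp add: power2_eq_1_iff)
  show "s = p" "r = - q" using assms d1 by algebra+
qed

lemma oframe_rotation:
  assumes g: "inner_product_at g x" and e: "oframe g x e1 e2" and f: "oframe g x f1 f2"
  obtains p q where "p\<^sup>2 + q\<^sup>2 = 1" "f1 = p *\<^sub>R e1 + q *\<^sub>R e2" "f2 = (- q) *\<^sub>R e1 + p *\<^sub>R e2"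
proof -
  obtain p q r s where f1: "f1 = p *\<^sub>R e1 + q *\<^sub>R e2" and f2: "f2 = r *\<^sub>R e1 + s *\<^sub>R e2"
    using oframe_expand[OF g e] by metis
  have e': "g x e1 e1 = 1" "g x e2 e2 = 1" "g x e1 e2 = 0" "g x e2 e1 = 0"
    using e inner_product_at_sym[OF g] unfolding oframe_def by metis+
  have eqs: "p * p + q * q = 1" "r * r + s * s = 1" "p * r + q * s = 0"
    using f e' unfolding oframe_def f1 f2 by (simp_all add: inner_product_at_simps[OF g] ac_simps)
  have "f1$1 * f2$2 - f1$2 * f2$1 = (p * s - q * r) * (e1$1 * e2$2 - e1$2 * e2$1)"
    unfolding f1 f2 by (simp add: algebra_simps)
  then have d: "0 < p * s - q * r"
    using e f unfolding oframe_def by (simp add: zero_less_mult_iff)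
  have "r = - q" "s = p" using rotation_coefficients[OF eqs d] by auto
  then show ?thesis using that[of p q] eqs f1 f2 by (simp add: power2_eq_square)
qed

text \<open>Gram-Schmidt on the coordinate basis. An explicit frame is needed because the one chosen
  by \<open>tframe\<close> need not vary smoothly.\<close>

definition gs1 :: "coord_metric \<Rightarrow> real^2 \<Rightarrow> real^2" where
  "gs1 g x = inverse (sqrt (g x (axis 1 1) (axis 1 1))) *\<^sub>R axis 1 1"

definition gs2 :: "coord_metric \<Rightarrow> real^2 \<Rightarrow> real^2" where
  "gs2 g x = (let w = axis 2 1 - g x (axis 2 1) (gs1 g x) *\<^sub>R gs1 g x in inverse (sqrt (g x w w)) *\<^sub>R w)"

text \<open>The second claim keeps the radicand in \<open>gs2\<close> positive, which its smoothness
  will need.\<close>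

lemma oframe_gs:
  assumes g: "inner_product_at g x"
  shows "oframe g x (gs1 g x) (gs2 g x)"
    and "0 < g x (axis 2 1 - g x (axis 2 1) (gs1 g x) *\<^sub>R gs1 g x)
      (axis 2 1 - g x (axis 2 1) (gs1 g x) *\<^sub>R gs1 g x)"
proof -
  let ?e = "gs1 g x" and ?r = "inverse (sqrt (g x (axis 1 1) (axis 1 1)))"
  define w where "w = axis 2 1 - g x (axis 2 1) ?e *\<^sub>R ?e"
  let ?s = "inverse (sqrt (g x w w))"
  have pos1: "0 < g x (axis 1 1) (axis 1 1)"
    by (rule inner_product_at_pos[OF g]) (simp add: axis2_neq_0)
  then have r: "?r > 0" "?r * ?r * g x (axis 1 1) (axis 1 1) = 1"
    by (simp_all add: field_simps)
  have e1: "g x ?e ?e = 1"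
    using r unfolding gs1_def by (simp add: inner_product_at_simps[OF g])
  have comp: "?e $ 1 = ?r" "?e $ 2 = 0" "w $ 2 = 1"
    unfolding w_def gs1_def by simp_all
  have w0: "w \<noteq> 0" using comp(3) by force
  then have pos2: "0 < g x w w" by (rule inner_product_at_pos[OF g])
  then have s: "?s > 0" "?s * ?s * g x w w = 1"
    by (simp_all add: field_simps)
  have ew: "g x ?e w = 0"
    unfolding w_def using e1 by (simp add: inner_product_at_simps[OF g] inner_product_at_sym[OF g, of ?e "axis 2 1"])
  have e2: "gs2 g x = ?s *\<^sub>R w" unfolding gs2_def w_def Let_def ..
  show "oframe g x ?e (gs2 g x)"
    unfolding oframe_def e2 using e1 s ew r comp by (simp add: inner_product_at_simps[OF g])
  show "0 < g x (axis 2 1 - g x (axis 2 1) ?e *\<^sub>R ?e) (axis 2 1 - g x (axis 2 1) ?e *\<^sub>R ?e)"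
    using pos2 unfolding w_def .
qed

lemma oframe_tframe:
  assumes "inner_product_at g x"
  shows "oframe g x (fst (tframe g x)) (snd (tframe g x))"
  unfolding tframe_def
  by (rule someI[of "\<lambda>e. oframe g x (fst e) (snd e)" "(gs1 g x, gs2 g x)"])
    (simp add: oframe_gs(1)[OF assms])

text \<open>The mixed terms of a rotation cancel even for a bilinear map that is not symmetric, so
  any smooth frame may replace the chosen one.\<close>

lemma mtrace_oframe:
  assumes g: "inner_product_at g x" and e: "oframe g x e1 e2" and B: "bilinear B"
  shows "mtrace g x B = B e1 e1 + B e2 e2"
proof -
  obtain p q where pq: "p\<^sup>2 + q\<^sup>2 = 1" "fst (tframe g x) = p *\<^sub>R e1 + q *\<^sub>R e2"
    "snd (tframe g x) = (- q) *\<^sub>R e1 + p *\<^sub>R e2"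
    using oframe_rotation[OF g e oframe_tframe[OF g]] .
  have "mtrace g x B = B (p *\<^sub>R e1 + q *\<^sub>R e2) (p *\<^sub>R e1 + q *\<^sub>R e2)
      + B ((- q) *\<^sub>R e1 + p *\<^sub>R e2) ((- q) *\<^sub>R e1 + p *\<^sub>R e2)"
    unfolding mtrace_def pq(2,3)[symmetric] by (simp add: case_prod_beta)
  also have "\<dots> = (p\<^sup>2 + q\<^sup>2) *\<^sub>R B e1 e1 + (p\<^sup>2 + q\<^sup>2) *\<^sub>R B e2 e2"
    by (simp add: bilinear_ladd[OF B] bilinear_radd[OF B] bilinear_lmul[OF B] bilinear_rmul[OF B]
        bilinear_lneg[OF B] bilinear_rneg[OF B] bilinear_lsub[OF B] bilinear_rsub[OF B]
        algebra_simps power2_eq_square)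
  finally show ?thesis using pq(1) by simp
qed

lemma rotJ_oframe:
  assumes g: "inner_product_at g x" and e: "oframe g x e1 e2"
  shows "rotJ g x (a *\<^sub>R e1 + b *\<^sub>R e2) = (- b) *\<^sub>R e1 + a *\<^sub>R e2"
  unfolding rotJ_def
proof (rule the_equality)
  have e': "g x e1 e1 = 1" "g x e2 e2 = 1" "g x e1 e2 = 0" "g x e2 e1 = 0"
    using e inner_product_at_sym[OF g] unfolding oframe_def by metis+
  let ?u = "a *\<^sub>R e1 + b *\<^sub>R e2"
  define d where "d = e1$1 * e2$2 - e1$2 * e2$1"
  have d: "d > 0" using e unfolding oframe_def d_def by simp
  have det: "?u$1 * (r *\<^sub>R e1 + s *\<^sub>R e2)$2 - ?u$2 * (r *\<^sub>R e1 + s *\<^sub>R e2)$1 = (a * s - b * r) * d" for r s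
    unfolding d_def by (simp add: algebra_simps)
  have gg: "g x ?u (r *\<^sub>R e1 + s *\<^sub>R e2) = a * r + b * s" for r s
    using e' by (simp add: inner_product_at_simps[OF g] algebra_simps)
  have nn: "g x (r *\<^sub>R e1 + s *\<^sub>R e2) (r *\<^sub>R e1 + s *\<^sub>R e2) = r * r + s * s" for r s
    using e' by (simp add: inner_product_at_simps[OF g] algebra_simps)
  have u0: "?u \<noteq> 0 \<longleftrightarrow> a\<^sup>2 + b\<^sup>2 > 0"
    using nn[of a b] inner_product_at_pos[OF g, of ?u] inner_product_at_zero[OF g]
    by (auto simp: power2_eq_square)
  show "g x ?u ((- b) *\<^sub>R e1 + a *\<^sub>R e2) = 0 \<and>
      g x ((- b) *\<^sub>R e1 + a *\<^sub>R e2) ((- b) *\<^sub>R e1 + a *\<^sub>R e2) = g x ?u ?u \<and>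
      (?u \<noteq> 0 \<longrightarrow> 0 < ?u$1 * ((- b) *\<^sub>R e1 + a *\<^sub>R e2)$2 - ?u$2 * ((- b) *\<^sub>R e1 + a *\<^sub>R e2)$1)"
    unfolding gg nn det u0 using d by (simp add: power2_eq_square)
  fix v
  assume v: "g x ?u v = 0 \<and> g x v v = g x ?u ?u \<and> (?u \<noteq> 0 \<longrightarrow> 0 < ?u$1 * v$2 - ?u$2 * v$1)"
  obtain r s where rs: "v = r *\<^sub>R e1 + s *\<^sub>R e2" using oframe_expand[OF g e] by blast
  have v': "a * r + b * s = 0" "r * r + s * s = a * a + b * b"
    "a\<^sup>2 + b\<^sup>2 > 0 \<longrightarrow> 0 < (a * s - b * r) * d"
    using v unfolding rs gg nn det u0 by auto
  show "v = (- b) *\<^sub>R e1 + a *\<^sub>R e2"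
  proof (cases "a\<^sup>2 + b\<^sup>2 > 0")
    case True
    define n where "n = a\<^sup>2 + b\<^sup>2"
    have pos: "0 < a * s - b * r" using v'(3) True d by (simp add: zero_less_mult_iff)
    \<comment> \<open>Lagrange's identity again; the orientation then selects the positive
      root.\<close>
    have "(a * s - b * r)\<^sup>2 = n\<^sup>2" using v'(1,2) unfolding n_def by algebra
    then have eq: "a * s - b * r = n" using pos True unfolding n_def
      by (simp add: power2_eq_iff)
    have "n * s = n * a" using eq v'(1) unfolding n_def by algebra
    moreover have "n * r = n * (- b)" using eq v'(1) unfolding n_def by algebra
    moreover have "n \<noteq> 0" using True unfolding n_def by linarith
    ultimately have "s = a" "r = - b" using mult_left_cancel[of n s a] mult_left_cancel[of n r "- b"] by blast+
    then show ?thesis unfolding rs by simp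
  next
    case False
    then have "a = 0" "b = 0" by (auto simp: not_less sum_power2_le_zero_iff)
    moreover from this v'(2) have "r * r + s * s = 0" by simp
    then have "r = 0" "s = 0" by (auto simp: sum_squares_eq_zero_iff)
    ultimately show ?thesis unfolding rs by simp
  qed
qed

lemma christoffelI:
  assumes g: "inner_product_at g x"
    and w: "\<And>z. g x w z = (dd (\<lambda>y. g y v z) x u + dd (\<lambda>y. g y u z) x v - dd (\<lambda>y. g y u v) x z) / 2"
  shows "christoffel g x u v = w"
  unfolding christoffel_def
proof (rule the_equality)
  show "\<forall>z. g x w z = (dd (\<lambda>y. g y v z) x u + dd (\<lambda>y. g y u z) x v - dd (\<lambda>y. g y u v) x z) / 2"
    using w by blast
  fix w'
  assume "\<forall>z. g x w' z = (dd (\<lambda>y. g y v z) x u + dd (\<lambda>y. g y u z) x v - dd (\<lambda>y. g y u v) x z) / 2"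
  then have "g x w' z = g x w z" for z
    using w by metis
  then have "g x (w' - w) (w' - w) = 0"
    by (simp add: inner_product_at_diff[OF g])
  then show "w' = w" using inner_product_at_pos[OF g, of "w' - w"] by force
qed

text \<open>Alternating forms on a plane are multiples of the determinant, so an identity between
  two of them may be tested on a single basis.\<close>

lemma alternating_vec2:
  assumes "\<And>u. linear (\<lambda>v. D u v)" "\<And>u v. D u v = - D v (u :: real^2)"
  shows "D u v = (u$1 * v$2 - u$2 * v$1) *\<^sub>R (D (axis 1 1) (axis 2 1) :: 'b::real_vector)"
proof -
  have "D w w = 0" for w using assms(2)[of w w] by (metis add_eq_0_iff scaleR_2 scale_eq_0_iff zero_neq_numeral)
  moreover have "D u v = v$1 *\<^sub>R D u (axis 1 1) + v$2 *\<^sub>R D u (axis 2 1)"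
    by (rule linear_vec2[OF assms(1)])
  moreover have "D u w = - (u$1 *\<^sub>R D w (axis 1 1) + u$2 *\<^sub>R D w (axis 2 1))" for w
    using linear_vec2[OF assms(1)[of w], of u] assms(2)[of u w] by simp
  ultimately show ?thesis
    using assms(2)[of "axis 2 1" "axis 1 1"] by (simp add: algebra_simps)
qed

lemma sign_cancel:
  assumes "\<sigma>\<^sup>2 = (1::real)"
  shows "\<sigma> * \<sigma> = 1" and "\<sigma> * (\<sigma> * t) = t"
  using assms by (simp_all add: power2_eq_square mult.assoc[symmetric])

lemma coframe_det_nonzero:
  fixes a b :: "real^2 \<Rightarrow> real"
  assumes lin: "linear a" "linear b" and nondeg: "\<And>u. u \<noteq> 0 \<Longrightarrow> a u \<noteq> 0 \<or> b u \<noteq> 0"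
  shows "a (axis 1 1) * b (axis 2 1) - a (axis 2 1) * b (axis 1 1) \<noteq> 0"
proof
  let ?i = "axis 1 1 :: real^2" and ?j = "axis 2 1 :: real^2"
  assume 0: "a ?i * b ?j - a ?j * b ?i = 0"
  \<comment> \<open>Two cofactor vectors, annihilated by both forms when the determinant vanishes.
    Nondegeneracy makes them zero, so both forms vanish on the first axis.\<close>
  define p where "p = b ?j *\<^sub>R ?i - b ?i *\<^sub>R ?j"
  define q where "q = a ?j *\<^sub>R ?i - a ?i *\<^sub>R ?j"
  have "a p = 0" "b p = 0" "a q = 0" "b q = 0"
    using 0 lin unfolding p_def q_def by (simp_all add: linear_diff linear_scale algebra_simps)
  then have "p = 0" "q = 0" using nondeg by blast+
  then have "p $ 1 = 0" "p $ 2 = 0" "q $ 1 = 0" "q $ 2 = 0" by simp_all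
  then have "a ?i = 0" "b ?i = 0" unfolding p_def q_def by simp_all
  then show False using nondeg[of ?i] axis2_neq_0 by blast
qed

text \<open>Cartan's structure equations: \<open>da = k \<and> b\<close> and \<open>db = - k \<and> a\<close> make \<open>k\<close> the connection form
  of the metric \<open>a\<^sup>2 + b\<^sup>2\<close>, and then \<open>dk = - K a \<and> b\<close>.\<close>
lemma gauss_curvature_coframe:
  assumes V: "open V" "x \<in> V"
    and forms: "smooth_form V a" "smooth_form V b" "smooth_form V k"
    and g: "\<And>y u v. y \<in> V \<Longrightarrow> g y u v = a y u * a y v + b y u * b y v"
    and nondeg: "\<And>y u. y \<in> V \<Longrightarrow> u \<noteq> 0 \<Longrightarrow> a y u \<noteq> 0 \<or> b y u \<noteq> (0::real)"
    and da: "\<And>y u v. y \<in> V \<Longrightarrow>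
      dd (\<lambda>z. a z v) y u - dd (\<lambda>z. a z u) y v = k y u * b y v - k y v * b y u"
    and db: "\<And>y u v. y \<in> V \<Longrightarrow>
      dd (\<lambda>z. b z v) y u - dd (\<lambda>z. b z u) y v = - (k y u * a y v - k y v * a y u)"
  shows "gauss_curvature g x * (a x u * b x v - a x v * b x u)
    = - (dd (\<lambda>y. k y v) x u - dd (\<lambda>y. k y u) x v)"
proof -
  let ?i = "axis 1 1 :: real^2" and ?j = "axis 2 1 :: real^2"
  have lin: "linear (a y)" "linear (b y)" "linear (k y)" if "y \<in> V" for y
    using forms smooth_form_linear that by blast+
  have sm: "smooth_on V (\<lambda>y. a y u)" "smooth_on V (\<lambda>y. b y u)" "smooth_on V (\<lambda>y. k y u)" for u
    using forms smooth_form_smooth by blast+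
  have df: "(\<lambda>y. a y u) differentiable (at y)" "(\<lambda>y. b y u) differentiable (at y)"
    "(\<lambda>y. k y u) differentiable (at y)" if "y \<in> V" for y u
    using smooth_on_differentiable[OF sm(1) that] smooth_on_differentiable[OF sm(2) that]
      smooth_on_differentiable[OF sm(3) that] by blast+
  have ip: "inner_product_at g y" if y: "y \<in> V" for y
    unfolding inner_product_at_def bilinear_def
  proof (intro conjI allI impI)
    show "linear (\<lambda>v. g y u v)" "linear (\<lambda>u. g y u v)" for u v
      unfolding g[OF y] using lin[OF y]
      by (auto intro!: linearI simp: linear_add linear_scale algebra_simps)
    show "g y u v = g y v u" for u v unfolding g[OF y] by simp
    show "0 < g y u u" if "u \<noteq> 0" for u
      using nondeg[OF y that] unfolding g[OF y] by (simp add: sum_squares_gt_zero_iff)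
  qed
  define D where "D y = a y ?i * b y ?j - a y ?j * b y ?i" for y
  have D: "D y \<noteq> 0" if "y \<in> V" for y
    unfolding D_def by (rule coframe_det_nonzero[OF lin(1,2)[OF that] nondeg[OF that]])
  \<comment> \<open>The frame dual to a, b, by Cramer's rule.\<close>
  define f1 where "f1 y = inverse (D y) *\<^sub>R (b y ?j *\<^sub>R ?i - b y ?i *\<^sub>R ?j)" for y
  define f2 where "f2 y = inverse (D y) *\<^sub>R (a y ?i *\<^sub>R ?j - a y ?j *\<^sub>R ?i)" for y
  have dual: "a y (f1 y) = 1" "b y (f1 y) = 0" "a y (f2 y) = 0" "b y (f2 y) = 1" if y: "y \<in> V" for y
    using D[OF y] lin[OF y] unfolding f1_def f2_def
    by (simp_all add: linear_diff linear_scale field_simps) (simp_all add: D_def algebra_simps)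
  have smD: "smooth_on V D" unfolding D_def
    by (intro smooth_on_diff smooth_on_mult V sm)
  have smf: "smooth_on V f1" "smooth_on V f2"
    unfolding f1_def f2_def
    by (intro smooth_on_scaleR smooth_on_diff smooth_on_inverse V sm smD D smooth_on_const | assumption)+
  \<comment> \<open>The expected components of \<nabla> of the constant field v along u, from
    \<nabla>a = k b and \<nabla>b = - k a. The hypotheses \<open>da\<close> and \<open>db\<close>
    say that they are symmetric in u and v, that is, that there is no torsion.\<close>
  define P where "P y u v = dd (\<lambda>z. a z v) y u - k y u * b y v" for y u v
  define Q where "Q y u v = dd (\<lambda>z. b z v) y u + k y u * a y v" for y u v
  define G where "G y u v = P y u v *\<^sub>R f1 y + Q y u v *\<^sub>R f2 y" for y u v
  have aG: "a y (G y u v) = P y u v" and bG: "b y (G y u v) = Q y u v" if y: "y \<in> V" for y u v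
    unfolding G_def using dual[OF y] lin[OF y] by (simp_all add: linear_add linear_scale)
  have smPQ: "smooth_on V (\<lambda>y. P y u v)" "smooth_on V (\<lambda>y. Q y u v)" for u v
    unfolding P_def Q_def
    by (intro smooth_on_diff smooth_on_add smooth_on_mult smooth_on_dd V sm)+
  have smG: "smooth_on V (\<lambda>y. G y u v)" for u v
    unfolding G_def by (intro smooth_on_add smooth_on_scaleR V smPQ smf)
  have chr: "christoffel g y u v = G y u v" if y: "y \<in> V" for y u v
  proof (rule christoffelI[OF ip[OF y]])
    fix z
    have dg: "dd (\<lambda>y. g y p q) y w
      = a y p * dd (\<lambda>z. a z q) y w + dd (\<lambda>z. a z p) y w * a y q
      + (b y p * dd (\<lambda>z. b z q) y w + dd (\<lambda>z. b z p) y w * b y q)" for p q w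
    proof -
      have "dd (\<lambda>y. g y p q) y w = dd (\<lambda>y. a y p * a y q + b y p * b y q) y w"
        by (rule arg_cong[OF dd_cong_open[OF V(1) y], where f = "\<lambda>h. h w"]) (rule g)
      then show ?thesis
        by (simp add: dd_plus differentiable_bilinear[OF bounded_bilinear_mult] df[OF y] dd_mult)
    qed
    \<comment> \<open>Koszul's formula: the structure equations at the three pairs among u, v, z
      exchange the arguments of the first derivatives as needed.\<close>
    have "2 * g y (G y u v) z = dd (\<lambda>y. g y v z) y u + dd (\<lambda>y. g y u z) y v - dd (\<lambda>y. g y u v) y z"
      unfolding dg g[OF y] aG[OF y] bG[OF y] P_def Q_def
      using da[OF y, of u v] db[OF y, of u v] da[OF y, of u z] db[OF y, of u z]
        da[OF y, of v z] db[OF y, of v z] by algebra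
    then show "g y (G y u v) z
      = (dd (\<lambda>y. g y v z) y u + dd (\<lambda>y. g y u z) y v - dd (\<lambda>y. g y u v) y z) / 2" by simp
  qed
  have sm1: "(\<lambda>y. dd (\<lambda>z. a z w) y v) differentiable (at x)"
    "(\<lambda>y. dd (\<lambda>z. b z w) y v) differentiable (at x)" for v w
    using smooth_on_differentiable[OF smooth_on_dd[OF sm(1)] V(2)]
      smooth_on_differentiable[OF smooth_on_dd[OF sm(2)] V(2)] by blast+
  define dk where "dk u v = dd (\<lambda>y. k y v) x u - dd (\<lambda>y. k y u) x v" for u v
  define R where "R u v w = riem g x u v w" for u v w
  have R: "R u v w = dd (\<lambda>y. G y v w) x u - dd (\<lambda>y. G y u w) x v + G x u (G x v w) - G x v (G x u w)"
    for u v w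
  proof -
    have "dd (\<lambda>y. christoffel g y v w) x = dd (\<lambda>y. G y v w) x" for v w
      by (rule dd_cong_open[OF V]) (rule chr)
    then show ?thesis unfolding R_def riem_def by (simp add: chr[OF V(2)])
  qed
  have dG: "(\<lambda>y. G y v w) differentiable (at x)" for v w
    using smooth_on_differentiable[OF smG V(2)] .
  \<comment> \<open>Only the components of the derivative of \<open>G\<close> are needed; they come
    from differentiating \<open>aG\<close> and \<open>bG\<close>.\<close>
  have aD: "a x (dd (\<lambda>y. G y v w) x u) = dd (\<lambda>y. P y v w) x u - dd (\<lambda>y. a y (G x v w)) x u" for u v w
  proof -
    have "dd (\<lambda>y. a y (G y v w)) x = dd (\<lambda>y. P y v w) x" by (rule dd_cong_open[OF V]) (rule aG)
    then show ?thesis using dd_form[OF V forms(1) dG, of v w u] by simp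
  qed
  have bD: "b x (dd (\<lambda>y. G y v w) x u) = dd (\<lambda>y. Q y v w) x u - dd (\<lambda>y. b y (G x v w)) x u" for u v w
  proof -
    have "dd (\<lambda>y. b y (G y v w)) x = dd (\<lambda>y. Q y v w) x" by (rule dd_cong_open[OF V]) (rule bG)
    then show ?thesis using dd_form[OF V forms(2) dG, of v w u] by simp
  qed
  have dP: "dd (\<lambda>y. P y v w) x u = dd (\<lambda>y. dd (\<lambda>z. a z w) y v) x u
      - (k x v * dd (\<lambda>y. b y w) x u + dd (\<lambda>y. k y v) x u * b x w)" for u v w
    unfolding P_def
    by (simp add: dd_minus_fun sm1 differentiable_bilinear[OF bounded_bilinear_mult] df[OF V(2)] dd_mult)
  have dQ: "dd (\<lambda>y. Q y v w) x u = dd (\<lambda>y. dd (\<lambda>z. b z w) y v) x u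
      + (k x v * dd (\<lambda>y. a y w) x u + dd (\<lambda>y. k y v) x u * a x w)" for u v w
    unfolding Q_def
    by (simp add: dd_plus sm1 differentiable_bilinear[OF bounded_bilinear_mult] df[OF V(2)] dd_mult)
  have aR: "a x (R u v w) = - dk u v * b x w" for u v w
    using smooth_on_dd_symmetric[OF V sm(1)[of w], of u v]
    unfolding R linear_diff[OF lin(1)[OF V(2)]] linear_add[OF lin(1)[OF V(2)]] aD aG[OF V(2)] dP dk_def
    unfolding P_def aG[OF V(2)] bG[OF V(2)] Q_def by (simp add: algebra_simps)
  have bR: "b x (R u v w) = dk u v * a x w" for u v w
    using smooth_on_dd_symmetric[OF V sm(2)[of w], of u v]
    unfolding R linear_diff[OF lin(2)[OF V(2)]] linear_add[OF lin(2)[OF V(2)]] bD bG[OF V(2)] dQ dk_def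
    unfolding Q_def aG[OF V(2)] bG[OF V(2)] P_def by (simp add: algebra_simps)
  obtain e1 e2 where tf: "tframe g x = (e1, e2)" by (cases "tframe g x")
  have of: "oframe g x e1 e2" using oframe_tframe[OF ip[OF V(2)]] tf by simp
  define w where "w u v = a x u * b x v - a x v * b x u" for u v
  have K: "gauss_curvature g x = - dk e1 e2 * w e1 e2"
    unfolding gauss_curvature_def tf g[OF V(2)] w_def R_def[symmetric] by (simp add: aR bR algebra_simps)
  \<comment> \<open>The coframe may be negatively oriented, so the area of the positive frame is
    known only up to sign. It occurs twice, and the sign drops out.\<close>
  have ww: "w e1 e2 * w e1 e2 = 1"
    using of unfolding oframe_def g[OF V(2)] w_def by algebra
  define det2 where "det2 u v = u$1 * v$2 - u$2 * v$1" for u v :: "real^2"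
  have dk2: "dk u v = det2 u v * dk ?i ?j" for u v
  proof -
    have "linear (\<lambda>v. dk u v)" for u
    proof (rule linearI)
      have c: "dd (\<lambda>y. k y (p + q)) x = dd (\<lambda>y. k y p + k y q) x" for p q
        by (rule dd_cong_open[OF V]) (simp add: lin linear_add)
      have c': "dd (\<lambda>y. k y (r *\<^sub>R p)) x = dd (\<lambda>y. r * k y p) x" for r p
        by (rule dd_cong_open[OF V]) (simp add: lin linear_scale)
      show "dk u (p + q) = dk u p + dk u q" for p q
        unfolding dk_def c by (simp add: dd_plus dd_add df[OF V(2)])
      show "dk u (r *\<^sub>R p) = r *\<^sub>R dk u p" for r p
        unfolding dk_def c' by (simp add: dd_mult dd_scaleR df[OF V(2)] algebra_simps)
    qed
    from alternating_vec2[of dk u v, OF this] show ?thesis unfolding det2_def by (simp add: dk_def)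
  qed
  have w2: "w u v = det2 u v * w ?i ?j" for u v
  proof -
    have "linear (\<lambda>v. w u v)" for u
      unfolding w_def by (auto intro!: linearI simp: lin[OF V(2)] linear_add linear_scale algebra_simps)
    from alternating_vec2[of w u v, OF this] show ?thesis unfolding det2_def by (simp add: w_def)
  qed
  have "gauss_curvature g x * w u v = - dk u v"
    unfolding K dk2[of e1 e2] dk2[of u v] w2[of u v] w2[of e1 e2]
    using ww unfolding w2[of e1 e2] by algebra
  then show ?thesis unfolding w_def dk_def .
qed

section \<open>The ambient space and adapted frames\<close>

lemma exhaust_5:
  fixes x :: 5
  shows "x = 1 \<or> x = 2 \<or> x = 3 \<or> x = 4 \<or> x = 5"
proof (induct x)
  case (of_int z)
  then have "0 \<le> z" and "z < 5" by simp_all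
  then have "z = 0 \<or> z = 1 \<or> z = 2 \<or> z = 3 \<or> z = 4" by arith
  then show ?case by auto
qed

lemma forall_5: "(\<forall>i::5. P i) \<longleftrightarrow> P 1 \<and> P 2 \<and> P 3 \<and> P 4 \<and> P 5"
  by (metis exhaust_5)

lemma UNIV_5: "UNIV = {1, 2, 3, 4, 5::5}"
  using exhaust_5 by auto

lemma sum_5: "sum f (UNIV::5 set) = f 1 + f 2 + f 3 + f 4 + f 5"
  unfolding UNIV_5 by (simp add: ac_simps)

lemma bounded_bilinear_amb: "bounded_bilinear (amb c)"
  unfolding bilinear_conv_bounded_bilinear[symmetric] bilinear_def amb_def
  by (auto intro!: linearI simp: algebra_simps add_divide_distrib)

lemma bounded_bilinear_ell: "bounded_bilinear (ell c)"
  unfolding bilinear_conv_bounded_bilinear[symmetric] bilinear_def ell_def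
  by (auto intro!: linearI simp: algebra_simps)

lemma amb_sym: "amb c v w = amb c w v"
  unfolding amb_def by (simp add: algebra_simps)

lemma ell_sym: "ell c v w = ell c w v"
  unfolding ell_def by (simp add: algebra_simps)

lemmas amb_simps = bounded_bilinear.add_left[OF bounded_bilinear_amb]
  bounded_bilinear.add_right[OF bounded_bilinear_amb]
  bounded_bilinear.diff_left[OF bounded_bilinear_amb]
  bounded_bilinear.diff_right[OF bounded_bilinear_amb]
  bounded_bilinear.minus_left[OF bounded_bilinear_amb]
  bounded_bilinear.minus_right[OF bounded_bilinear_amb]
  bounded_bilinear.scaleR_left[OF bounded_bilinear_amb]
  bounded_bilinear.scaleR_right[OF bounded_bilinear_amb]
  bounded_bilinear.zero_left[OF bounded_bilinear_amb]
  bounded_bilinear.zero_right[OF bounded_bilinear_amb]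

lemmas ell_simps = bounded_bilinear.add_left[OF bounded_bilinear_ell]
  bounded_bilinear.add_right[OF bounded_bilinear_ell]
  bounded_bilinear.diff_left[OF bounded_bilinear_ell]
  bounded_bilinear.diff_right[OF bounded_bilinear_ell]
  bounded_bilinear.minus_left[OF bounded_bilinear_ell]
  bounded_bilinear.minus_right[OF bounded_bilinear_ell]
  bounded_bilinear.scaleR_left[OF bounded_bilinear_ell]
  bounded_bilinear.scaleR_right[OF bounded_bilinear_ell]
  bounded_bilinear.zero_left[OF bounded_bilinear_ell]
  bounded_bilinear.zero_right[OF bounded_bilinear_ell]

lemma ell_eq_amb: "c \<noteq> 0 \<Longrightarrow> ell c v w = c * amb c v w"
  unfolding ell_def amb_def by (simp add: algebra_simps)

text \<open>For c = 0 both sides vanish, because \<open>P$5\<close> is nonzero and so a tangent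
  vector has no fifth component. This lets later arguments treat all c at once.\<close>

lemma ell_eq_amb_TQ:
  assumes P: "ell c P P = 1" and v: "v \<in> TQ c P"
  shows "ell c v w = c * amb c v w"
proof (cases "c = 0")
  case True
  then have "P$5 * P$5 = 1" "P$5 * v$5 = 0" using P v unfolding ell_def TQ_def by auto
  then have "v$5 = 0" by auto
  then show ?thesis using True unfolding ell_def by simp
qed (simp add: ell_eq_amb)

text \<open>The factor c covers the flat case, in which the position vector need not be orthogonal
  to the tangent space.\<close>

lemma amb_TQ_base:
  assumes "v \<in> TQ c P"
  shows "c * amb c P v = 0"
  using assms ell_eq_amb[of c P v] unfolding TQ_def by (cases "c = 0") auto

lemma TQ_linear:
  "v \<in> TQ c P \<Longrightarrow> w \<in> TQ c P \<Longrightarrow> v + w \<in> TQ c P"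
  "v \<in> TQ c P \<Longrightarrow> w \<in> TQ c P \<Longrightarrow> v - w \<in> TQ c P"
  "v \<in> TQ c P \<Longrightarrow> - v \<in> TQ c P"
  "v \<in> TQ c P \<Longrightarrow> r *\<^sub>R v \<in> TQ c P"
  "0 \<in> TQ c P"
  unfolding TQ_def by (simp_all add: ell_simps)

lemma nspace_linear:
  "v \<in> nspace c F x \<Longrightarrow> w \<in> nspace c F x \<Longrightarrow> v + w \<in> nspace c F x"
  "v \<in> nspace c F x \<Longrightarrow> w \<in> nspace c F x \<Longrightarrow> v - w \<in> nspace c F x"
  "v \<in> nspace c F x \<Longrightarrow> - v \<in> nspace c F x"
  "v \<in> nspace c F x \<Longrightarrow> r *\<^sub>R v \<in> nspace c F x"
  "0 \<in> nspace c F x"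
  unfolding nspace_def by (simp_all add: TQ_linear amb_simps)

text \<open>The map \<open>S\<close> builds a vector from five coordinates and \<open>R\<close>
  reads them off. That \<open>R\<close> inverts \<open>S\<close> from the left is a computation; in
  equal finite dimensions it then inverts it from the right, which is the claim.\<close>

lemma TQ_orthonormal_expand:
  assumes P: "ell c P P = 1" and T: "\<And>i. i < 4 \<Longrightarrow> E i \<in> TQ c P"
    and on: "\<And>i j. i < 4 \<Longrightarrow> j < 4 \<Longrightarrow> amb c (E i) (E j) = (if i = j then 1 else 0)"
  shows "v = ell c P v *\<^sub>R P + (\<Sum>i<(4::nat). amb c (v - ell c P v *\<^sub>R P) (E i) *\<^sub>R E i)"
proof -
  define S :: "real^5 \<Rightarrow> real^5" where
    "S y = y$5 *\<^sub>R P + (y$1 *\<^sub>R E 0 + y$2 *\<^sub>R E 1 + y$3 *\<^sub>R E 2 + y$4 *\<^sub>R E 3)" for y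
  define q where "q v i = amb c (v - ell c P v *\<^sub>R P) (E i)" for v i
  define R :: "real^5 \<Rightarrow> real^5" where
    "R v = q v 0 *\<^sub>R axis 1 1 + q v 1 *\<^sub>R axis 2 1 + q v 2 *\<^sub>R axis 3 1 + q v 3 *\<^sub>R axis 4 1
      + ell c P v *\<^sub>R axis 5 1" for v
  have lS: "linear S" unfolding S_def by (auto intro!: linearI simp: algebra_simps)
  have lR: "linear R" unfolding R_def q_def
    by (auto intro!: linearI simp: algebra_simps amb_simps ell_simps)
  have T': "ell c P (E i) = 0" if "i < 4" for i using T[OF that] unfolding TQ_def by simp
  have RS: "R (S y) = y" for y
  proof -
    have l: "ell c P (S y) = y$5" unfolding S_def by (simp add: ell_simps T' P)
    have "S y - ell c P (S y) *\<^sub>R P = y$1 *\<^sub>R E 0 + y$2 *\<^sub>R E 1 + y$3 *\<^sub>R E 2 + y$4 *\<^sub>R E 3"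
      unfolding l unfolding S_def by simp
    then have "q (S y) 0 = y$1" "q (S y) 1 = y$2" "q (S y) 2 = y$3" "q (S y) 3 = y$4"
      unfolding q_def by (simp_all add: amb_simps on)
    then show ?thesis unfolding R_def l by (simp add: vec_eq_iff forall_5 axis_def)
  qed
  then have "R \<circ> S = id" by auto
  then have "S \<circ> R = id" using linear_inverse_left[OF lS lR] by simp
  then have "S (R v) = v" by (metis comp_apply id_apply)
  moreover have "S (R v) = ell c P v *\<^sub>R P
      + (q v 0 *\<^sub>R E 0 + q v 1 *\<^sub>R E 1 + q v 2 *\<^sub>R E 2 + q v 3 *\<^sub>R E 3)"
    unfolding S_def R_def by (simp add: axis_def)
  moreover have "(\<Sum>i<(4::nat). q v i *\<^sub>R E i) = q v 0 *\<^sub>R E 0 + q v 1 *\<^sub>R E 1 + q v 2 *\<^sub>R E 2 + q v 3 *\<^sub>R E 3"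
    by (simp add: eval_nat_numeral)
  ultimately show ?thesis unfolding q_def by simp
qed

section \<open>Moving frames along an immersion and their structure equations\<close>

locale adapted_frame =
  fixes c :: real and V :: "(real^2) set" and F :: "real^2 \<Rightarrow> real^5" and g :: coord_metric
    and e1 e2 :: "real^2 \<Rightarrow> real^2" and N3 N4 :: "real^2 \<Rightarrow> real^5"
  assumes open_V: "open V"
    and smooth_F: "smooth_on V F"
    and F_Q4: "y \<in> V \<Longrightarrow> F y \<in> Q4 c"
    and isometric: "y \<in> V \<Longrightarrow> amb c (dd F y u) (dd F y v) = g y u v"
    and ip: "y \<in> V \<Longrightarrow> inner_product_at g y"
    and smooth_e: "smooth_on V e1" "smooth_on V e2"
    and oframe: "y \<in> V \<Longrightarrow> oframe g y (e1 y) (e2 y)"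
    and smooth_N: "smooth_on V N3" "smooth_on V N4"
    and nspace_N: "y \<in> V \<Longrightarrow> N3 y \<in> nspace c F y" "y \<in> V \<Longrightarrow> N4 y \<in> nspace c F y"
    and orthonormal_N: "y \<in> V \<Longrightarrow> amb c (N3 y) (N3 y) = 1"
      "y \<in> V \<Longrightarrow> amb c (N4 y) (N4 y) = 1" "y \<in> V \<Longrightarrow> amb c (N3 y) (N4 y) = 0"
    and positive_N: "y \<in> V \<Longrightarrow> npositive F y (N3 y) (N4 y)"
begin

definition "E1 = (\<lambda>y. dd F y (e1 y))"
definition "E2 = (\<lambda>y. dd F y (e2 y))"

text \<open>Cartan's coefficients: \<open>k1\<close>, \<open>k2\<close> are the values of the
  Levi-Civita connection form on \<open>e1\<close>, \<open>e2\<close>, and \<open>n1\<close>,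
  \<open>n2\<close> those of the normal connection form; the other six are components of \<alpha>
  along \<open>N3\<close> and \<open>N4\<close>. Flat derivatives suffice, since the projection to
  the space form does not change products with frame vectors.\<close>

definition "k1 = (\<lambda>y. amb c (dd E1 y (e1 y)) (E2 y))"
definition "k2 = (\<lambda>y. amb c (dd E1 y (e2 y)) (E2 y))"
definition "n1 = (\<lambda>y. amb c (dd N3 y (e1 y)) (N4 y))"
definition "n2 = (\<lambda>y. amb c (dd N3 y (e2 y)) (N4 y))"
definition "h311 = (\<lambda>y. amb c (dd E1 y (e1 y)) (N3 y))"
definition "h312 = (\<lambda>y. amb c (dd E2 y (e1 y)) (N3 y))"
definition "h322 = (\<lambda>y. amb c (dd E2 y (e2 y)) (N3 y))"
definition "h411 = (\<lambda>y. amb c (dd E1 y (e1 y)) (N4 y))"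
definition "h412 = (\<lambda>y. amb c (dd E2 y (e1 y)) (N4 y))"
definition "h422 = (\<lambda>y. amb c (dd E2 y (e2 y)) (N4 y))"

definition tfield :: "(real^2 \<Rightarrow> real^5) \<Rightarrow> bool" where
  "tfield X \<longleftrightarrow> smooth_on V X \<and> (\<forall>y\<in>V. X y \<in> TQ c (F y))"

lemma F_unit: "y \<in> V \<Longrightarrow> ell c (F y) (F y) = 1"
  using F_Q4 unfolding Q4_def by blast

lemma F_differentiable: "y \<in> V \<Longrightarrow> F differentiable (at y)"
  using smooth_on_differentiable[OF smooth_F] .

lemma dF_TQ:
  assumes y: "y \<in> V"
  shows "dd F y u \<in> TQ c (F y)"
proof -
  have "dd (\<lambda>y. ell c (F y) (F y)) y u = dd (\<lambda>_. 1::real) y u"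
    by (rule arg_cong[OF dd_cong_open[OF open_V y], where f = "\<lambda>h. h u"]) (rule F_unit)
  then show ?thesis
    using dd_bilinear[OF bounded_bilinear_ell F_differentiable[OF y] F_differentiable[OF y], of c u]
      ell_sym[of c "F y" "dd F y u"] unfolding TQ_def by simp
qed

lemma smooth_dF: "smooth_on V X \<Longrightarrow> smooth_on V (\<lambda>y. dd F y (X y))"
  by (rule smooth_form_apply[OF open_V smooth_form_dd[OF smooth_F]])

lemma smooth_E: "smooth_on V E1" "smooth_on V E2"
  unfolding E1_def E2_def by (rule smooth_dF, rule smooth_e)+

lemma tfield_frame: "tfield E1" "tfield E2" "tfield N3" "tfield N4"
  using smooth_E smooth_N dF_TQ nspace_N unfolding tfield_def E1_def E2_def nspace_def by auto

lemma tfield_differentiable: "tfield X \<Longrightarrow> y \<in> V \<Longrightarrow> X differentiable (at y)"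
  unfolding tfield_def using smooth_on_differentiable by blast

lemma orthonormal:
  assumes y: "y \<in> V"
  shows "amb c (E1 y) (E1 y) = 1" "amb c (E1 y) (E2 y) = 0" "amb c (E2 y) (E1 y) = 0" "amb c (E2 y) (E2 y) = 1"
    "amb c (E1 y) (N3 y) = 0" "amb c (N3 y) (E1 y) = 0" "amb c (E1 y) (N4 y) = 0" "amb c (N4 y) (E1 y) = 0"
    "amb c (E2 y) (N3 y) = 0" "amb c (N3 y) (E2 y) = 0" "amb c (E2 y) (N4 y) = 0" "amb c (N4 y) (E2 y) = 0"
    "amb c (N3 y) (N3 y) = 1" "amb c (N3 y) (N4 y) = 0" "amb c (N4 y) (N3 y) = 0" "amb c (N4 y) (N4 y) = 1"
proof -
  show 1: "amb c (E1 y) (E1 y) = 1" "amb c (E1 y) (E2 y) = 0" "amb c (E2 y) (E2 y) = 1"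
    using oframe[OF y] unfolding E1_def E2_def isometric[OF y] oframe_def by auto
  show 2: "amb c (N3 y) (E1 y) = 0" "amb c (N4 y) (E1 y) = 0" "amb c (N3 y) (E2 y) = 0" "amb c (N4 y) (E2 y) = 0"
    using nspace_N[OF y] unfolding E1_def E2_def nspace_def by auto
  show 3: "amb c (N3 y) (N3 y) = 1" "amb c (N3 y) (N4 y) = 0" "amb c (N4 y) (N4 y) = 1"
    using orthonormal_N[OF y] by auto
  show "amb c (E2 y) (E1 y) = 0" "amb c (E1 y) (N3 y) = 0" "amb c (E1 y) (N4 y) = 0"
    "amb c (E2 y) (N3 y) = 0" "amb c (E2 y) (N4 y) = 0" "amb c (N4 y) (N3 y) = 0"
    using 1 2 3 amb_sym by metis+
qed

lemma ell_frame:
  assumes y: "y \<in> V"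
  shows "ell c (F y) (E1 y) = 0" "ell c (F y) (E2 y) = 0" "ell c (F y) (N3 y) = 0" "ell c (F y) (N4 y) = 0"
  using tfield_frame y unfolding tfield_def TQ_def by auto

lemma expand:
  assumes y: "y \<in> V"
  shows "v = ell c (F y) v *\<^sub>R F y
    + (amb c (v - ell c (F y) v *\<^sub>R F y) (E1 y) *\<^sub>R E1 y + amb c (v - ell c (F y) v *\<^sub>R F y) (E2 y) *\<^sub>R E2 y
      + amb c (v - ell c (F y) v *\<^sub>R F y) (N3 y) *\<^sub>R N3 y + amb c (v - ell c (F y) v *\<^sub>R F y) (N4 y) *\<^sub>R N4 y)"
proof -
  define E where "E i = [E1 y, E2 y, N3 y, N4 y] ! i" for i :: nat
  have E: "E 0 = E1 y" "E 1 = E2 y" "E 2 = N3 y" "E 3 = N4 y" unfolding E_def by simp_all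
  have all4: "(\<forall>i<4::nat. P i) \<longleftrightarrow> P 0 \<and> P 1 \<and> P 2 \<and> P 3" for P
    by (auto simp: numeral_eq_Suc less_Suc_eq)
  have "\<forall>i<4. E i \<in> TQ c (F y)"
    unfolding all4 E using tfield_frame y unfolding tfield_def by auto
  moreover have "\<forall>i<4. \<forall>j<4. amb c (E i) (E j) = (if i = j then 1 else 0)"
    unfolding all4 E using orthonormal[OF y] by simp
  ultimately have v: "v = ell c (F y) v *\<^sub>R F y + (\<Sum>i<(4::nat). amb c (v - ell c (F y) v *\<^sub>R F y) (E i) *\<^sub>R E i)"
    using TQ_orthonormal_expand[OF F_unit[OF y], of E v] by blast
  have sum4: "(\<Sum>i<(4::nat). f i *\<^sub>R E i) = f 0 *\<^sub>R E 0 + f 1 *\<^sub>R E 1 + f 2 *\<^sub>R E 2 + f 3 *\<^sub>R E 3" for f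
    by (simp add: eval_nat_numeral)
  show ?thesis using v unfolding sum4 E .
qed

lemma expand_TQ:
  assumes "y \<in> V" "v \<in> TQ c (F y)"
  shows "v = amb c v (E1 y) *\<^sub>R E1 y + amb c v (E2 y) *\<^sub>R E2 y + amb c v (N3 y) *\<^sub>R N3 y + amb c v (N4 y) *\<^sub>R N4 y"
  using expand[OF assms(1), of v] assms(2) unfolding TQ_def by simp

text \<open>Differentiate \<open>ell c (F y) (X y) = 0\<close>. This component along the position
  vector is the second fundamental form of the quadric, the source of c in the Gauss
  equation.\<close>

lemma ell_dX:
  assumes X: "tfield X" and y: "y \<in> V"
  shows "ell c (F y) (dd X y u) = - c * amb c (dd F y u) (X y)"
proof -
  have "dd (\<lambda>y. ell c (F y) (X y)) y u = dd (\<lambda>_. 0::real) y u"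
    by (rule arg_cong[OF dd_cong_open[OF open_V y], where f = "\<lambda>h. h u"])
      (use X in \<open>auto simp: tfield_def TQ_def\<close>)
  then have "ell c (F y) (dd X y u) + ell c (dd F y u) (X y) = 0"
    using dd_bilinear[OF bounded_bilinear_ell F_differentiable[OF y] tfield_differentiable[OF X y], of c u]
    by simp
  then show ?thesis using ell_eq_amb_TQ[OF F_unit[OF y] dF_TQ[OF y], of u "X y"] by simp
qed

text \<open>The position component carries a factor c, and c times the product of the position
  vector with a tangent vector is zero.\<close>

lemma amb_tproj:
  assumes X: "tfield X" and y: "y \<in> V" and w: "w \<in> TQ c (F y)"
  shows "amb c (dd X y u - ell c (F y) (dd X y u) *\<^sub>R F y) w = amb c (dd X y u) w"
  using amb_TQ_base[OF w] unfolding ell_dX[OF X y] by (auto simp: amb_simps)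

lemma dX_expand:
  assumes X: "tfield X" and y: "y \<in> V"
  shows "dd X y u = (- c * amb c (dd F y u) (X y)) *\<^sub>R F y
    + (amb c (dd X y u) (E1 y) *\<^sub>R E1 y + amb c (dd X y u) (E2 y) *\<^sub>R E2 y
      + amb c (dd X y u) (N3 y) *\<^sub>R N3 y + amb c (dd X y u) (N4 y) *\<^sub>R N4 y)"
proof -
  have T: "E1 y \<in> TQ c (F y)" "E2 y \<in> TQ c (F y)" "N3 y \<in> TQ c (F y)" "N4 y \<in> TQ c (F y)"
    using tfield_frame y unfolding tfield_def by auto
  show ?thesis
    using expand[OF y, of "dd X y u"] amb_tproj[OF X y T(1), of u] amb_tproj[OF X y T(2), of u]
      amb_tproj[OF X y T(3), of u] amb_tproj[OF X y T(4), of u] ell_dX[OF X y, of u] by simp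
qed

text \<open>Parseval's identity with the position vector as a fifth direction. Its two components
  are multiples of - c and its square is 1/c if c is nonzero, hence the single c. Expanding only one
  factor avoids the division.\<close>

lemma amb_dX_dY:
  assumes X: "tfield X" and Y: "tfield Y" and y: "y \<in> V"
  shows "amb c (dd X y u) (dd Y y v)
    = amb c (dd X y u) (E1 y) * amb c (dd Y y v) (E1 y) + amb c (dd X y u) (E2 y) * amb c (dd Y y v) (E2 y)
      + amb c (dd X y u) (N3 y) * amb c (dd Y y v) (N3 y) + amb c (dd X y u) (N4 y) * amb c (dd Y y v) (N4 y)
      + c * amb c (dd F y u) (X y) * amb c (dd F y v) (Y y)"
proof -
  have F: "c * amb c (F y) (dd Y y v) = - c * amb c (dd F y v) (Y y)"
    using ell_dX[OF Y y, of v] ell_eq_amb[of c "F y" "dd Y y v"] by (cases "c = 0") auto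
  have s: "amb c (E1 y) (dd Y y v) = amb c (dd Y y v) (E1 y)" "amb c (E2 y) (dd Y y v) = amb c (dd Y y v) (E2 y)"
    "amb c (N3 y) (dd Y y v) = amb c (dd Y y v) (N3 y)" "amb c (N4 y) (dd Y y v) = amb c (dd Y y v) (N4 y)"
    by (rule amb_sym)+
  show ?thesis
    by (subst dX_expand[OF X y, of u], simp only: amb_simps s real_scaleR_def) (use F in algebra)
qed

lemma dd_amb:
  assumes "tfield X" "tfield Y" "y \<in> V"
  shows "dd (\<lambda>y. amb c (X y) (Y y)) y u = amb c (X y) (dd Y y u) + amb c (dd X y u) (Y y)"
  using dd_bilinear[OF bounded_bilinear_amb] tfield_differentiable assms by blast

lemma amb_dX_antisym:
  assumes X: "tfield X" and Y: "tfield Y" and y: "y \<in> V"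
    and const: "\<And>z. z \<in> V \<Longrightarrow> amb c (X z) (Y z) = a"
  shows "amb c (dd X y u) (Y y) = - amb c (dd Y y u) (X y)"
proof -
  have "dd (\<lambda>y. amb c (X y) (Y y)) y u = dd (\<lambda>_. a) y u"
    by (rule arg_cong[OF dd_cong_open[OF open_V y], where f = "\<lambda>h. h u"]) (rule const)
  then show ?thesis using dd_amb[OF X Y y, of u] amb_sym[of c "X y"] by simp
qed

lemma
  assumes y: "y \<in> V"
  shows amb_dE1: "amb c (dd E1 y u) (E1 y) = 0" and amb_dE2: "amb c (dd E2 y u) (E2 y) = 0"
    and amb_dN3: "amb c (dd N3 y u) (N3 y) = 0" and amb_dN4: "amb c (dd N4 y u) (N4 y) = 0"
    and amb_dE2_E1: "amb c (dd E2 y u) (E1 y) = - amb c (dd E1 y u) (E2 y)"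
    and amb_dN3_E1: "amb c (dd N3 y u) (E1 y) = - amb c (dd E1 y u) (N3 y)"
    and amb_dN3_E2: "amb c (dd N3 y u) (E2 y) = - amb c (dd E2 y u) (N3 y)"
    and amb_dN4_E1: "amb c (dd N4 y u) (E1 y) = - amb c (dd E1 y u) (N4 y)"
    and amb_dN4_E2: "amb c (dd N4 y u) (E2 y) = - amb c (dd E2 y u) (N4 y)"
    and amb_dN4_N3: "amb c (dd N4 y u) (N3 y) = - amb c (dd N3 y u) (N4 y)"
  using amb_dX_antisym[OF tfield_frame(1,1) y, of 1 u] amb_dX_antisym[OF tfield_frame(2,2) y, of 1 u]
    amb_dX_antisym[OF tfield_frame(3,3) y, of 1 u] amb_dX_antisym[OF tfield_frame(4,4) y, of 1 u]
    amb_dX_antisym[OF tfield_frame(2,1) y, of 0 u] amb_dX_antisym[OF tfield_frame(3,1) y, of 0 u]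
    amb_dX_antisym[OF tfield_frame(3,2) y, of 0 u] amb_dX_antisym[OF tfield_frame(4,1) y, of 0 u]
    amb_dX_antisym[OF tfield_frame(4,2) y, of 0 u] amb_dX_antisym[OF tfield_frame(4,3) y, of 0 u]
  by (simp_all add: orthonormal)

lemmas connection_table = amb_dE1 amb_dE2 amb_dN3 amb_dN4 amb_dE2_E1 amb_dN3_E1 amb_dN3_E2
  amb_dN4_E1 amb_dN4_E2 amb_dN4_N3

text \<open>\<alpha> is tensorial: letting the frame vector move adds only a tangent vector,
  invisible to normals.\<close>

lemma amb_dE_normal:
  assumes y: "y \<in> V" and N: "N \<in> nspace c F y"
  shows "amb c (dd E1 y u) N = amb c (dd (\<lambda>z. dd F z (e1 y)) y u) N"
    and "amb c (dd E2 y u) N = amb c (dd (\<lambda>z. dd F z (e2 y)) y u) N"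
proof -
  have 0: "amb c (dd F y w) N = 0" for w
    using N amb_sym[of c N] unfolding nspace_def by auto
  show "amb c (dd E1 y u) N = amb c (dd (\<lambda>z. dd F z (e1 y)) y u) N"
    unfolding E1_def
    using dd_form[OF open_V y smooth_form_dd[OF smooth_F] smooth_on_differentiable[OF smooth_e(1) y], of u] 0
    by (simp add: amb_simps)
  show "amb c (dd E2 y u) N = amb c (dd (\<lambda>z. dd F z (e2 y)) y u) N"
    unfolding E2_def
    using dd_form[OF open_V y smooth_form_dd[OF smooth_F] smooth_on_differentiable[OF smooth_e(2) y], of u] 0
    by (simp add: amb_simps)
qed

lemma second_form_symmetric:
  assumes y: "y \<in> V"
  shows "amb c (dd E1 y (e2 y)) (N3 y) = h312 y" "amb c (dd E1 y (e2 y)) (N4 y) = h412 y"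
  unfolding h312_def h412_def amb_dE_normal[OF y nspace_N(1)[OF y]] amb_dE_normal[OF y nspace_N(2)[OF y]]
  using smooth_on_dd_symmetric[OF open_V y smooth_F] by metis+

text \<open>Torsion-freeness. The bracket is pushed into the ambient space, where the second
  derivatives of \<open>F\<close> cancel, and is read off from the derivatives of \<open>E1\<close>
  and \<open>E2\<close>.\<close>

lemma bracket_e:
  assumes y: "y \<in> V"
  shows "dd e2 y (e1 y) - dd e1 y (e2 y) = (- k1 y) *\<^sub>R e1 y - k2 y *\<^sub>R e2 y"
proof -
  let ?W = "dd e2 y (e1 y) - dd e1 y (e2 y)"
  have "dd F y ?W = dd E2 y (e1 y) - dd E1 y (e2 y)"
    unfolding E1_def E2_def
    using dd_form[OF open_V y smooth_form_dd[OF smooth_F] smooth_on_differentiable[OF smooth_e(1) y], of "e2 y"]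
      dd_form[OF open_V y smooth_form_dd[OF smooth_F] smooth_on_differentiable[OF smooth_e(2) y], of "e1 y"]
      smooth_on_dd_symmetric[OF open_V y smooth_F, of "e1 y" "e2 y"]
    by (simp add: dd_diff[OF F_differentiable[OF y]])
  then have "g y ?W (e1 y) = amb c (dd E2 y (e1 y) - dd E1 y (e2 y)) (E1 y)"
    "g y ?W (e2 y) = amb c (dd E2 y (e1 y) - dd E1 y (e2 y)) (E2 y)"
    unfolding isometric[OF y, symmetric] E1_def[symmetric] E2_def[symmetric]
    by (simp_all add: E1_def E2_def)
  then have "g y ?W (e1 y) = - k1 y" "g y ?W (e2 y) = - k2 y"
    unfolding k1_def k2_def by (simp_all add: amb_simps connection_table[OF y])
  then show ?thesis using oframe_expand[OF ip[OF y] oframe[OF y], of ?W] by simp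
qed

lemma bracket:
  fixes \<phi> :: "real^2 \<Rightarrow> 'b::euclidean_space"
  assumes \<phi>: "smooth_on V \<phi>" and y: "y \<in> V"
  shows "dd (\<lambda>z. dd \<phi> z (e2 z)) y (e1 y) - dd (\<lambda>z. dd \<phi> z (e1 z)) y (e2 y)
    = (- k1 y) *\<^sub>R dd \<phi> y (e1 y) - k2 y *\<^sub>R dd \<phi> y (e2 y)"
proof -
  note df = smooth_on_differentiable[OF \<phi> y]
  have "dd (\<lambda>z. dd \<phi> z (e2 z)) y (e1 y) - dd (\<lambda>z. dd \<phi> z (e1 z)) y (e2 y)
    = dd \<phi> y (dd e2 y (e1 y) - dd e1 y (e2 y))"
    using dd_form[OF open_V y smooth_form_dd[OF \<phi>] smooth_on_differentiable[OF smooth_e(1) y], of "e2 y"]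
      dd_form[OF open_V y smooth_form_dd[OF \<phi>] smooth_on_differentiable[OF smooth_e(2) y], of "e1 y"]
      smooth_on_dd_symmetric[OF open_V y \<phi>, of "e1 y" "e2 y"]
    by (simp add: dd_diff[OF df])
  then show ?thesis unfolding bracket_e[OF y] by (simp add: dd_diff[OF df] dd_scaleR[OF df] dd_minus[OF df])
qed

lemma smooth_along: "smooth_on V \<phi> \<Longrightarrow> smooth_on V (\<lambda>y. dd \<phi> y (e1 y))"
  "smooth_on V \<phi> \<Longrightarrow> smooth_on V (\<lambda>y. dd \<phi> y (e2 y))"
  using smooth_form_apply[OF open_V smooth_form_dd] smooth_e by blast+

lemma smooth_amb: "smooth_on V X \<Longrightarrow> smooth_on V Y \<Longrightarrow> smooth_on V (\<lambda>y. amb c (X y) (Y y))"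
  by (rule smooth_on_bilinear[OF bounded_bilinear_amb open_V])

lemmas coefficient_defs = k1_def k2_def n1_def n2_def h311_def h312_def h322_def
  h411_def h412_def h422_def

lemma smooth_coefficients:
  "smooth_on V k1" "smooth_on V k2" "smooth_on V n1" "smooth_on V n2"
  "smooth_on V h311" "smooth_on V h312" "smooth_on V h322"
  "smooth_on V h411" "smooth_on V h412" "smooth_on V h422"
  unfolding coefficient_defs
  by (intro smooth_amb smooth_along smooth_E smooth_N)+

text \<open>The source of the equations of Gauss, Codazzi and Ricci: the mixed derivatives of a frame
  vector \<open>X\<close> differ only by the bracket of \<open>e1\<close> and \<open>e2\<close>.\<close>
lemma structure_equation:
  assumes X: "tfield X" and Y: "tfield Y" and y: "y \<in> V"
  shows "dd (\<lambda>z. amb c (dd X z (e2 z)) (Y z)) y (e1 y) - dd (\<lambda>z. amb c (dd X z (e1 z)) (Y z)) y (e2 y)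
    = - k1 y * amb c (dd X y (e1 y)) (Y y) - k2 y * amb c (dd X y (e2 y)) (Y y)
      + amb c (dd X y (e2 y)) (dd Y y (e1 y)) - amb c (dd X y (e1 y)) (dd Y y (e2 y))"
proof -
  have sX: "smooth_on V X" using X unfolding tfield_def by blast
  note d = smooth_on_differentiable[OF smooth_along(1)[OF sX] y] smooth_on_differentiable[OF smooth_along(2)[OF sX] y]
    tfield_differentiable[OF Y y]
  have "dd (\<lambda>z. amb c (dd X z (e2 z)) (Y z)) y (e1 y) - dd (\<lambda>z. amb c (dd X z (e1 z)) (Y z)) y (e2 y)
    = amb c (dd X y (e2 y)) (dd Y y (e1 y)) - amb c (dd X y (e1 y)) (dd Y y (e2 y))
      + amb c (dd (\<lambda>z. dd X z (e2 z)) y (e1 y) - dd (\<lambda>z. dd X z (e1 z)) y (e2 y)) (Y y)"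
    by (simp add: dd_bilinear[OF bounded_bilinear_amb] d amb_simps)
  then show ?thesis unfolding bracket[OF sX y] by (simp add: amb_simps)
qed

lemma dF_frame:
  assumes y: "y \<in> V"
  shows "amb c (dd F y (e1 y)) (E1 y) = 1" "amb c (dd F y (e1 y)) (E2 y) = 0"
    "amb c (dd F y (e2 y)) (E1 y) = 0" "amb c (dd F y (e2 y)) (E2 y) = 1"
    "amb c (dd F y u) (N3 y) = 0" "amb c (dd F y u) (N4 y) = 0"
  using orthonormal(1-4)[OF y] nspace_N[OF y] amb_sym[of c "dd F y u"]
  unfolding E1_def E2_def nspace_def by auto

text \<open>The structure equation for a tangent and a normal frame vector. The constant c is absent
  because \<open>F\<close> has no derivative in normal directions.\<close>

lemma codazzi:
  assumes y: "y \<in> V"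
  shows "dd h312 y (e1 y) - dd h311 y (e2 y)
      = - k1 y * h311 y - 2 * k2 y * h312 y + k1 y * h322 y + n1 y * h412 y - n2 y * h411 y"
    and "dd h412 y (e1 y) - dd h411 y (e2 y)
      = - k1 y * h411 y - 2 * k2 y * h412 y + k1 y * h422 y - n1 y * h312 y + n2 y * h311 y"
    and "dd h322 y (e1 y) - dd h312 y (e2 y)
      = - 2 * k1 y * h312 y - k2 y * h322 y + k2 y * h311 y + n1 y * h422 y - n2 y * h412 y"
    and "dd h422 y (e1 y) - dd h412 y (e2 y)
      = - 2 * k1 y * h412 y - k2 y * h422 y + k2 y * h411 y - n1 y * h322 y + n2 y * h312 y"
proof -
  have 1: "dd (\<lambda>z. amb c (dd E1 z (e2 z)) (N3 z)) y = dd h312 y"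
    "dd (\<lambda>z. amb c (dd E1 z (e2 z)) (N4 z)) y = dd h412 y"
    by (rule dd_cong_open[OF open_V y], simp add: second_form_symmetric)+
  note f = tfield_frame
  note simps = amb_dX_dY[OF _ _ y] f connection_table[OF y] dF_frame[OF y] second_form_symmetric[OF y]
  show "dd h312 y (e1 y) - dd h311 y (e2 y)
      = - k1 y * h311 y - 2 * k2 y * h312 y + k1 y * h322 y + n1 y * h412 y - n2 y * h411 y"
    using structure_equation[OF f(1,3) y] unfolding 1 h311_def[symmetric]
    by (simp add: simps) (simp add: coefficient_defs)
  show "dd h412 y (e1 y) - dd h411 y (e2 y)
      = - k1 y * h411 y - 2 * k2 y * h412 y + k1 y * h422 y - n1 y * h312 y + n2 y * h311 y"
    using structure_equation[OF f(1,4) y] unfolding 1 h411_def[symmetric]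
    by (simp add: simps) (simp add: coefficient_defs)
  show "dd h322 y (e1 y) - dd h312 y (e2 y)
      = - 2 * k1 y * h312 y - k2 y * h322 y + k2 y * h311 y + n1 y * h422 y - n2 y * h412 y"
    using structure_equation[OF f(2,3) y] unfolding h322_def[symmetric] h312_def[symmetric]
    by (simp add: simps) (simp add: coefficient_defs)
  show "dd h422 y (e1 y) - dd h412 y (e2 y)
      = - 2 * k1 y * h412 y - k2 y * h422 y + k2 y * h411 y - n1 y * h322 y + n2 y * h312 y"
    using structure_equation[OF f(2,4) y] unfolding h422_def[symmetric] h412_def[symmetric]
    by (simp add: simps) (simp add: coefficient_defs)
qed

end

lemma det_two_rows_combination:
  fixes r :: "'n::finite \<Rightarrow> real^'n"
  assumes ij: "i \<noteq> j"
  shows "det (\<chi> k. if k = i then a *\<^sub>R \<xi> + b *\<^sub>R \<eta> else if k = j then p *\<^sub>R \<xi> + q *\<^sub>R \<eta> else r k)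
    = (a * q - b * p) * det (\<chi> k. if k = i then \<xi> else if k = j then \<eta> else r k)"
proof -
  define d where "d v w = det (\<chi> k. if k = i then v else if k = j then w else r k)" for v w
  have swap: "(\<chi> k. if k = i then v else if k = j then w else r k) = (\<chi> k. if k = j then w else if k = i then v else r k)" for v w
    using ij by (simp add: vec_eq_iff)
  have 1: "d (v + v') w = d v w + d v' w" "d (s *\<^sub>R v) w = s * d v w" for v v' w s
    unfolding d_def using det_row_add[of i "\<lambda>_. v" "\<lambda>_. v'" "\<lambda>k. if k = j then w else r k"]
      det_row_mul[of i s "\<lambda>_. v" "\<lambda>k. if k = j then w else r k", unfolded scalar_mult_eq_scaleR] by simp_all
  have 2: "d w (v + v') = d w v + d w v'" "d w (s *\<^sub>R v) = s * d w v" for v v' w s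
    unfolding d_def swap using det_row_add[of j "\<lambda>_. v" "\<lambda>_. v'" "\<lambda>k. if k = i then w else r k"]
      det_row_mul[of j s "\<lambda>_. v" "\<lambda>k. if k = i then w else r k", unfolded scalar_mult_eq_scaleR] by simp_all
  have 3: "d v v = 0" for v
    unfolding d_def by (rule det_identical_rows[OF ij]) (simp add: row_def vec_eq_iff ij)
  have "d (\<xi> + \<eta>) (\<xi> + \<eta>) = d \<xi> \<xi> + d \<xi> \<eta> + d \<eta> \<xi> + d \<eta> \<eta>" unfolding 1 2 by simp
  then have "d \<eta> \<xi> = - d \<xi> \<eta>" unfolding 3 by simp
  then have "d (a *\<^sub>R \<xi> + b *\<^sub>R \<eta>) (p *\<^sub>R \<xi> + q *\<^sub>R \<eta>) = (a * q - b * p) * d \<xi> \<eta>"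
    unfolding 1 2 3 by (simp add: algebra_simps)
  then show ?thesis unfolding d_def .
qed

text \<open>This reduces the orientation of a normal pair to the sign of a 2x2 determinant.\<close>

lemma vol_combination:
  "vol P v1 v2 (a *\<^sub>R \<xi> + b *\<^sub>R \<eta>) (p *\<^sub>R \<xi> + q *\<^sub>R \<eta>) = (a * q - b * p) * vol P v1 v2 \<xi> \<eta>"
proof -
  have "(vector [P, v1, v2, x, y] :: real^5^5)
      = (\<chi> i. if i = 4 then x else if i = 5 then y else if i = 1 then P else if i = 2 then v1 else v2)" for x y
    by (simp add: vec_eq_iff forall_5 vector_def)
  then show ?thesis unfolding vol_def by (simp only:) (rule det_two_rows_combination, simp)
qed

lemma vol_combination_tangent:
  "vol P (a *\<^sub>R v + b *\<^sub>R w) (p *\<^sub>R v + q *\<^sub>R w) \<xi> \<eta> = (a * q - b * p) * vol P v w \<xi> \<eta>"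
proof -
  have "(vector [P, x, y, \<xi>, \<eta>] :: real^5^5)
      = (\<chi> i. if i = 2 then x else if i = 3 then y else if i = 1 then P else if i = 4 then \<xi> else \<eta>)" for x y
    by (simp add: vec_eq_iff forall_5 vector_def)
  then show ?thesis unfolding vol_def by (simp only:) (rule det_two_rows_combination, simp)
qed

section \<open>The normal bundle, and the equations of Gauss and Ricci\<close>

context adapted_frame
begin

lemma nspace_expand:
  assumes y: "y \<in> V" and xi: "\<xi> \<in> nspace c F y"
  shows "\<xi> = amb c \<xi> (N3 y) *\<^sub>R N3 y + amb c \<xi> (N4 y) *\<^sub>R N4 y"
proof -
  have 0: "amb c \<xi> (E1 y) = 0" "amb c \<xi> (E2 y) = 0" and T: "\<xi> \<in> TQ c (F y)"
    using xi unfolding nspace_def E1_def E2_def by auto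
  show ?thesis by (rule trans[OF expand_TQ[OF y T]]) (simp add: 0)
qed

lemma nspace_combination: "y \<in> V \<Longrightarrow> a *\<^sub>R N3 y + b *\<^sub>R N4 y \<in> nspace c F y"
  by (intro nspace_linear(1,4) nspace_N)

lemma amb_combination:
  assumes y: "y \<in> V"
  shows "amb c (a *\<^sub>R N3 y + b *\<^sub>R N4 y) (r *\<^sub>R N3 y + s *\<^sub>R N4 y) = a * r + b * s"
  by (simp add: amb_simps orthonormal[OF y])

lemma combination_eq_iff:
  assumes y: "y \<in> V"
  shows "a *\<^sub>R N3 y + b *\<^sub>R N4 y = r *\<^sub>R N3 y + s *\<^sub>R N4 y \<longleftrightarrow> a = r \<and> b = s"
proof
  assume eq: "a *\<^sub>R N3 y + b *\<^sub>R N4 y = r *\<^sub>R N3 y + s *\<^sub>R N4 y"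
  show "a = r \<and> b = s"
    using arg_cong[OF eq, of "\<lambda>w. amb c w (N3 y)"] arg_cong[OF eq, of "\<lambda>w. amb c w (N4 y)"]
    by (simp add: amb_simps orthonormal[OF y])
qed simp

text \<open>In the decomposition behind \<open>nproj\<close>, \<open>ell\<close> reads off the
  position component. It has to be removed before taking products with the normals, to which the
  position vector need not be orthogonal when c = 0.\<close>

lemma nproj_eq:
  assumes y: "y \<in> V"
  shows "nproj c F y v = amb c (v - ell c (F y) v *\<^sub>R F y) (N3 y) *\<^sub>R N3 y
    + amb c (v - ell c (F y) v *\<^sub>R F y) (N4 y) *\<^sub>R N4 y"
  unfolding nproj_def
proof (rule the_equality)
  let ?w = "v - ell c (F y) v *\<^sub>R F y"
  have "amb c ?w (E1 y) *\<^sub>R E1 y + amb c ?w (E2 y) *\<^sub>R E2 y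
      = dd F y (amb c ?w (E1 y) *\<^sub>R e1 y + amb c ?w (E2 y) *\<^sub>R e2 y)"
    unfolding E1_def E2_def by (simp add: dd_add dd_scaleR F_differentiable[OF y])
  then have "v = ell c (F y) v *\<^sub>R F y + dd F y (amb c ?w (E1 y) *\<^sub>R e1 y + amb c ?w (E2 y) *\<^sub>R e2 y)
      + (amb c ?w (N3 y) *\<^sub>R N3 y + amb c ?w (N4 y) *\<^sub>R N4 y)"
    by (intro trans[OF expand[OF y, of v]]) (simp add: add.assoc)
  then show "amb c ?w (N3 y) *\<^sub>R N3 y + amb c ?w (N4 y) *\<^sub>R N4 y \<in> nspace c F y \<and>
      (\<exists>a u. v = a *\<^sub>R F y + dd F y u + (amb c ?w (N3 y) *\<^sub>R N3 y + amb c ?w (N4 y) *\<^sub>R N4 y))"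
    using nspace_combination[OF y] by blast
  fix \<xi>
  assume xi: "\<xi> \<in> nspace c F y \<and> (\<exists>a u. v = a *\<^sub>R F y + dd F y u + \<xi>)"
  then obtain a u where v: "v = a *\<^sub>R F y + dd F y u + \<xi>" by blast
  have "ell c (F y) \<xi> = 0" using xi unfolding nspace_def TQ_def by simp
  moreover have "ell c (F y) (dd F y u) = 0" using dF_TQ[OF y] unfolding TQ_def by simp
  ultimately have "ell c (F y) v = a" unfolding v by (simp add: ell_simps F_unit[OF y])
  then have w: "?w = dd F y u + \<xi>" unfolding v by simp
  show "\<xi> = amb c ?w (N3 y) *\<^sub>R N3 y + amb c ?w (N4 y) *\<^sub>R N4 y"
    by (rule trans[OF nspace_expand[OF y]]) (use xi in \<open>auto simp: w amb_simps dF_frame[OF y]\<close>)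
qed

lemma nproj_dX:
  assumes X: "tfield X" and y: "y \<in> V"
  shows "nproj c F y (dd X y u) = amb c (dd X y u) (N3 y) *\<^sub>R N3 y + amb c (dd X y u) (N4 y) *\<^sub>R N4 y"
  using nspace_N[OF y] unfolding nproj_eq[OF y] nspace_def by (simp add: amb_tproj[OF X y])

lemma nproj_linear: "y \<in> V \<Longrightarrow> linear (nproj c F y)"
  by (auto intro!: linearI simp: nproj_eq amb_simps ell_simps algebra_simps)

lemma nproj_nspace:
  assumes "y \<in> V" "\<xi> \<in> nspace c F y"
  shows "nproj c F y \<xi> = \<xi>"
  by (rule trans[OF _ nspace_expand[OF assms, symmetric]])
    (use assms(2) in \<open>auto simp: nproj_eq[OF assms(1)] nspace_def TQ_def\<close>)

lemma tfield_dF: "tfield (\<lambda>z. dd F z v)"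
  unfolding tfield_def using smooth_on_dd[OF smooth_F] dF_TQ by blast

lemma sff_eq:
  assumes y: "y \<in> V"
  shows "sff c F y u v = amb c (dd (\<lambda>z. dd F z v) y u) (N3 y) *\<^sub>R N3 y
    + amb c (dd (\<lambda>z. dd F z v) y u) (N4 y) *\<^sub>R N4 y"
  unfolding sff_def by (rule nproj_dX[OF tfield_dF y])

lemma sff_bilinear:
  assumes y: "y \<in> V"
  shows "bilinear (sff c F y)"
proof -
  note B = second_dd_bilinear[OF open_V y smooth_F]
  have s: "sff c F y u v = nproj c F y (dd (\<lambda>z. dd F z v) y u)" for u v unfolding sff_def ..
  note L = nproj_linear[OF y]
  show ?thesis
    unfolding bilinear_def s
    by (auto intro!: linearI simp: bilinear_ladd[OF B] bilinear_radd[OF B] bilinear_lmul[OF B]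
        bilinear_rmul[OF B] linear_add[OF L] linear_scale[OF L])
qed

lemma sff_frame:
  assumes y: "y \<in> V"
  shows "sff c F y (e1 y) (e1 y) = h311 y *\<^sub>R N3 y + h411 y *\<^sub>R N4 y"
    "sff c F y (e1 y) (e2 y) = h312 y *\<^sub>R N3 y + h412 y *\<^sub>R N4 y"
    "sff c F y (e2 y) (e2 y) = h322 y *\<^sub>R N3 y + h422 y *\<^sub>R N4 y"
  unfolding sff_eq[OF y] h311_def h312_def h322_def h411_def h412_def h422_def
    amb_dE_normal[OF y nspace_N(1)[OF y]] amb_dE_normal[OF y nspace_N(2)[OF y]] by simp_all

definition "H3 = (\<lambda>y. (h311 y + h322 y) / 2)"
definition "H4 = (\<lambda>y. (h411 y + h422 y) / 2)"

lemma H34_double: "2 * H3 y = h311 y + h322 y" "2 * H4 y = h411 y + h422 y"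
  unfolding H3_def H4_def by simp_all

lemma mean_curv_eq:
  assumes y: "y \<in> V"
  shows "mean_curv c g F y = H3 y *\<^sub>R N3 y + H4 y *\<^sub>R N4 y"
  unfolding mean_curv_def mtrace_oframe[OF ip[OF y] oframe[OF y] sff_bilinear[OF y]] sff_frame[OF y] H3_def H4_def
  by (simp add: algebra_simps add_divide_distrib)

lemma npositive_combination:
  assumes y: "y \<in> V"
  shows "npositive F y (a *\<^sub>R N3 y + b *\<^sub>R N4 y) (r *\<^sub>R N3 y + s *\<^sub>R N4 y) \<longleftrightarrow> 0 < a * s - b * r"
  using positive_N[OF y] unfolding npositive_def vol_combination by (simp add: zero_less_mult_iff)

lemma Jperp_eq:
  assumes y: "y \<in> V"
  shows "Jperp c F y (a *\<^sub>R N3 y + b *\<^sub>R N4 y) = (- b) *\<^sub>R N3 y + a *\<^sub>R N4 y"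
  unfolding Jperp_def
proof (rule the_equality)
  let ?x = "a *\<^sub>R N3 y + b *\<^sub>R N4 y"
  have x0: "?x \<noteq> 0 \<longleftrightarrow> 0 < a\<^sup>2 + b\<^sup>2"
    using combination_eq_iff[OF y, of a b 0 0] by (simp add: sum_power2_gt_zero_iff)
  show "(- b) *\<^sub>R N3 y + a *\<^sub>R N4 y \<in> nspace c F y \<and> amb c ?x ((- b) *\<^sub>R N3 y + a *\<^sub>R N4 y) = 0 \<and>
      amb c ((- b) *\<^sub>R N3 y + a *\<^sub>R N4 y) ((- b) *\<^sub>R N3 y + a *\<^sub>R N4 y) = amb c ?x ?x \<and>
      (?x \<noteq> 0 \<longrightarrow> npositive F y ?x ((- b) *\<^sub>R N3 y + a *\<^sub>R N4 y))"
    unfolding amb_combination[OF y] npositive_combination[OF y] x0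
    using nspace_combination[OF y, of "- b" a] by (simp add: power2_eq_square)
  fix \<eta>
  assume eta: "\<eta> \<in> nspace c F y \<and> amb c ?x \<eta> = 0 \<and> amb c \<eta> \<eta> = amb c ?x ?x \<and>
      (?x \<noteq> 0 \<longrightarrow> npositive F y ?x \<eta>)"
  then obtain r s where rs: "\<eta> = r *\<^sub>R N3 y + s *\<^sub>R N4 y" using nspace_expand[OF y] by blast
  have v: "a * r + b * s = 0" "r * r + s * s = a * a + b * b" "0 < a\<^sup>2 + b\<^sup>2 \<longrightarrow> 0 < a * s - b * r"
    using eta unfolding rs amb_combination[OF y] npositive_combination[OF y] x0 by auto
  have "s = a \<and> r = - b"
  proof (cases "0 < a\<^sup>2 + b\<^sup>2")
    case True
    define n where "n = a\<^sup>2 + b\<^sup>2"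
    have "(a * s - b * r)\<^sup>2 = n\<^sup>2" using v(1,2) unfolding n_def by algebra
    then have eq: "a * s - b * r = n" using v(3) True unfolding n_def by (simp add: power2_eq_iff)
    have "n * s = n * a" using eq v(1) unfolding n_def by algebra
    moreover have "n * r = n * (- b)" using eq v(1) unfolding n_def by algebra
    moreover have "n \<noteq> 0" using True unfolding n_def by linarith
    ultimately show ?thesis using mult_left_cancel[of n s a] mult_left_cancel[of n r "- b"] by blast
  next
    case False
    then have "a = 0" "b = 0" by (auto simp: not_less sum_power2_le_zero_iff)
    moreover from this v(2) have "r * r + s * s = 0" by simp
    then have "r = 0" "s = 0" by (auto simp: sum_squares_eq_zero_iff)
    ultimately show ?thesis by simp
  qed
  then show "\<eta> = (- b) *\<^sub>R N3 y + a *\<^sub>R N4 y" unfolding rs by simp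
qed

lemma nconn_combination:
  assumes y: "y \<in> V" and U: "open U" "y \<in> U" "\<And>z. z \<in> U \<Longrightarrow> \<xi> z = p z *\<^sub>R N3 z + q z *\<^sub>R N4 z"
    and d: "p differentiable (at y)" "q differentiable (at y)"
  shows "nconn c F \<xi> y u = (dd p y u - q y * amb c (dd N3 y u) (N4 y)) *\<^sub>R N3 y
    + (dd q y u + p y * amb c (dd N3 y u) (N4 y)) *\<^sub>R N4 y"
proof -
  note dN = smooth_on_differentiable[OF smooth_N(1) y] smooth_on_differentiable[OF smooth_N(2) y]
  have "dd \<xi> y u = dd (\<lambda>z. p z *\<^sub>R N3 z + q z *\<^sub>R N4 z) y u"
    by (rule arg_cong[OF dd_cong_open[OF U(1,2)], where f = "\<lambda>h. h u"]) (rule U(3))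
  also have "\<dots> = p y *\<^sub>R dd N3 y u + dd p y u *\<^sub>R N3 y + (q y *\<^sub>R dd N4 y u + dd q y u *\<^sub>R N4 y)"
    by (simp add: dd_plus dd_scaleR_fun differentiable_bilinear[OF bounded_bilinear_scaleR] d dN)
  finally have "nconn c F \<xi> y u = p y *\<^sub>R nproj c F y (dd N3 y u) + dd p y u *\<^sub>R N3 y
    + (q y *\<^sub>R nproj c F y (dd N4 y u) + dd q y u *\<^sub>R N4 y)"
    unfolding nconn_def
    by (simp add: linear_add[OF nproj_linear[OF y]] linear_scale[OF nproj_linear[OF y]]
        nproj_nspace[OF y] nspace_N[OF y])
  then show ?thesis
    unfolding nproj_dX[OF tfield_frame(3) y] nproj_dX[OF tfield_frame(4) y] connection_table[OF y]
    by (simp add: algebra_simps)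
qed

text \<open>The counterpart of \<open>structure_equation\<close> for constant directions, whose
  bracket is zero.\<close>

lemma second_dX_cancel:
  assumes X: "tfield X" and Y: "tfield Y" and y: "y \<in> V"
  shows "dd (\<lambda>z. amb c (dd X z v) (Y z)) y u - dd (\<lambda>z. amb c (dd X z u) (Y z)) y v
    = amb c (dd X y v) (dd Y y u) - amb c (dd X y u) (dd Y y v)"
proof -
  have sX: "smooth_on V X" using X unfolding tfield_def by blast
  note d = smooth_on_differentiable[OF smooth_on_dd[OF sX] y] tfield_differentiable[OF Y y]
  show ?thesis
    using smooth_on_dd_symmetric[OF open_V y sX, of u v]
    by (simp add: dd_bilinear[OF bounded_bilinear_amb] d amb_simps)
qed

lemma smooth_form_amb_dX:
  assumes X: "smooth_on V X" and Y: "smooth_on V Y"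
  shows "smooth_form V (\<lambda>y u. amb c (dd X y u) (Y y))"
  unfolding smooth_form_def
proof (intro conjI ballI allI)
  show "linear (\<lambda>u. amb c (dd X y u) (Y y))" if "y \<in> V" for y
    using smooth_on_differentiable[OF X that]
    by (auto intro!: linearI simp: amb_simps dd_add dd_scaleR)
  show "smooth_on V (\<lambda>y. amb c (dd X y u) (Y y))" for u
    by (rule smooth_amb[OF smooth_on_dd[OF X] Y])
qed

text \<open>The dual coframe of \<open>e1\<close>, \<open>e2\<close> satisfies Cartan's structure
  equations with connection form k, so the curvature is minus the derivative of k on the frame.
  Expanding that derivative gives c from the position components and the determinants of \<alpha>
  from the normal ones.\<close>

lemma gauss_equation:
  assumes y: "y \<in> V"
  shows "gauss_curvature g y = c + h311 y * h322 y + h411 y * h422 y - (h312 y)\<^sup>2 - (h412 y)\<^sup>2"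
proof -
  define a where "a = (\<lambda>y u. amb c (dd F y u) (E1 y))"
  define b where "b = (\<lambda>y u. amb c (dd F y u) (E2 y))"
  define k where "k = (\<lambda>y u. amb c (dd E1 y u) (E2 y))"
  have forms: "smooth_form V a" "smooth_form V b" "smooth_form V k"
    unfolding a_def b_def k_def
    by (intro smooth_form_amb_dX smooth_F smooth_E)+
  have dF: "dd F z u = a z u *\<^sub>R E1 z + b z u *\<^sub>R E2 z" if z: "z \<in> V" for z u
    by (rule trans[OF expand_TQ[OF z dF_TQ[OF z]]]) (simp add: a_def b_def dF_frame[OF z])
  have gz: "g z u v = a z u * a z v + b z u * b z v" if z: "z \<in> V" for z u v
    unfolding isometric[OF z, symmetric] dF[OF z]
    by (simp add: amb_simps orthonormal[OF z] algebra_simps)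
  have nondeg: "a z u \<noteq> 0 \<or> b z u \<noteq> 0" if z: "z \<in> V" and u: "u \<noteq> 0" for z u
    using inner_product_at_pos[OF ip[OF z] u] unfolding gz[OF z] by auto
  \<comment> \<open>The position field is not a \<open>tfield\<close>, so the cancellation of second
    derivatives is repeated for it.\<close>
  have cross: "dd (\<lambda>z. amb c (dd F z v) (X z)) z u - dd (\<lambda>z. amb c (dd F z u) (X z)) z v
      = amb c (dd F z v) (dd X z u) - amb c (dd F z u) (dd X z v)"
    if z: "z \<in> V" and X: "tfield X" for z u v X
  proof -
    note d = smooth_on_differentiable[OF smooth_on_dd[OF smooth_F] z] tfield_differentiable[OF X z]
    show ?thesis
      using smooth_on_dd_symmetric[OF open_V z smooth_F, of u v]
      by (simp add: dd_bilinear[OF bounded_bilinear_amb] d amb_simps)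
  qed
  have E: "amb c (dd F z v) (dd E1 z u) = k z u * b z v" "amb c (dd F z v) (dd E2 z u) = - k z u * a z v"
    if z: "z \<in> V" for z u v
    unfolding dF[OF z] amb_simps amb_sym[of c "E1 z"] amb_sym[of c "E2 z"] connection_table[OF z]
    unfolding k_def by simp_all
  have da: "dd (\<lambda>z. a z v) z u - dd (\<lambda>z. a z u) z v = k z u * b z v - k z v * b z u" if z: "z \<in> V" for z u v
    using cross[OF z tfield_frame(1), of v u] unfolding E[OF z] unfolding a_def .
  have db: "dd (\<lambda>z. b z v) z u - dd (\<lambda>z. b z u) z v = - (k z u * a z v - k z v * a z u)" if z: "z \<in> V" for z u v
    using cross[OF z tfield_frame(2), of v u] unfolding E[OF z] unfolding b_def by simp
  have "gauss_curvature g y * (a y (e1 y) * b y (e2 y) - a y (e2 y) * b y (e1 y))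
    = - (dd (\<lambda>z. k z (e2 y)) y (e1 y) - dd (\<lambda>z. k z (e1 y)) y (e2 y))"
    by (rule gauss_curvature_coframe[OF open_V y forms gz nondeg da db])
  also have "a y (e1 y) * b y (e2 y) - a y (e2 y) * b y (e1 y) = 1"
    unfolding a_def b_def by (simp add: dF_frame[OF y])
  also have "dd (\<lambda>z. k z (e2 y)) y (e1 y) - dd (\<lambda>z. k z (e1 y)) y (e2 y)
    = amb c (dd E1 y (e2 y)) (dd E2 y (e1 y)) - amb c (dd E1 y (e1 y)) (dd E2 y (e2 y))"
    unfolding k_def by (rule second_dX_cancel[OF tfield_frame(1,2) y])
  also have "\<dots> = (h312 y)\<^sup>2 + (h412 y)\<^sup>2 - h311 y * h322 y - h411 y * h422 y - c"
    unfolding amb_dX_dY[OF tfield_frame(1,2) y] connection_table[OF y] dF_frame[OF y]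
      second_form_symmetric[OF y]
    unfolding h311_def h312_def h322_def h411_def h412_def h422_def by (simp add: power2_eq_square)
  finally show ?thesis by simp
qed

text \<open>A bundle of rank two has a single connection form \<nu>. Its curvature is d\<nu> times a
  rotation, since the products of values of \<nu> cancel.\<close>

lemma nriem_eq:
  assumes y: "y \<in> V" and xi: "\<xi> \<in> nspace c F y"
  shows "nriem c F y u v \<xi> = (amb c (dd N3 y v) (dd N4 y u) - amb c (dd N3 y u) (dd N4 y v))
    *\<^sub>R (amb c \<xi> (N3 y) *\<^sub>R N4 y - amb c \<xi> (N4 y) *\<^sub>R N3 y)"
proof -
  define p where "p z = amb c (\<xi> - ell c (F z) \<xi> *\<^sub>R F z) (N3 z)" for z
  define q where "q z = amb c (\<xi> - ell c (F z) \<xi> *\<^sub>R F z) (N4 z)" for z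
  define \<nu> where "\<nu> z u = amb c (dd N3 z u) (N4 z)" for z u
  have sw: "smooth_on V (\<lambda>z. \<xi> - ell c (F z) \<xi> *\<^sub>R F z)"
    by (intro smooth_on_diff smooth_on_const smooth_on_scaleR open_V smooth_F
        smooth_on_bilinear[OF bounded_bilinear_ell])
  have s: "smooth_on V p" "smooth_on V q" "\<And>u. smooth_on V (\<lambda>z. \<nu> z u)"
    unfolding p_def q_def \<nu>_def by (intro smooth_amb sw smooth_N smooth_on_dd)+
  have py: "p y = amb c \<xi> (N3 y)" "q y = amb c \<xi> (N4 y)"
    using xi unfolding p_def q_def nspace_def TQ_def by auto
  have X: "nproj c F z \<xi> = p z *\<^sub>R N3 z + q z *\<^sub>R N4 z" if "z \<in> V" for z
    unfolding p_def q_def by (rule nproj_eq[OF that])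
  note d = smooth_on_differentiable[OF s(1)] smooth_on_differentiable[OF s(2)] smooth_on_differentiable[OF s(3)]
    smooth_on_differentiable[OF smooth_on_dd[OF s(1)]] smooth_on_differentiable[OF smooth_on_dd[OF s(2)]]
  have c1: "nconn c F (\<lambda>y. nproj c F y \<xi>) z w = (dd p z w - q z * \<nu> z w) *\<^sub>R N3 z + (dd q z w + p z * \<nu> z w) *\<^sub>R N4 z"
    if z: "z \<in> V" for z w
    unfolding \<nu>_def by (rule nconn_combination[OF z open_V z X d(1)[OF z] d(2)[OF z]])
  have c2: "nconn c F (\<lambda>y. nconn c F (\<lambda>y. nproj c F y \<xi>) y v) y u
    = (dd (\<lambda>z. dd p z v - q z * \<nu> z v) y u - (dd q y v + p y * \<nu> y v) * \<nu> y u) *\<^sub>R N3 y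
      + (dd (\<lambda>z. dd q z v + p z * \<nu> z v) y u + (dd p y v - q y * \<nu> y v) * \<nu> y u) *\<^sub>R N4 y" for u v
    unfolding \<nu>_def[of y u]
    by (rule nconn_combination[OF y open_V y c1])
      (auto intro!: differentiable_diff differentiable_add differentiable_bilinear[OF bounded_bilinear_mult] d y)
  have d1: "dd (\<lambda>z. dd p z v - q z * \<nu> z v) y u
      = dd (\<lambda>z. dd p z v) y u - (q y * dd (\<lambda>z. \<nu> z v) y u + dd q y u * \<nu> y v)" for u v
    by (simp add: dd_minus_fun dd_mult d[OF y] differentiable_bilinear[OF bounded_bilinear_mult])
  have d2: "dd (\<lambda>z. dd q z v + p z * \<nu> z v) y u
      = dd (\<lambda>z. dd q z v) y u + (p y * dd (\<lambda>z. \<nu> z v) y u + dd p y u * \<nu> y v)" for u v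
    by (simp add: dd_plus dd_mult d[OF y] differentiable_bilinear[OF bounded_bilinear_mult])
  have dn: "amb c (dd N3 y v) (dd N4 y u) - amb c (dd N3 y u) (dd N4 y v)
      = dd (\<lambda>z. \<nu> z v) y u - dd (\<lambda>z. \<nu> z u) y v"
    unfolding \<nu>_def by (rule second_dX_cancel[OF tfield_frame(3,4) y, symmetric])
  show ?thesis
    using smooth_on_dd_symmetric[OF open_V y s(1), of u v] smooth_on_dd_symmetric[OF open_V y s(2), of u v]
    unfolding nriem_def Let_def c2 d1 d2 dn py[symmetric] by (simp add: algebra_simps)
qed

text \<open>The frames in \<open>normal_curv\<close> come from a choice. They are rotations of the
  adapted ones, and each rotation contributes only a factor cos^2 + sin^2.\<close>

lemma ricci_equation:
  assumes y: "y \<in> V"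
  shows "normal_curv c g F y = (h311 y - h322 y) * h412 y - (h411 y - h422 y) * h312 y"
proof -
  obtain f1 f2 where f: "tframe g y = (f1, f2)" by (cases "tframe g y")
  obtain n3 n4 where n: "nframe c F y = (n3, n4)" by (cases "nframe c F y")
  let ?P = "\<lambda>e. fst e \<in> nspace c F y \<and> snd e \<in> nspace c F y \<and>
     amb c (fst e) (fst e) = 1 \<and> amb c (snd e) (snd e) = 1 \<and> amb c (fst e) (snd e) = 0 \<and>
     npositive F y (fst e) (snd e)"
  have "?P (N3 y, N4 y)" using nspace_N[OF y] orthonormal_N[OF y] positive_N[OF y] by simp
  then have nn: "n3 \<in> nspace c F y" "n4 \<in> nspace c F y" "amb c n3 n3 = 1" "amb c n4 n4 = 1"
    "amb c n3 n4 = 0" "npositive F y n3 n4"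
    using someI[of ?P "(N3 y, N4 y)"] n unfolding nframe_def by auto
  obtain p q r s where n3: "n3 = p *\<^sub>R N3 y + q *\<^sub>R N4 y" and n4: "n4 = r *\<^sub>R N3 y + s *\<^sub>R N4 y"
    using nspace_expand[OF y nn(1)] nspace_expand[OF y nn(2)] by blast
  have 1: "p * p + q * q = 1" "r * r + s * s = 1" "p * r + q * s = 0" "0 < p * s - q * r"
    using nn(3-6) unfolding n3 n4 amb_combination[OF y] npositive_combination[OF y] by auto
  note rot = rotation_coefficients[OF 1]
  obtain p' q' where pq: "p'\<^sup>2 + q'\<^sup>2 = 1" "f1 = p' *\<^sub>R e1 y + q' *\<^sub>R e2 y" "f2 = (- q') *\<^sub>R e1 y + p' *\<^sub>R e2 y"
    using oframe_rotation[OF ip[OF y] oframe[OF y] oframe_tframe[OF ip[OF y]]] f by (metis fst_conv snd_conv)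
  note dN = smooth_on_differentiable[OF smooth_N(1) y] smooth_on_differentiable[OF smooth_N(2) y]
  have "amb c (dd N3 y f2) (dd N4 y f1) - amb c (dd N3 y f1) (dd N4 y f2)
    = (p'\<^sup>2 + q'\<^sup>2) * (amb c (dd N3 y (e2 y)) (dd N4 y (e1 y)) - amb c (dd N3 y (e1 y)) (dd N4 y (e2 y)))"
    unfolding pq(2,3)
    by (simp add: dd_add dd_scaleR dd_minus dd_diff dN amb_simps algebra_simps power2_eq_square)
  also have "\<dots> = h312 y * h411 y + h322 y * h412 y - h311 y * h412 y - h312 y * h422 y"
    unfolding pq(1) amb_dX_dY[OF tfield_frame(3,4) y] connection_table[OF y] dF_frame[OF y]
      second_form_symmetric[OF y]
    unfolding h311_def h312_def h322_def h411_def h412_def h422_def by simp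
  finally have R: "amb c (dd N3 y f2) (dd N4 y f1) - amb c (dd N3 y f1) (dd N4 y f2)
    = h312 y * h411 y + h322 y * h412 y - h311 y * h412 y - h312 y * h422 y" .
  have "amb c (amb c n4 (N3 y) *\<^sub>R N4 y - amb c n4 (N4 y) *\<^sub>R N3 y) n3 = - (p * p + q * q)"
    unfolding n3 n4 rot by (simp add: amb_simps orthonormal[OF y])
  then have "normal_curv c g F y
    = - (h312 y * h411 y + h322 y * h412 y - h311 y * h412 y - h312 y * h422 y)"
    unfolding normal_curv_def f n prod.case nriem_eq[OF y nn(2)] R amb_simps using 1(1) by (simp add: amb_simps)
  then show ?thesis by (simp add: algebra_simps)
qed

section \<open>The components of one sign of the Hopf differential and of \<nabla>H\<close>

definition "B3 \<sigma> = (\<lambda>y. h311 y - h322 y - 2 * \<sigma> * h412 y)"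
definition "B4 \<sigma> = (\<lambda>y. h411 y - h422 y + 2 * \<sigma> * h312 y)"
definition "Z3 \<sigma> = (\<lambda>y. dd H3 y (e1 y) - n1 y * H4 y - \<sigma> * (dd H4 y (e2 y) + n2 y * H3 y))"
definition "Z4 \<sigma> = (\<lambda>y. dd H4 y (e1 y) + n1 y * H3 y + \<sigma> * (dd H3 y (e2 y) - n2 y * H4 y))"

lemma smooth_HBZ:
  "smooth_on V H3" "smooth_on V H4" "smooth_on V (B3 \<sigma>)" "smooth_on V (B4 \<sigma>)"
  "smooth_on V (Z3 \<sigma>)" "smooth_on V (Z4 \<sigma>)"
proof -
  show H: "smooth_on V H3" "smooth_on V H4"
    unfolding H3_def H4_def
    by (intro smooth_on_divide smooth_on_add smooth_on_const open_V smooth_coefficients, simp)+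
  show "smooth_on V (B3 \<sigma>)" "smooth_on V (B4 \<sigma>)"
    unfolding B3_def B4_def
    by (intro smooth_on_diff smooth_on_add smooth_on_mult smooth_on_const open_V smooth_coefficients)+
  show "smooth_on V (Z3 \<sigma>)" "smooth_on V (Z4 \<sigma>)"
    unfolding Z3_def Z4_def
    by (intro smooth_on_diff smooth_on_add smooth_on_mult smooth_on_const open_V smooth_coefficients
        smooth_along H)+
qed

text \<open>Gauss and Ricci turn the radicand into a sum of squares. Hence it is nonnegative, and it
  vanishes exactly where B does.\<close>

lemma calH_radicand:
  assumes y: "y \<in> V" and \<sigma>: "\<sigma>\<^sup>2 = 1"
  shows "amb c (mean_curv c g F y) (mean_curv c g F y) - (gauss_curvature g y - c) - \<sigma> * normal_curv c g F y
    = ((B3 \<sigma> y)\<^sup>2 + (B4 \<sigma> y)\<^sup>2) / 4"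
proof -
  have "4 * (amb c (mean_curv c g F y) (mean_curv c g F y) - (gauss_curvature g y - c) - \<sigma> * normal_curv c g F y)
    = (B3 \<sigma> y)\<^sup>2 + (B4 \<sigma> y)\<^sup>2"
    unfolding mean_curv_eq[OF y] amb_combination[OF y] gauss_equation[OF y] ricci_equation[OF y]
      B3_def B4_def using \<sigma> H34_double[of y] by algebra
  then show ?thesis by simp
qed

lemma calH_norm_eq:
  assumes "y \<in> V" "\<sigma>\<^sup>2 = 1"
  shows "calH_norm c g \<sigma> F y = sqrt (((B3 \<sigma> y)\<^sup>2 + (B4 \<sigma> y)\<^sup>2) / 4)"
  unfolding calH_norm_def calH_radicand[OF assms] ..

lemma Z_double:
  assumes y: "y \<in> V"
  shows "2 * Z3 \<sigma> y = dd h311 y (e1 y) + dd h322 y (e1 y) - n1 y * (h411 y + h422 y)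
      - \<sigma> * (dd h411 y (e2 y) + dd h422 y (e2 y) + n2 y * (h311 y + h322 y))"
    and "2 * Z4 \<sigma> y = dd h411 y (e1 y) + dd h422 y (e1 y) + n1 y * (h311 y + h322 y)
      + \<sigma> * (dd h311 y (e2 y) + dd h322 y (e2 y) - n2 y * (h411 y + h422 y))"
proof -
  note d = smooth_coefficients[THEN smooth_on_differentiable[OF _ y]]
  have H: "2 * dd H3 y u = dd h311 y u + dd h322 y u" "2 * dd H4 y u = dd h411 y u + dd h422 y u" for u
    unfolding H3_def H4_def using dd_mult[of "\<lambda>y. h311 y + h322 y" y "\<lambda>_. 1/2" u]
      dd_mult[of "\<lambda>y. h411 y + h422 y" y "\<lambda>_. 1/2" u] by (simp_all add: dd_plus d)
  show "2 * Z3 \<sigma> y = dd h311 y (e1 y) + dd h322 y (e1 y) - n1 y * (h411 y + h422 y)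
      - \<sigma> * (dd h411 y (e2 y) + dd h422 y (e2 y) + n2 y * (h311 y + h322 y))"
    using H[of "e1 y"] H[of "e2 y"] H34_double[of y] unfolding Z3_def by algebra
  show "2 * Z4 \<sigma> y = dd h411 y (e1 y) + dd h422 y (e1 y) + n1 y * (h311 y + h322 y)
      + \<sigma> * (dd h311 y (e2 y) + dd h322 y (e2 y) - n2 y * (h411 y + h422 y))"
    using H[of "e1 y"] H[of "e2 y"] H34_double[of y] unfolding Z4_def by algebra
qed

text \<open>The normal field \<open>B\<close> stands for eight times \<open>\<Phi>\<^sup>\<plusminus>(e1)\<close> and \<open>Z\<close> for \<open>\<nabla>\<^sub>1 H \<plusminus> J\<^sup>\<bottom> \<nabla>\<^sub>2 H\<close>;
  this is the Codazzi equation in the form \<open>2 \<nabla>\<^sub>z\<^sub>\<bar> \<Phi>\<^sup>\<plusminus> = \<lambda>\<^sup>2 \<nabla>\<^sub>z H\<^sup>\<plusminus>\<close>.\<close>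
lemma codazzi_B:
  assumes y: "y \<in> V" and \<sigma>: "\<sigma>\<^sup>2 = 1"
  shows "dd (B3 \<sigma>) y (e1 y) - (n1 y + 2 * \<sigma> * k1 y) * B4 \<sigma> y
      + \<sigma> * (dd (B4 \<sigma>) y (e2 y) + (n2 y + 2 * \<sigma> * k2 y) * B3 \<sigma> y) = 2 * Z3 \<sigma> y"
    and "dd (B4 \<sigma>) y (e1 y) + (n1 y + 2 * \<sigma> * k1 y) * B3 \<sigma> y
      - \<sigma> * (dd (B3 \<sigma>) y (e2 y) - (n2 y + 2 * \<sigma> * k2 y) * B4 \<sigma> y) = 2 * Z4 \<sigma> y"
proof -
  note d = smooth_coefficients[THEN smooth_on_differentiable[OF _ y]]
  note mult = differentiable_bilinear[OF bounded_bilinear_mult]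
  have B: "dd (B3 \<sigma>) y u = dd h311 y u - dd h322 y u - 2 * \<sigma> * dd h412 y u"
    "dd (B4 \<sigma>) y u = dd h411 y u - dd h422 y u + 2 * \<sigma> * dd h312 y u" for u
    unfolding B3_def B4_def by (simp_all add: dd_minus_fun dd_plus dd_mult d mult)
  note Z3 = Z_double(1)[OF y, of \<sigma>] and Z4 = Z_double(2)[OF y, of \<sigma>]
  note ss = sign_cancel(1)[OF \<sigma>] and \<sigma>s = sign_cancel(2)[OF \<sigma>]
  note cod = codazzi[OF y]
  show "dd (B3 \<sigma>) y (e1 y) - (n1 y + 2 * \<sigma> * k1 y) * B4 \<sigma> y
      + \<sigma> * (dd (B4 \<sigma>) y (e2 y) + (n2 y + 2 * \<sigma> * k2 y) * B3 \<sigma> y) = 2 * Z3 \<sigma> y"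
    using cod(3) arg_cong[OF cod(2), of "\<lambda>t. \<sigma> * t"] unfolding Z3 B unfolding B3_def B4_def
    by (simp add: algebra_simps \<sigma>s)
  show "dd (B4 \<sigma>) y (e1 y) + (n1 y + 2 * \<sigma> * k1 y) * B3 \<sigma> y
      - \<sigma> * (dd (B3 \<sigma>) y (e2 y) - (n2 y + 2 * \<sigma> * k2 y) * B4 \<sigma> y) = 2 * Z4 \<sigma> y"
    using cod(4) arg_cong[OF cod(1), of "\<lambda>t. \<sigma> * t"] unfolding Z4 B unfolding B3_def B4_def
    by (simp add: algebra_simps \<sigma>s)
qed

text \<open>The imaginary part is \<plusminus>J of the real part for the normal rotation J, because
  (1 \<plusminus> iJ)/2 projects onto an eigenspace of J. So B carries the whole form, and a factor
  cis (- \<sigma> \<theta>) rotates B by \<theta> for either sign.\<close>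

lemma hopf_pm_eq:
  assumes y: "y \<in> V" and \<sigma>: "\<sigma>\<^sup>2 = 1"
  shows "hopf_pm c g \<sigma> F y (e1 y) = cvec ((B3 \<sigma> y / 8) *\<^sub>R N3 y + (B4 \<sigma> y / 8) *\<^sub>R N4 y)
    ((- \<sigma> * B4 \<sigma> y / 8) *\<^sub>R N3 y + (\<sigma> * B3 \<sigma> y / 8) *\<^sub>R N4 y)"
proof -
  have J: "rotJ g y (e1 y) = e2 y" using rotJ_oframe[OF ip[OF y] oframe[OF y], of 1 0] by simp
  define a3 where "a3 = (h311 y - h322 y) / 4"
  define a4 where "a4 = (h411 y - h422 y) / 4"
  define b3 where "b3 = - h312 y / 2"
  define b4 where "b4 = - h412 y / 2"
  have h: "hopf c g F y (e1 y) = cvec (a3 *\<^sub>R N3 y + a4 *\<^sub>R N4 y) (b3 *\<^sub>R N3 y + b4 *\<^sub>R N4 y)"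
    unfolding hopf_def J Let_def sff_frame[OF y] a3_def a4_def b3_def b4_def
    by (intro arg_cong2[where f = cvec]) (simp_all add: algebra_simps diff_divide_distrib)
  have parts: "(\<chi> k. Re (cvec a b $ k)) = a" "(\<chi> k. Im (cvec a b $ k)) = b" for a b
    unfolding cvec_def by (simp_all add: vec_eq_iff)
  have B: "B3 \<sigma> y = 4 * (a3 + \<sigma> * b4)" "B4 \<sigma> y = 4 * (a4 - \<sigma> * b3)"
    unfolding B3_def B4_def a3_def a4_def b3_def b4_def by (simp_all add: field_simps)
  note ss = sign_cancel(1)[OF \<sigma>] and \<sigma>' = sign_cancel(2)[OF \<sigma>]
  show ?thesis
    unfolding hopf_pm_def h cext_def parts Jperp_eq[OF y] B
    by (simp add: vec_eq_iff cvec_def complex_eq_iff algebra_simps \<sigma>')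
      (simp add: diff_divide_distrib add_divide_distrib)
qed

end

section \<open>The tension field of the Gauss lift\<close>

lemma bounded_bilinear_matrix_mult:
  "bounded_bilinear ((**) :: real^'n^'m \<Rightarrow> real^'p^'n \<Rightarrow> real^'p^'m)"
  unfolding bilinear_conv_bounded_bilinear[symmetric] bilinear_def
  by (auto intro!: linearI
      simp: vec_eq_iff matrix_matrix_mult_def sum.distrib algebra_simps sum_distrib_left)

lemma bounded_bilinear_matrix_vector:
  "bounded_bilinear ((*v) :: real^'n^'m \<Rightarrow> real^'n \<Rightarrow> real^'m)"
  unfolding bilinear_conv_bounded_bilinear[symmetric] bilinear_def
  by (auto intro!: linearI
      simp: vec_eq_iff matrix_vector_mult_def sum.distrib algebra_simps sum_distrib_left)

lemma bounded_linear_trace: "bounded_linear (trace :: real^'n^'n \<Rightarrow> real)"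
  unfolding linear_conv_bounded_linear[symmetric]
  by (auto intro!: linearI simp: trace_def sum.distrib sum_distrib_left)

lemmas matrix_mult_simps = bounded_bilinear.add_left[OF bounded_bilinear_matrix_mult]
  bounded_bilinear.add_right[OF bounded_bilinear_matrix_mult]
  bounded_bilinear.diff_left[OF bounded_bilinear_matrix_mult]
  bounded_bilinear.diff_right[OF bounded_bilinear_matrix_mult]
  bounded_bilinear.minus_left[OF bounded_bilinear_matrix_mult]
  bounded_bilinear.minus_right[OF bounded_bilinear_matrix_mult]
  bounded_bilinear.scaleR_left[OF bounded_bilinear_matrix_mult]
  bounded_bilinear.scaleR_right[OF bounded_bilinear_matrix_mult]
  bounded_bilinear.zero_left[OF bounded_bilinear_matrix_mult]
  bounded_bilinear.zero_right[OF bounded_bilinear_matrix_mult]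

lemmas matrix_vector_simps = bounded_bilinear.add_left[OF bounded_bilinear_matrix_vector]
  bounded_bilinear.add_right[OF bounded_bilinear_matrix_vector]
  bounded_bilinear.diff_left[OF bounded_bilinear_matrix_vector]
  bounded_bilinear.diff_right[OF bounded_bilinear_matrix_vector]
  bounded_bilinear.minus_left[OF bounded_bilinear_matrix_vector]
  bounded_bilinear.minus_right[OF bounded_bilinear_matrix_vector]
  bounded_bilinear.scaleR_left[OF bounded_bilinear_matrix_vector]
  bounded_bilinear.scaleR_right[OF bounded_bilinear_matrix_vector]
  bounded_bilinear.zero_left[OF bounded_bilinear_matrix_vector]
  bounded_bilinear.zero_right[OF bounded_bilinear_matrix_vector]

lemma matrix_eqI: "(\<And>v. (A :: real^'n^'m) *v v = B *v v) \<Longrightarrow> A = B"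
  by (simp add: matrix_eq)

lemma trace_rank_one:
  assumes l: "linear (l :: real^'n \<Rightarrow> real)" and A: "\<And>v. A *v v = l v *\<^sub>R w"
  shows "trace A = l w"
proof -
  have "A $ i $ i = l (axis i 1) * w $ i" for i
  proof -
    have "A $ i $ i = (A *v axis i 1) $ i" by (simp add: matrix_vector_mult_basis column_def)
    then show ?thesis unfolding A by simp
  qed
  moreover have "l w = (\<Sum>i\<in>UNIV. w $ i * l (axis i 1))"
  proof -
    have "l w = l (\<Sum>i\<in>UNIV. w $ i *\<^sub>R axis i 1)"
      using basis_expansion[of w] by (simp add: scalar_mult_eq_scaleR)
    then show ?thesis using l by (simp add: linear_sum linear_scale)
  qed
  ultimately show ?thesis unfolding trace_def by (simp add: mult.commute)
qed

lemma tproj_linear: "linear (tproj c P)"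
  unfolding tproj_def by (auto intro!: linearI simp: ell_simps algebra_simps)

lemma matrix_tproj: "matrix (tproj c P) *v v = tproj c P v"
  by (rule matrix_works[OF tproj_linear[unfolded linear_matrix_vector_mul_eq[symmetric]]])

lemma dd_vec_nth: "F differentiable (at x) \<Longrightarrow> dd (\<lambda>y. F y $ i) x u = dd F x u $ i"
  by (rule dd_bounded_linear[OF bounded_linear_vec_nth])

lemma smooth_matrix_tproj: "smooth_on UNIV (\<lambda>P. matrix (tproj c P))"
  unfolding matrix_def tproj_def
  by (intro smooth_on_vec_lambda open_UNIV smooth_on_vec_nth smooth_on_diff smooth_on_scaleR
      smooth_on_const smooth_on_bilinear[OF bounded_bilinear_ell] smooth_on_linear[OF bounded_linear_ident])

lemma dd_matrix_tproj: "dd (\<lambda>P. matrix (tproj c P)) P p *v v = - (ell c p v *\<^sub>R P + ell c P v *\<^sub>R p)"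
proof -
  note d = smooth_on_differentiable[OF smooth_matrix_tproj UNIV_I]
  have "dd (\<lambda>P. matrix (tproj c P)) P p *v v = dd (\<lambda>P. matrix (tproj c P) *v v) P p"
    using dd_bilinear[OF bounded_bilinear_matrix_vector d differentiable_const[of v], of c P p]
    by (simp add: matrix_vector_simps)
  also have "\<dots> = dd (\<lambda>P. v - ell c P v *\<^sub>R P) P p"
    unfolding matrix_tproj unfolding tproj_def ..
  also have "\<dots> = - (ell c p v *\<^sub>R P + ell c P v *\<^sub>R p)"
    using dd_minus_fun[of "\<lambda>_. v" P "\<lambda>P. ell c P v *\<^sub>R P" p]
    by (simp add: dd_bilinear[OF bounded_bilinear_scaleR] dd_bilinear[OF bounded_bilinear_ell]
        differentiable_bilinear[OF bounded_bilinear_scaleR] differentiable_bilinear[OF bounded_bilinear_ell]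
        ell_simps)
  finally show ?thesis .
qed

lemma vert_vertical:
  assumes "B *v P = 0" "\<And>v. B *v v \<in> TQ c P"
  shows "vert c P B = B" "matrix (tproj c P) ** B = B" "B ** matrix (tproj c P) = B"
proof -
  show 1: "matrix (tproj c P) ** B = B"
    by (rule matrix_eqI)
      (use assms(2) in \<open>auto simp: matrix_vector_mul_assoc[symmetric] matrix_tproj tproj_def TQ_def\<close>)
  show 2: "B ** matrix (tproj c P) = B"
    by (rule matrix_eqI)
      (simp add: matrix_vector_mul_assoc[symmetric] matrix_tproj tproj_def matrix_vector_simps assms(1))
  show "vert c P B = B" unfolding vert_def 1 2 ..
qed

lemma differentiable_vert: "(\<lambda>R. vert c R S) differentiable (at P)"
  unfolding vert_def
  by (intro differentiable_bilinear[OF bounded_bilinear_matrix_mult] differentiable_const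
      smooth_on_differentiable[OF smooth_matrix_tproj UNIV_I])

text \<open>The base point enters through the projections inside \<open>vert\<close>. As B is
  vertical, the product rule leaves only two terms, both traces of maps of rank one.\<close>

lemma dd_trace_vert:
  assumes P: "ell c P P = 1" and B: "B *v P = 0" "\<And>v. B *v v \<in> TQ c P"
  shows "dd (\<lambda>R. trace (vert c R S ** vert c R B)) P p
    = - ell c p (B *v (S *v P)) - ell c P (S *v (B *v p))"
proof -
  define Q where "Q = matrix (tproj c P)"
  define D where "D = dd (\<lambda>P. matrix (tproj c P)) P p"
  note dQ = smooth_on_differentiable[OF smooth_matrix_tproj UNIV_I]
  note dm = differentiable_bilinear[OF bounded_bilinear_matrix_mult]
  have dv: "dd (\<lambda>R. vert c R S) P p = Q ** S ** D + D ** S ** Q" for S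
    unfolding vert_def Q_def D_def
    by (simp add: dd_bilinear[OF bounded_bilinear_matrix_mult] dm dQ matrix_mult_simps)
  have QB: "vert c P B = B" "Q ** B = B" "B ** Q = B"
    using vert_vertical[OF B] unfolding Q_def by auto
  have Dv: "D *v v = - (ell c p v *\<^sub>R P + ell c P v *\<^sub>R p)" for v
    unfolding D_def by (rule dd_matrix_tproj)
  have Bv: "ell c P (B *v v) = 0" for v using B(2) unfolding TQ_def by blast
  have QDB: "Q ** (D ** B) = 0"
    by (rule matrix_eqI)
      (simp add: matrix_vector_mul_assoc[symmetric] Dv Bv Q_def matrix_tproj tproj_def ell_simps P matrix_vector_simps)
  have BDQ: "B ** D ** Q = 0"
    by (rule matrix_eqI)
      (simp add: matrix_vector_mul_assoc[symmetric] Dv B(1) Q_def matrix_tproj tproj_def ell_simps P matrix_vector_simps)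
  have "dd (\<lambda>R. trace (vert c R S ** vert c R B)) P p
    = trace (vert c P S ** (Q ** B ** D + D ** B ** Q) + (Q ** S ** D + D ** S ** Q) ** B)"
    using dd_bounded_linear[OF bounded_linear_trace dm[OF differentiable_vert differentiable_vert]]
    by (simp add: dd_bilinear[OF bounded_bilinear_matrix_mult] differentiable_vert dv QB(1))
  also have "vert c P S ** (Q ** B ** D + D ** B ** Q) + (Q ** S ** D + D ** S ** Q) ** B
    = Q ** (S ** (Q ** (B ** D))) + Q ** (S ** (Q ** (D ** B))) + Q ** (S ** (D ** B)) + D ** (S ** (Q ** B))"
    unfolding vert_def Q_def[symmetric] by (simp add: matrix_mult_simps matrix_mul_assoc[symmetric] QB)
  also have "\<dots> = Q ** (S ** (B ** D)) + Q ** (S ** (D ** B)) + D ** (S ** B)"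
    unfolding QDB by (simp add: matrix_mul_assoc QB matrix_mult_simps)
  also have "trace \<dots> = trace (Q ** (S ** (B ** D))) + trace (Q ** (S ** (D ** B))) + trace (D ** (S ** B))"
    by (simp add: trace_add)
  also have "trace (Q ** (S ** (B ** D))) = 0"
    using trace_mul_sym[of Q "S ** (B ** D)"] BDQ
    by (simp add: matrix_mul_assoc[symmetric] matrix_mult_simps trace_0[unfolded mat_def] trace_def)
  also have "trace (Q ** (S ** (D ** B))) = trace (S ** (D ** B))"
    using trace_mul_sym[of Q "S ** (D ** B)"] QB by (simp add: matrix_mul_assoc[symmetric])
  also have "trace (S ** (D ** B)) = - ell c p (B *v (S *v P))"
    by (rule trace_rank_one)
      (auto intro!: linearI
        simp: matrix_vector_mul_assoc[symmetric] Dv Bv matrix_vector_simps ell_simps algebra_simps)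
  also have "trace (D ** (S ** B)) = - ell c P (S *v (B *v p))"
  proof -
    have "trace (D ** (S ** B)) = trace (S ** B ** D)" by (rule trace_mul_sym)
    also have "\<dots> = - ell c P (S *v (B *v p))"
      by (rule trace_rank_one[where l = "\<lambda>v. - ell c P v" and w = "S *v (B *v p)", simplified])
        (auto intro!: linearI
          simp: matrix_vector_mul_assoc[symmetric] Dv B(1) matrix_vector_simps ell_simps algebra_simps)
    finally show ?thesis .
  qed
  finally show ?thesis by simp
qed

text \<open>\<open>g1\<close> looks only at the first component of the point, so its coefficients
  are constant in the fibre variable.\<close>

lemma dd_g1_base: "dd (\<lambda>z. g1 c z Y W) (P, A) X = - dd (\<lambda>R. trace (vert c R (snd Y) ** vert c R (snd W))) P (fst X) / 4"
proof -
  define \<phi> where "\<phi> R = trace (vert c R (snd Y) ** vert c R (snd W))" for R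
  have d: "\<phi> differentiable (at P)"
    unfolding \<phi>_def
    by (rule differentiable_bounded_linear[OF bounded_linear_trace
          differentiable_bilinear[OF bounded_bilinear_matrix_mult differentiable_vert differentiable_vert]])
  have "((\<lambda>z. \<phi> (fst z)) has_derivative (\<lambda>X. dd \<phi> P (fst X))) (at (P, A))"
    using has_derivative_compose[OF has_derivative_fst[OF has_derivative_ident], of \<phi> "dd \<phi> P" "(P, A)"]
      dd_has_derivative[OF d] by simp
  then have "((\<lambda>z. amb c (fst Y) (fst W) - \<phi> (fst z) / 4) has_derivative (\<lambda>X. - (dd \<phi> P (fst X) / 4))) (at (P, A))"
    by (auto intro!: derivative_eq_intros)
  from ddI[OF this] show ?thesis unfolding g1_def \<phi>_def[symmetric] by simp
qed

text \<open>The connection matrix in the frame \<open>E1\<close>, \<open>E2\<close>,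
  \<open>N3\<close>, \<open>N4\<close>, \<open>F\<close>: each column is the derivative of one frame
  vector. Thus k and n are the tangent and normal connection, the b entries are \<alpha>, column 5
  is the derivative of the position, and row 5 contains the position components produced by
  c.\<close>

definition omat :: "real \<Rightarrow> real \<Rightarrow> real \<Rightarrow> real \<Rightarrow> real \<Rightarrow> real \<Rightarrow> real \<Rightarrow> real \<Rightarrow> real \<Rightarrow> real^5^5" where
  "omat c k t1 t2 b31 b32 b41 b42 n = (\<chi> i j.
     if i = 2 \<and> j = 1 then k else if i = 1 \<and> j = 2 then - k else
     if i = 3 \<and> j = 1 then b31 else if i = 1 \<and> j = 3 then - b31 else
     if i = 3 \<and> j = 2 then b32 else if i = 2 \<and> j = 3 then - b32 else
     if i = 4 \<and> j = 1 then b41 else if i = 1 \<and> j = 4 then - b41 else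
     if i = 4 \<and> j = 2 then b42 else if i = 2 \<and> j = 4 then - b42 else
     if i = 4 \<and> j = 3 then n else if i = 3 \<and> j = 4 then - n else
     if i = 1 \<and> j = 5 then t1 else if i = 5 \<and> j = 1 then - c * t1 else
     if i = 2 \<and> j = 5 then t2 else if i = 5 \<and> j = 2 then - c * t2 else 0)"

lemma omat_nth [simp]:
  "omat c k t1 t2 b31 b32 b41 b42 n $ 1 $ 1 = 0" "omat c k t1 t2 b31 b32 b41 b42 n $ 1 $ 2 = - k"
  "omat c k t1 t2 b31 b32 b41 b42 n $ 1 $ 3 = - b31" "omat c k t1 t2 b31 b32 b41 b42 n $ 1 $ 4 = - b41"
  "omat c k t1 t2 b31 b32 b41 b42 n $ 1 $ 5 = t1"
  "omat c k t1 t2 b31 b32 b41 b42 n $ 2 $ 1 = k" "omat c k t1 t2 b31 b32 b41 b42 n $ 2 $ 2 = 0"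
  "omat c k t1 t2 b31 b32 b41 b42 n $ 2 $ 3 = - b32" "omat c k t1 t2 b31 b32 b41 b42 n $ 2 $ 4 = - b42"
  "omat c k t1 t2 b31 b32 b41 b42 n $ 2 $ 5 = t2"
  "omat c k t1 t2 b31 b32 b41 b42 n $ 3 $ 1 = b31" "omat c k t1 t2 b31 b32 b41 b42 n $ 3 $ 2 = b32"
  "omat c k t1 t2 b31 b32 b41 b42 n $ 3 $ 3 = 0" "omat c k t1 t2 b31 b32 b41 b42 n $ 3 $ 4 = - n"
  "omat c k t1 t2 b31 b32 b41 b42 n $ 3 $ 5 = 0"
  "omat c k t1 t2 b31 b32 b41 b42 n $ 4 $ 1 = b41" "omat c k t1 t2 b31 b32 b41 b42 n $ 4 $ 2 = b42"
  "omat c k t1 t2 b31 b32 b41 b42 n $ 4 $ 3 = n" "omat c k t1 t2 b31 b32 b41 b42 n $ 4 $ 4 = 0"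
  "omat c k t1 t2 b31 b32 b41 b42 n $ 4 $ 5 = 0"
  "omat c k t1 t2 b31 b32 b41 b42 n $ 5 $ 1 = - c * t1" "omat c k t1 t2 b31 b32 b41 b42 n $ 5 $ 2 = - c * t2"
  "omat c k t1 t2 b31 b32 b41 b42 n $ 5 $ 3 = 0" "omat c k t1 t2 b31 b32 b41 b42 n $ 5 $ 4 = 0"
  "omat c k t1 t2 b31 b32 b41 b42 n $ 5 $ 5 = 0"
  unfolding omat_def by simp_all

text \<open>The complex structure of the Gauss lift in frame coordinates: the rotation of the
  tangent plane and \<plusminus> that of the normal plane.\<close>

definition Kmat :: "real \<Rightarrow> real^5^5" where
  "Kmat \<sigma> = omat 0 1 0 0 0 0 0 0 \<sigma>"

text \<open>The vertical vectors in frame coordinates: two parameters for the tangent plane of the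
  fibre sphere.\<close>

definition bmat :: "real \<Rightarrow> real \<Rightarrow> real \<Rightarrow> real^5^5" where
  "bmat \<sigma> s t = omat 0 0 0 0 s (\<sigma> * t) t (- \<sigma> * s) 0"

lemma mat5_eq_iff: "A = B \<longleftrightarrow> (\<forall>i j. A $ i $ j = B $ i $ (j::5))" for A B :: "real^5^5"
  by (simp add: vec_eq_iff)

text \<open>If a frame matrix f satisfies f' = f X, this is the frame matrix of the derivative of f
  K f^-1.\<close>

definition comm :: "real^5^5 \<Rightarrow> real^5^5 \<Rightarrow> real^5^5" where
  "comm K X = X ** K - K ** X"

text \<open>Of the six parameters of a skew 4x4 block, entries (1,1) and (3,3) of the anticommutator
  kill the rotations within the two planes, and entries (3,1) and (4,1) tie the four mixed ones
  together in pairs.\<close>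

lemma bmat_unique:
  fixes b :: "real^5^5"
  assumes \<sigma>: "\<sigma>\<^sup>2 = 1" and "\<And>i. b $ i $ 5 = 0" "\<And>j. b $ 5 $ j = 0"
    and skew: "\<And>i j. i \<noteq> 5 \<Longrightarrow> j \<noteq> 5 \<Longrightarrow> b $ i $ j = - b $ j $ i" and anti: "Kmat \<sigma> ** b + b ** Kmat \<sigma> = 0"
  shows "b = bmat \<sigma> (b $ 3 $ 1) (b $ 4 $ 1)"
proof -
  note ss = sign_cancel(1)[OF \<sigma>] and \<sigma>s = sign_cancel(2)[OF \<sigma>]
  have sk: "b $ 1 $ 1 = 0" "b $ 2 $ 2 = 0" "b $ 3 $ 3 = 0" "b $ 4 $ 4 = 0"
    "b $ 1 $ 2 = - b $ 2 $ 1" "b $ 1 $ 3 = - b $ 3 $ 1" "b $ 1 $ 4 = - b $ 4 $ 1"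
    "b $ 2 $ 3 = - b $ 3 $ 2" "b $ 2 $ 4 = - b $ 4 $ 2" "b $ 3 $ 4 = - b $ 4 $ 3"
    using skew[of 1 1] skew[of 2 2] skew[of 3 3] skew[of 4 4] skew[of 1 2] skew[of 1 3] skew[of 1 4]
      skew[of 2 3] skew[of 2 4] skew[of 3 4] by simp_all
  have e: "(Kmat \<sigma> ** b + b ** Kmat \<sigma>) $ i $ j = 0" for i j using anti by simp
  have "b $ 2 $ 1 = 0"
    using e[of 1 1] by (simp add: matrix_matrix_mult_def sum_5 Kmat_def assms(2,3) sk)
  moreover have "\<sigma> * b $ 4 $ 3 = 0"
    using e[of 3 3] by (simp add: matrix_matrix_mult_def sum_5 Kmat_def assms(2,3) sk)
  then have "b $ 4 $ 3 = 0" using ss by (metis mult_zero_right \<sigma>s)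
  moreover have "b $ 3 $ 2 = \<sigma> * b $ 4 $ 1"
    using e[of 3 1] by (simp add: matrix_matrix_mult_def sum_5 Kmat_def assms(2,3) sk)
  moreover have "b $ 4 $ 2 = - \<sigma> * b $ 3 $ 1"
    using e[of 4 1] by (simp add: matrix_matrix_mult_def sum_5 Kmat_def assms(2,3) sk)
  ultimately show ?thesis
    unfolding mat5_eq_iff forall_5 by (simp add: bmat_def assms(2,3) sk)
qed

lemma Kmat_bmat: "\<sigma>\<^sup>2 = 1 \<Longrightarrow> Kmat \<sigma> ** bmat \<sigma> s t + bmat \<sigma> s t ** Kmat \<sigma> = 0"
proof -
  assume \<sigma>: "\<sigma>\<^sup>2 = 1"
  note ss = sign_cancel(1)[OF \<sigma>] and \<sigma>s = sign_cancel(2)[OF \<sigma>]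
  show ?thesis
    unfolding mat5_eq_iff forall_5 by (simp add: matrix_matrix_mult_def sum_5 Kmat_def bmat_def ss \<sigma>s algebra_simps)
qed

section \<open>The Gauss lift in frame coordinates\<close>

context adapted_frame
begin

definition frv :: "real^2 \<Rightarrow> 5 \<Rightarrow> real^5" where
  "frv y a = (if a = 1 then E1 y else if a = 2 then E2 y else if a = 3 then N3 y else if a = 4 then N4 y else F y)"

definition cofr :: "real^2 \<Rightarrow> 5 \<Rightarrow> real^5 \<Rightarrow> real" where
  "cofr y a v = (if a = 5 then ell c (F y) v else amb c (v - ell c (F y) v *\<^sub>R F y) (frv y a))"

definition fmat :: "real^2 \<Rightarrow> real^5^5" where
  "fmat y = (\<chi> i a. frv y a $ i)"

definition comat :: "real^2 \<Rightarrow> real^5^5" where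
  "comat y = (\<chi> a j. cofr y a (axis j 1))"

lemma frv_simps [simp]:
  "frv y 1 = E1 y" "frv y 2 = E2 y" "frv y 3 = N3 y" "frv y 4 = N4 y" "frv y 5 = F y"
  unfolding frv_def by simp_all

lemma cofr_linear: "linear (cofr y a)"
  unfolding cofr_def by (auto intro!: linearI simp: amb_simps ell_simps algebra_simps)

lemma comat_vec: "(comat y *v v) $ a = cofr y a v"
proof -
  have "cofr y a v = cofr y a (\<Sum>j\<in>UNIV. v $ j *\<^sub>R axis j 1)"
    using basis_expansion[of v] by (simp add: scalar_mult_eq_scaleR)
  then show ?thesis
    by (simp add: comat_def matrix_vector_mult_def linear_sum[OF cofr_linear] linear_scale[OF cofr_linear]
        mult.commute)
qed

lemma fmat_vec: "fmat y *v w = w$1 *\<^sub>R E1 y + w$2 *\<^sub>R E2 y + w$3 *\<^sub>R N3 y + w$4 *\<^sub>R N4 y + w$5 *\<^sub>R F y"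
  by (simp add: fmat_def matrix_vector_mult_def vec_eq_iff sum_5 algebra_simps)

lemma cofr_fr:
  assumes y: "y \<in> V"
  shows "cofr y a (frv y b) = (if a = b then 1 else 0)"
proof -
  have "\<forall>a b. cofr y a (frv y b) = (if a = b then 1 else 0)"
    unfolding forall_5 cofr_def
    by (simp add: orthonormal[OF y] ell_frame[OF y] F_unit[OF y] amb_simps)
  then show ?thesis by blast
qed

lemma comat_fmat: "y \<in> V \<Longrightarrow> comat y ** fmat y = mat 1"
proof -
  assume y: "y \<in> V"
  have "(comat y ** fmat y) $ a $ b = (comat y *v frv y b) $ a" for a b
    by (simp add: matrix_matrix_mult_def matrix_vector_mult_def fmat_def)
  then show ?thesis unfolding comat_vec cofr_fr[OF y] by (simp add: vec_eq_iff mat_def)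
qed

lemma fmat_comat: "y \<in> V \<Longrightarrow> fmat y ** comat y = mat 1"
  using comat_fmat matrix_left_right_inverse by blast

lemma fmat_comat_cancel:
  assumes "y \<in> V"
  shows "comat y ** (fmat y ** X) = X" "fmat y ** (comat y ** X) = X"
  using comat_fmat[OF assms] fmat_comat[OF assms] by (simp_all add: matrix_mul_assoc)

lemma fmat_axis: "fmat y *v axis a 1 = frv y a"
  by (simp add: matrix_vector_mult_basis column_def fmat_def vec_eq_iff)

lemma comat_frv: "y \<in> V \<Longrightarrow> comat y *v frv y b = axis b 1"
  by (simp add: vec_eq_iff comat_vec cofr_fr axis_def)

lemma smooth_fmat: "smooth_on V fmat"
proof -
  have "\<forall>a. smooth_on V (\<lambda>y. frv y a)"
    unfolding forall_5 using smooth_E smooth_N smooth_F by simp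
  then show ?thesis unfolding fmat_def by (intro smooth_on_vec_lambda smooth_on_vec_nth open_V) blast
qed

lemma smooth_comat: "smooth_on V comat"
proof -
  have "\<forall>a. smooth_on V (\<lambda>y. cofr y a v)" for v
    unfolding forall_5 cofr_def
    by (simp, intro conjI smooth_amb smooth_on_diff smooth_on_const smooth_on_scaleR open_V smooth_F
        smooth_on_bilinear[OF bounded_bilinear_ell] smooth_E smooth_N)
  then show ?thesis unfolding comat_def by (intro smooth_on_vec_lambda open_V) blast
qed

definition Amat :: "real \<Rightarrow> real^2 \<Rightarrow> real^5^5" where
  "Amat \<sigma> y = fmat y ** Kmat \<sigma> ** comat y"

lemma smooth_Amat: "smooth_on V (Amat \<sigma>)"
  unfolding Amat_def
  by (intro smooth_on_bilinear[OF bounded_bilinear_matrix_mult] open_V smooth_fmat smooth_comat smooth_on_const)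

lemma Amat_frame:
  assumes y: "y \<in> V"
  shows "Amat \<sigma> y *v E1 y = E2 y" "Amat \<sigma> y *v E2 y = - E1 y"
    "Amat \<sigma> y *v N3 y = \<sigma> *\<^sub>R N4 y" "Amat \<sigma> y *v N4 y = - \<sigma> *\<^sub>R N3 y" "Amat \<sigma> y *v F y = 0"
proof -
  have "Amat \<sigma> y *v frv y a = fmat y *v (Kmat \<sigma> *v axis a 1)" for a
    unfolding Amat_def by (simp add: matrix_vector_mul_assoc[symmetric] comat_frv[OF y])
  then have *: "Amat \<sigma> y *v frv y a = fmat y *v column a (Kmat \<sigma>)" for a
    by (simp add: matrix_vector_mult_basis)
  show "Amat \<sigma> y *v E1 y = E2 y" "Amat \<sigma> y *v E2 y = - E1 y"
    "Amat \<sigma> y *v N3 y = \<sigma> *\<^sub>R N4 y" "Amat \<sigma> y *v N4 y = - \<sigma> *\<^sub>R N3 y" "Amat \<sigma> y *v F y = 0"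
    using *[of 1] *[of 2] *[of 3] *[of 4] *[of 5]
    by (simp_all add: fmat_vec column_def Kmat_def)
qed

lemma matrix_eq_on_frame:
  assumes y: "y \<in> V" and eq: "A *v E1 y = B *v E1 y" "A *v E2 y = B *v E2 y" "A *v N3 y = B *v N3 y"
    "A *v N4 y = B *v N4 y" "A *v F y = B *v F y"
  shows "(A :: real^5^5) = B"
proof (rule matrix_eqI)
  fix v
  have v: "v = fmat y *v (comat y *v v)" using fmat_comat[OF y] by (simp add: matrix_vector_mul_assoc)
  show "A *v v = B *v v"
    by (subst (1 2) v) (simp add: fmat_vec matrix_vector_simps eq)
qed

text \<open>A matrix is determined by its values on the frame, which makes the definite description
  unique.\<close>

lemma gauss_lift_eq:
  assumes y: "y \<in> V"
  shows "gauss_lift c g \<sigma> F y = (F y, Amat \<sigma> y)"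
proof -
  have dF: "dd F y u = g y u (e1 y) *\<^sub>R E1 y + g y u (e2 y) *\<^sub>R E2 y" for u
    by (subst oframe_expand[OF ip[OF y] oframe[OF y], of u])
      (simp add: E1_def E2_def dd_add dd_scaleR F_differentiable[OF y])
  have rJ: "dd F y (rotJ g y u) = (- g y u (e2 y)) *\<^sub>R E1 y + g y u (e1 y) *\<^sub>R E2 y" for u
    by (subst oframe_expand[OF ip[OF y] oframe[OF y], of u], subst rotJ_oframe[OF ip[OF y] oframe[OF y]])
      (simp add: E1_def E2_def dd_add dd_scaleR dd_minus dd_diff F_differentiable[OF y])
  have "(THE A. A *v F y = 0 \<and> (\<forall>u. A *v dd F y u = dd F y (rotJ g y u)) \<and>
     (\<forall>\<xi>\<in>nspace c F y. A *v \<xi> = \<sigma> *\<^sub>R Jperp c F y \<xi>)) = Amat \<sigma> y"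
  proof (rule the_equality)
    have "Amat \<sigma> y *v \<xi> = \<sigma> *\<^sub>R Jperp c F y \<xi>" if n: "\<xi> \<in> nspace c F y" for \<xi>
    proof -
      obtain a b where xi: "\<xi> = a *\<^sub>R N3 y + b *\<^sub>R N4 y" using nspace_expand[OF y n] by blast
      show ?thesis unfolding xi Jperp_eq[OF y]
        by (simp add: matrix_vector_simps Amat_frame[OF y] algebra_simps)
    qed
    then show "Amat \<sigma> y *v F y = 0 \<and> (\<forall>u. Amat \<sigma> y *v dd F y u = dd F y (rotJ g y u)) \<and>
     (\<forall>\<xi>\<in>nspace c F y. Amat \<sigma> y *v \<xi> = \<sigma> *\<^sub>R Jperp c F y \<xi>)"
      unfolding rJ unfolding dF by (simp add: matrix_vector_simps Amat_frame[OF y])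
    fix A
    assume A: "A *v F y = 0 \<and> (\<forall>u. A *v dd F y u = dd F y (rotJ g y u)) \<and>
     (\<forall>\<xi>\<in>nspace c F y. A *v \<xi> = \<sigma> *\<^sub>R Jperp c F y \<xi>)"
    have J: "rotJ g y (e1 y) = e2 y" "rotJ g y (e2 y) = - e1 y"
      using rotJ_oframe[OF ip[OF y] oframe[OF y], of 1 0] rotJ_oframe[OF ip[OF y] oframe[OF y], of 0 1] by simp_all
    have "Jperp c F y (N3 y) = N4 y" "Jperp c F y (N4 y) = - N3 y"
      using Jperp_eq[OF y, of 1 0] Jperp_eq[OF y, of 0 1] by simp_all
    moreover have "A *v E1 y = E2 y" "A *v E2 y = - E1 y"
      using A J unfolding E1_def E2_def by (simp_all add: dd_minus[OF F_differentiable[OF y]])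
    ultimately show "A = Amat \<sigma> y"
      by (intro matrix_eq_on_frame[OF y]) (use A nspace_N[OF y] in \<open>auto simp: Amat_frame[OF y]\<close>)
  qed
  then show ?thesis unfolding gauss_lift_def by simp
qed

lemma Amat_TQ:
  assumes y: "y \<in> V"
  shows "Amat \<sigma> y *v v \<in> TQ c (F y)"
proof -
  have "ell c (F y) (Amat \<sigma> y *v v) = cofr y 5 (fmat y *v (Kmat \<sigma> *v (comat y *v v)))"
    unfolding cofr_def Amat_def by (simp add: matrix_vector_mul_assoc matrix_mul_assoc)
  also have "\<dots> = (Kmat \<sigma> *v (comat y *v v)) $ 5"
    unfolding comat_vec[symmetric] using comat_fmat[OF y] by (simp add: matrix_vector_mul_assoc matrix_mul_assoc)
  also have "\<dots> = 0" by (simp add: matrix_vector_mult_def sum_5 Kmat_def)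
  finally show ?thesis unfolding TQ_def by simp
qed

definition Om1 :: "real^2 \<Rightarrow> real^5^5" where
  "Om1 y = omat c (k1 y) 1 0 (h311 y) (h312 y) (h411 y) (h412 y) (n1 y)"
definition Om2 :: "real^2 \<Rightarrow> real^5^5" where
  "Om2 y = omat c (k2 y) 0 1 (h312 y) (h322 y) (h412 y) (h422 y) (n2 y)"

text \<open>Cartan's equation f' = f \<Omega> for the frame matrix. Including the position vector
  makes the frame a basis of the ambient space, so no projection is left over.\<close>

lemma dd_fmat:
  assumes y: "y \<in> V"
  shows "dd fmat y (e1 y) = fmat y ** Om1 y" "dd fmat y (e2 y) = fmat y ** Om2 y"
proof -
  have df: "\<forall>a. (\<lambda>y. frv y a) differentiable (at y)"
    unfolding forall_5 using tfield_differentiable[OF tfield_frame(1) y] tfield_differentiable[OF tfield_frame(2) y]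
      tfield_differentiable[OF tfield_frame(3) y] tfield_differentiable[OF tfield_frame(4) y]
      F_differentiable[OF y] by simp
  have col: "dd fmat y u *v axis a 1 = dd (\<lambda>y. frv y a) y u" for u a
    using dd_bilinear[OF bounded_bilinear_matrix_vector smooth_on_differentiable[OF smooth_fmat y]
        differentiable_const, of "axis a 1" u] by (simp add: fmat_axis matrix_vector_simps)
  have eqI: "dd fmat y u = fmat y ** M"
    if "\<forall>a. dd (\<lambda>y. frv y a) y u = fmat y *v column a M" for u M
  proof -
    have "column a (dd fmat y u) = column a (fmat y ** M)" for a
      unfolding matrix_vector_mult_basis[symmetric] matrix_vector_mul_assoc[symmetric] col
      using that by (simp add: matrix_vector_mult_basis)
    then show ?thesis by (simp add: vec_eq_iff column_def)
  qed
  note ex = dX_expand[OF tfield_frame(1) y] dX_expand[OF tfield_frame(2) y]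
    dX_expand[OF tfield_frame(3) y] dX_expand[OF tfield_frame(4) y]
  note tab = connection_table[OF y] dF_frame[OF y] second_form_symmetric[OF y]
  have A: "dd E1 y (e1 y) = (- c) *\<^sub>R F y + (k1 y *\<^sub>R E2 y + h311 y *\<^sub>R N3 y + h411 y *\<^sub>R N4 y)"
    "dd E2 y (e1 y) = - k1 y *\<^sub>R E1 y + h312 y *\<^sub>R N3 y + h412 y *\<^sub>R N4 y"
    "dd N3 y (e1 y) = - h311 y *\<^sub>R E1 y - h312 y *\<^sub>R E2 y + n1 y *\<^sub>R N4 y"
    "dd N4 y (e1 y) = - h411 y *\<^sub>R E1 y - h412 y *\<^sub>R E2 y - n1 y *\<^sub>R N3 y"
    by (rule trans[OF ex(1)] trans[OF ex(2)] trans[OF ex(3)] trans[OF ex(4)]; simp add: tab; simp add: coefficient_defs)+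
  have B: "dd E1 y (e2 y) = k2 y *\<^sub>R E2 y + h312 y *\<^sub>R N3 y + h412 y *\<^sub>R N4 y"
    "dd E2 y (e2 y) = (- c) *\<^sub>R F y + (- k2 y *\<^sub>R E1 y + h322 y *\<^sub>R N3 y + h422 y *\<^sub>R N4 y)"
    "dd N3 y (e2 y) = - h312 y *\<^sub>R E1 y - h322 y *\<^sub>R E2 y + n2 y *\<^sub>R N4 y"
    "dd N4 y (e2 y) = - h412 y *\<^sub>R E1 y - h422 y *\<^sub>R E2 y - n2 y *\<^sub>R N3 y"
    by (rule trans[OF ex(1)] trans[OF ex(2)] trans[OF ex(3)] trans[OF ex(4)]; simp add: tab; simp add: coefficient_defs)+
  show "dd fmat y (e1 y) = fmat y ** Om1 y"
    by (rule eqI) (unfold forall_5, simp add: fmat_vec column_def Om1_def A, simp add: E1_def)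
  show "dd fmat y (e2 y) = fmat y ** Om2 y"
    by (rule eqI) (unfold forall_5, simp add: fmat_vec column_def Om2_def B, simp add: E2_def)
qed

lemma dd_comat:
  assumes y: "y \<in> V"
  shows "dd comat y u = - (comat y ** dd fmat y u ** comat y)"
proof -
  note d = smooth_on_differentiable[OF smooth_fmat y] smooth_on_differentiable[OF smooth_comat y]
  have "dd (\<lambda>y. comat y ** fmat y) y u = dd (\<lambda>_. mat 1) y u"
    by (rule arg_cong[OF dd_cong_open[OF open_V y], where f = "\<lambda>h. h u"]) (rule comat_fmat)
  then have "comat y ** dd fmat y u + dd comat y u ** fmat y = 0"
    by (simp add: dd_bilinear[OF bounded_bilinear_matrix_mult] d)
  then have "(comat y ** dd fmat y u + dd comat y u ** fmat y) ** comat y = 0"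
    by (simp add: matrix_mult_simps)
  then have "comat y ** dd fmat y u ** comat y + dd comat y u = 0"
    by (simp add: matrix_mult_simps matrix_mul_assoc[symmetric] fmat_comat[OF y])
  then show ?thesis by (simp add: eq_neg_iff_add_eq_0 add.commute)
qed

text \<open>For an endomorphism given in the moving frame, the derivative is the coordinate
  derivative plus the commutator with \<Omega>.\<close>

lemma dd_conjugate:
  assumes y: "y \<in> V" and X: "X differentiable (at y)" and Om: "dd fmat y u = fmat y ** Om"
  shows "dd (\<lambda>z. fmat z ** X z ** comat z) y u = fmat y ** (Om ** X y - X y ** Om + dd X y u) ** comat y"
proof -
  note d = smooth_on_differentiable[OF smooth_fmat y] smooth_on_differentiable[OF smooth_comat y]
  note dm = differentiable_bilinear[OF bounded_bilinear_matrix_mult]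
  have "dd comat y u = - (Om ** comat y)"
    unfolding dd_comat[OF y] Om by (simp add: matrix_mul_assoc[symmetric] fmat_comat_cancel[OF y])
  then show ?thesis
    by (simp add: dd_bilinear[OF bounded_bilinear_matrix_mult] d X dm Om matrix_mult_simps
        matrix_mul_assoc[symmetric] algebra_simps)
qed

lemma dd_Amat:
  assumes y: "y \<in> V"
  shows "dd (Amat \<sigma>) y (e1 y) = fmat y ** comm (Kmat \<sigma>) (Om1 y) ** comat y"
    "dd (Amat \<sigma>) y (e2 y) = fmat y ** comm (Kmat \<sigma>) (Om2 y) ** comat y"
  unfolding Amat_def comm_def
  using dd_conjugate[OF y differentiable_const dd_fmat(1)[OF y], of "Kmat \<sigma>"]
    dd_conjugate[OF y differentiable_const dd_fmat(2)[OF y], of "Kmat \<sigma>"] by simp_all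

lemma smooth_omat:
  assumes "smooth_on V k" "smooth_on V b31" "smooth_on V b32" "smooth_on V b41" "smooth_on V b42" "smooth_on V n"
  shows "smooth_on V (\<lambda>y. omat c' (k y) t1 t2 (b31 y) (b32 y) (b41 y) (b42 y) (n y))"
proof -
  have "\<forall>i j. smooth_on V (\<lambda>y. omat c' (k y) t1 t2 (b31 y) (b32 y) (b41 y) (b42 y) (n y) $ i $ j)"
    unfolding forall_5 by (simp add: smooth_on_const smooth_on_uminus[OF open_V] assms)
  then have "smooth_on V (\<lambda>y. \<chi> i j. omat c' (k y) t1 t2 (b31 y) (b32 y) (b41 y) (b42 y) (n y) $ i $ j)"
    by (intro smooth_on_vec_lambda open_V) blast
  then show ?thesis by simp
qed

lemma dd_omat:
  assumes y: "y \<in> V" and s: "smooth_on V k" "smooth_on V b31" "smooth_on V b32" "smooth_on V b41" "smooth_on V b42" "smooth_on V n"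
  shows "dd (\<lambda>y. omat c' (k y) t1 t2 (b31 y) (b32 y) (b41 y) (b42 y) (n y)) y u
    = omat c' (dd k y u) 0 0 (dd b31 y u) (dd b32 y u) (dd b41 y u) (dd b42 y u) (dd n y u)"
proof -
  note d = s[THEN smooth_on_differentiable[OF _ y]]
  note D = smooth_on_differentiable[OF smooth_omat[OF s] y]
  have "dd (\<lambda>y. omat c' (k y) t1 t2 (b31 y) (b32 y) (b41 y) (b42 y) (n y)) y u $ i $ j
    = dd (\<lambda>y. omat c' (k y) t1 t2 (b31 y) (b32 y) (b41 y) (b42 y) (n y) $ i $ j) y u" for i j
    using dd_vec_nth[OF D] dd_vec_nth[OF differentiable_bounded_linear[OF bounded_linear_vec_nth D]] by metis
  then show ?thesis
    unfolding mat5_eq_iff forall_5 by (simp add: dd_uminus d)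
qed

text \<open>The frame matrix of the trace of the second derivative of \<open>Amat\<close>. The last
  two terms subtract its derivatives along k1 e2 and - k2 e1, the covariant derivatives of
  \<open>e1\<close> and \<open>e2\<close> along themselves.\<close>

definition Msum :: "real \<Rightarrow> real^2 \<Rightarrow> real^5^5" where
  "Msum \<sigma> y = Om1 y ** comm (Kmat \<sigma>) (Om1 y) - comm (Kmat \<sigma>) (Om1 y) ** Om1 y + comm (Kmat \<sigma>) (dd Om1 y (e1 y))
    + (Om2 y ** comm (Kmat \<sigma>) (Om2 y) - comm (Kmat \<sigma>) (Om2 y) ** Om2 y + comm (Kmat \<sigma>) (dd Om2 y (e2 y)))
    - k1 y *\<^sub>R comm (Kmat \<sigma>) (Om2 y) + k2 y *\<^sub>R comm (Kmat \<sigma>) (Om1 y)"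

lemma smooth_Om: "smooth_on V Om1" "smooth_on V Om2"
  unfolding Om1_def Om2_def by (intro smooth_omat smooth_coefficients)+

lemma rough_laplacian_Amat:
  assumes y: "y \<in> V"
  shows "dd (\<lambda>z. dd (Amat \<sigma>) z (e1 z)) y (e1 y) + dd (\<lambda>z. dd (Amat \<sigma>) z (e2 z)) y (e2 y)
      - k1 y *\<^sub>R dd (Amat \<sigma>) y (e2 y) + k2 y *\<^sub>R dd (Amat \<sigma>) y (e1 y) = fmat y ** Msum \<sigma> y ** comat y"
proof -
  have bl: "bounded_linear (comm (Kmat \<sigma>))"
    unfolding comm_def linear_conv_bounded_linear[symmetric]
    by (auto intro!: linearI simp: matrix_mult_simps algebra_simps)
  note dO = smooth_Om[THEN smooth_on_differentiable[OF _ y]]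
  have 1: "dd (\<lambda>z. dd (Amat \<sigma>) z (e1 z)) y = dd (\<lambda>z. fmat z ** comm (Kmat \<sigma>) (Om1 z) ** comat z) y"
    by (rule dd_cong_open[OF open_V y]) (rule dd_Amat)
  have 2: "dd (\<lambda>z. dd (Amat \<sigma>) z (e2 z)) y = dd (\<lambda>z. fmat z ** comm (Kmat \<sigma>) (Om2 z) ** comat z) y"
    by (rule dd_cong_open[OF open_V y]) (rule dd_Amat)
  show ?thesis
    unfolding 1 2 dd_conjugate[OF y differentiable_bounded_linear[OF bl dO(1)] dd_fmat(1)[OF y]]
      dd_conjugate[OF y differentiable_bounded_linear[OF bl dO(2)] dd_fmat(2)[OF y]]
      dd_bounded_linear[OF bl dO(1)] dd_bounded_linear[OF bl dO(2)] dd_Amat[OF y] Msum_def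
    by (simp add: matrix_mult_simps)
qed

text \<open>Here the tension field becomes a derivative of H: the Codazzi equations trade the
  divergence of the trace-free part of \<alpha> for the derivative of its trace.\<close>

lemma trace_Msum_bmat:
  assumes y: "y \<in> V" and \<sigma>: "\<sigma>\<^sup>2 = 1"
  shows "trace (Msum \<sigma> y ** bmat \<sigma> s t) = - 8 * \<sigma> * (Z4 \<sigma> y * s - Z3 \<sigma> y * t)"
proof -
  note ss = sign_cancel(1)[OF \<sigma>] and \<sigma>s = sign_cancel(2)[OF \<sigma>]
  note Z3 = Z_double(1)[OF y, of \<sigma>] and Z4 = Z_double(2)[OF y, of \<sigma>]
  have dOm: "dd Om1 y u = omat c (dd k1 y u) 0 0 (dd h311 y u) (dd h312 y u) (dd h411 y u) (dd h412 y u) (dd n1 y u)"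
    "dd Om2 y u = omat c (dd k2 y u) 0 0 (dd h312 y u) (dd h322 y u) (dd h412 y u) (dd h422 y u) (dd n2 y u)" for u
    unfolding Om1_def Om2_def by (rule dd_omat[OF y]; rule smooth_coefficients)+
  note cod = codazzi[OF y]
  let ?M = "Msum \<sigma> y"
  \<comment> \<open>Only eight entries of \<open>bmat\<close> are nonzero, so only eight entries of
    the long matrix sum have to be computed.\<close>
  have tr: "trace (?M ** bmat \<sigma> s t) = s * (?M$1$3 - ?M$3$1 - \<sigma> * ?M$2$4 + \<sigma> * ?M$4$2)
      + t * (\<sigma> * ?M$2$3 - \<sigma> * ?M$3$2 + ?M$1$4 - ?M$4$1)"
    unfolding trace_def matrix_matrix_mult_def by (simp add: sum_5 bmat_def algebra_simps)
  note entries = Msum_def comm_def dOm Kmat_def Om1_def Om2_def matrix_matrix_mult_def sum_5 algebra_simps \<sigma>s ss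
  have "2 * (\<sigma> * Z4 \<sigma> y) = \<sigma> * (dd h411 y (e1 y) + dd h422 y (e1 y) + n1 y * (h311 y + h322 y))
      + (dd h311 y (e2 y) + dd h322 y (e2 y) - n2 y * (h411 y + h422 y))"
    using arg_cong[OF Z4, of "\<lambda>t. \<sigma> * t"] by (simp add: algebra_simps \<sigma>s)
  moreover have "?M$1$3 - ?M$3$1 - \<sigma> * ?M$2$4 + \<sigma> * ?M$4$2
    = - 4 * (\<sigma> * (dd h411 y (e1 y) + dd h422 y (e1 y) + n1 y * (h311 y + h322 y))
      + (dd h311 y (e2 y) + dd h322 y (e2 y) - n2 y * (h411 y + h422 y)))"
    using cod(1) cod(3) arg_cong[OF cod(2), of "\<lambda>t. \<sigma> * t"] arg_cong[OF cod(4), of "\<lambda>t. \<sigma> * t"]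
    by (simp add: entries)
  ultimately have s: "?M$1$3 - ?M$3$1 - \<sigma> * ?M$2$4 + \<sigma> * ?M$4$2 = - 4 * (2 * (\<sigma> * Z4 \<sigma> y))" by metis
  have "2 * (\<sigma> * Z3 \<sigma> y) = \<sigma> * (dd h311 y (e1 y) + dd h322 y (e1 y) - n1 y * (h411 y + h422 y))
      - (dd h411 y (e2 y) + dd h422 y (e2 y) + n2 y * (h311 y + h322 y))"
    using arg_cong[OF Z3, of "\<lambda>t. \<sigma> * t"] by (simp add: algebra_simps \<sigma>s)
  moreover have "\<sigma> * ?M$2$3 - \<sigma> * ?M$3$2 + ?M$1$4 - ?M$4$1
    = 4 * (\<sigma> * (dd h311 y (e1 y) + dd h322 y (e1 y) - n1 y * (h411 y + h422 y))
      - (dd h411 y (e2 y) + dd h422 y (e2 y) + n2 y * (h311 y + h322 y)))"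
    using cod(2) cod(4) arg_cong[OF cod(1), of "\<lambda>t. \<sigma> * t"] arg_cong[OF cod(3), of "\<lambda>t. \<sigma> * t"]
    by (simp add: entries)
  ultimately have t: "\<sigma> * ?M$2$3 - \<sigma> * ?M$3$2 + ?M$1$4 - ?M$4$1 = 4 * (2 * (\<sigma> * Z3 \<sigma> y))" by metis
  show ?thesis unfolding tr s t by (simp add: algebra_simps)
qed

text \<open>Conjugation with the frame matrix turns the conditions on a vertical vector into those
  of \<open>bmat_unique\<close>.\<close>

lemma vspace_eq:
  assumes y: "y \<in> V" and \<sigma>: "\<sigma>\<^sup>2 = 1"
  shows "vspace c (F y, Amat \<sigma> y) = {(0, fmat y ** bmat \<sigma> s t ** comat y) | s t. True}"
proof -
  note assoc = matrix_mul_assoc[symmetric]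
  have fm: "amb c (fmat y *v p) (fmat y *v q) = p$1 * q$1 + p$2 * q$2 + p$3 * q$3 + p$4 * q$4"
    if "p$5 = 0" "q$5 = 0" for p q
    using that by (simp add: fmat_vec amb_simps orthonormal[OF y])
  have ell5: "ell c (F y) (fmat y *v p) = p$5" for p
    by (simp add: fmat_vec ell_simps ell_frame[OF y] F_unit[OF y])
  have repr: "v = fmat y *v (comat y *v v)" for v
    using fmat_comat[OF y] by (simp add: matrix_vector_mul_assoc)
  have comatF: "comat y *v F y = axis 5 1" using comat_frv[OF y, of 5] by simp
  have "(0, fmat y ** bmat \<sigma> s t ** comat y) \<in> vspace c (F y, Amat \<sigma> y)" for s t
  proof -
    let ?b = "bmat \<sigma> s t"
    let ?B = "fmat y ** ?b ** comat y"
    have Bv: "?B *v v = fmat y *v (?b *v (comat y *v v))" for v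
      by (simp add: matrix_vector_mul_assoc matrix_mul_assoc)
    have b5: "(?b *v w) $ 5 = 0" for w by (simp add: bmat_def matrix_vector_mult_def sum_5)
    have "?B *v F y = 0"
      unfolding Bv comatF matrix_vector_mult_basis by (simp add: fmat_vec column_def bmat_def)
    moreover have "?B *v v \<in> TQ c (F y)" for v
      unfolding Bv TQ_def by (simp add: ell5 b5)
    moreover have "amb c (?B *v v) w = - amb c v (?B *v w)" if "v \<in> TQ c (F y)" "w \<in> TQ c (F y)" for v w
    proof -
      have 5: "(comat y *v v) $ 5 = 0" "(comat y *v w) $ 5 = 0"
        using that unfolding comat_vec cofr_def TQ_def by simp_all
      have "amb c (?B *v v) w = amb c (fmat y *v (?b *v (comat y *v v))) (fmat y *v (comat y *v w))"
        unfolding Bv using repr[of w] by simp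
      also have "\<dots> = - amb c (fmat y *v (comat y *v v)) (fmat y *v (?b *v (comat y *v w)))"
        using 5 by (simp add: fm b5) (simp add: matrix_vector_mult_def sum_5 bmat_def algebra_simps)
      also have "\<dots> = - amb c v (?B *v w)" unfolding Bv using repr[of v] by simp
      finally show ?thesis .
    qed
    moreover have "Amat \<sigma> y ** ?B + ?B ** Amat \<sigma> y = 0"
    proof -
      have "Amat \<sigma> y ** ?B + ?B ** Amat \<sigma> y = fmat y ** (Kmat \<sigma> ** ?b + ?b ** Kmat \<sigma>) ** comat y"
        unfolding Amat_def by (simp add: assoc fmat_comat_cancel[OF y] matrix_mult_simps)
      then show ?thesis unfolding Kmat_bmat[OF \<sigma>] by (simp add: matrix_mult_simps)
    qed
    ultimately show ?thesis unfolding vspace_def by simp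
  qed
  moreover have "\<exists>s t. W = (0, fmat y ** bmat \<sigma> s t ** comat y)" if W: "W \<in> vspace c (F y, Amat \<sigma> y)" for W
  proof -
    obtain B where W': "W = (0, B)" and B: "B *v F y = 0" "\<And>v. B *v v \<in> TQ c (F y)"
      "\<And>v w. v \<in> TQ c (F y) \<Longrightarrow> w \<in> TQ c (F y) \<Longrightarrow> amb c (B *v v) w = - amb c v (B *v w)"
      "Amat \<sigma> y ** B + B ** Amat \<sigma> y = 0"
      using W unfolding vspace_def by auto
    define b where "b = comat y ** B ** fmat y"
    have be: "b $ i $ j = cofr y i (B *v frv y j)" for i j
    proof -
      have "b $ i $ j = (b *v axis j 1) $ i" by (simp add: matrix_vector_mult_basis column_def)
      also have "b *v axis j 1 = comat y *v (B *v frv y j)"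
        unfolding b_def by (simp add: matrix_vector_mul_assoc[symmetric] fmat_axis)
      finally show ?thesis unfolding comat_vec .
    qed
    have T: "frv y i \<in> TQ c (F y)" if "i \<noteq> 5" for i
      using that exhaust_5[of i] tfield_frame y unfolding tfield_def by auto
    have 5: "b $ i $ 5 = 0" "b $ 5 $ i = 0" for i
      unfolding be using B(1) B(2)[of "frv y i"] linear_0[OF cofr_linear, of y i] by (simp_all add: cofr_def TQ_def)
    have skew: "b $ i $ j = - b $ j $ i" if "i \<noteq> 5" "j \<noteq> 5" for i j
    proof -
      have "b $ i $ j = amb c (B *v frv y j) (frv y i)" "b $ j $ i = amb c (B *v frv y i) (frv y j)"
        unfolding be cofr_def using that B(2) unfolding TQ_def by simp_all
      then show ?thesis using B(3)[OF T[OF that(2)] T[OF that(1)]] amb_sym[of c "frv y j"] by simp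
    qed
    have "Kmat \<sigma> ** b + b ** Kmat \<sigma> = comat y ** (Amat \<sigma> y ** B + B ** Amat \<sigma> y) ** fmat y"
    proof -
      have "comat y ** fmat y = mat 1" by (rule comat_fmat[OF y])
      then show ?thesis
        unfolding Amat_def b_def by (simp add: assoc fmat_comat_cancel[OF y] matrix_mult_simps)
    qed
    then have "Kmat \<sigma> ** b + b ** Kmat \<sigma> = 0" unfolding B(4) by (simp add: matrix_mult_simps)
    from bmat_unique[OF \<sigma> 5 skew this] obtain s t where "b = bmat \<sigma> s t" by blast
    moreover have "B = fmat y ** b ** comat y"
      unfolding b_def using fmat_comat[OF y] by (simp add: assoc fmat_comat_cancel[OF y])
    ultimately show ?thesis unfolding W' by blast
  qed
  ultimately show ?thesis by auto
qed

lemma vspace_vertical: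
  assumes y: "y \<in> V" and \<sigma>: "\<sigma>\<^sup>2 = 1"
  defines "B \<equiv> \<lambda>s t. fmat y ** bmat \<sigma> s t ** comat y"
  shows "B s t *v F y = 0" "B s t *v v \<in> TQ c (F y)" "Amat \<sigma> y ** B s t + B s t ** Amat \<sigma> y = 0"
proof -
  have "(0, B s t) \<in> vspace c (F y, Amat \<sigma> y)" unfolding vspace_eq[OF y \<sigma>] B_def by blast
  then show "B s t *v F y = 0" "B s t *v v \<in> TQ c (F y)" "Amat \<sigma> y ** B s t + B s t ** Amat \<sigma> y = 0"
    unfolding vspace_def by auto
qed

text \<open>The factor 1/4 in \<open>g1\<close> makes s and t orthonormal coordinates of the
  vertical space.\<close>

lemma g1_vertical:
  assumes y: "y \<in> V" and \<sigma>: "\<sigma>\<^sup>2 = 1"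
  shows "g1 c (F y, A) (0, fmat y ** bmat \<sigma> s t ** comat y) (0, fmat y ** bmat \<sigma> s' t' ** comat y) = s * s' + t * t'"
proof -
  note ss = sign_cancel(1)[OF \<sigma>] and \<sigma>s = sign_cancel(2)[OF \<sigma>]
  let ?B = "fmat y ** bmat \<sigma> s t ** comat y" and ?B' = "fmat y ** bmat \<sigma> s' t' ** comat y"
  note v = vspace_vertical[OF y \<sigma>]
  have "vert c (F y) ?B = ?B" "vert c (F y) ?B' = ?B'"
    by (rule vert_vertical[OF v(1,2)])+
  moreover have "trace (?B ** ?B') = trace (bmat \<sigma> s t ** bmat \<sigma> s' t')"
  proof -
    have "trace (?B ** ?B') = trace (fmat y ** (bmat \<sigma> s t ** bmat \<sigma> s' t' ** comat y))"
      by (simp add: matrix_mul_assoc[symmetric] fmat_comat_cancel[OF y])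
    also have "\<dots> = trace (bmat \<sigma> s t ** bmat \<sigma> s' t')"
      using trace_mul_sym[of "fmat y"] comat_fmat[OF y] by (simp add: matrix_mul_assoc[symmetric])
    finally show ?thesis .
  qed
  moreover have "trace (bmat \<sigma> s t ** bmat \<sigma> s' t') = - 4 * (s * s' + t * t')"
    unfolding trace_def matrix_matrix_mult_def by (simp add: sum_5 bmat_def algebra_simps \<sigma>s)
  ultimately show ?thesis unfolding g1_def by (simp add: amb_simps field_simps)
qed

text \<open>The Levi-Civita connection is the tangent part of the flat derivative: with g(p,q) = (dF
  p, dF q), the symmetry of second derivatives collapses Koszul's formula to one term.\<close>

lemma christoffel_eq:
  assumes y: "y \<in> V"
  shows "christoffel g y u v = amb c (dd (\<lambda>z. dd F z v) y u) (E1 y) *\<^sub>R e1 y + amb c (dd (\<lambda>z. dd F z v) y u) (E2 y) *\<^sub>R e2 y"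
proof (rule christoffelI[OF ip[OF y]])
  fix w
  note d = smooth_on_differentiable[OF smooth_on_dd[OF smooth_F] y]
  have dg: "dd (\<lambda>z. g z p q) y w = amb c (dd F y p) (dd (\<lambda>z. dd F z q) y w) + amb c (dd (\<lambda>z. dd F z p) y w) (dd F y q)" for p q w
  proof -
    have "dd (\<lambda>z. g z p q) y w = dd (\<lambda>z. amb c (dd F z p) (dd F z q)) y w"
      by (rule arg_cong[OF dd_cong_open[OF open_V y], where f = "\<lambda>h. h w"]) (simp add: isometric)
    then show ?thesis by (simp add: dd_bilinear[OF bounded_bilinear_amb] d)
  qed
  let ?D = "\<lambda>u v. dd (\<lambda>z. dd F z v) y u"
  have sym: "?D u v = ?D v u" for u v by (rule smooth_on_dd_symmetric[OF open_V y smooth_F])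
  have "(dd (\<lambda>z. g z v w) y u + dd (\<lambda>z. g z u w) y v - dd (\<lambda>z. g z u v) y w) / 2 = amb c (?D u v) (dd F y w)"
    unfolding dg sym[of w] sym[of v u] using amb_sym[of c "dd F y u"] amb_sym[of c "dd F y v"] by simp
  also have "dd F y w = g y w (e1 y) *\<^sub>R E1 y + g y w (e2 y) *\<^sub>R E2 y"
    by (subst oframe_expand[OF ip[OF y] oframe[OF y], of w])
      (simp add: E1_def E2_def dd_add dd_scaleR F_differentiable[OF y])
  finally show "g y (amb c (?D u v) (E1 y) *\<^sub>R e1 y + amb c (?D u v) (E2 y) *\<^sub>R e2 y) w
    = (dd (\<lambda>z. g z v w) y u + dd (\<lambda>z. g z u w) y v - dd (\<lambda>z. g z u v) y w) / 2"
    using inner_product_at_sym[OF ip[OF y], of w] by (simp add: inner_product_at_simps[OF ip[OF y]] amb_simps)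
qed

lemma christoffel_bilinear:
  assumes y: "y \<in> V"
  shows "bilinear (christoffel g y)"
proof -
  note B = second_dd_bilinear[OF open_V y smooth_F]
  show ?thesis
    unfolding bilinear_def christoffel_eq[OF y]
    by (auto intro!: linearI simp: bilinear_ladd[OF B] bilinear_radd[OF B] bilinear_lmul[OF B]
        bilinear_rmul[OF B] amb_simps algebra_simps)
qed

text \<open>\<open>christoffel\<close> differentiates constant fields, so the derivative of the
  moving components is added to obtain \<nabla>.\<close>

lemma covariant_frame:
  assumes y: "y \<in> V"
  shows "dd e1 y (e1 y) + christoffel g y (e1 y) (e1 y) = k1 y *\<^sub>R e2 y"
    "dd e2 y (e2 y) + christoffel g y (e2 y) (e2 y) = - k2 y *\<^sub>R e1 y"
proof -
  have dE: "dd E1 y u = dd (\<lambda>z. dd F z (e1 y)) y u + dd F y (dd e1 y u)"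
    "dd E2 y u = dd (\<lambda>z. dd F z (e2 y)) y u + dd F y (dd e2 y u)" for u
    unfolding E1_def E2_def
    using dd_form[OF open_V y smooth_form_dd[OF smooth_F] smooth_on_differentiable[OF smooth_e(1) y], of u]
      dd_form[OF open_V y smooth_form_dd[OF smooth_F] smooth_on_differentiable[OF smooth_e(2) y], of u] by auto
  have g: "g y w (e1 y) = amb c (dd F y w) (E1 y)" "g y w (e2 y) = amb c (dd F y w) (E2 y)" for w
    unfolding isometric[OF y, symmetric] E1_def E2_def by simp_all
  have ge: "g y (e1 y) (e1 y) = 1" "g y (e1 y) (e2 y) = 0" "g y (e2 y) (e1 y) = 0" "g y (e2 y) (e2 y) = 1"
    unfolding g by (simp_all add: dF_frame[OF y])
  note s = inner_product_at_simps[OF ip[OF y]]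
  have 1: "g y (dd e1 y (e1 y) + christoffel g y (e1 y) (e1 y)) (e1 y) = 0"
    "g y (dd e1 y (e1 y) + christoffel g y (e1 y) (e1 y)) (e2 y) = k1 y"
    using amb_dE1[OF y, of "e1 y"] unfolding christoffel_eq[OF y] s ge k1_def dE by (simp_all add: g amb_simps)
  have 2: "g y (dd e2 y (e2 y) + christoffel g y (e2 y) (e2 y)) (e1 y) = - k2 y"
    "g y (dd e2 y (e2 y) + christoffel g y (e2 y) (e2 y)) (e2 y) = 0"
    using amb_dE2[OF y, of "e2 y"] amb_dE2_E1[OF y, of "e2 y"] unfolding christoffel_eq[OF y] s ge k2_def dE
    by (simp_all add: g amb_simps)
  show "dd e1 y (e1 y) + christoffel g y (e1 y) (e1 y) = k1 y *\<^sub>R e2 y"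
    by (rule trans[OF oframe_expand[OF ip[OF y] oframe[OF y]]]) (simp only: 1, simp)
  show "dd e2 y (e2 y) + christoffel g y (e2 y) (e2 y) = - k2 y *\<^sub>R e1 y"
    by (rule trans[OF oframe_expand[OF ip[OF y] oframe[OF y]]]) (simp only: 2, simp)
qed

text \<open>The derivatives of the metric contribute nothing: along the fibre \<open>g1\<close> is
  constant, and the other two Koszul corrections cancel each other. What remains is the Laplacian of
  A, paired with B by the trace.\<close>

lemma tension_pairing_eq:
  assumes y: "y \<in> V" and \<sigma>: "\<sigma>\<^sup>2 = 1"
  shows "tension_pairing g (g1 c) (gauss_lift c g \<sigma> F) y (0, fmat y ** bmat \<sigma> s t ** comat y)
    = 2 * \<sigma> * (Z4 \<sigma> y * s - Z3 \<sigma> y * t)"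
proof -
  define B where "B = fmat y ** bmat \<sigma> s t ** comat y"
  define A where "A = Amat \<sigma>"
  define G where "G = gauss_lift c g \<sigma> F"
  note B = vspace_vertical[OF y \<sigma>, of s t, folded B_def A_def]
  have A: "smooth_on V A" unfolding A_def by (rule smooth_Amat)
  note dA = smooth_on_differentiable[OF A]
  note dF = F_differentiable[OF y]
  have G: "G z = (F z, A z)" if "z \<in> V" for z unfolding G_def A_def by (rule gauss_lift_eq[OF that])
  have dG: "dd G z u = (dd F z u, dd A z u)" if z: "z \<in> V" for z u
  proof -
    have "dd G z = dd (\<lambda>z. (F z, A z)) z" by (rule dd_cong_open[OF open_V z]) (rule G)
    then show ?thesis
      using ddI[OF has_derivative_Pair[OF dd_has_derivative dd_has_derivative, OF F_differentiable[OF z] dA[OF z]]]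
      by simp
  qed
  have ddG: "dd (\<lambda>z. dd G z v) y u = (dd (\<lambda>z. dd F z v) y u, dd (\<lambda>z. dd A z v) y u)" for u v
  proof -
    have "dd (\<lambda>z. dd G z v) y = dd (\<lambda>z. (dd F z v, dd A z v)) y" by (rule dd_cong_open[OF open_V y]) (rule dG)
    then show ?thesis
      using ddI[OF has_derivative_Pair[OF dd_has_derivative dd_has_derivative,
            OF smooth_on_differentiable[OF smooth_on_dd[OF smooth_F] y] smooth_on_differentiable[OF smooth_on_dd[OF A] y]]]
      by simp
  qed
  \<comment> \<open>Differentiating A F = 0, and below \<open>ell c (F z) (A z *v w) = 0\<close>,
    trades the derivative of A in the metric corrections for A itself.\<close>
  have AF: "dd A y v *v F y = - (A y *v dd F y v)" for v
  proof -
    have "dd (\<lambda>z. A z *v F z) y v = dd (\<lambda>_. 0::real^5) y v"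
      by (rule arg_cong[OF dd_cong_open[OF open_V y], where f = "\<lambda>h. h v"]) (simp add: A_def Amat_frame)
    then have "A y *v dd F y v + dd A y v *v F y = 0"
      by (simp add: dd_bilinear[OF bounded_bilinear_matrix_vector dA[OF y] dF])
    then show ?thesis by (simp add: eq_neg_iff_add_eq_0 add.commute)
  qed
  have lA: "ell c (F y) (dd A y v *v w) = - ell c (dd F y v) (A y *v w)" for v w
  proof -
    note dw = differentiable_bilinear[OF bounded_bilinear_matrix_vector dA[OF y] differentiable_const[of w]]
    have "dd (\<lambda>z. ell c (F z) (A z *v w)) y v = dd (\<lambda>_. 0::real) y v"
      by (rule arg_cong[OF dd_cong_open[OF open_V y], where f = "\<lambda>h. h v"])
        (use Amat_TQ in \<open>auto simp: A_def TQ_def\<close>)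
    then have "ell c (F y) (dd A y v *v w) + ell c (dd F y v) (A y *v w) = 0"
      by (simp add: dd_bilinear[OF bounded_bilinear_ell dF dw] matrix_vector_simps
          dd_bilinear[OF bounded_bilinear_matrix_vector dA[OF y] differentiable_const])
    then show ?thesis by linarith
  qed
  have base: "dd (\<lambda>z. g1 c z (dd G y v) (0, B)) (G y) (dd G y u)
      = - (ell c (dd F y u) (B *v (A y *v dd F y v)) + ell c (dd F y v) (A y *v (B *v dd F y u))) / 4" for u v
    unfolding G[OF y] dd_g1_base dG[OF y]
    by (simp add: dd_trace_vert[OF F_unit[OF y] B(1,2)] AF lA matrix_vector_simps ell_simps)
  have AB: "A y *v (B *v w) + B *v (A y *v w) = 0" for w
    using arg_cong[OF B(3), of "\<lambda>M. M *v w"] by (simp add: matrix_vector_simps matrix_vector_mul_assoc)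
  \<comment> \<open>The four terms pair off into values of A B + B A, which vanishes for a vertical
    B.\<close>
  have cancel: "dd (\<lambda>z. g1 c z (dd G y v) (0, B)) (G y) (dd G y u)
      + dd (\<lambda>z. g1 c z (dd G y u) (0, B)) (G y) (dd G y v) = 0" for u v
  proof -
    have l: "ell c p (A y *v (B *v q)) + ell c p (B *v (A y *v q)) = 0" for p q
      using arg_cong[OF AB, of "ell c p"] by (simp add: ell_simps)
    have "- (q + r) / 4 + - (s + p) / 4 = 0" if "p + q = 0" "r + s = 0" for p q r s :: real
      using that by (simp add: field_simps)
    from this[OF l l] show ?thesis unfolding base .
  qed
  have vertd: "dd (\<lambda>z. g1 c z X Y) (G y) (0, B) = 0" for X Y
  proof -
    have "(\<lambda>R. trace (vert c R (snd X) ** vert c R (snd Y))) differentiable (at (F y))"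
      by (rule differentiable_bounded_linear[OF bounded_linear_trace
            differentiable_bilinear[OF bounded_bilinear_matrix_mult differentiable_vert differentiable_vert]])
    then show ?thesis unfolding G[OF y] dd_g1_base by (simp add: dd_zero)
  qed
  have vB: "vert c (F y) B = B" "matrix (tproj c (F y)) ** B = B" "B ** matrix (tproj c (F y)) = B"
    by (rule vert_vertical[OF B(1,2)])+
  have hG: "g1 c (G y) X (0, B) = - trace (snd X ** B) / 4" for X
  proof -
    let ?Q = "matrix (tproj c (F y))"
    have "trace (vert c (F y) (snd X) ** vert c (F y) B) = trace (?Q ** (snd X ** B))"
      unfolding vB(1) unfolding vert_def by (simp add: matrix_mul_assoc[symmetric] vB)
    also have "\<dots> = trace (snd X ** B)" using trace_mul_sym[of ?Q "snd X ** B"] vB by (simp add: matrix_mul_assoc[symmetric])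
    finally show ?thesis unfolding g1_def G[OF y] by (simp add: amb_simps)
  qed
  define T where "T u v = - trace ((dd (\<lambda>z. dd A z v) y u - dd A y (christoffel g y u v)) ** B) / 4" for u v
  have tp: "tension_pairing g (g1 c) G y (0, B) = mtrace g y T"
  proof -
    have "(let X = dd G y u; Y = dd G y v in
       g1 c (G y) (dd (\<lambda>y. dd G y v) y u - dd G y (christoffel g y u v)) (0, B)
       + (dd (\<lambda>z. g1 c z Y (0, B)) (G y) X + dd (\<lambda>z. g1 c z X (0, B)) (G y) Y
          - dd (\<lambda>z. g1 c z X Y) (G y) (0, B)) / 2) = T u v" for u v
      unfolding Let_def vertd cancel unfolding hG ddG dG[OF y] T_def by simp
    then show ?thesis unfolding tension_pairing_def by simp
  qed
  have bT: "bilinear T"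
  proof -
    note D = second_dd_bilinear[OF open_V y A] and C = christoffel_bilinear[OF y]
    show ?thesis
      unfolding bilinear_def T_def
      by (auto intro!: linearI simp: bilinear_ladd[OF D] bilinear_radd[OF D] bilinear_lmul[OF D]
          bilinear_rmul[OF D] bilinear_ladd[OF C] bilinear_radd[OF C] bilinear_lmul[OF C]
          bilinear_rmul[OF C] dd_add[OF dA[OF y]] dd_scaleR[OF dA[OF y]] matrix_mult_simps
          trace_add trace_sub linear_scale[OF bounded_linear.linear[OF bounded_linear_trace]] field_simps)
  qed
  \<comment> \<open>The constant extensions of the frame vectors are replaced by the moving ones;
    the difference is what \<open>covariant_frame\<close> computes.\<close>
  have along: "dd (\<lambda>z. dd A z (e1 y)) y (e1 y) - dd A y (christoffel g y (e1 y) (e1 y))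
      = dd (\<lambda>z. dd A z (e1 z)) y (e1 y) - k1 y *\<^sub>R dd A y (e2 y)"
    "dd (\<lambda>z. dd A z (e2 y)) y (e2 y) - dd A y (christoffel g y (e2 y) (e2 y))
      = dd (\<lambda>z. dd A z (e2 z)) y (e2 y) + k2 y *\<^sub>R dd A y (e1 y)"
    using dd_form[OF open_V y smooth_form_dd[OF A] smooth_on_differentiable[OF smooth_e(1) y], of "e1 y"]
      dd_form[OF open_V y smooth_form_dd[OF A] smooth_on_differentiable[OF smooth_e(2) y], of "e2 y"]
      arg_cong[OF covariant_frame(1)[OF y], of "dd A y"] arg_cong[OF covariant_frame(2)[OF y], of "dd A y"]
    by (simp_all add: dd_add[OF dA[OF y]] dd_scaleR[OF dA[OF y]] dd_minus[OF dA[OF y]] algebra_simps eq_neg_iff_add_eq_0)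
  have "mtrace g y T = T (e1 y) (e1 y) + T (e2 y) (e2 y)"
    by (rule mtrace_oframe[OF ip[OF y] oframe[OF y] bT])
  also have "\<dots> = - trace ((dd (\<lambda>z. dd A z (e1 z)) y (e1 y) + dd (\<lambda>z. dd A z (e2 z)) y (e2 y)
      - k1 y *\<^sub>R dd A y (e2 y) + k2 y *\<^sub>R dd A y (e1 y)) ** B) / 4"
    unfolding T_def along
    by (simp add: matrix_mult_simps trace_add trace_sub add_divide_distrib diff_divide_distrib)
  also have "\<dots> = - trace (fmat y ** (Msum \<sigma> y ** bmat \<sigma> s t ** comat y)) / 4"
    unfolding A_def rough_laplacian_Amat[OF y] B_def
    by (simp add: matrix_mul_assoc[symmetric] fmat_comat_cancel[OF y])
  also have "\<dots> = - trace (Msum \<sigma> y ** bmat \<sigma> s t) / 4"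
    using trace_mul_sym[of "fmat y"] comat_fmat[OF y] by (simp add: matrix_mul_assoc[symmetric])
  finally show ?thesis
    unfolding tp[unfolded G_def B_def] trace_Msum_bmat[OF y \<sigma>] by simp
qed

text \<open>In the orthonormal coordinates s, t a vertical vector is read off from its pairings with
  (1,0) and (0,1).\<close>

lemma vtension_eq:
  assumes y: "y \<in> V" and \<sigma>: "\<sigma>\<^sup>2 = 1"
  shows "vtension c g \<sigma> F y
    = (0, fmat y ** bmat \<sigma> (2 * \<sigma> * Z4 \<sigma> y) (- 2 * \<sigma> * Z3 \<sigma> y) ** comat y)"
  unfolding vtension_def Let_def gauss_lift_eq[OF y] vspace_eq[OF y \<sigma>]
proof (rule the_equality)
  let ?B = "\<lambda>s t. (0, fmat y ** bmat \<sigma> s t ** comat y) :: tw"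
  let ?V = "?B (2 * \<sigma> * Z4 \<sigma> y) (- 2 * \<sigma> * Z3 \<sigma> y)"
  show "?V \<in> {?B s t | s t. True} \<and> (\<forall>W\<in>{?B s t | s t. True}.
      g1 c (F y, Amat \<sigma> y) ?V W = tension_pairing g (g1 c) (gauss_lift c g \<sigma> F) y W)"
    by (auto simp: g1_vertical[OF y \<sigma>] tension_pairing_eq[OF y \<sigma>] algebra_simps)
  fix U
  assume U: "U \<in> {?B s t | s t. True} \<and> (\<forall>W\<in>{?B s t | s t. True}.
      g1 c (F y, Amat \<sigma> y) U W = tension_pairing g (g1 c) (gauss_lift c g \<sigma> F) y W)"
  then obtain p q where pq: "U = ?B p q" by blast
  have "g1 c (F y, Amat \<sigma> y) (?B p q) (?B s t) = tension_pairing g (g1 c) (gauss_lift c g \<sigma> F) y (?B s t)" for s t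
    using U unfolding pq by blast
  then have "p * s + q * t = 2 * \<sigma> * (Z4 \<sigma> y * s - Z3 \<sigma> y * t)" for s t
    unfolding g1_vertical[OF y \<sigma>] tension_pairing_eq[OF y \<sigma>] .
  from this[of 1 0] this[of 0 1] have "p = 2 * \<sigma> * Z4 \<sigma> y" "q = - 2 * \<sigma> * Z3 \<sigma> y" by simp_all
  then show "U = ?V" unfolding pq by simp
qed

lemma vtension_sq_eq:
  assumes y: "y \<in> V" and \<sigma>: "\<sigma>\<^sup>2 = 1"
  shows "vtension_sq c g \<sigma> F y = 4 * ((Z3 \<sigma> y)\<^sup>2 + (Z4 \<sigma> y)\<^sup>2)"
  unfolding vtension_sq_def Let_def vtension_eq[OF y \<sigma>] gauss_lift_eq[OF y] g1_vertical[OF y \<sigma>]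
  using \<sigma> by algebra

lemma vtension_nonzero:
  assumes y: "y \<in> V" and \<sigma>: "\<sigma>\<^sup>2 = 1" and "vtension c g \<sigma> F y \<noteq> 0"
  shows "(Z3 \<sigma> y)\<^sup>2 + (Z4 \<sigma> y)\<^sup>2 \<noteq> 0"
proof
  assume "(Z3 \<sigma> y)\<^sup>2 + (Z4 \<sigma> y)\<^sup>2 = 0"
  then have "Z3 \<sigma> y = 0" "Z4 \<sigma> y = 0" by (simp_all add: sum_power2_eq_zero_iff)
  moreover have "bmat \<sigma> 0 0 = 0" unfolding mat5_eq_iff forall_5 by (simp add: bmat_def)
  ultimately show False using assms(3) unfolding vtension_eq[OF y \<sigma>] by (simp add: matrix_mult_simps zero_prod_def)
qed

section \<open>The coframe of the new metric\<close>

definition "nB \<sigma> = (\<lambda>y. (B3 \<sigma> y)\<^sup>2 + (B4 \<sigma> y)\<^sup>2)"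
text \<open>With \<open>N3\<close>, \<open>N4\<close> read as 1 and i, \<open>pf + i qf\<close> is
  the complex quotient 2 Z / B.\<close>

definition "pf \<sigma> = (\<lambda>y. 2 * (Z3 \<sigma> y * B3 \<sigma> y + Z4 \<sigma> y * B4 \<sigma> y) / nB \<sigma> y)"
definition "qf \<sigma> = (\<lambda>y. 2 * (Z4 \<sigma> y * B3 \<sigma> y - Z3 \<sigma> y * B4 \<sigma> y) / nB \<sigma> y)"

text \<open>In isothermal coordinates, with \<open>\<nabla>\<^sub>z\<^sub>\<bar> \<Phi>\<^sup>\<plusminus> = h \<Phi>\<^sup>\<plusminus>\<close>, these are up to sign the real and
  imaginary part of the form \<open>2 h\<^sub>\<bar> dz\<close>.\<close>
definition "w1 \<sigma> = (\<lambda>y u. pf \<sigma> y * g y u (e1 y) - \<sigma> * qf \<sigma> y * g y u (e2 y))"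
definition "w2 \<sigma> = (\<lambda>y u. - qf \<sigma> y * g y u (e1 y) - \<sigma> * pf \<sigma> y * g y u (e2 y))"

lemma smooth_nB: "smooth_on V (nB \<sigma>)"
  unfolding nB_def power2_eq_square by (intro smooth_on_add smooth_on_mult open_V smooth_HBZ)

lemma open_nonzero: "open {y \<in> V. nB \<sigma> y \<noteq> 0}"
proof -
  have "{y \<in> V. nB \<sigma> y \<noteq> 0} = nB \<sigma> -` (- {0}) \<inter> V" by auto
  then show ?thesis
    using continuous_open_preimage[OF smooth_on_continuous[OF smooth_nB] open_V, of "- {0}" \<sigma>]
    by (simp add: Int_commute open_Compl)
qed

lemma coframe_linear: "y \<in> V \<Longrightarrow> linear (\<lambda>u. g y u w)"
  using ip unfolding inner_product_at_def bilinear_def by blast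

lemma smooth_coframe:
  assumes "smooth_on V e"
  shows "smooth_form V (\<lambda>y u. g y u (e y))"
  unfolding smooth_form_def
proof (intro conjI ballI allI)
  show "linear (\<lambda>u. g y u (e y))" if "y \<in> V" for y by (rule coframe_linear[OF that])
  show "smooth_on V (\<lambda>y. g y u (e y))" for u
    by (rule smooth_on_cong[OF open_V _ smooth_amb[OF smooth_on_dd[OF smooth_F, of u] smooth_dF[OF assms]]])
      (rule isometric)
qed

lemma smooth_forms_w:
  assumes W: "W \<subseteq> {y \<in> V. nB \<sigma> y \<noteq> 0}" "open W"
  shows "smooth_form W (w1 \<sigma>)" "smooth_form W (w2 \<sigma>)" "smooth_on W (pf \<sigma>)" "smooth_on W (qf \<sigma>)"
proof -
  have WV: "W \<subseteq> V" using W by blast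
  note sub = smooth_on_subset[OF _ WV]
  have s: "smooth_on W (B3 \<sigma>)" "smooth_on W (B4 \<sigma>)" "smooth_on W (Z3 \<sigma>)" "smooth_on W (Z4 \<sigma>)" "smooth_on W (nB \<sigma>)"
    using sub smooth_HBZ smooth_nB by blast+
  show pq: "smooth_on W (pf \<sigma>)" "smooth_on W (qf \<sigma>)"
    unfolding pf_def qf_def
    by (intro smooth_on_divide smooth_on_mult smooth_on_add smooth_on_diff smooth_on_const W s, use W in blast)+
  have ge: "smooth_on W (\<lambda>y. g y u (e1 y))" "smooth_on W (\<lambda>y. g y u (e2 y))" for u
    using sub smooth_form_smooth[OF smooth_coframe[OF smooth_e(1)]] smooth_form_smooth[OF smooth_coframe[OF smooth_e(2)]]
    by blast+
  have "linear (w1 \<sigma> y)" "linear (w2 \<sigma> y)" if "y \<in> W" for y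
    unfolding w1_def w2_def using that WV
    by (auto intro!: linearI simp: inner_product_at_simps[OF ip] algebra_simps)
  moreover have "smooth_on W (\<lambda>y. w1 \<sigma> y u)" "smooth_on W (\<lambda>y. w2 \<sigma> y u)" for u
    unfolding w1_def w2_def
    by (intro smooth_on_diff smooth_on_mult smooth_on_uminus smooth_on_const W(2) pq ge)+
  ultimately show "smooth_form W (w1 \<sigma>)" "smooth_form W (w2 \<sigma>)"
    unfolding smooth_form_def by blast+
qed

text \<open>The forms arise from the dual coframe by a similarity of ratio |2 Z / B|. The square of
  this ratio is the conformal factor, as \<open>vtension_sq\<close> is 4 |Z|^2 and four times the
  square of \<open>calH_norm\<close> is |B|^2.\<close>

lemma hat_metric_eq:
  assumes y: "y \<in> V" and \<sigma>: "\<sigma>\<^sup>2 = 1" and nz: "nB \<sigma> y \<noteq> 0"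
  shows "vtension_sq c g \<sigma> F y / (4 * (calH_norm c g \<sigma> F y)\<^sup>2) * g y u v = w1 \<sigma> y u * w1 \<sigma> y v + w2 \<sigma> y u * w2 \<sigma> y v"
proof -
  have ge: "g y u v = g y u (e1 y) * g y v (e1 y) + g y u (e2 y) * g y v (e2 y)"
    using arg_cong[OF oframe_expand[OF ip[OF y] oframe[OF y], of v], of "g y u"]
    by (simp add: inner_product_at_simps[OF ip[OF y]] mult.commute)
  have pq: "pf \<sigma> y * pf \<sigma> y + qf \<sigma> y * qf \<sigma> y = 4 * ((Z3 \<sigma> y)\<^sup>2 + (Z4 \<sigma> y)\<^sup>2) / nB \<sigma> y"
  proof -
    have "(2 * (Z3 \<sigma> y * B3 \<sigma> y + Z4 \<sigma> y * B4 \<sigma> y)) * (2 * (Z3 \<sigma> y * B3 \<sigma> y + Z4 \<sigma> y * B4 \<sigma> y))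
      + (2 * (Z4 \<sigma> y * B3 \<sigma> y - Z3 \<sigma> y * B4 \<sigma> y)) * (2 * (Z4 \<sigma> y * B3 \<sigma> y - Z3 \<sigma> y * B4 \<sigma> y))
      = 4 * ((Z3 \<sigma> y)\<^sup>2 + (Z4 \<sigma> y)\<^sup>2) * nB \<sigma> y"
      unfolding nB_def by algebra
    moreover have "pf \<sigma> y * pf \<sigma> y + qf \<sigma> y * qf \<sigma> y
      = ((2 * (Z3 \<sigma> y * B3 \<sigma> y + Z4 \<sigma> y * B4 \<sigma> y)) * (2 * (Z3 \<sigma> y * B3 \<sigma> y + Z4 \<sigma> y * B4 \<sigma> y))
        + (2 * (Z4 \<sigma> y * B3 \<sigma> y - Z3 \<sigma> y * B4 \<sigma> y)) * (2 * (Z4 \<sigma> y * B3 \<sigma> y - Z3 \<sigma> y * B4 \<sigma> y)))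
        / (nB \<sigma> y * nB \<sigma> y)"
      unfolding pf_def qf_def add_divide_distrib times_divide_times_eq ..
    ultimately show ?thesis using nz by simp
  qed
  have "0 \<le> nB \<sigma> y" unfolding nB_def by simp
  then have cal: "4 * (calH_norm c g \<sigma> F y)\<^sup>2 = nB \<sigma> y"
    unfolding calH_norm_eq[OF y \<sigma>] nB_def by (simp add: field_simps)
  have "w1 \<sigma> y u * w1 \<sigma> y v + w2 \<sigma> y u * w2 \<sigma> y v = (pf \<sigma> y * pf \<sigma> y + qf \<sigma> y * qf \<sigma> y) * g y u v"
    unfolding ge w1_def w2_def using \<sigma> by algebra
  then show ?thesis unfolding cal vtension_sq_eq[OF y \<sigma>] pq by simp
qed

lemma calH_norm_zero_iff: "y \<in> V \<Longrightarrow> \<sigma>\<^sup>2 = 1 \<Longrightarrow> calH_norm c g \<sigma> F y = 0 \<longleftrightarrow> nB \<sigma> y = 0"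
  unfolding nB_def by (simp add: calH_norm_eq)

text \<open>The invariant formula for the exterior derivative: passing from constant to frame fields
  costs the value of the form on the bracket of \<open>e1\<close> and \<open>e2\<close>.\<close>

lemma form_along_frame:
  assumes W: "open W" "W \<subseteq> V" "y \<in> W" and a: "smooth_form W a"
  shows "dd (\<lambda>z. a z (e2 y)) y (e1 y) - dd (\<lambda>z. a z (e1 y)) y (e2 y)
    = dd (\<lambda>z. a z (e2 z)) y (e1 y) - dd (\<lambda>z. a z (e1 z)) y (e2 y) + k1 y * a y (e1 y) + k2 y * a y (e2 y)"
proof -
  have y: "y \<in> V" using W by blast
  note l = smooth_form_linear[OF a W(3)]
  have "a y (dd e2 y (e1 y)) - a y (dd e1 y (e2 y)) = - k1 y * a y (e1 y) - k2 y * a y (e2 y)"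
    unfolding linear_diff[OF l, symmetric] bracket_e[OF y]
    by (simp add: linear_diff[OF l] linear_scale[OF l] linear_neg[OF l])
  then show ?thesis
    using dd_form[OF W(1,3) a smooth_on_differentiable[OF smooth_e(1) y], of "e2 y"]
      dd_form[OF W(1,3) a smooth_on_differentiable[OF smooth_e(2) y], of "e1 y"] by simp
qed

lemma w_frame:
  assumes y: "y \<in> V"
  shows "w1 \<sigma> y (e1 y) = pf \<sigma> y" "w1 \<sigma> y (e2 y) = - \<sigma> * qf \<sigma> y"
    "w2 \<sigma> y (e1 y) = - qf \<sigma> y" "w2 \<sigma> y (e2 y) = - \<sigma> * pf \<sigma> y"
  using oframe[OF y] inner_product_at_sym[OF ip[OF y], of "e2 y" "e1 y"] unfolding oframe_def w1_def w2_def by simp_all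

text \<open>At a zero of \<open>B\<close> the quotient \<open>(P, Q)\<close> of \<open>B\<close> by \<open>Z\<close> vanishes, and the structure equations
  multiplied by \<open>P\<^sup>2 + Q\<^sup>2\<close> extend to it.  Their leading terms along \<open>e1\<close> and \<open>e2\<close> and the Codazzi
  equation are incompatible.\<close>
lemma B_nonzero:
  assumes \<sigma>: "\<sigma>\<^sup>2 = 1" and Z: "\<And>y. y \<in> V \<Longrightarrow> (Z3 \<sigma> y)\<^sup>2 + (Z4 \<sigma> y)\<^sup>2 \<noteq> 0"
    and dw1: "\<And>y u v. y \<in> V \<Longrightarrow> nB \<sigma> y \<noteq> 0 \<Longrightarrow> dd (\<lambda>z. w1 \<sigma> z v) y u - dd (\<lambda>z. w1 \<sigma> z u) y v = 0"
    and dw2: "\<And>y u v. y \<in> V \<Longrightarrow> nB \<sigma> y \<noteq> 0 \<Longrightarrow> dd (\<lambda>z. w2 \<sigma> z v) y u - dd (\<lambda>z. w2 \<sigma> z u) y v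
      = w1 \<sigma> y u * w2 \<sigma> y v - w1 \<sigma> y v * w2 \<sigma> y u"
    and x: "x \<in> V"
  shows "nB \<sigma> x \<noteq> 0"
proof
  assume zero: "nB \<sigma> x = 0"
  then have Bx: "B3 \<sigma> x = 0" "B4 \<sigma> x = 0" unfolding nB_def by (simp_all add: sum_power2_eq_zero_iff)
  note ss = sign_cancel(1)[OF \<sigma>] and \<sigma>s = sign_cancel(2)[OF \<sigma>]
  define nZ where "nZ = (\<lambda>y. (Z3 \<sigma> y)\<^sup>2 + (Z4 \<sigma> y)\<^sup>2)"
  have nZ: "nZ y \<noteq> 0" if "y \<in> V" for y using Z[OF that] unfolding nZ_def .
  \<comment> \<open>P - iQ is the quotient B / Z, smooth also where B vanishes. With r its squared
    modulus, \<open>pf + i qf\<close> is 2 (P + iQ) / r.\<close>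
  define P where "P = (\<lambda>y. (Z3 \<sigma> y * B3 \<sigma> y + Z4 \<sigma> y * B4 \<sigma> y) / nZ y)"
  define Q where "Q = (\<lambda>y. (Z4 \<sigma> y * B3 \<sigma> y - Z3 \<sigma> y * B4 \<sigma> y) / nZ y)"
  have smZ: "smooth_on V nZ" unfolding nZ_def power2_eq_square by (intro smooth_on_add smooth_on_mult open_V smooth_HBZ)
  have sPQ: "smooth_on V P" "smooth_on V Q"
    unfolding P_def Q_def
    by (intro smooth_on_divide smooth_on_add smooth_on_diff smooth_on_mult open_V smooth_HBZ smZ nZ | assumption)+
  have PQB: "((P y)\<^sup>2 + (Q y)\<^sup>2) * nZ y = nB \<sigma> y" if y: "y \<in> V" for y
  proof -
    have "(Z3 \<sigma> y * B3 \<sigma> y + Z4 \<sigma> y * B4 \<sigma> y)\<^sup>2 + (Z4 \<sigma> y * B3 \<sigma> y - Z3 \<sigma> y * B4 \<sigma> y)\<^sup>2 = nB \<sigma> y * nZ y"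
      unfolding nB_def nZ_def by algebra
    moreover have "(P y)\<^sup>2 + (Q y)\<^sup>2 = ((Z3 \<sigma> y * B3 \<sigma> y + Z4 \<sigma> y * B4 \<sigma> y)\<^sup>2
        + (Z4 \<sigma> y * B3 \<sigma> y - Z3 \<sigma> y * B4 \<sigma> y)\<^sup>2) / (nZ y)\<^sup>2"
      unfolding P_def Q_def by (simp only: power_divide add_divide_distrib[symmetric])
    ultimately show ?thesis using nZ[OF y] by (simp add: power2_eq_square)
  qed
  define r where "r = (\<lambda>y. (P y)\<^sup>2 + (Q y)\<^sup>2)"
  have r0: "r y = 0 \<longleftrightarrow> nB \<sigma> y = 0" if "y \<in> V" for y using PQB[OF that] nZ[OF that] unfolding r_def by auto
  have pr: "pf \<sigma> y * r y = 2 * P y" "qf \<sigma> y * r y = 2 * Q y" if y: "y \<in> V" and nz: "nB \<sigma> y \<noteq> 0" for y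
  proof -
    have "r y = nB \<sigma> y / nZ y" using PQB[OF y] nZ[OF y] unfolding r_def by (simp add: field_simps)
    then show "pf \<sigma> y * r y = 2 * P y" "qf \<sigma> y * r y = 2 * Q y"
      unfolding pf_def qf_def P_def Q_def using nz by simp_all
  qed
  \<comment> \<open>X - i\<sigma>Y is (e1 + i\<sigma> e2) applied to u = P - iQ.\<close>
  define X where "X = (\<lambda>y. dd P y (e1 y) + \<sigma> * dd Q y (e2 y))"
  define Y where "Y = (\<lambda>y. \<sigma> * dd Q y (e1 y) - dd P y (e2 y))"
  \<comment> \<open>In complex form: r (e1 + i\<sigma> e2) u = - 2 u^2 + r (k2 - i\<sigma> k1) u.
    Off the zeros these are the structure equations with denominators cleared; at a zero both sides
    are 0.\<close>
  have XY: "r y * X y = - 2 * ((P y)\<^sup>2 - (Q y)\<^sup>2) + r y * (k2 y * P y - \<sigma> * k1 y * Q y)"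
    "r y * Y y = - 4 * \<sigma> * P y * Q y + r y * (k1 y * P y + \<sigma> * k2 y * Q y)" if y: "y \<in> V" for y
  proof -
    have "r y * X y = - 2 * ((P y)\<^sup>2 - (Q y)\<^sup>2) + r y * (k2 y * P y - \<sigma> * k1 y * Q y) \<and>
      r y * Y y = - 4 * \<sigma> * P y * Q y + r y * (k1 y * P y + \<sigma> * k2 y * Q y)"
    proof (cases "nB \<sigma> y = 0")
      case True
      then have "P y = 0" "Q y = 0" using r0[OF y] unfolding r_def by (simp_all add: sum_power2_eq_zero_iff)
      then show ?thesis using True r0[OF y] by simp
    next
      case nz: False
      define W where "W = {y \<in> V. nB \<sigma> y \<noteq> 0}"
      have W: "open W" "W \<subseteq> V" "y \<in> W" "W \<subseteq> {y \<in> V. nB \<sigma> y \<noteq> 0}"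
        using open_nonzero y nz unfolding W_def by auto
      note sw = smooth_forms_w[OF W(4,1)]
      have dpq: "pf \<sigma> differentiable (at y)" "qf \<sigma> differentiable (at y)"
        using sw(3,4) smooth_on_differentiable W(3) by blast+
      have dPQ: "P differentiable (at y)" "Q differentiable (at y)"
        using sPQ smooth_on_differentiable y by blast+
      have dr: "r differentiable (at y)" "dd r y u = 2 * (P y * dd P y u + Q y * dd Q y u)" for u
        unfolding r_def power2_eq_square
        by (simp_all add: dd_plus dd_mult dPQ differentiable_bilinear[OF bounded_bilinear_mult] algebra_simps)
      have e: "pf \<sigma> y * dd r y u + dd (pf \<sigma>) y u * r y = 2 * dd P y u"
        "qf \<sigma> y * dd r y u + dd (qf \<sigma>) y u * r y = 2 * dd Q y u" for u
      proof -
        have "dd (\<lambda>z. pf \<sigma> z * r z) y u = dd (\<lambda>z. 2 * P z) y u" "dd (\<lambda>z. qf \<sigma> z * r z) y u = dd (\<lambda>z. 2 * Q z) y u"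
          by (rule arg_cong[OF dd_cong_open[OF W(1,3)], where f = "\<lambda>h. h u"], use pr W in blast)+
        then show "pf \<sigma> y * dd r y u + dd (pf \<sigma>) y u * r y = 2 * dd P y u"
          "qf \<sigma> y * dd r y u + dd (qf \<sigma>) y u * r y = 2 * dd Q y u"
          by (simp_all add: dd_mult dpq dr dPQ)
      qed
      \<comment> \<open>m - in is u^2, of modulus r. It appears because the derivative of 2/u is - 2
        u' / u^2.\<close>
      define m where "m = (P y)\<^sup>2 - (Q y)\<^sup>2"
      define n where "n = 2 * P y * Q y"
      have r: "r y \<noteq> 0" "m\<^sup>2 + n\<^sup>2 = (r y)\<^sup>2"
        using r0[OF y] nz by simp (unfold m_def n_def r_def, algebra)
      have dp: "dd (pf \<sigma>) y u * (r y)\<^sup>2 = - 2 * (m * dd P y u + n * dd Q y u)"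
        "dd (qf \<sigma>) y u * (r y)\<^sup>2 = 2 * (m * dd Q y u - n * dd P y u)" for u
      proof -
        have e': "dd (pf \<sigma>) y u * r y = 2 * dd P y u - pf \<sigma> y * dd r y u"
          "dd (qf \<sigma>) y u * r y = 2 * dd Q y u - qf \<sigma> y * dd r y u" using e[of u] by linarith+
        have "dd (pf \<sigma>) y u * (r y)\<^sup>2 = dd (pf \<sigma>) y u * r y * r y" by (simp add: power2_eq_square)
        also have "\<dots> = 2 * dd P y u * r y - pf \<sigma> y * r y * dd r y u" unfolding e' by (simp add: algebra_simps)
        also have "\<dots> = - 2 * (m * dd P y u + n * dd Q y u)"
          unfolding pr[OF y nz] dr(2) unfolding m_def n_def r_def by (simp add: algebra_simps power2_eq_square)
        finally show "dd (pf \<sigma>) y u * (r y)\<^sup>2 = - 2 * (m * dd P y u + n * dd Q y u)" .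
        have "dd (qf \<sigma>) y u * (r y)\<^sup>2 = dd (qf \<sigma>) y u * r y * r y" by (simp add: power2_eq_square)
        also have "\<dots> = 2 * dd Q y u * r y - qf \<sigma> y * r y * dd r y u" unfolding e' by (simp add: algebra_simps)
        also have "\<dots> = 2 * (m * dd Q y u - n * dd P y u)"
          unfolding pr[OF y nz] dr(2) unfolding m_def n_def r_def by (simp add: algebra_simps power2_eq_square)
        finally show "dd (qf \<sigma>) y u * (r y)\<^sup>2 = 2 * (m * dd Q y u - n * dd P y u)" .
      qed
      have along: "dd (\<lambda>z. w1 \<sigma> z (e1 z)) y = dd (pf \<sigma>) y" "dd (\<lambda>z. w1 \<sigma> z (e2 z)) y = dd (\<lambda>z. - \<sigma> * qf \<sigma> z) y"
        "dd (\<lambda>z. w2 \<sigma> z (e1 z)) y = dd (\<lambda>z. - qf \<sigma> z) y" "dd (\<lambda>z. w2 \<sigma> z (e2 z)) y = dd (\<lambda>z. - \<sigma> * pf \<sigma> z) y"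
        by (rule dd_cong_open[OF open_V y], simp add: w_frame)+
      have scal: "dd (\<lambda>z. - \<sigma> * qf \<sigma> z) y u = - \<sigma> * dd (qf \<sigma>) y u" "dd (\<lambda>z. - \<sigma> * pf \<sigma> z) y u = - \<sigma> * dd (pf \<sigma>) y u" for u
        using dd_bounded_linear[OF bounded_linear_mult_right dpq(2), of "- \<sigma>" u]
          dd_bounded_linear[OF bounded_linear_mult_right dpq(1), of "- \<sigma>" u] by simp_all
      have A: "- \<sigma> * dd (qf \<sigma>) y (e1 y) - dd (pf \<sigma>) y (e2 y) + k1 y * pf \<sigma> y - \<sigma> * k2 y * qf \<sigma> y = 0"
        using form_along_frame[OF W(1-3) sw(1)] dw1[OF y nz, of "e2 y" "e1 y"]
        unfolding along scal w_frame[OF y] by simp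
      have B: "- \<sigma> * dd (pf \<sigma>) y (e1 y) + dd (qf \<sigma>) y (e2 y) - k1 y * qf \<sigma> y - \<sigma> * k2 y * pf \<sigma> y
        = - \<sigma> * (pf \<sigma> y * pf \<sigma> y + qf \<sigma> y * qf \<sigma> y)"
        using form_along_frame[OF W(1-3) sw(2)] dw2[OF y nz, of "e2 y" "e1 y"]
        unfolding along scal dd_uminus[OF dpq(2)] w_frame[OF y] by (simp add: algebra_simps)
      have A2: "- m * Y y + \<sigma> * n * X y + r y * (k1 y * P y - \<sigma> * k2 y * Q y) = 0"
      proof -
        have "0 = (r y)\<^sup>2 * (- \<sigma> * dd (qf \<sigma>) y (e1 y) - dd (pf \<sigma>) y (e2 y) + k1 y * pf \<sigma> y - \<sigma> * k2 y * qf \<sigma> y)"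
          unfolding A by simp
        also have "\<dots> = - \<sigma> * (dd (qf \<sigma>) y (e1 y) * (r y)\<^sup>2) - dd (pf \<sigma>) y (e2 y) * (r y)\<^sup>2
            + k1 y * (pf \<sigma> y * r y) * r y - \<sigma> * k2 y * (qf \<sigma> y * r y) * r y"
          by (simp add: algebra_simps power2_eq_square)
        also have "\<dots> = 2 * (- m * Y y + \<sigma> * n * X y + r y * (k1 y * P y - \<sigma> * k2 y * Q y))"
          unfolding dp pr[OF y nz] X_def Y_def by (simp add: algebra_simps \<sigma>s)
        finally show ?thesis by simp
      qed
      have B2: "\<sigma> * m * X y + n * Y y + r y * (- k1 y * Q y - \<sigma> * k2 y * P y) = - 2 * \<sigma> * r y"
      proof -
        have "- 4 * \<sigma> * r y = - \<sigma> * (pf \<sigma> y * r y * (pf \<sigma> y * r y) + qf \<sigma> y * r y * (qf \<sigma> y * r y))"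
          unfolding pr[OF y nz] unfolding r_def by (simp add: algebra_simps power2_eq_square)
        also have "\<dots> = (r y)\<^sup>2 * (- \<sigma> * (pf \<sigma> y * pf \<sigma> y + qf \<sigma> y * qf \<sigma> y))"
          by (simp add: algebra_simps power2_eq_square)
        also have "\<dots> = - \<sigma> * (dd (pf \<sigma>) y (e1 y) * (r y)\<^sup>2) + dd (qf \<sigma>) y (e2 y) * (r y)\<^sup>2
            - k1 y * (qf \<sigma> y * r y) * r y - \<sigma> * k2 y * (pf \<sigma> y * r y) * r y"
          unfolding B[symmetric] by (simp add: algebra_simps power2_eq_square)
        also have "\<dots> = 2 * (\<sigma> * m * X y + n * Y y + r y * (- k1 y * Q y - \<sigma> * k2 y * P y))"
          unfolding dp pr[OF y nz] X_def Y_def by (simp add: algebra_simps \<sigma>s)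
        finally show ?thesis by simp
      qed
      \<comment> \<open>\<open>A2\<close> and \<open>B2\<close> are linear in X and Y with
        determinant m^2 + n^2 = r^2 up to sign. Solving them leaves one common factor r to
        cancel.\<close>
      have "(m\<^sup>2 + n\<^sup>2) * X y = r y * (- 2 * m + (\<sigma> * m * (k1 y * Q y + \<sigma> * k2 y * P y) - \<sigma> * n * (k1 y * P y - \<sigma> * k2 y * Q y)))"
        using arg_cong[OF B2, of "\<lambda>s. \<sigma> * m * s"] arg_cong[OF A2, of "\<lambda>s. \<sigma> * n * s"]
        by (simp add: algebra_simps power2_eq_square \<sigma>s)
      also have "\<sigma> * m * (k1 y * Q y + \<sigma> * k2 y * P y) - \<sigma> * n * (k1 y * P y - \<sigma> * k2 y * Q y)
          = r y * (k2 y * P y - \<sigma> * k1 y * Q y)"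
        unfolding m_def n_def r_def by (simp add: algebra_simps power2_eq_square \<sigma>s)
      finally have "r y * (r y * X y) = r y * (- 2 * m + r y * (k2 y * P y - \<sigma> * k1 y * Q y))"
        unfolding r(2) by (simp add: power2_eq_square)
      moreover have "(m\<^sup>2 + n\<^sup>2) * Y y = r y * (- 2 * \<sigma> * n + (n * (k1 y * Q y + \<sigma> * k2 y * P y) + m * (k1 y * P y - \<sigma> * k2 y * Q y)))"
        using arg_cong[OF B2, of "\<lambda>s. n * s"] arg_cong[OF A2, of "\<lambda>s. m * s"]
        by (simp add: algebra_simps power2_eq_square)
      then have "r y * (r y * Y y) = r y * (- 2 * \<sigma> * n + (n * (k1 y * Q y + \<sigma> * k2 y * P y) + m * (k1 y * P y - \<sigma> * k2 y * Q y)))"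
        unfolding r(2) by (simp add: power2_eq_square)
      moreover have "n * (k1 y * Q y + \<sigma> * k2 y * P y) + m * (k1 y * P y - \<sigma> * k2 y * Q y) = r y * (k1 y * P y + \<sigma> * k2 y * Q y)"
        unfolding m_def n_def r_def by (simp add: algebra_simps power2_eq_square)
      ultimately show ?thesis using r(1) unfolding m_def n_def by simp
    qed
    then show "r y * X y = - 2 * ((P y)\<^sup>2 - (Q y)\<^sup>2) + r y * (k2 y * P y - \<sigma> * k1 y * Q y)"
      "r y * Y y = - 4 * \<sigma> * P y * Q y + r y * (k1 y * P y + \<sigma> * k2 y * Q y)" by auto
  qed
  have dPQ: "P differentiable (at x)" "Q differentiable (at x)"
    using sPQ smooth_on_differentiable x by blast+
  have PQx: "P x = 0" "Q x = 0" unfolding P_def Q_def Bx by simp_all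
  \<comment> \<open>Divide \<open>XY\<close> by t^2 along x + t u and let t tend to 0. As P and Q
    vanish at x, P/t and Q/t tend to their derivatives, while the connection terms keep an undivided
    factor P or Q and disappear.\<close>
  have lim: "((dd P x u)\<^sup>2 + (dd Q x u)\<^sup>2) * X x = - 2 * ((dd P x u)\<^sup>2 - (dd Q x u)\<^sup>2)"
    "((dd P x u)\<^sup>2 + (dd Q x u)\<^sup>2) * Y x = - 4 * \<sigma> * dd P x u * dd Q x u" for u
  proof -
    define l where "l t = x + t *\<^sub>R u" for t :: real
    have l: "(l \<longlongrightarrow> x) (at 0)" unfolding l_def by (auto intro!: tendsto_eq_intros)
    have lV: "\<forall>\<^sub>F t in at 0. l t \<in> V"
      using topological_tendstoD[OF l open_V x] .
    have cont: "((\<lambda>t. \<phi> (l t)) \<longlongrightarrow> \<phi> x) (at 0)" if "smooth_on V \<phi>" for \<phi> :: "real^2 \<Rightarrow> real"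
      using smooth_on_continuous[OF that] x open_V l
      by (metis continuous_on_eq_continuous_at isCont_tendsto_compose)
    have quot: "((\<lambda>t. \<phi> (l t) / t) \<longlongrightarrow> dd \<phi> x u) (at 0)"
      if d: "\<phi> differentiable (at x)" and 0: "\<phi> x = 0" for \<phi> :: "real^2 \<Rightarrow> real"
    proof -
      have "(l has_derivative (\<lambda>t. t *\<^sub>R u)) (at 0)" unfolding l_def by (auto intro!: derivative_eq_intros)
      moreover have "(\<phi> has_derivative dd \<phi> x) (at (l 0))" using dd_has_derivative[OF d] unfolding l_def by simp
      ultimately have "((\<lambda>t. \<phi> (l t)) has_derivative (\<lambda>t. dd \<phi> x (t *\<^sub>R u))) (at 0)"
        by (rule has_derivative_compose)
      then have "((\<lambda>t. \<phi> (l t)) has_real_derivative dd \<phi> x u) (at 0)"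
        by (simp add: has_field_derivative_def dd_scaleR[OF d] mult_commute_abs)
      then show ?thesis using 0 unfolding DERIV_def by (simp add: l_def)
    qed
    have sX: "smooth_on V X" "smooth_on V Y" unfolding X_def Y_def
      by (intro smooth_on_add smooth_on_diff smooth_on_mult smooth_on_const open_V smooth_along sPQ)+
    have sk: "smooth_on V (\<lambda>y. k2 y * P y - \<sigma> * k1 y * Q y)" "smooth_on V (\<lambda>y. k1 y * P y + \<sigma> * k2 y * Q y)"
      by (intro smooth_on_add smooth_on_diff smooth_on_mult smooth_on_const open_V smooth_coefficients sPQ)+
    note qP = quot[OF dPQ(1) PQx(1)] and qQ = quot[OF dPQ(2) PQx(2)]
    define R where "R t = (P (l t) / t)\<^sup>2 + (Q (l t) / t)\<^sup>2" for t
    have limR: "(R \<longlongrightarrow> (dd P x u)\<^sup>2 + (dd Q x u)\<^sup>2) (at 0)"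
      unfolding R_def by (intro tendsto_intros qP qQ)
    have Rr: "R t = r (l t) / t\<^sup>2" for t unfolding R_def r_def by (simp add: power_divide add_divide_distrib)
    have ev: "\<forall>\<^sub>F t in at (0::real). l t \<in> V \<and> t \<noteq> 0"
      using lV eventually_neq_at_within[of 0 0 UNIV] by eventually_elim auto
    have e1: "\<forall>\<^sub>F t in at 0. - 2 * ((P (l t) / t)\<^sup>2 - (Q (l t) / t)\<^sup>2)
        + R t * (k2 (l t) * P (l t) - \<sigma> * k1 (l t) * Q (l t)) = R t * X (l t)"
      using ev
    proof eventually_elim
      case (elim t)
      then show ?case using arg_cong[OF XY(1)[of "l t"], of "\<lambda>s. s / t\<^sup>2"] unfolding Rr
        by (simp add: power_divide diff_divide_distrib add_divide_distrib)
    qed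
    have e2: "\<forall>\<^sub>F t in at 0. - 4 * \<sigma> * (P (l t) / t) * (Q (l t) / t)
        + R t * (k1 (l t) * P (l t) + \<sigma> * k2 (l t) * Q (l t)) = R t * Y (l t)"
      using ev
    proof eventually_elim
      case (elim t)
      then show ?case using arg_cong[OF XY(2)[of "l t"], of "\<lambda>s. s / t\<^sup>2"] unfolding Rr
        by (simp add: power2_eq_square diff_divide_distrib add_divide_distrib)
    qed
    have t1: "((\<lambda>t. R t * X (l t)) \<longlongrightarrow> - 2 * ((dd P x u)\<^sup>2 - (dd Q x u)\<^sup>2) + ((dd P x u)\<^sup>2 + (dd Q x u)\<^sup>2) * (k2 x * P x - \<sigma> * k1 x * Q x)) (at 0)"
      by (rule Lim_transform_eventually[OF _ e1]) (intro tendsto_intros qP qQ limR cont[OF sk(1)])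
    have t2: "((\<lambda>t. R t * Y (l t)) \<longlongrightarrow> - 4 * \<sigma> * dd P x u * dd Q x u + ((dd P x u)\<^sup>2 + (dd Q x u)\<^sup>2) * (k1 x * P x + \<sigma> * k2 x * Q x)) (at 0)"
      by (rule Lim_transform_eventually[OF _ e2]) (intro tendsto_intros qP qQ limR cont[OF sk(2)])
    have "((\<lambda>t. R t * X (l t)) \<longlongrightarrow> ((dd P x u)\<^sup>2 + (dd Q x u)\<^sup>2) * X x) (at 0)"
      "((\<lambda>t. R t * Y (l t)) \<longlongrightarrow> ((dd P x u)\<^sup>2 + (dd Q x u)\<^sup>2) * Y x) (at 0)"
      by (intro tendsto_intros limR cont sX)+
    from tendsto_unique[OF _ this(1) t1] tendsto_unique[OF _ this(2) t2]
    show "((dd P x u)\<^sup>2 + (dd Q x u)\<^sup>2) * X x = - 2 * ((dd P x u)\<^sup>2 - (dd Q x u)\<^sup>2)"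
      "((dd P x u)\<^sup>2 + (dd Q x u)\<^sup>2) * Y x = - 4 * \<sigma> * dd P x u * dd Q x u"
      using PQx by simp_all
  qed
  note dBZ = smooth_HBZ(3-6)[THEN smooth_on_differentiable[OF _ x]]
  note mult = differentiable_bilinear[OF bounded_bilinear_mult]
  have dP: "dd P x u * nZ x = Z3 \<sigma> x * dd (B3 \<sigma>) x u + Z4 \<sigma> x * dd (B4 \<sigma>) x u"
    "dd Q x u * nZ x = Z4 \<sigma> x * dd (B3 \<sigma>) x u - Z3 \<sigma> x * dd (B4 \<sigma>) x u" for u
  proof -
    have "dd (\<lambda>z. P z * nZ z) x u = dd (\<lambda>z. Z3 \<sigma> z * B3 \<sigma> z + Z4 \<sigma> z * B4 \<sigma> z) x u"
      "dd (\<lambda>z. Q z * nZ z) x u = dd (\<lambda>z. Z4 \<sigma> z * B3 \<sigma> z - Z3 \<sigma> z * B4 \<sigma> z) x u"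
      by (rule arg_cong[OF dd_cong_open[OF open_V x], where f = "\<lambda>h. h u"], use nZ in \<open>simp add: P_def Q_def\<close>)+
    then show "dd P x u * nZ x = Z3 \<sigma> x * dd (B3 \<sigma>) x u + Z4 \<sigma> x * dd (B4 \<sigma>) x u"
      "dd Q x u * nZ x = Z4 \<sigma> x * dd (B3 \<sigma>) x u - Z3 \<sigma> x * dd (B4 \<sigma>) x u"
      using smooth_on_differentiable[OF smZ x] dPQ PQx Bx
      by (simp_all add: dd_plus dd_minus_fun dd_mult mult dBZ)
  qed
  have cod: "dd (B3 \<sigma>) x (e1 x) + \<sigma> * dd (B4 \<sigma>) x (e2 x) = 2 * Z3 \<sigma> x"
    "dd (B4 \<sigma>) x (e1 x) - \<sigma> * dd (B3 \<sigma>) x (e2 x) = 2 * Z4 \<sigma> x"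
    using codazzi_B[OF x \<sigma>] unfolding Bx by simp_all
  define P1 Q1 P2 Q2 where "P1 = dd P x (e1 x)" and "Q1 = dd Q x (e1 x)" and "P2 = dd P x (e2 x)" and "Q2 = dd Q x (e2 x)"
  note d1 = dP[of "e1 x", folded P1_def Q1_def] and d2 = dP[of "e2 x", folded P2_def Q2_def]
  \<comment> \<open>At x, where B = 0, the Codazzi equation says (e1 - i\<sigma> e2)(P - iQ) = 2.
    Its two parts express the derivatives along \<open>e2\<close> by those along
    \<open>e1\<close>.\<close>
  have "nZ x * (P1 - \<sigma> * Q2) = P1 * nZ x - \<sigma> * (Q2 * nZ x)" by (simp add: algebra_simps)
  also have "\<dots> = Z3 \<sigma> x * (dd (B3 \<sigma>) x (e1 x) + \<sigma> * dd (B4 \<sigma>) x (e2 x))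
      + Z4 \<sigma> x * (dd (B4 \<sigma>) x (e1 x) - \<sigma> * dd (B3 \<sigma>) x (e2 x))"
    unfolding d1 d2 by (simp add: algebra_simps)
  also have "\<dots> = nZ x * 2" unfolding cod nZ_def by (simp add: algebra_simps power2_eq_square)
  finally have "\<sigma> * Q2 = P1 - 2" using nZ[OF x] by simp
  then have Q2: "Q2 = \<sigma> * (P1 - 2)" using \<sigma>s[of Q2] by simp
  have "nZ x * (Q1 + \<sigma> * P2) = Q1 * nZ x + \<sigma> * (P2 * nZ x)" by (simp add: algebra_simps)
  also have "\<dots> = Z4 \<sigma> x * (dd (B3 \<sigma>) x (e1 x) + \<sigma> * dd (B4 \<sigma>) x (e2 x))
      - Z3 \<sigma> x * (dd (B4 \<sigma>) x (e1 x) - \<sigma> * dd (B3 \<sigma>) x (e2 x))"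
    unfolding d1 d2 by (simp add: algebra_simps)
  also have "\<dots> = nZ x * 0" unfolding cod nZ_def by simp
  finally have "\<sigma> * P2 = - Q1" using nZ[OF x] by simp
  then have P2: "P2 = - \<sigma> * Q1" using \<sigma>s[of P2] by simp
  have Xx: "X x = 2 * P1 - 2" and Yx: "Y x = 2 * \<sigma> * Q1"
    unfolding X_def Y_def P1_def[symmetric] Q1_def[symmetric] P2_def[symmetric] Q2_def[symmetric] P2 Q2
    by (simp_all add: algebra_simps \<sigma>s ss)
  have L1: "(P1\<^sup>2 + Q1\<^sup>2) * (2 * P1 - 2) = - 2 * (P1\<^sup>2 - Q1\<^sup>2)" "(P1\<^sup>2 + Q1\<^sup>2) * (2 * \<sigma> * Q1) = - 4 * \<sigma> * P1 * Q1"
    using lim[of "e1 x"] unfolding Xx Yx P1_def[symmetric] Q1_def[symmetric] by auto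
  have L2: "(P2\<^sup>2 + Q2\<^sup>2) * (2 * P1 - 2) = - 2 * (P2\<^sup>2 - Q2\<^sup>2)"
    using lim(1)[of "e2 x"] unfolding Xx P2_def[symmetric] Q2_def[symmetric] .
  \<comment> \<open>For v = P1 - i Q1 the limit along \<open>e1\<close> reads |v|^2 (v - 1) = - v^2.
    If v were nonzero, division by v would make |v|^2 equal to conj v - v, which is purely
    imaginary.\<close>
  have "P1\<^sup>2 + Q1\<^sup>2 = 0"
  proof (cases "Q1 = 0")
    case True
    then have "P1 * P1 * P1 = 0" using L1(1) by algebra
    then show ?thesis using True by simp
  next
    case False
    have "Q1 * (P1\<^sup>2 + Q1\<^sup>2 + 2 * P1) = 0" using L1(2) \<sigma> by algebra
    then have n: "P1\<^sup>2 + Q1\<^sup>2 + 2 * P1 = 0" using False by simp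
    then have "P1 = 0" using L1(1) by algebra
    then show ?thesis using n by simp
  qed
  then have "P1 = 0" "Q1 = 0" by (simp_all add: sum_power2_eq_zero_iff)
  \<comment> \<open>Now P2 = 0 and Q2 = - 2\<sigma>, so the first limit along \<open>e2\<close>
    reads - 8 = 8.\<close>
  then show False using L2 \<sigma> unfolding P2 Q2 by (simp add: power_mult_distrib)
qed

definition sf :: "real^2 \<Rightarrow> real^2 \<Rightarrow> real^2 \<Rightarrow> real^5 \<Rightarrow> real" where
  "sf y u v \<xi> = amb c (dd (\<lambda>z. dd F z v) y u) \<xi>"

text \<open>A rotation of the tangent frame turns B by twice its angle up to sign, and a rotation of
  the normal frame by its angle up to sign. So |B|^2 makes sense without reference to a frame, as is
  needed to change charts.\<close>

lemma nB_any_frame: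
  assumes y: "y \<in> V" and \<sigma>: "\<sigma>\<^sup>2 = 1" and uv: "oframe g y u v"
    and n: "\<xi> \<in> nspace c F y" "\<eta> \<in> nspace c F y" "amb c \<xi> \<xi> = 1" "amb c \<eta> \<eta> = 1" "amb c \<xi> \<eta> = 0" "npositive F y \<xi> \<eta>"
  shows "nB \<sigma> y = (sf y u u \<xi> - sf y v v \<xi> - 2 * \<sigma> * sf y u v \<eta>)\<^sup>2 + (sf y u u \<eta> - sf y v v \<eta> + 2 * \<sigma> * sf y u v \<xi>)\<^sup>2"
proof -
  obtain a b a' b' where ab: "\<xi> = a *\<^sub>R N3 y + b *\<^sub>R N4 y" "\<eta> = a' *\<^sub>R N3 y + b' *\<^sub>R N4 y"
    using nspace_expand[OF y n(1)] nspace_expand[OF y n(2)] by blast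
  have 1: "a * a + b * b = 1" "a' * a' + b' * b' = 1" "a * a' + b * b' = 0" "0 < a * b' - b * a'"
    using n(3-6) unfolding ab amb_combination[OF y] npositive_combination[OF y] by auto
  note rot = rotation_coefficients[OF 1]
  obtain p q where pq: "p\<^sup>2 + q\<^sup>2 = 1" "u = p *\<^sub>R e1 y + q *\<^sub>R e2 y" "v = (- q) *\<^sub>R e1 y + p *\<^sub>R e2 y"
    using oframe_rotation[OF ip[OF y] oframe[OF y] uv] .
  note B = second_dd_bilinear[OF open_V y smooth_F]
  have h: "sf y (e1 y) (e1 y) (N3 y) = h311 y" "sf y (e1 y) (e2 y) (N3 y) = h312 y" "sf y (e2 y) (e1 y) (N3 y) = h312 y"
    "sf y (e2 y) (e2 y) (N3 y) = h322 y" "sf y (e1 y) (e1 y) (N4 y) = h411 y" "sf y (e1 y) (e2 y) (N4 y) = h412 y"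
    "sf y (e2 y) (e1 y) (N4 y) = h412 y" "sf y (e2 y) (e2 y) (N4 y) = h422 y"
    unfolding sf_def amb_dE_normal[OF y nspace_N(1)[OF y], symmetric] amb_dE_normal[OF y nspace_N(2)[OF y], symmetric]
      second_form_symmetric[OF y]
    unfolding h311_def h312_def h322_def h411_def h412_def h422_def by simp_all
  have lin: "sf y (r *\<^sub>R s + r' *\<^sub>R s') w \<zeta> = r * sf y s w \<zeta> + r' * sf y s' w \<zeta>"
    "sf y w (r *\<^sub>R s + r' *\<^sub>R s') \<zeta> = r * sf y w s \<zeta> + r' * sf y w s' \<zeta>"
    "sf y w w' (r *\<^sub>R \<zeta> + r' *\<^sub>R \<zeta>') = r * sf y w w' \<zeta> + r' * sf y w w' \<zeta>'" for r s r' s' w w' \<zeta> \<zeta>'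
    unfolding sf_def bilinear_ladd[OF B] bilinear_radd[OF B] bilinear_lmul[OF B] bilinear_rmul[OF B]
    by (simp_all add: amb_simps)
  \<comment> \<open>Cosine and sine of the doubled angle.\<close>
  define P where "P = p\<^sup>2 - q\<^sup>2"
  define Q where "Q = 2 * p * q"
  have PQ: "P\<^sup>2 + Q\<^sup>2 = 1" using pq(1) unfolding P_def Q_def by algebra
  have D: "sf y u u \<zeta> - sf y v v \<zeta> = P * (sf y (e1 y) (e1 y) \<zeta> - sf y (e2 y) (e2 y) \<zeta>) + Q * (sf y (e1 y) (e2 y) \<zeta> + sf y (e2 y) (e1 y) \<zeta>)"
    "2 * sf y u v \<zeta> = - Q * (sf y (e1 y) (e1 y) \<zeta> - sf y (e2 y) (e2 y) \<zeta>) + 2 * (p\<^sup>2 * sf y (e1 y) (e2 y) \<zeta> - q\<^sup>2 * sf y (e2 y) (e1 y) \<zeta>)" for \<zeta>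
    unfolding pq(2,3) lin P_def Q_def by algebra+
  define s3 where "s3 \<zeta> = sf y u u \<zeta> - sf y v v \<zeta>" for \<zeta>
  define s12 where "s12 \<zeta> = 2 * sf y u v \<zeta>" for \<zeta>
  have D3: "s3 (N3 y) = P * (h311 y - h322 y) + 2 * Q * h312 y" "s3 (N4 y) = P * (h411 y - h422 y) + 2 * Q * h412 y"
    "s12 (N3 y) = - Q * (h311 y - h322 y) + 2 * P * h312 y" "s12 (N4 y) = - Q * (h411 y - h422 y) + 2 * P * h412 y"
    unfolding s3_def s12_def D h P_def by (simp_all add: algebra_simps)
  have lin2: "s3 (r *\<^sub>R \<zeta> + r' *\<^sub>R \<zeta>') = r * s3 \<zeta> + r' * s3 \<zeta>'" "s12 (r *\<^sub>R \<zeta> + r' *\<^sub>R \<zeta>') = r * s12 \<zeta> + r' * s12 \<zeta>'" for r \<zeta> r' \<zeta>'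
    unfolding s3_def s12_def lin(3) by (simp_all add: algebra_simps)
  define C3 where "C3 = s3 (N3 y) - \<sigma> * s12 (N4 y)"
  define C4 where "C4 = s3 (N4 y) + \<sigma> * s12 (N3 y)"
  have C: "C3 = P * B3 \<sigma> y + \<sigma> * Q * B4 \<sigma> y" "C4 = P * B4 \<sigma> y - \<sigma> * Q * B3 \<sigma> y"
    unfolding C3_def C4_def D3 B3_def B4_def using \<sigma> by algebra+
  have "s3 \<xi> - \<sigma> * s12 \<eta> = a * C3 + b * C4" "s3 \<eta> + \<sigma> * s12 \<xi> = a * C4 - b * C3"
    unfolding ab rot lin2 C3_def C4_def by (simp_all add: algebra_simps)
  then have "(s3 \<xi> - \<sigma> * s12 \<eta>)\<^sup>2 + (s3 \<eta> + \<sigma> * s12 \<xi>)\<^sup>2 = (a * C3 + b * C4)\<^sup>2 + (a * C4 - b * C3)\<^sup>2"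
    by simp
  also have "\<dots> = (a * a + b * b) * (C3\<^sup>2 + C4\<^sup>2)" by algebra
  also have "\<dots> = (P\<^sup>2 + Q\<^sup>2) * nB \<sigma> y" unfolding 1(1) C nB_def using \<sigma> by algebra
  finally show ?thesis unfolding PQ s3_def s12_def by (simp add: algebra_simps)
qed

end

section \<open>Two immersions whose normal frames have the same connection form and the same
  components of H\<close>

locale frame_pair = a: adapted_frame c V F g e1 e2 N3 N4 + b: adapted_frame c V F' g e1 e2 M3 M4
  for c V F g e1 e2 N3 N4 F' M3 M4 +
  assumes normal_connection: "y \<in> V \<Longrightarrow> amb c (dd M3 y u) (M4 y) = amb c (dd N3 y u) (N4 y)"
    and mean_curvature: "y \<in> V \<Longrightarrow> b.H3 y = a.H3 y" "y \<in> V \<Longrightarrow> b.H4 y = a.H4 y"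
begin

text \<open>The Levi-Civita coefficients are read off from the bracket of the common frame
  \<open>e1\<close>, \<open>e2\<close>, which knows nothing of the immersion.\<close>

lemma same_connection:
  assumes y: "y \<in> V"
  shows "b.k1 y = a.k1 y" "b.k2 y = a.k2 y" "b.n1 y = a.n1 y" "b.n2 y = a.n2 y"
proof -
  have eq: "(- b.k1 y) *\<^sub>R e1 y - b.k2 y *\<^sub>R e2 y = (- a.k1 y) *\<^sub>R e1 y - a.k2 y *\<^sub>R e2 y"
    using a.bracket_e[OF y] b.bracket_e[OF y] by simp
  have "g y (e1 y) (e1 y) = 1" "g y (e2 y) (e2 y) = 1" "g y (e1 y) (e2 y) = 0" "g y (e2 y) (e1 y) = 0"
    using a.oframe[OF y] inner_product_at_sym[OF a.ip[OF y]] unfolding oframe_def by metis+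
  then show "b.k1 y = a.k1 y" "b.k2 y = a.k2 y"
    using arg_cong[OF eq, of "\<lambda>w. g y w (e1 y)"] arg_cong[OF eq, of "\<lambda>w. g y w (e2 y)"]
    by (simp_all add: inner_product_at_simps[OF a.ip[OF y]])
  show "b.n1 y = a.n1 y" "b.n2 y = a.n2 y"
    unfolding a.n1_def b.n1_def a.n2_def b.n2_def by (rule normal_connection[OF y])+
qed

lemma same_Z:
  assumes y: "y \<in> V"
  shows "b.Z3 \<sigma> y = a.Z3 \<sigma> y" "b.Z4 \<sigma> y = a.Z4 \<sigma> y"
proof -
  have "dd b.H3 y = dd a.H3 y" "dd b.H4 y = dd a.H4 y"
    by (rule dd_cong_open[OF a.open_V y], rule mean_curvature, assumption)+
  then show "b.Z3 \<sigma> y = a.Z3 \<sigma> y" "b.Z4 \<sigma> y = a.Z4 \<sigma> y"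
    unfolding a.Z3_def b.Z3_def a.Z4_def b.Z4_def same_connection[OF y] mean_curvature[OF y] by simp_all
qed

text \<open>Both Codazzi equations have the same right-hand side, so rotating B by \<theta> leaves
  linear equations for d\<theta> whose coefficients involve 1 - cos \<theta> and sin \<theta>. Since
  cot (\<theta>/2) = sin \<theta> / (1 - cos \<theta>) has derivative - d\<theta> / (1 - cos
  \<theta>), they become affine in it.\<close>

lemma phase_equation:
  assumes \<sigma>: "\<sigma>\<^sup>2 = 1" and W: "open W" "W \<subseteq> V" "y \<in> W"
    and \<theta>: "\<theta> differentiable (at y)" and s0: "sin (\<theta> y / 2) \<noteq> 0" and nz: "a.nB \<sigma> y \<noteq> 0"
    and rot: "\<And>z. z \<in> W \<Longrightarrow> b.B3 \<sigma> z = cos (\<theta> z) * a.B3 \<sigma> z - sin (\<theta> z) * a.B4 \<sigma> z"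
      "\<And>z. z \<in> W \<Longrightarrow> b.B4 \<sigma> z = cos (\<theta> z) * a.B4 \<sigma> z + sin (\<theta> z) * a.B3 \<sigma> z"
  shows "(\<lambda>z. cot (\<theta> z / 2)) differentiable (at y)"
    and "dd (\<lambda>z. cot (\<theta> z / 2)) y u = cot (\<theta> y / 2) * a.w1 \<sigma> y u - a.w2 \<sigma> y u"
proof -
  have y: "y \<in> V" using W by blast
  note D\<theta> = dd_has_derivative[OF \<theta>]
  have dcs: "((\<lambda>z. cos (\<theta> z)) has_derivative (\<lambda>u. dd \<theta> y u * - sin (\<theta> y))) (at y)"
    "((\<lambda>z. sin (\<theta> z)) has_derivative (\<lambda>u. dd \<theta> y u * cos (\<theta> y))) (at y)"
    by (rule DERIV_compose_FDERIV[OF _ D\<theta>], rule DERIV_cos, rule DERIV_compose_FDERIV[OF _ D\<theta>], rule DERIV_sin)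
  have dc: "(\<lambda>z. cos (\<theta> z)) differentiable (at y)" "(\<lambda>z. sin (\<theta> z)) differentiable (at y)"
    using dcs unfolding differentiable_def by blast+
  have ddc: "dd (\<lambda>z. cos (\<theta> z)) y u = dd \<theta> y u * - sin (\<theta> y)" "dd (\<lambda>z. sin (\<theta> z)) y u = dd \<theta> y u * cos (\<theta> y)" for u
    using ddI[OF dcs(1)] ddI[OF dcs(2)] by simp_all
  have dC: "((\<lambda>z. cot (\<theta> z / 2)) has_derivative (\<lambda>u. dd \<theta> y u / 2 * - inverse ((sin (\<theta> y / 2))\<^sup>2))) (at y)"
  proof -
    have "((\<lambda>z. \<theta> z / 2) has_derivative (\<lambda>u. dd \<theta> y u / 2)) (at y)"
      by (rule bounded_linear.has_derivative[OF bounded_linear_divide D\<theta>])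
    from DERIV_compose_FDERIV[OF DERIV_cot[OF s0] this] show ?thesis .
  qed
  then show "(\<lambda>z. cot (\<theta> z / 2)) differentiable (at y)" unfolding differentiable_def by blast
  have ddC: "dd (\<lambda>z. cot (\<theta> z / 2)) y u = dd \<theta> y u / 2 * - inverse ((sin (\<theta> y / 2))\<^sup>2)" for u
    using ddI[OF dC] by simp
  note dB = a.smooth_HBZ(3,4)[THEN smooth_on_differentiable[OF _ y]]
  note mult = differentiable_bilinear[OF bounded_bilinear_mult]
  let ?co = "cos (\<theta> y)" and ?si = "sin (\<theta> y)"
  have dB': "dd (b.B3 \<sigma>) y u = ?co * dd (a.B3 \<sigma>) y u - ?si * dd (a.B4 \<sigma>) y u - dd \<theta> y u * b.B4 \<sigma> y"
    "dd (b.B4 \<sigma>) y u = ?co * dd (a.B4 \<sigma>) y u + ?si * dd (a.B3 \<sigma>) y u + dd \<theta> y u * b.B3 \<sigma> y" for u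
  proof -
    have "dd (b.B3 \<sigma>) y u = dd (\<lambda>z. cos (\<theta> z) * a.B3 \<sigma> z - sin (\<theta> z) * a.B4 \<sigma> z) y u"
      "dd (b.B4 \<sigma>) y u = dd (\<lambda>z. cos (\<theta> z) * a.B4 \<sigma> z + sin (\<theta> z) * a.B3 \<sigma> z) y u"
      by (rule arg_cong[OF dd_cong_open[OF W(1,3)], where f = "\<lambda>h. h u"], rule rot, assumption)+
    then show "dd (b.B3 \<sigma>) y u = ?co * dd (a.B3 \<sigma>) y u - ?si * dd (a.B4 \<sigma>) y u - dd \<theta> y u * b.B4 \<sigma> y"
      "dd (b.B4 \<sigma>) y u = ?co * dd (a.B4 \<sigma>) y u + ?si * dd (a.B3 \<sigma>) y u + dd \<theta> y u * b.B3 \<sigma> y"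
      unfolding rot[OF W(3)]
      by (simp_all add: dd_plus dd_minus_fun dd_mult dc mult dB ddc algebra_simps)
  qed
  \<comment> \<open>In half angles 1 - cos \<theta> and sin \<theta> have the common factor 2 sin
    (\<theta>/2).\<close>
  define sh ch where "sh = sin (\<theta> y / 2)" and "ch = cos (\<theta> y / 2)"
  have half: "?co = 1 - 2 * sh\<^sup>2" "?si = 2 * sh * ch" "sh\<^sup>2 + ch\<^sup>2 = 1"
    using cos_double_sin[of "\<theta> y / 2"] sin_double[of "\<theta> y / 2"] unfolding sh_def ch_def by simp_all
  define t1 t2 where "t1 = dd \<theta> y (e1 y)" and "t2 = dd \<theta> y (e2 y)"
  define p q where "p = a.Z3 \<sigma> y * a.B3 \<sigma> y + a.Z4 \<sigma> y * a.B4 \<sigma> y"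
    and "q = a.Z4 \<sigma> y * a.B3 \<sigma> y - a.Z3 \<sigma> y * a.B4 \<sigma> y"
  define n where "n = a.nB \<sigma> y"
  have n: "n = (a.B3 \<sigma> y)\<^sup>2 + (a.B4 \<sigma> y)\<^sup>2" unfolding n_def a.nB_def ..
  note ca = a.codazzi_B[OF y \<sigma>] and cb = b.codazzi_B[OF y \<sigma>, unfolded same_connection[OF y] same_Z[OF y] dB']
  \<comment> \<open>The second Codazzi equation minus the rotated first one: the derivatives of B
    cancel, and only that of \<theta> is left.\<close>
  have I: "- t1 * b.B4 \<sigma> y + \<sigma> * t2 * b.B3 \<sigma> y = 2 * a.Z3 \<sigma> y * (1 - ?co) + 2 * ?si * a.Z4 \<sigma> y"
    using cb(1) arg_cong[OF ca(1), of "\<lambda>s. ?co * s"] arg_cong[OF ca(2), of "\<lambda>s. ?si * s"]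
    unfolding t1_def t2_def rot[OF W(3)] by (simp add: algebra_simps)
  have II: "t1 * b.B3 \<sigma> y + \<sigma> * t2 * b.B4 \<sigma> y = 2 * a.Z4 \<sigma> y * (1 - ?co) - 2 * ?si * a.Z3 \<sigma> y"
    using cb(2) arg_cong[OF ca(2), of "\<lambda>s. ?co * s"] arg_cong[OF ca(1), of "\<lambda>s. ?si * s"]
    unfolding t1_def t2_def rot[OF W(3)] by (simp add: algebra_simps)
  \<comment> \<open>The system for the derivatives of \<theta> has the components of the rotated B
    as coefficients, so it is solved up to the factor |B|^2.\<close>
  have T1: "t1 * n = - 4 * sh * (ch * p + sh * q)"
    using I II half(3) unfolding rot[OF W(3)] half(1,2) p_def q_def n by algebra
  have T2: "\<sigma> * t2 * n = 4 * sh * (ch * q - sh * p)"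
    using I II half(3) unfolding rot[OF W(3)] half(1,2) p_def q_def n by algebra
  have sh: "sh \<noteq> 0" "n \<noteq> 0" using s0 nz unfolding sh_def n_def by auto
  have pq: "a.pf \<sigma> y = 2 * p / n" "a.qf \<sigma> y = 2 * q / n" unfolding a.pf_def a.qf_def p_def q_def n_def by simp_all
  have cot: "cot (\<theta> y / 2) = ch / sh" unfolding cot_def sh_def ch_def ..
  have C1: "t1 / 2 * - inverse (sh\<^sup>2) = cot (\<theta> y / 2) * a.pf \<sigma> y + a.qf \<sigma> y"
  proof -
    have "t1 = - 4 * sh * (ch * p + sh * q) / n" using T1 sh by (simp add: field_simps)
    then show ?thesis unfolding pq cot using sh by (simp add: field_simps power2_eq_square)
  qed
  have C2: "t2 / 2 * - inverse (sh\<^sup>2) = - \<sigma> * cot (\<theta> y / 2) * a.qf \<sigma> y + \<sigma> * a.pf \<sigma> y"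
  proof -
    have "t2 * n = \<sigma> * (4 * sh * (ch * q - sh * p))" using T2 \<sigma> by algebra
    then have "t2 = \<sigma> * (4 * sh * (ch * q - sh * p)) / n" using sh by (simp add: field_simps)
    then show ?thesis unfolding pq cot using sh by (simp add: field_simps power2_eq_square)
  qed
  have "dd \<theta> y u = g y u (e1 y) * t1 + g y u (e2 y) * t2"
    unfolding t1_def t2_def
    by (subst oframe_expand[OF a.ip[OF y] a.oframe[OF y], of u]) (simp add: dd_add[OF \<theta>] dd_scaleR[OF \<theta>])
  then have "dd (\<lambda>z. cot (\<theta> z / 2)) y u
    = g y u (e1 y) * (t1 / 2 * - inverse (sh\<^sup>2)) + g y u (e2 y) * (t2 / 2 * - inverse (sh\<^sup>2))"
    unfolding ddC sh_def[symmetric] by (simp add: algebra_simps add_divide_distrib)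
  then show "dd (\<lambda>z. cot (\<theta> z / 2)) y u = cot (\<theta> y / 2) * a.w1 \<sigma> y u - a.w2 \<sigma> y u"
    unfolding C1 C2 a.w1_def a.w2_def by (simp add: algebra_simps)
qed

end

section \<open>Existence of adapted frames\<close>

text \<open>Only c < 0 needs an argument. There the ambient form is Lorentzian and P is timelike, so
  its orthogonal complement is spacelike, by Cauchy-Schwarz.\<close>

lemma amb_pos:
  assumes P: "P \<in> Q4 c" and v: "v \<in> TQ c P" and v0: "v \<noteq> 0"
  shows "0 < amb c v v"
proof -
  define S where "S x y = x$1 * y$1 + x$2 * y$2 + x$3 * y$3 + x$4 * (y$4 :: real)" for x y :: "real^5"
  have Pe: "P$5 * P$5 + c * S P P = 1" and ve: "P$5 * v$5 + c * S P v = 0"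
    using P v unfolding Q4_def TQ_def ell_def S_def by auto
  have amb: "amb c v v = S v v + v$5 * v$5 / c" unfolding amb_def S_def by simp
  have Sv: "0 \<le> S v v" "S v v = 0 \<Longrightarrow> v$1 = 0 \<and> v$2 = 0 \<and> v$3 = 0 \<and> v$4 = 0"
    unfolding S_def by (auto simp: add_nonneg_eq_0_iff)
  have pos: "0 < S v v" if "v$5 = 0"
    using Sv v0 that by (auto simp: vec_eq_iff forall_5 order_less_le)
  consider "c > 0" | "c = 0" | "c < 0" by linarith
  then show ?thesis
  proof cases
    case 1
    show ?thesis
    proof (cases "v$5 = 0")
      case False
      then have "0 < v$5 * v$5 / c" using 1 by (metis divide_pos_pos not_real_square_gt_zero)
      then show ?thesis unfolding amb using Sv(1) by linarith
    qed (use pos amb in simp)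
  next
    case 2
    then have "v$5 = 0" using Pe ve by auto
    then show ?thesis using pos amb 2 by simp
  next
    case 3
    \<comment> \<open>Cauchy-Schwarz in four variables, by Lagrange's identity.\<close>
    have cs: "(S P v)\<^sup>2 \<le> S P P * S v v"
    proof -
      have "S P P * S v v - (S P v)\<^sup>2 = (P$1 * v$2 - P$2 * v$1)\<^sup>2 + (P$1 * v$3 - P$3 * v$1)\<^sup>2 + (P$1 * v$4 - P$4 * v$1)\<^sup>2
        + (P$2 * v$3 - P$3 * v$2)\<^sup>2 + (P$2 * v$4 - P$4 * v$2)\<^sup>2 + (P$3 * v$4 - P$4 * v$3)\<^sup>2"
        unfolding S_def by (simp add: algebra_simps power2_eq_square)
      then show ?thesis by (smt (verit) zero_le_power2)
    qed
    \<comment> \<open>Tangency and Cauchy-Schwarz bound m times the square of \<open>v$5\<close> by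
      c (1 - m) \<open>S v v\<close>. As m is at least 1, the negative term of \<open>amb\<close>
      cannot outweigh \<open>S v v\<close>.\<close>
    define m where "m = P$5 * P$5"
    have "0 \<le> S P P" unfolding S_def by simp
    then have m: "1 \<le> m" using Pe 3 mult_nonpos_nonneg[of c "S P P"] unfolding m_def by linarith
    have "m * (v$5 * v$5) = c * c * (S P v)\<^sup>2"
      using ve unfolding m_def by algebra
    also have "\<dots> \<le> c * c * (S P P * S v v)" using cs by (intro mult_left_mono) auto
    also have "\<dots> = c * (1 - m) * S v v" using Pe unfolding m_def by algebra
    finally have le: "m * (v$5 * v$5) \<le> c * (1 - m) * S v v" .
    have "m * amb c v v * c = m * (S v v * c) + m * (v$5 * v$5)"
      unfolding amb using 3 by (simp add: field_simps)
    also have "\<dots> \<le> c * S v v" using le by (simp add: algebra_simps)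
    finally have "c * S v v \<ge> c * (m * amb c v v)" by (simp add: algebra_simps)
    then have "S v v \<le> m * amb c v v" using 3 by simp
    moreover have "0 < S v v"
    proof (rule ccontr)
      assume "\<not> 0 < S v v"
      then have S0: "S v v = 0" using Sv(1) by simp
      then have "m * (v$5 * v$5) \<le> 0" using le by simp
      moreover have "0 \<le> (m - 1) * (v$5 * v$5)" using m by simp
      ultimately have "v$5 * v$5 \<le> 0" by (simp add: algebra_simps)
      then have "v$5 = 0" by (metis mult_eq_0_iff order_antisym zero_le_square)
      then show False using pos S0 by simp
    qed
    ultimately have "0 < m * amb c v v" by linarith
    then show ?thesis using m by (simp add: zero_less_mult_iff)
  qed
qed

text \<open>A constant vector is projected off \<open>F\<close> and the given fields. Chosen outside
  their span at x, it leaves a nonzero remainder there, hence one of positive length nearby; this is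
  why the neighbourhood shrinks.\<close>

lemma gram_schmidt_extend:
  fixes F :: "'a::euclidean_space \<Rightarrow> real^5" and E :: "nat \<Rightarrow> 'a \<Rightarrow> real^5"
  assumes U: "open U" "x \<in> U" and F: "smooth_on U F" "\<And>y. y \<in> U \<Longrightarrow> F y \<in> Q4 c" and k: "k < 4"
    and E: "\<And>i. i < k \<Longrightarrow> smooth_on U (E i)" "\<And>i y. i < k \<Longrightarrow> y \<in> U \<Longrightarrow> E i y \<in> TQ c (F y)"
    and on: "\<And>i j y. i < k \<Longrightarrow> j < k \<Longrightarrow> y \<in> U \<Longrightarrow> amb c (E i y) (E j y) = (if i = j then 1 else 0)"
  obtains V N where "open V" "x \<in> V" "V \<subseteq> U" "smooth_on V N" "\<And>y. y \<in> V \<Longrightarrow> N y \<in> TQ c (F y)"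
    "\<And>y. y \<in> V \<Longrightarrow> amb c (N y) (N y) = 1" "\<And>i y. i < k \<Longrightarrow> y \<in> V \<Longrightarrow> amb c (N y) (E i y) = 0"
proof -
  \<comment> \<open>At most k + 1 vectors in a space of dimension five, with k < 4.\<close>
  define B where "B = insert (F x) ((\<lambda>i. E i x) ` {..<k})"
  have "dim (span B) \<le> card B" unfolding dim_span by (rule dim_le_card') (simp add: B_def)
  also have "\<dots> \<le> Suc k" unfolding B_def using card_insert_le_m1 card_image_le[of "{..<k}" "\<lambda>i. E i x"]
    by (metis card_insert_if card_lessThan finite_imageI finite_lessThan le_SucI not_less_eq_eq)
  also have "\<dots> < dim (UNIV :: (real^5) set)" using k by simp
  finally have "span B \<noteq> UNIV" by (metis less_irrefl)
  then obtain w where w: "w \<notin> span B" by blast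
  define t where "t y = w - ell c (F y) w *\<^sub>R F y" for y
  define X where "X y = t y - (\<Sum>i<k. amb c (t y) (E i y) *\<^sub>R E i y)" for y
  have sX: "smooth_on U X"
    unfolding X_def t_def
    by (intro smooth_on_diff smooth_on_sum smooth_on_scaleR smooth_on_const smooth_on_bilinear[OF bounded_bilinear_ell]
        smooth_on_bilinear[OF bounded_bilinear_amb] U F(1) E(1)) auto
  have TX: "X y \<in> TQ c (F y)" if y: "y \<in> U" for y
  proof -
    have "ell c (F y) (F y) = 1" using F(2)[OF y] unfolding Q4_def by blast
    then have "ell c (F y) (t y) = 0" unfolding t_def by (simp add: ell_simps)
    moreover have "ell c (F y) (\<Sum>i<k. amb c (t y) (E i y) *\<^sub>R E i y) = 0"
      using E(2) y unfolding bounded_bilinear.sum_right[OF bounded_bilinear_ell] TQ_def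
      by (intro sum.neutral) (auto simp: ell_simps)
    ultimately show ?thesis unfolding TQ_def X_def by (simp add: ell_simps)
  qed
  have XE: "amb c (X y) (E j y) = 0" if j: "j < k" and y: "y \<in> U" for j y
  proof -
    have "amb c (\<Sum>i<k. amb c (t y) (E i y) *\<^sub>R E i y) (E j y) = (\<Sum>i<k. if i = j then amb c (t y) (E i y) else 0)"
      unfolding bounded_bilinear.sum_left[OF bounded_bilinear_amb]
      by (intro sum.cong) (auto simp: amb_simps on[OF _ j y])
    then show ?thesis unfolding X_def using j by (simp add: amb_simps)
  qed
  have X0: "X x \<noteq> 0"
  proof
    assume "X x = 0"
    then have "w = ell c (F x) w *\<^sub>R F x + (\<Sum>i<k. amb c (t x) (E i x) *\<^sub>R E i x)"
      unfolding X_def t_def by (simp add: algebra_simps)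
    also have "\<dots> \<in> span B"
      by (intro span_add span_scale span_sum span_base) (auto simp: B_def)
    finally show False using w by blast
  qed
  define V where "V = {y \<in> U. 0 < amb c (X y) (X y)}"
  have sn: "smooth_on U (\<lambda>y. amb c (X y) (X y))" by (rule smooth_on_bilinear[OF bounded_bilinear_amb U(1) sX sX])
  have "V = (\<lambda>y. amb c (X y) (X y)) -` {0<..} \<inter> U" unfolding V_def by auto
  then have V: "open V" using continuous_open_preimage[OF smooth_on_continuous[OF sn] U(1), of "{0<..}"]
    by (simp add: Int_commute)
  have VU: "V \<subseteq> U" unfolding V_def by blast
  have pos: "0 < amb c (X y) (X y)" if "y \<in> V" for y using that unfolding V_def by blast
  define N where "N y = inverse (sqrt (amb c (X y) (X y))) *\<^sub>R X y" for y
  show ?thesis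
  proof (rule that[of V N])
    show "open V" "V \<subseteq> U" by fact+
    show "x \<in> V" unfolding V_def using U amb_pos[OF F(2) TX X0] by blast
    show "smooth_on V N" unfolding N_def
      by (intro smooth_on_scaleR smooth_on_inverse smooth_on_sqrt V smooth_on_subset[OF sn VU] smooth_on_subset[OF sX VU])
        (use pos in force)+
    show "N y \<in> TQ c (F y)" if "y \<in> V" for y unfolding N_def using TX VU that TQ_linear(4) by blast
    show "amb c (N y) (N y) = 1" if "y \<in> V" for y
      unfolding N_def using pos[OF that] by (simp add: amb_simps field_simps)
    show "amb c (N y) (E i y) = 0" if "i < k" "y \<in> V" for i y
      unfolding N_def using XE that VU by (auto simp: amb_simps)
  qed
qed

lemma continuous_on_vol:
  assumes "continuous_on V P" "continuous_on V v1" "continuous_on V v2" "continuous_on V v3" "continuous_on V v4"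
  shows "continuous_on V (\<lambda>y. vol (P y) (v1 y) (v2 y) (v3 y) (v4 y))"
proof -
  have "\<forall>i. continuous_on V (\<lambda>y. (vector [P y, v1 y, v2 y, v3 y, v4 y] :: real^5^5) $ i)"
    unfolding forall_5 by (simp add: vector_def assms)
  then have "continuous_on V (\<lambda>y. (vector [P y, v1 y, v2 y, v3 y, v4 y] :: real^5^5) $ i)" for i
    by blast
  note c = bounded_linear.continuous_on[OF bounded_linear_vec_nth this]
  show ?thesis unfolding vol_def det_def
    by (intro continuous_on_sum continuous_on_mult continuous_on_const continuous_on_prod c)
qed

lemma smooth_gs:
  assumes U: "open U" and g: "\<And>u v. smooth_on U (\<lambda>x. g x u v)" and ip: "\<And>x. x \<in> U \<Longrightarrow> inner_product_at g x"
  shows "smooth_on U (gs1 g)" "smooth_on U (gs2 g)"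
proof -
  have pos: "0 < g x (axis 1 1) (axis 1 1)" if "x \<in> U" for x
    by (rule inner_product_at_pos[OF ip[OF that]]) (simp add: axis2_neq_0)
  then have nz: "sqrt (g x (axis 1 1) (axis 1 1)) \<noteq> 0" if "x \<in> U" for x using that by force
  show s1: "smooth_on U (gs1 g)"
    unfolding gs1_def
    by (intro smooth_on_scaleR smooth_on_inverse smooth_on_sqrt smooth_on_const U g pos nz | assumption)+
  have form: "smooth_form U (\<lambda>x u. g x u (X x))" if X: "smooth_on U X" for X
    unfolding smooth_form_def
  proof (intro conjI ballI allI)
    show "linear (\<lambda>u. g y u (X y))" if "y \<in> U" for y
      using ip[OF that] unfolding inner_product_at_def bilinear_def by blast
    show "smooth_on U (\<lambda>y. g y u (X y))" for u
    proof (rule smooth_form_apply[OF U _ X])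
      show "smooth_form U (\<lambda>y. g y u)"
        unfolding smooth_form_def using ip g unfolding inner_product_at_def bilinear_def by blast
    qed
  qed
  define w where "w x = axis 2 1 - g x (axis 2 1) (gs1 g x) *\<^sub>R gs1 g x" for x
  have sw: "smooth_on U w"
    unfolding w_def
    by (intro smooth_on_diff smooth_on_const smooth_on_scaleR U s1 smooth_form_smooth[OF form[OF s1]])
  have sn: "smooth_on U (\<lambda>x. g x (w x) (w x))" by (rule smooth_form_apply[OF U form[OF sw] sw])
  have pos2: "0 < g x (w x) (w x)" if "x \<in> U" for x
    using oframe_gs(2)[OF ip[OF that]] unfolding w_def .
  then have nz2: "sqrt (g x (w x) (w x)) \<noteq> 0" if "x \<in> U" for x using that by force
  have "gs2 g = (\<lambda>x. inverse (sqrt (g x (w x) (w x))) *\<^sub>R w x)" unfolding gs2_def w_def Let_def by (rule ext) simp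
  then show "smooth_on U (gs2 g)"
    by (simp only:) (intro smooth_on_scaleR smooth_on_inverse smooth_on_sqrt U sn sw pos2 nz2 | assumption)+
qed

lemma dd_F_TQ:
  assumes U: "open U" "y \<in> U" and F: "smooth_on U F" "\<And>y. y \<in> U \<Longrightarrow> F y \<in> Q4 c"
  shows "dd F y u \<in> TQ c (F y)"
proof -
  have d: "F differentiable (at y)" using smooth_on_differentiable F U by blast
  have "dd (\<lambda>y. ell c (F y) (F y)) y u = dd (\<lambda>_. 1::real) y u"
    by (rule arg_cong[OF dd_cong_open[OF U], where f = "\<lambda>h. h u"]) (use F(2) in \<open>auto simp: Q4_def\<close>)
  then show ?thesis
    using dd_bilinear[OF bounded_bilinear_ell d d, of c u] ell_sym[of c "F y" "dd F y u"] unfolding TQ_def by simp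
qed

text \<open>Two rounds of Gram-Schmidt supply the normals, possibly with the wrong orientation. A
  constant sign on the second one corrects it at x without harming smoothness, and continuity of the
  volume keeps it nearby.\<close>

lemma adapted_frame_exists:
  assumes U: "open U" "x \<in> U" and F: "smooth_on U F" "\<And>y. y \<in> U \<Longrightarrow> F y \<in> Q4 c"
    and iso: "\<And>y u v. y \<in> U \<Longrightarrow> amb c (dd F y u) (dd F y v) = g y u v"
    and ip: "\<And>y. y \<in> U \<Longrightarrow> inner_product_at g y"
  obtains V N3 N4 where "x \<in> V" "V \<subseteq> U" "adapted_frame c V F g (gs1 g) (gs2 g) N3 N4"
proof -
  have sg: "smooth_on U (\<lambda>y. g y u v)" for u v
    by (rule smooth_on_cong[OF U(1) iso])
      (auto intro!: smooth_on_bilinear[OF bounded_bilinear_amb U(1)] smooth_on_dd F(1))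
  note se = smooth_gs[OF U(1) sg ip]
  define E1 where "E1 y = dd F y (gs1 g y)" for y
  define E2 where "E2 y = dd F y (gs2 g y)" for y
  have sE: "smooth_on U E1" "smooth_on U E2"
    using smooth_form_apply[OF U(1) smooth_form_dd[OF F(1)] se(1)]
      smooth_form_apply[OF U(1) smooth_form_dd[OF F(1)] se(2)]
    unfolding E1_def E2_def by auto
  have TF: "dd F y u \<in> TQ c (F y)" if "y \<in> U" for y u using dd_F_TQ[OF U(1) that F] .
  have oE: "amb c (E1 y) (E1 y) = 1" "amb c (E1 y) (E2 y) = 0" "amb c (E2 y) (E1 y) = 0" "amb c (E2 y) (E2 y) = 1"
    if y: "y \<in> U" for y
    using oframe_gs(1)[OF ip[OF y]] inner_product_at_sym[OF ip[OF y], of "gs2 g y" "gs1 g y"]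
    unfolding E1_def E2_def iso[OF y] oframe_def by auto
  have all2: "(\<forall>i<2::nat. P i) \<longleftrightarrow> P 0 \<and> P 1" for P by (auto simp: numeral_eq_Suc less_Suc_eq)
  have all3: "(\<forall>i<3::nat. P i) \<longleftrightarrow> P 0 \<and> P 1 \<and> P 2" for P by (auto simp: numeral_eq_Suc less_Suc_eq)
  have all4: "(\<forall>i<4::nat. P i) \<longleftrightarrow> P 0 \<and> P 1 \<and> P 2 \<and> P 3" for P by (auto simp: numeral_eq_Suc less_Suc_eq)
  define Ea where "Ea i = (if i = 0 then E1 else E2)" for i :: nat
  have a: "\<forall>i<2. smooth_on U (Ea i)" "\<forall>i<2. \<forall>y\<in>U. Ea i y \<in> TQ c (F y)"
    "\<forall>i<2. \<forall>j<2. \<forall>y\<in>U. amb c (Ea i y) (Ea j y) = (if i = j then 1 else 0)"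
    unfolding all2 Ea_def using sE TF oE by (auto simp: E1_def E2_def)
  obtain V1 N3 where V1: "open V1" "x \<in> V1" "V1 \<subseteq> U" and N3: "smooth_on V1 N3" "\<And>y. y \<in> V1 \<Longrightarrow> N3 y \<in> TQ c (F y)"
    "\<And>y. y \<in> V1 \<Longrightarrow> amb c (N3 y) (N3 y) = 1" "\<And>i y. i < 2 \<Longrightarrow> y \<in> V1 \<Longrightarrow> amb c (N3 y) (Ea i y) = 0"
    by (rule gram_schmidt_extend[OF U F, of 2 Ea]) (use a in auto)
  have N3E: "amb c (N3 y) (E1 y) = 0" "amb c (N3 y) (E2 y) = 0" if "y \<in> V1" for y
    using N3(4)[of 0 y] N3(4)[of 1 y] that unfolding Ea_def by auto
  have EN3: "amb c (E1 y) (N3 y) = 0" "amb c (E2 y) (N3 y) = 0" if "y \<in> V1" for y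
    using N3E[OF that] amb_sym[of c "N3 y"] by simp_all
  define Eb where "Eb i = (if i = 0 then E1 else if i = 1 then E2 else N3)" for i :: nat
  have sub: "smooth_on V1 E1" "smooth_on V1 E2" "smooth_on V1 F" using smooth_on_subset V1(3) sE F(1) by blast+
  have b: "\<forall>i<3. smooth_on V1 (Eb i)" "\<forall>i<3. \<forall>y\<in>V1. Eb i y \<in> TQ c (F y)"
    "\<forall>i<3. \<forall>j<3. \<forall>y\<in>V1. amb c (Eb i y) (Eb j y) = (if i = j then 1 else 0)"
    unfolding all3 Eb_def using sub TF oE V1(3) N3(1-3) N3E EN3 by (auto simp: E1_def E2_def subset_iff)
  obtain V2 M where V2: "open V2" "x \<in> V2" "V2 \<subseteq> V1" and M: "smooth_on V2 M" "\<And>y. y \<in> V2 \<Longrightarrow> M y \<in> TQ c (F y)"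
    "\<And>y. y \<in> V2 \<Longrightarrow> amb c (M y) (M y) = 1" "\<And>i y. i < 3 \<Longrightarrow> y \<in> V2 \<Longrightarrow> amb c (M y) (Eb i y) = 0"
    by (rule gram_schmidt_extend[OF V1(1,2) sub(3), of c 3 Eb]) (use b F(2) V1(3) in auto)
  have ME: "amb c (M y) (E1 y) = 0" "amb c (M y) (E2 y) = 0" "amb c (M y) (N3 y) = 0" if "y \<in> V2" for y
    using M(4)[of 0 y] M(4)[of 1 y] M(4)[of 2 y] that unfolding Eb_def by auto
  have EM: "amb c (E1 y) (M y) = 0" "amb c (E2 y) (M y) = 0" "amb c (N3 y) (M y) = 0" if "y \<in> V2" for y
    using ME[OF that] amb_sym[of c "M y"] by simp_all
  define vl where "vl y = vol (F y) (dd F y (axis 1 1)) (dd F y (axis 2 1)) (N3 y) (M y)" for y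
  \<comment> \<open>If the determinant vanished, some nonzero v would be Euclidean-orthogonal to all
    rows. But v is a combination of the rows, so it would be orthogonal to itself.\<close>
  have vx: "vl x \<noteq> 0"
  proof
    assume "vl x = 0"
    define A :: "real^5^5" where "A = vector [F x, dd F x (axis 1 1), dd F x (axis 2 1), N3 x, M x]"
    have "det A = 0" using \<open>vl x = 0\<close> unfolding vl_def vol_def A_def .
    then have "\<not> invertible A" using invertible_det_nz by blast
    then obtain v where v: "v \<noteq> 0" "A *v v = 0"
      using matrix_left_invertible_ker[of A] invertible_left_inverse by blast
    have "(A *v v) $ i = A $ i \<bullet> v" for i by (simp add: matrix_vector_mult_def inner_vec_def)
    then have "\<forall>i. A $ i \<bullet> v = 0" using v(2) by simp
    then have o: "F x \<bullet> v = 0" "dd F x (axis 1 1) \<bullet> v = 0" "dd F x (axis 2 1) \<bullet> v = 0" "N3 x \<bullet> v = 0" "M x \<bullet> v = 0"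
      unfolding forall_5 A_def by (simp_all add: vector_def)
    have dF: "dd F x u \<bullet> v = 0" for u
      using linear_vec2[OF dd_linear[OF smooth_on_differentiable[OF F(1) U(2)]], of u] o by (simp add: inner_add_left)
    define Ec where "Ec i = (if i = 0 then E1 x else if i = 1 then E2 x else if i = 2 then N3 x else M x)" for i :: nat
    have xV: "x \<in> U" "x \<in> V1" "x \<in> V2" using U V1 V2 by auto
    have "\<forall>i<4. Ec i \<in> TQ c (F x)" "\<forall>i<4. \<forall>j<4. amb c (Ec i) (Ec j) = (if i = j then 1 else 0)"
      unfolding all4 Ec_def
      using TF xV oE[OF xV(1)] N3(2,3)[OF xV(2)] N3E[OF xV(2)] EN3[OF xV(2)] M(2,3)[OF xV(3)]
        ME[OF xV(3)] EM[OF xV(3)]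
      by (auto simp: E1_def E2_def)
    then have v': "v = ell c (F x) v *\<^sub>R F x + (\<Sum>i<(4::nat). amb c (v - ell c (F x) v *\<^sub>R F x) (Ec i) *\<^sub>R Ec i)"
      using TQ_orthonormal_expand[of c "F x" Ec v] F(2)[OF xV(1)] unfolding Q4_def by blast
    have Ev: "Ec i \<bullet> v = 0" for i using o dF unfolding Ec_def E1_def E2_def by simp
    have "v \<bullet> v = (ell c (F x) v *\<^sub>R F x + (\<Sum>i<(4::nat). amb c (v - ell c (F x) v *\<^sub>R F x) (Ec i) *\<^sub>R Ec i)) \<bullet> v"
      using v' by metis
    also have "\<dots> = 0" by (simp add: inner_add_left inner_sum_left Ev o)
    finally show False using v(1) by simp
  qed
  have cv: "continuous_on V2 vl"
    unfolding vl_def using V1 V2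
    by (intro continuous_on_vol smooth_on_continuous)
      (auto intro: smooth_on_subset[OF F(1)] smooth_on_subset[OF smooth_on_dd[OF F(1)]] smooth_on_subset[OF N3(1)] M(1))
  define s where "s = sgn (vl x)"
  have s: "s * s = 1" "0 < s * vl x" using vx unfolding s_def by (auto simp: sgn_if)
  define V where "V = {y \<in> V2. 0 < s * vl y}"
  have "V = (\<lambda>y. s * vl y) -` {0<..} \<inter> V2" unfolding V_def by auto
  then have oV: "open V"
    using continuous_open_preimage[OF continuous_on_mult_left[OF cv] V2(1), of "{0<..}" s] by (simp add: Int_commute)
  define N4 where "N4 y = s *\<^sub>R M y" for y
  have VV: "V \<subseteq> V2" unfolding V_def by blast
  have VU: "V \<subseteq> V1" "V \<subseteq> U" using VV V2 V1 by auto
  have nsp: "\<xi> \<in> nspace c F y" if "y \<in> U" "\<xi> \<in> TQ c (F y)" "amb c \<xi> (E1 y) = 0" "amb c \<xi> (E2 y) = 0" for \<xi> y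
  proof -
    have "amb c \<xi> (dd F y u) = 0" for u
    proof -
      note d = smooth_on_differentiable[OF F(1) that(1)]
      have "dd F y u = g y u (gs1 g y) *\<^sub>R E1 y + g y u (gs2 g y) *\<^sub>R E2 y"
        by (subst oframe_expand[OF ip[OF that(1)] oframe_gs(1)[OF ip[OF that(1)]], of u])
          (simp add: E1_def E2_def dd_add[OF d] dd_scaleR[OF d])
      then show ?thesis using that(3,4) by (simp add: amb_simps)
    qed
    then show ?thesis using that(2) unfolding nspace_def by blast
  qed
  have "adapted_frame c V F g (gs1 g) (gs2 g) N3 N4"
  proof
    show "open V" by fact
    show "smooth_on V F" "smooth_on V (gs1 g)" "smooth_on V (gs2 g)" using smooth_on_subset VU F(1) se by blast+
    show "smooth_on V N3" using smooth_on_subset VU N3(1) by blast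
    show "smooth_on V N4" unfolding N4_def
      by (intro smooth_on_scaleR smooth_on_const oV smooth_on_subset[OF M(1) VV])
    fix y assume y: "y \<in> V"
    then have y': "y \<in> U" "y \<in> V1" "y \<in> V2" using VU VV by auto
    show "F y \<in> Q4 c" "inner_product_at g y" using F(2) ip y' by auto
    show "amb c (dd F y u) (dd F y v) = g y u v" for u v using iso y' by auto
    show "oframe g y (gs1 g y) (gs2 g y)" using oframe_gs(1)[OF ip] y' by blast
    show "N3 y \<in> nspace c F y" using nsp N3(2) N3E y' by blast
    show "N4 y \<in> nspace c F y" unfolding N4_def using nsp M(2) ME y' nspace_linear(4) by blast
    show "amb c (N3 y) (N3 y) = 1" using N3(3) y' by blast
    show "amb c (N4 y) (N4 y) = 1" unfolding N4_def using M(3)[OF y'(3)] s(1) by (simp add: amb_simps)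
    show "amb c (N3 y) (N4 y) = 0" unfolding N4_def using EM(3)[OF y'(3)] by (simp add: amb_simps)
    show "npositive F y (N3 y) (N4 y)"
      using y vol_combination[of "F y" "dd F y (axis 1 1)" "dd F y (axis 2 1)" 1 "N3 y" 0 "M y" 0 s]
      unfolding npositive_def N4_def V_def vl_def by simp
  qed
  moreover have "x \<in> V" unfolding V_def using V2 s(2) by blast
  ultimately show ?thesis using that VU by blast
qed

section \<open>Isometric immersions of the surface\<close>

lemma op_isometry_id: "op_isometry c id"
proof -
  have "dd (id :: real^5 \<Rightarrow> real^5) P v = v" for P v by simp
  moreover have "smooth_on UNIV (id :: real^5 \<Rightarrow> real^5)"
    using smooth_on_linear[OF bounded_linear_ident] unfolding id_def .
  ultimately show ?thesis unfolding op_isometry_def by auto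
qed

lemma isometric_immersion_compose:
  assumes f: "isometric_immersion c A g f" and \<Psi>: "op_isometry c \<Psi>"
    and A: "\<And>\<kappa>. \<kappa> \<in> A \<Longrightarrow> open (chart_image \<kappa>)"
  shows "isometric_immersion c A g (\<Psi> \<circ> f)"
  unfolding isometric_immersion_def
proof (intro conjI ballI)
  have r: "range f \<subseteq> Q4 c" using f unfolding isometric_immersion_def by blast
  have bij: "\<Psi> ` Q4 c = Q4 c" using \<Psi> unfolding op_isometry_def bij_betw_def by blast
  show "range (\<Psi> \<circ> f) \<subseteq> Q4 c" using r bij by auto
  obtain W where W: "open W" "Q4 c \<subseteq> W" "smooth_on W \<Psi>" using \<Psi> unfolding op_isometry_def by blast
  have rep: "rep \<kappa> (\<Psi> \<circ> f) = (\<lambda>x. \<Psi> (rep \<kappa> f x))" for \<kappa> unfolding rep_def by auto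
  fix \<kappa> assume \<kappa>: "\<kappa> \<in> A"
  have F: "smooth_on (chart_image \<kappa>) (rep \<kappa> f)" using f \<kappa> unfolding isometric_immersion_def by blast
  have Q: "rep \<kappa> f x \<in> Q4 c" for x using r unfolding rep_def by auto
  show "smooth_on (chart_image \<kappa>) (rep \<kappa> (\<Psi> \<circ> f))"
    unfolding rep by (rule smooth_on_compose[OF A[OF \<kappa>] W(1) _ F W(3)]) (use Q W in blast)
  show "\<forall>u v. amb c (dd (rep \<kappa> (\<Psi> \<circ> f)) x u) (dd (rep \<kappa> (\<Psi> \<circ> f)) x v) = g \<kappa> x u v" if x: "x \<in> chart_image \<kappa>" for x
  proof (intro allI)
    fix u v
    have d: "rep \<kappa> f differentiable at x" "\<Psi> differentiable at (rep \<kappa> f x)"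
      using smooth_on_differentiable F x W Q by blast+
    have T: "dd (rep \<kappa> f) x w \<in> TQ c (rep \<kappa> f x)" for w by (rule dd_F_TQ[OF A[OF \<kappa>] x F Q])
    have "amb c (dd \<Psi> (rep \<kappa> f x) (dd (rep \<kappa> f) x u)) (dd \<Psi> (rep \<kappa> f x) (dd (rep \<kappa> f) x v))
        = amb c (dd (rep \<kappa> f) x u) (dd (rep \<kappa> f) x v)"
      using \<Psi> Q T unfolding op_isometry_def by blast
    also have "\<dots> = g \<kappa> x u v" using f \<kappa> x unfolding isometric_immersion_def by blast
    finally show "amb c (dd (rep \<kappa> (\<Psi> \<circ> f)) x u) (dd (rep \<kappa> (\<Psi> \<circ> f)) x v) = g \<kappa> x u v"
      unfolding rep dd_chain(1)[OF d] .
  qed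
qed

text \<open>A point of the moduli component is a class, and a representative of it is known only to
  have the same class as an immersion. Being congruent to that immersion, it is one itself.\<close>

lemma isometric_immersion_iso_class:
  assumes f: "isometric_immersion c A g f" and cls: "iso_class c h = iso_class c f"
    and A: "\<And>\<kappa>. \<kappa> \<in> A \<Longrightarrow> open (chart_image \<kappa>)"
  shows "isometric_immersion c A g h"
proof -
  have "h = id \<circ> h" by simp
  then have "h \<in> iso_class c h" unfolding iso_class_def using op_isometry_id by blast
  then obtain \<Psi> where "op_isometry c \<Psi>" "h = \<Psi> \<circ> f" unfolding cls unfolding iso_class_def by blast
  then show ?thesis using isometric_immersion_compose[OF f _ A] by blast
qed

section \<open>Change of charts and the zero set\<close>

locale riemannian_surface =
  fixes A :: "('m::{t2_space,second_countable_topology}) chart set" and g :: "'m chart \<Rightarrow> coord_metric"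
  assumes surface: "oriented_surface A" and metric: "riemannian_metric A g"
begin

lemma
  assumes "\<kappa> \<in> A"
  shows open_chart: "open (fst \<kappa>)" and open_image: "open (chart_image \<kappa>)"
    and chart_homeomorphism: "homeomorphism (fst \<kappa>) (chart_image \<kappa>) (snd \<kappa>) (inv_into (fst \<kappa>) (snd \<kappa>))"
  using surface assms unfolding oriented_surface_def by blast+

lemma rep_at: "\<kappa> \<in> A \<Longrightarrow> p \<in> fst \<kappa> \<Longrightarrow> rep \<kappa> F (snd \<kappa> p) = F p"
  using chart_homeomorphism unfolding homeomorphism_def rep_def by fastforce

definition overlap :: "'m chart \<Rightarrow> 'm chart \<Rightarrow> (real^2) set" where
  "overlap \<kappa> \<kappa>' = snd \<kappa> ` (fst \<kappa> \<inter> fst \<kappa>')"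

definition transition :: "'m chart \<Rightarrow> 'm chart \<Rightarrow> real^2 \<Rightarrow> real^2" where
  "transition \<kappa> \<kappa>' = rep \<kappa> (snd \<kappa>')"

lemma overlap_subset: "overlap \<kappa> \<kappa>' \<subseteq> chart_image \<kappa>"
  unfolding overlap_def by blast

lemma
  assumes \<kappa>: "\<kappa> \<in> A" and \<kappa>': "\<kappa>' \<in> A"
  shows open_overlap: "open (overlap \<kappa> \<kappa>')"
    and smooth_transition: "smooth_on (overlap \<kappa> \<kappa>') (transition \<kappa> \<kappa>')"
    and det_transition: "x \<in> overlap \<kappa> \<kappa>' \<Longrightarrow> 0 < det (matrix (dd (transition \<kappa> \<kappa>') x))"
    and transition_image: "x \<in> overlap \<kappa> \<kappa>' \<Longrightarrow> transition \<kappa> \<kappa>' x \<in> chart_image \<kappa>'"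
    and rep_transition: "x \<in> overlap \<kappa> \<kappa>' \<Longrightarrow> rep \<kappa> F x = rep \<kappa>' F (transition \<kappa> \<kappa>' x)"
    and metric_transition: "x \<in> overlap \<kappa> \<kappa>' \<Longrightarrow> g \<kappa> x u v
      = g \<kappa>' (transition \<kappa> \<kappa>' x) (dd (transition \<kappa> \<kappa>') x u) (dd (transition \<kappa> \<kappa>') x v)"
proof -
  note h = chart_homeomorphism[OF \<kappa>]
  have "overlap \<kappa> \<kappa>' = chart_image \<kappa> \<inter> inv_into (fst \<kappa>) (snd \<kappa>) -` fst \<kappa>'"
    using h unfolding overlap_def homeomorphism_def by force
  then show "open (overlap \<kappa> \<kappa>')"
    using continuous_open_preimage[OF _ open_image[OF \<kappa>] open_chart[OF \<kappa>']] h unfolding homeomorphism_def by metis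
  show "smooth_on (overlap \<kappa> \<kappa>') (transition \<kappa> \<kappa>')"
    using surface \<kappa> \<kappa>' unfolding oriented_surface_def overlap_def transition_def by blast
  show "0 < det (matrix (dd (transition \<kappa> \<kappa>') x))" if "x \<in> overlap \<kappa> \<kappa>'"
    using surface \<kappa> \<kappa>' that unfolding oriented_surface_def overlap_def transition_def by blast
  show "g \<kappa> x u v = g \<kappa>' (transition \<kappa> \<kappa>' x) (dd (transition \<kappa> \<kappa>') x u) (dd (transition \<kappa> \<kappa>') x v)"
    if "x \<in> overlap \<kappa> \<kappa>'"
    using metric \<kappa> \<kappa>' that unfolding riemannian_metric_def overlap_def transition_def by blast
  show "transition \<kappa> \<kappa>' x \<in> chart_image \<kappa>'" if "x \<in> overlap \<kappa> \<kappa>'"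
    using that unfolding overlap_def transition_def by (auto simp: rep_at[OF \<kappa>])
  show "rep \<kappa> F x = rep \<kappa>' F (transition \<kappa> \<kappa>' x)" if "x \<in> overlap \<kappa> \<kappa>'"
    using that unfolding overlap_def transition_def by (auto simp: rep_at[OF \<kappa>] rep_at[OF \<kappa>'])
qed

lemma metric_inner_product: "\<kappa> \<in> A \<Longrightarrow> x \<in> chart_image \<kappa> \<Longrightarrow> inner_product_at (g \<kappa>) x"
  using metric unfolding riemannian_metric_def inner_product_at_def by blast

lemma
  assumes "isometric_immersion c A g f" "\<kappa> \<in> A"
  shows immersion_smooth: "smooth_on (chart_image \<kappa>) (rep \<kappa> f)"
    and immersion_Q4: "rep \<kappa> f x \<in> Q4 c"
    and immersion_isometric: "x \<in> chart_image \<kappa> \<Longrightarrow> amb c (dd (rep \<kappa> f) x u) (dd (rep \<kappa> f) x v) = g \<kappa> x u v"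
  using assms unfolding isometric_immersion_def rep_def by auto

lemma immersion_frame:
  assumes f: "isometric_immersion c A g f" and \<kappa>: "\<kappa> \<in> A" and x: "x \<in> chart_image \<kappa>"
  obtains V N3 N4 where "x \<in> V" "V \<subseteq> chart_image \<kappa>"
    "adapted_frame c V (rep \<kappa> f) (g \<kappa>) (gs1 (g \<kappa>)) (gs2 (g \<kappa>)) N3 N4"
  using adapted_frame_exists[OF open_image[OF \<kappa>] x immersion_smooth[OF f \<kappa>] immersion_Q4[OF f \<kappa>]
      immersion_isometric[OF f \<kappa>] metric_inner_product[OF \<kappa>]] by blast

text \<open>\<open>calH_zeros\<close> asks for some chart, while the phases are used in a given one,
  so vanishing must not depend on the chart. The coordinate change maps positive orthonormal frames
  to such frames, and \<open>nB_any_frame\<close> evaluates both sides on them.\<close>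

lemma calH_zero_transition:
  assumes f: "isometric_immersion c A g f" and \<sigma>: "\<sigma>\<^sup>2 = 1" and \<kappa>: "\<kappa> \<in> A" "\<kappa>' \<in> A"
    and x: "x \<in> overlap \<kappa> \<kappa>'"
  shows "calH_norm c (g \<kappa>) \<sigma> (rep \<kappa> f) x = 0 \<longleftrightarrow> calH_norm c (g \<kappa>') \<sigma> (rep \<kappa>' f) (transition \<kappa> \<kappa>' x) = 0"
proof -
  define F where "F = rep \<kappa> f"
  define F' where "F' = rep \<kappa>' f"
  define \<tau> where "\<tau> = transition \<kappa> \<kappa>'"
  define D where "D = overlap \<kappa> \<kappa>'"
  have D: "open D" "x \<in> D" "D \<subseteq> chart_image \<kappa>" unfolding D_def using open_overlap[OF \<kappa>] x overlap_subset by auto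
  have s\<tau>: "smooth_on D \<tau>" unfolding D_def \<tau>_def by (rule smooth_transition[OF \<kappa>])
  have \<tau>D: "\<tau> y \<in> chart_image \<kappa>'" if "y \<in> D" for y using transition_image[OF \<kappa>] that unfolding D_def \<tau>_def by blast
  have FF: "F y = F' (\<tau> y)" if "y \<in> D" for y
    using rep_transition[OF \<kappa>] that unfolding D_def \<tau>_def F_def F'_def by blast
  note sF' = immersion_smooth[OF f \<kappa>(2), folded F'_def]
  have dF: "dd F y u = dd F' (\<tau> y) (dd \<tau> y u)" if y: "y \<in> D" for y u
  proof -
    have "dd F y = dd (\<lambda>y. F' (\<tau> y)) y" by (rule dd_cong_open[OF D(1) y FF])
    then show ?thesis
      using dd_chain(1)[OF smooth_on_differentiable[OF s\<tau> y] smooth_on_differentiable[OF sF' \<tau>D[OF y]]] by simp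
  qed
  have xI: "x \<in> chart_image \<kappa>" using D by blast
  obtain V N3 N4 where V: "x \<in> V" "V \<subseteq> chart_image \<kappa>"
    and fr: "adapted_frame c V F (g \<kappa>) (gs1 (g \<kappa>)) (gs2 (g \<kappa>)) N3 N4"
    using immersion_frame[OF f \<kappa>(1) xI] unfolding F_def by metis
  obtain V' M3 M4 where V': "\<tau> x \<in> V'" "V' \<subseteq> chart_image \<kappa>'"
    and fr': "adapted_frame c V' F' (g \<kappa>') (gs1 (g \<kappa>')) (gs2 (g \<kappa>')) M3 M4"
    using immersion_frame[OF f \<kappa>(2) \<tau>D[OF D(2)]] unfolding F'_def by metis
  interpret a: adapted_frame c V F "g \<kappa>" "gs1 (g \<kappa>)" "gs2 (g \<kappa>)" N3 N4 by (rule fr)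
  interpret b: adapted_frame c V' F' "g \<kappa>'" "gs1 (g \<kappa>')" "gs2 (g \<kappa>')" M3 M4 by (rule fr')
  define L where "L = dd \<tau> x"
  have L: "linear L" unfolding L_def by (rule dd_linear[OF smooth_on_differentiable[OF s\<tau> D(2)]])
  define i j where "i = (axis 1 1 :: real^2)" and "j = (axis 2 1 :: real^2)"
  have Lu: "L u = u$1 *\<^sub>R L i + u$2 *\<^sub>R L j" for u unfolding i_def j_def by (rule linear_vec2[OF L])
  have det: "det (matrix L) = (L i)$1 * (L j)$2 - (L i)$2 * (L j)$1"
    unfolding det_2 matrix_def i_def j_def by (simp add: mult.commute)
  have pos: "0 < det (matrix L)" using det_transition[OF \<kappa> x] unfolding L_def \<tau>_def .
  have surj: "\<exists>w. L w = u" for u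
  proof -
    have "invertible (matrix L)" using pos invertible_det_nz by force
    then have "surj L" using L
      by (metis matrix_right_invertible_surjective invertible_def matrix_vector_mul(2) ext)
    then show ?thesis by (metis surjD)
  qed
  have nsp: "nspace c F' (\<tau> x) = nspace c F x"
    unfolding nspace_def dF[OF D(2)] FF[OF D(2)] L_def[symmetric] using surj by (metis (mono_tags, lifting))
  let ?u = "gs1 (g \<kappa>) x" and ?v = "gs2 (g \<kappa>) x"
  have of: "oframe (g \<kappa>') (\<tau> x) (L ?u) (L ?v)"
  proof -
    have m: "g \<kappa>' (\<tau> x) (L s) (L t) = g \<kappa> x s t" for s t
      using metric_transition[OF \<kappa> x] unfolding L_def \<tau>_def by simp
    have "(L ?u)$1 * (L ?v)$2 - (L ?u)$2 * (L ?v)$1 = det (matrix L) * (?u$1 * ?v$2 - ?u$2 * ?v$1)"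
      unfolding det by (subst (1 2 3 4) Lu) (simp add: algebra_simps)
    then show ?thesis using a.oframe[OF V(1)] pos unfolding oframe_def m by simp
  qed
  have np: "npositive F' (\<tau> x) (N3 x) (N4 x)"
  proof -
    have dL: "dd F' (\<tau> x) (L w) = (L w)$1 *\<^sub>R dd F' (\<tau> x) i + (L w)$2 *\<^sub>R dd F' (\<tau> x) j" for w
      unfolding i_def j_def by (rule linear_vec2[OF dd_linear[OF b.F_differentiable[OF V'(1)]]])
    have "vol (F x) (dd F x i) (dd F x j) (N3 x) (N4 x)
      = det (matrix L) * vol (F' (\<tau> x)) (dd F' (\<tau> x) i) (dd F' (\<tau> x) j) (N3 x) (N4 x)"
      unfolding dF[OF D(2)] FF[OF D(2)] L_def[symmetric] dL[of i] dL[of j] vol_combination_tangent det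
      by simp
    then show ?thesis
      using a.positive_N[OF V(1)] pos unfolding npositive_def i_def[symmetric] j_def[symmetric]
      by (simp add: zero_less_mult_iff)
  qed
  \<comment> \<open>The second derivative of the coordinate change enters only through a tangent
    vector, which has no product with a normal one.\<close>
  have sf: "b.sf (\<tau> x) (L s) (L t) \<xi> = a.sf x s t \<xi>" if xi: "\<xi> \<in> nspace c F x" for s t \<xi>
  proof -
    have form: "smooth_form D (\<lambda>y w. dd F' (\<tau> y) w)"
      unfolding smooth_form_def
    proof (intro conjI ballI allI)
      show "linear (dd F' (\<tau> y))" if "y \<in> D" for y
        by (rule dd_linear[OF smooth_on_differentiable[OF sF' \<tau>D[OF that]]])
      show "smooth_on D (\<lambda>y. dd F' (\<tau> y) w)" for w
        by (rule smooth_on_compose[OF D(1) open_image[OF \<kappa>(2)] _ s\<tau> smooth_on_dd[OF sF']]) (use \<tau>D in blast)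
    qed
    have "dd (\<lambda>z. dd F z t) x = dd (\<lambda>y. dd F' (\<tau> y) (dd \<tau> y t)) x"
      by (rule dd_cong_open[OF D(1,2) dF])
    then have "dd (\<lambda>z. dd F z t) x s = dd (\<lambda>y. dd F' (\<tau> y) (L t)) x s + dd F' (\<tau> x) (dd (\<lambda>y. dd \<tau> y t) x s)"
      using dd_form[OF D(1,2) form smooth_on_differentiable[OF smooth_on_dd[OF s\<tau>] D(2)], of t s]
      unfolding L_def by simp
    also have "dd (\<lambda>y. dd F' (\<tau> y) (L t)) x s = dd (\<lambda>z. dd F' z (L t)) (\<tau> x) (L s)"
      unfolding L_def
      by (rule dd_chain(1)[OF smooth_on_differentiable[OF s\<tau> D(2)]
            smooth_on_differentiable[OF smooth_on_dd[OF sF'] \<tau>D[OF D(2)]]])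
    finally have "dd (\<lambda>z. dd F z t) x s = dd (\<lambda>z. dd F' z (L t)) (\<tau> x) (L s) + dd F' (\<tau> x) (dd (\<lambda>y. dd \<tau> y t) x s)" .
    moreover have "amb c (dd F' (\<tau> x) w) \<xi> = 0" for w
    proof -
      have "\<xi> \<in> nspace c F' (\<tau> x)" using xi nsp by simp
      then have "amb c \<xi> (dd F' (\<tau> x) w) = 0" unfolding nspace_def by blast
      then show ?thesis by (simp add: amb_sym[of c _ \<xi>])
    qed
    ultimately show ?thesis unfolding a.sf_def b.sf_def by (simp add: amb_simps)
  qed
  have "a.nB \<sigma> x = b.nB \<sigma> (\<tau> x)"
    using a.nB_any_frame[OF V(1) \<sigma> a.oframe[OF V(1)] a.nspace_N[OF V(1)] a.orthonormal_N[OF V(1)] a.positive_N[OF V(1)]]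
      b.nB_any_frame[OF V'(1) \<sigma> of _ _ a.orthonormal_N[OF V(1)] np] a.nspace_N[OF V(1)]
    unfolding nsp sf[OF a.nspace_N(1)[OF V(1)]] sf[OF a.nspace_N(2)[OF V(1)]] by simp
  then show ?thesis
    using a.calH_norm_zero_iff[OF V(1) \<sigma>] b.calH_norm_zero_iff[OF V'(1) \<sigma>] unfolding F_def F'_def \<tau>_def by simp
qed

lemma calH_zeros_iff:
  assumes f: "isometric_immersion c A g f" and \<sigma>: "\<sigma>\<^sup>2 = 1" and \<kappa>: "\<kappa> \<in> A" and p: "p \<in> fst \<kappa>"
  shows "p \<in> calH_zeros c A g \<sigma> f \<longleftrightarrow> calH_norm c (g \<kappa>) \<sigma> (rep \<kappa> f) (snd \<kappa> p) = 0"
proof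
  assume "p \<in> calH_zeros c A g \<sigma> f"
  then obtain \<kappa>' where \<kappa>': "\<kappa>' \<in> A" "p \<in> fst \<kappa>'" "calH_norm c (g \<kappa>') \<sigma> (rep \<kappa>' f) (snd \<kappa>' p) = 0"
    unfolding calH_zeros_def by blast
  have "snd \<kappa> p \<in> overlap \<kappa> \<kappa>'" unfolding overlap_def using p \<kappa>' by blast
  from calH_zero_transition[OF f \<sigma> \<kappa> \<kappa>'(1) this] \<kappa>'(3)
  show "calH_norm c (g \<kappa>) \<sigma> (rep \<kappa> f) (snd \<kappa> p) = 0"
    unfolding transition_def rep_at[OF \<kappa> p] by simp
next
  assume "calH_norm c (g \<kappa>) \<sigma> (rep \<kappa> f) (snd \<kappa> p) = 0"
  then show "p \<in> calH_zeros c A g \<sigma> f" unfolding calH_zeros_def using \<kappa> p by blast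
qed

end

section \<open>Phase functions and the structure equations\<close>

lemma cot_half_injective:
  assumes "sin (a / 2) \<noteq> 0" "sin (b / 2) \<noteq> 0" "cot (a / 2) = cot (b / 2)"
  shows "cis a = cis (b :: real)"
proof -
  \<comment> \<open>The half-angle formulas: cosine and sine are rational functions of the cotangent
    of the half angle.\<close>
  have *: "cos t = ((cot (t / 2))\<^sup>2 - 1) / ((cot (t / 2))\<^sup>2 + 1) \<and> sin t = 2 * cot (t / 2) / ((cot (t / 2))\<^sup>2 + 1)"
    if s: "sin (t / 2) \<noteq> 0" for t :: real
  proof -
    let ?s = "sin (t / 2)" and ?c = "cos (t / 2)"
    have 1: "?s\<^sup>2 + ?c\<^sup>2 = 1" by simp
    have "(cot (t / 2))\<^sup>2 + 1 = 1 / ?s\<^sup>2" "(cot (t / 2))\<^sup>2 - 1 = (?c\<^sup>2 - ?s\<^sup>2) / ?s\<^sup>2"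
      unfolding cot_def using s 1 by (simp_all add: field_simps power_divide)
    moreover have "cos t = ?c\<^sup>2 - ?s\<^sup>2" "sin t = 2 * ?s * ?c"
      using cos_double[of "t / 2"] sin_double[of "t / 2"] by simp_all
    ultimately show ?thesis using s by (simp add: cot_def power2_eq_square)
  qed
  show ?thesis using *[OF assms(1)] *[OF assms(2)] assms(3) by (simp add: complex_eq_iff)
qed

lemma half_sine_pos: "0 < t \<Longrightarrow> t < 2 * pi \<Longrightarrow> sin (t / 2) \<noteq> 0"
  using sin_gt_zero[of "t / 2"] by simp

text \<open>What is kept of the moduli circle: immersions with phases over an index set, two of
  which differ at any given point off the zeros. This pointwise separation is what the integrability
  argument needs.\<close>

locale phase_family = riemannian_surface A g
  for A :: "('m::{t2_space,second_countable_topology}) chart set" and g :: "'m chart \<Rightarrow> coord_metric" +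
  fixes f :: "'m \<Rightarrow> real^5" and c \<sigma> :: real and Ft :: "real \<Rightarrow> 'm \<Rightarrow> real^5" and \<theta> :: "real \<Rightarrow> 'm \<Rightarrow> real" and I :: "real set"
  assumes immersion: "isometric_immersion c A g f" and sign: "\<sigma> = 1 \<or> \<sigma> = -1"
    and immersion_t: "t \<in> I \<Longrightarrow> isometric_immersion c A g (Ft t)"
    and phase: "t \<in> I \<Longrightarrow> phase_of c A g \<sigma> f (Ft t) (\<theta> t)"
    and distinct_phases: "p \<notin> calH_zeros c A g \<sigma> f \<Longrightarrow> \<exists>t\<in>I. \<exists>t'\<in>I. cis (\<theta> t p) \<noteq> cis (\<theta> t' p)"
    and tension: "\<kappa> \<in> A \<Longrightarrow> x \<in> chart_image \<kappa> \<Longrightarrow> vtension c (g \<kappa>) \<sigma> (rep \<kappa> f) x \<noteq> 0"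
begin

lemma sign_square: "\<sigma>\<^sup>2 = 1"
  using sign by auto

lemma zeros_chart:
  assumes \<kappa>: "\<kappa> \<in> A" and x: "x \<in> chart_image \<kappa>"
  shows "x \<in> snd \<kappa> ` (fst \<kappa> - calH_zeros c A g \<sigma> f) \<longleftrightarrow> calH_norm c (g \<kappa>) \<sigma> (rep \<kappa> f) x \<noteq> 0"
proof -
  obtain p where p: "p \<in> fst \<kappa>" "x = snd \<kappa> p" using x by blast
  have inj: "inj_on (snd \<kappa>) (fst \<kappa>)"
    using chart_homeomorphism[OF \<kappa>] unfolding homeomorphism_def by (metis inj_onI)
  have "x \<in> snd \<kappa> ` (fst \<kappa> - calH_zeros c A g \<sigma> f) \<longleftrightarrow> p \<notin> calH_zeros c A g \<sigma> f"
    using inj p by (auto dest: inj_onD)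
  then show ?thesis using calH_zeros_iff[OF immersion sign_square \<kappa> p(1)] p(2) by simp
qed

abbreviation phase_cot :: "real \<Rightarrow> 'm chart \<Rightarrow> real^2 \<Rightarrow> real" where
  "phase_cot t \<kappa> \<equiv> \<lambda>z. cot (rep \<kappa> (\<theta> t) z / 2)"

end

locale phase_chart = phase_family A g f c \<sigma> Ft \<theta> I + a: adapted_frame c V "rep \<kappa> f" "g \<kappa>" e1 e2 N3 N4
  for A :: "('m::{t2_space,second_countable_topology}) chart set" and g f c \<sigma> Ft \<theta> I V \<kappa> e1 e2 N3 N4 +
  assumes chart: "\<kappa> \<in> A" and V_chart: "V \<subseteq> chart_image \<kappa>"
begin

lemma zeros_frame: "y \<in> V \<Longrightarrow> y \<in> snd \<kappa> ` (fst \<kappa> - calH_zeros c A g \<sigma> f) \<longleftrightarrow> a.nB \<sigma> y \<noteq> 0"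
  using zeros_chart[OF chart] a.calH_norm_zero_iff[OF _ sign_square] V_chart by blast

text \<open>T carries the normal frame of f to an adapted one of \<open>Ft t\<close>. In these
  frames, parallelism and TH = H' become the hypotheses of \<open>frame_pair\<close>, and the
  relation between the Hopf differentials becomes a rotation of B.\<close>

lemma phase_derivative:
  assumes t: "t \<in> I" and y: "y \<in> V" and nz: "a.nB \<sigma> y \<noteq> 0"
  shows "phase_cot t \<kappa> differentiable (at y)" and "sin (rep \<kappa> (\<theta> t) y / 2) \<noteq> 0"
    and "dd (phase_cot t \<kappa>) y u = phase_cot t \<kappa> y * a.w1 \<sigma> y u - a.w2 \<sigma> y u"
proof -
  define F' where "F' = rep \<kappa> (Ft t)"
  note it = immersion_t[OF t]
  obtain T where T: "same_mean_curv_via c A g f (Ft t) T"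
    and pull: "\<And>x X. x \<in> snd \<kappa> ` (fst \<kappa> - calH_zeros c A g \<sigma> f) \<Longrightarrow>
      pulled_hopf c g \<sigma> f (Ft t) T \<kappa> x X = cis (- \<sigma> * rep \<kappa> (\<theta> t) x) *s hopf_pm c (g \<kappa>) \<sigma> (rep \<kappa> f) x X"
    using phase[OF t] chart unfolding phase_of_def by blast
  have range\<theta>: "0 < \<theta> t p \<and> \<theta> t p < 2 * pi" if "p \<notin> calH_zeros c A g \<sigma> f" for p
    using phase[OF t] that unfolding phase_of_def by blast
  have smooth\<theta>: "smooth_on (snd \<kappa> ` (fst \<kappa> - calH_zeros c A g \<sigma> f)) (rep \<kappa> (\<theta> t))"
    using phase[OF t] chart unfolding phase_of_def by blast
  define S where "S = rep \<kappa> T"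
  have par: "parallel_bundle_isometry c A f (Ft t) T"
    and mc: "\<And>x. x \<in> chart_image \<kappa> \<Longrightarrow> S x (mean_curv c (g \<kappa>) (rep \<kappa> f) x) = mean_curv c (g \<kappa>) F' x"
    using T chart unfolding same_mean_curv_via_def S_def F'_def by auto
  note parc = par[unfolded parallel_bundle_isometry_def Let_def, rule_format, OF chart, folded F'_def S_def]
  have yc: "z \<in> chart_image \<kappa>" if "z \<in> V" for z using V_chart that by blast
  have bij: "bij_betw (S z) (nspace c (rep \<kappa> f) z) (nspace c F' z)" if "z \<in> V" for z using parc yc[OF that] by blast
  have Sadd: "S z (\<xi> + \<eta>) = S z \<xi> + S z \<eta>" if "z \<in> V" "\<xi> \<in> nspace c (rep \<kappa> f) z" "\<eta> \<in> nspace c (rep \<kappa> f) z" for z \<xi> \<eta>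
    using parc yc[OF that(1)] that by blast
  have Sscale: "S z (r *\<^sub>R \<xi>) = r *\<^sub>R S z \<xi>" if "z \<in> V" "\<xi> \<in> nspace c (rep \<kappa> f) z" for z \<xi> r
    using parc yc[OF that(1)] that by blast
  have Samb: "amb c (S z \<xi>) (S z \<eta>) = amb c \<xi> \<eta>" if "z \<in> V" "\<xi> \<in> nspace c (rep \<kappa> f) z" "\<eta> \<in> nspace c (rep \<kappa> f) z" for z \<xi> \<eta>
    using parc yc[OF that(1)] that by blast
  have Spos: "npositive F' z (S z \<xi>) (S z \<eta>)"
    if "z \<in> V" "\<xi> \<in> nspace c (rep \<kappa> f) z" "\<eta> \<in> nspace c (rep \<kappa> f) z" "npositive (rep \<kappa> f) z \<xi> \<eta>" for z \<xi> \<eta>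
    using parc yc[OF that(1)] that by blast
  have Ssmooth: "smooth_on V (\<lambda>y. S y (\<xi> y))" and Sconn: "\<And>x u. x \<in> V \<Longrightarrow> nconn c F' (\<lambda>y. S y (\<xi> y)) x u = S x (nconn c (rep \<kappa> f) \<xi> x u)"
    if "smooth_on V \<xi>" "\<And>y. y \<in> V \<Longrightarrow> \<xi> y \<in> nspace c (rep \<kappa> f) y" for \<xi>
    using parc that a.open_V V_chart by blast+
  note nN = a.nspace_N
  define M3 where "M3 z = S z (N3 z)" for z
  define M4 where "M4 z = S z (N4 z)" for z
  have M: "S z (p *\<^sub>R N3 z + q *\<^sub>R N4 z) = p *\<^sub>R M3 z + q *\<^sub>R M4 z" if z: "z \<in> V" for z p q
    unfolding M3_def M4_def using Sadd[OF z] Sscale[OF z] nN[OF z] nspace_linear(4) by simp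
  interpret b: adapted_frame c V F' "g \<kappa>" e1 e2 M3 M4
  proof
    show "open V" by (rule a.open_V)
    show "smooth_on V F'" unfolding F'_def by (rule smooth_on_subset[OF immersion_smooth[OF it chart] V_chart])
    show "smooth_on V e1" "smooth_on V e2" by (rule a.smooth_e)+
    show "smooth_on V M3" "smooth_on V M4"
      unfolding M3_def M4_def by (rule Ssmooth, rule a.smooth_N, erule nN)+
    fix z assume z: "z \<in> V"
    show "F' z \<in> Q4 c" unfolding F'_def by (rule immersion_Q4[OF it chart])
    show "amb c (dd F' z u) (dd F' z v) = g \<kappa> z u v" for u v
      unfolding F'_def by (rule immersion_isometric[OF it chart yc[OF z]])
    show "inner_product_at (g \<kappa>) z" "oframe (g \<kappa>) z (e1 z) (e2 z)" by (rule a.ip[OF z], rule a.oframe[OF z])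
    show "M3 z \<in> nspace c F' z" "M4 z \<in> nspace c F' z"
      unfolding M3_def M4_def using bij_betwE[OF bij[OF z]] nN[OF z] by auto
    show "amb c (M3 z) (M3 z) = 1" "amb c (M4 z) (M4 z) = 1" "amb c (M3 z) (M4 z) = 0"
      unfolding M3_def M4_def using Samb[OF z] nN[OF z] a.orthonormal_N[OF z] by auto
    show "npositive F' z (M3 z) (M4 z)"
      unfolding M3_def M4_def using Spos[OF z] nN[OF z] a.positive_N[OF z] by blast
  qed
  interpret fp: frame_pair c V "rep \<kappa> f" "g \<kappa>" e1 e2 N3 N4 F' M3 M4
  proof unfold_locales
    fix z assume z: "z \<in> V"
    show "amb c (dd M3 z u) (M4 z) = amb c (dd N3 z u) (N4 z)" for u
    proof -
      have "amb c (dd M3 z u) (M4 z) *\<^sub>R M4 z = nconn c F' M3 z u"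
        unfolding nconn_def b.nproj_dX[OF b.tfield_frame(3) z] b.amb_dN3[OF z] by simp
      also have "\<dots> = S z (nconn c (rep \<kappa> f) N3 z u)"
        using Sconn[OF a.smooth_N(1) nN(1) z, of u] unfolding M3_def[abs_def] by simp
      also have "nconn c (rep \<kappa> f) N3 z u = amb c (dd N3 z u) (N4 z) *\<^sub>R N4 z"
        unfolding nconn_def a.nproj_dX[OF a.tfield_frame(3) z] a.amb_dN3[OF z] by simp
      also have "S z \<dots> = amb c (dd N3 z u) (N4 z) *\<^sub>R M4 z" unfolding M4_def by (rule Sscale[OF z nN(2)[OF z]])
      finally show ?thesis using b.combination_eq_iff[OF z, of 0 _ 0] by simp
    qed
    have "b.H3 z *\<^sub>R M3 z + b.H4 z *\<^sub>R M4 z = a.H3 z *\<^sub>R M3 z + a.H4 z *\<^sub>R M4 z"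
      using mc[OF yc[OF z]] unfolding b.mean_curv_eq[OF z] a.mean_curv_eq[OF z] M[OF z] by simp
    then show "b.H3 z = a.H3 z" "b.H4 z = a.H4 z" unfolding b.combination_eq_iff[OF z] by auto
  qed
  define W where "W = {z \<in> V. a.nB \<sigma> z \<noteq> 0}"
  have W: "open W" "W \<subseteq> V" "y \<in> W" using a.open_nonzero y nz unfolding W_def by auto
  have rot: "b.B3 \<sigma> z = cos (rep \<kappa> (\<theta> t) z) * a.B3 \<sigma> z - sin (rep \<kappa> (\<theta> t) z) * a.B4 \<sigma> z \<and>
    b.B4 \<sigma> z = cos (rep \<kappa> (\<theta> t) z) * a.B4 \<sigma> z + sin (rep \<kappa> (\<theta> t) z) * a.B3 \<sigma> z" if zW: "z \<in> W" for z
  proof -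
    have z: "z \<in> V" "a.nB \<sigma> z \<noteq> 0" using zW unfolding W_def by auto
    define L where "L = inv_into (nspace c (rep \<kappa> f) z) (S z)"
    have Linv: "L (p *\<^sub>R M3 z + q *\<^sub>R M4 z) = p *\<^sub>R N3 z + q *\<^sub>R N4 z" for p q
      unfolding L_def M[OF z(1), symmetric]
      using inv_into_f_f[OF bij_betw_imp_inj_on[OF bij[OF z(1)]]] a.nspace_combination[OF z(1)] by blast
    have cext: "cext L (cvec p q) = cvec (L p) (L q)" for p q
      unfolding cext_def cvec_def by simp
    let ?th = "rep \<kappa> (\<theta> t) z"
    \<comment> \<open>The factor cis (- \<sigma> \<theta>) meets an imaginary part that itself
      carries \<sigma>, so both signs give a rotation by \<theta>.\<close>
    have trig: "cos (\<sigma> * ?th) = cos ?th" "\<sigma> * sin (\<sigma> * ?th) = sin ?th" using sign by auto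
    have "z \<in> snd \<kappa> ` (fst \<kappa> - calH_zeros c A g \<sigma> f)" using zeros_frame z by blast
    from pull[OF this, of "e1 z"]
    have eq: "cvec ((b.B3 \<sigma> z / 8) *\<^sub>R N3 z + (b.B4 \<sigma> z / 8) *\<^sub>R N4 z)
        ((- \<sigma> * b.B4 \<sigma> z / 8) *\<^sub>R N3 z + (\<sigma> * b.B3 \<sigma> z / 8) *\<^sub>R N4 z)
      = cis (- \<sigma> * ?th) *s cvec ((a.B3 \<sigma> z / 8) *\<^sub>R N3 z + (a.B4 \<sigma> z / 8) *\<^sub>R N4 z)
        ((- \<sigma> * a.B4 \<sigma> z / 8) *\<^sub>R N3 z + (\<sigma> * a.B3 \<sigma> z / 8) *\<^sub>R N4 z)"
      unfolding pulled_hopf_def F'_def[symmetric] S_def[symmetric] L_def[symmetric]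
        b.hopf_pm_eq[OF z(1) sign_square] cext Linv
      unfolding a.hopf_pm_eq[OF z(1) sign_square] .
    have re: "(\<chi> k. Re ((x *s cvec p q) $ k)) = Re x *\<^sub>R p - Im x *\<^sub>R q" for x p q
      unfolding cvec_def by (simp add: vec_eq_iff)
    have re1: "(\<chi> k. Re (cvec p q $ k)) = p" for p q
      unfolding cvec_def by (simp add: vec_eq_iff)
    have "(b.B3 \<sigma> z / 8) *\<^sub>R N3 z + (b.B4 \<sigma> z / 8) *\<^sub>R N4 z
      = cos (\<sigma> * ?th) *\<^sub>R ((a.B3 \<sigma> z / 8) *\<^sub>R N3 z + (a.B4 \<sigma> z / 8) *\<^sub>R N4 z)
        + sin (\<sigma> * ?th) *\<^sub>R ((- \<sigma> * a.B4 \<sigma> z / 8) *\<^sub>R N3 z + (\<sigma> * a.B3 \<sigma> z / 8) *\<^sub>R N4 z)"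
      using arg_cong[OF eq, of "\<lambda>w. \<chi> k. Re (w $ k)"] unfolding re re1 by simp
    also have "\<dots> = ((cos ?th * a.B3 \<sigma> z - sin ?th * a.B4 \<sigma> z) / 8) *\<^sub>R N3 z
        + ((cos ?th * a.B4 \<sigma> z + sin ?th * a.B3 \<sigma> z) / 8) *\<^sub>R N4 z"
      unfolding trig(1) trig(2)[symmetric] by (simp add: algebra_simps add_divide_distrib diff_divide_distrib)
    finally show ?thesis unfolding a.combination_eq_iff[OF z(1)] by simp
  qed
  have y0: "y \<in> snd \<kappa> ` (fst \<kappa> - calH_zeros c A g \<sigma> f)" using zeros_frame y nz by blast
  have d\<theta>: "rep \<kappa> (\<theta> t) differentiable (at y)" by (rule smooth_on_differentiable[OF smooth\<theta> y0])
  obtain p where "p \<in> fst \<kappa>" "p \<notin> calH_zeros c A g \<sigma> f" "y = snd \<kappa> p" using y0 by blast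
  then show s0: "sin (rep \<kappa> (\<theta> t) y / 2) \<noteq> 0"
    using half_sine_pos range\<theta>[of p] rep_at[OF chart, of p "\<theta> t"] by simp
  show "phase_cot t \<kappa> differentiable (at y)"
    by (rule fp.phase_equation(1)[OF sign_square W d\<theta> s0 nz]) (use rot in auto)
  show "dd (phase_cot t \<kappa>) y u = phase_cot t \<kappa> y * a.w1 \<sigma> y u - a.w2 \<sigma> y u"
    by (rule fp.phase_equation(2)[OF sign_square W d\<theta> s0 nz]) (use rot in auto)
qed

text \<open>Equality of the mixed derivatives of \<open>cot (\<theta>/2)\<close> is an affine condition on its value, so two
  different values separate it.\<close>
lemma structure_w:
  assumes y: "y \<in> V" and nz: "a.nB \<sigma> y \<noteq> 0"
  shows "dd (\<lambda>z. a.w1 \<sigma> z v) y u - dd (\<lambda>z. a.w1 \<sigma> z u) y v = 0"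
    and "dd (\<lambda>z. a.w2 \<sigma> z v) y u - dd (\<lambda>z. a.w2 \<sigma> z u) y v = a.w1 \<sigma> y u * a.w2 \<sigma> y v - a.w1 \<sigma> y v * a.w2 \<sigma> y u"
proof -
  define W where "W = {z \<in> V. a.nB \<sigma> z \<noteq> 0}"
  have W: "open W" "W \<subseteq> V" "y \<in> W" using a.open_nonzero y nz unfolding W_def by auto
  have Wnz: "z \<in> V" "a.nB \<sigma> z \<noteq> 0" if "z \<in> W" for z using that unfolding W_def by auto
  have forms: "smooth_form W (a.w1 \<sigma>)" "smooth_form W (a.w2 \<sigma>)"
    by (rule a.smooth_forms_w; use W W_def in blast)+
  have dw: "(\<lambda>z. a.w1 \<sigma> z u) differentiable (at y)" "(\<lambda>z. a.w2 \<sigma> z u) differentiable (at y)" for u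
    using forms smooth_form_smooth smooth_on_differentiable W(3) by blast+
  define d1 where "d1 = dd (\<lambda>z. a.w1 \<sigma> z v) y u - dd (\<lambda>z. a.w1 \<sigma> z u) y v"
  define d2 where "d2 = dd (\<lambda>z. a.w2 \<sigma> z v) y u - dd (\<lambda>z. a.w2 \<sigma> z u) y v"
  have key: "phase_cot t \<kappa> y * d1 = d2 - (a.w1 \<sigma> y u * a.w2 \<sigma> y v - a.w1 \<sigma> y v * a.w2 \<sigma> y u)" if t: "t \<in> I" for t
  proof -
    define C where "C = phase_cot t \<kappa>"
    have dC: "C differentiable (at z)" if "z \<in> W" for z
      unfolding C_def using phase_derivative(1)[OF t Wnz[OF that]] .
    have ddC: "dd C z w = C z * a.w1 \<sigma> z w - a.w2 \<sigma> z w" if "z \<in> W" for z w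
      unfolding C_def using phase_derivative(3)[OF t Wnz[OF that]] .
    have dif: "(\<lambda>z. dd C z w) differentiable (at y)" for w
      by (rule differentiable_cong_open[OF W(1,3) ddC[symmetric]])
        (auto intro!: differentiable_diff differentiable_bilinear[OF bounded_bilinear_mult] dC W dw)
    have d2C: "dd (\<lambda>z. dd C z w) y w' = C y * dd (\<lambda>z. a.w1 \<sigma> z w) y w' + dd C y w' * a.w1 \<sigma> y w - dd (\<lambda>z. a.w2 \<sigma> z w) y w'" for w w'
    proof -
      have "dd (\<lambda>z. dd C z w) y = dd (\<lambda>z. C z * a.w1 \<sigma> z w - a.w2 \<sigma> z w) y" by (rule dd_cong_open[OF W(1,3) ddC])
      then show ?thesis
        by (simp add: dd_minus_fun dd_mult differentiable_bilinear[OF bounded_bilinear_mult] dC W(3) dw)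
    qed
    have "dd (\<lambda>z. dd C z u) y v = dd (\<lambda>z. dd C z v) y u"
      by (rule dd_symmetric_real[OF W(1,3) dC dif dif])
    moreover have "phase_cot t \<kappa> y = C y" unfolding C_def ..
    ultimately show ?thesis
      unfolding d2C ddC[OF W(3)] d1_def d2_def by (simp add: algebra_simps)
  qed
  obtain p where p: "p \<in> fst \<kappa>" "p \<notin> calH_zeros c A g \<sigma> f" "y = snd \<kappa> p" using zeros_frame[OF y] nz by blast
  obtain t t' where t: "t \<in> I" "t' \<in> I" "cis (\<theta> t p) \<noteq> cis (\<theta> t' p)" using distinct_phases[OF p(2)] by blast
  have "phase_cot t \<kappa> y \<noteq> phase_cot t' \<kappa> y"
    using cot_half_injective[OF phase_derivative(2)[OF t(1) y nz] phase_derivative(2)[OF t(2) y nz]] t(3)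
    unfolding p(3) rep_at[OF chart p(1)] by blast
  moreover have "(phase_cot t \<kappa> y - phase_cot t' \<kappa> y) * d1 = 0"
    unfolding left_diff_distrib key[OF t(1)] key[OF t(2)] by simp
  ultimately have d1: "d1 = 0" by simp
  then have d2: "d2 = a.w1 \<sigma> y u * a.w2 \<sigma> y v - a.w1 \<sigma> y v * a.w2 \<sigma> y u" using key[OF t(1)] by simp
  show "dd (\<lambda>z. a.w1 \<sigma> z v) y u - dd (\<lambda>z. a.w1 \<sigma> z u) y v = 0"
    "dd (\<lambda>z. a.w2 \<sigma> z v) y u - dd (\<lambda>z. a.w2 \<sigma> z u) y v = a.w1 \<sigma> y u * a.w2 \<sigma> y v - a.w1 \<sigma> y v * a.w2 \<sigma> y u"
    using d1 d2 unfolding d1_def d2_def by auto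
qed

lemma Z_nonzero: "y \<in> V \<Longrightarrow> (a.Z3 \<sigma> y)\<^sup>2 + (a.Z4 \<sigma> y)\<^sup>2 \<noteq> 0"
  using a.vtension_nonzero[OF _ sign_square] tension[OF chart] V_chart by blast

text \<open>The phases give the structure equations only off the zeros of B, but this is all that
  \<open>B_nonzero\<close> asks for.\<close>

lemma nB_nonzero: "y \<in> V \<Longrightarrow> a.nB \<sigma> y \<noteq> 0"
  by (rule a.B_nonzero[OF sign_square Z_nonzero structure_w])

lemma smooth_forms: "smooth_form V (a.w1 \<sigma>)" "smooth_form V (a.w2 \<sigma>)"
  by (rule a.smooth_forms_w; use nB_nonzero a.open_V in blast)+

lemma hat_metric_forms:
  assumes y: "y \<in> V"
  shows "hat_metric c g \<sigma> f \<kappa> y u v = a.w1 \<sigma> y u * a.w1 \<sigma> y v + a.w2 \<sigma> y u * a.w2 \<sigma> y v"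
  unfolding hat_metric_def by (rule a.hat_metric_eq[OF y sign_square nB_nonzero[OF y]])

lemma hat_metric_pos:
  assumes y: "y \<in> V" and u: "u \<noteq> 0"
  shows "0 < hat_metric c g \<sigma> f \<kappa> y u u"
proof -
  have "0 \<le> (a.Z3 \<sigma> y)\<^sup>2 + (a.Z4 \<sigma> y)\<^sup>2" by simp
  then have "0 < (a.Z3 \<sigma> y)\<^sup>2 + (a.Z4 \<sigma> y)\<^sup>2" using Z_nonzero[OF y] by (metis order_less_le)
  then have "0 < vtension_sq c (g \<kappa>) \<sigma> (rep \<kappa> f) y"
    unfolding a.vtension_sq_eq[OF y sign_square] by (simp only: mult_pos_pos zero_less_numeral)
  moreover have "calH_norm c (g \<kappa>) \<sigma> (rep \<kappa> f) y \<noteq> 0"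
    using nB_nonzero[OF y] a.calH_norm_zero_iff[OF y sign_square] by blast
  ultimately show ?thesis
    unfolding hat_metric_def using inner_product_at_pos[OF a.ip[OF y] u] by simp
qed

end

context phase_family
begin

lemma chart_frame:
  assumes \<kappa>: "\<kappa> \<in> A" and x: "x \<in> chart_image \<kappa>"
  obtains V N3 N4 where "x \<in> V" "phase_chart A g f c \<sigma> Ft \<theta> I V \<kappa> (gs1 (g \<kappa>)) (gs2 (g \<kappa>)) N3 N4"
proof -
  obtain V N3 N4 where V: "x \<in> V" "V \<subseteq> chart_image \<kappa>"
    and fr: "adapted_frame c V (rep \<kappa> f) (g \<kappa>) (gs1 (g \<kappa>)) (gs2 (g \<kappa>)) N3 N4"
    using immersion_frame[OF immersion \<kappa> x] by metis
  have "phase_chart A g f c \<sigma> Ft \<theta> I V \<kappa> (gs1 (g \<kappa>)) (gs2 (g \<kappa>)) N3 N4"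
    by (intro phase_chart.intro phase_chart_axioms.intro phase_family_axioms fr \<kappa> V(2))
  then show ?thesis using that V(1) by blast
qed

lemma gauss_curvature_hat:
  assumes \<kappa>: "\<kappa> \<in> A" and x: "x \<in> chart_image \<kappa>"
  shows "gauss_curvature (hat_metric c g \<sigma> f \<kappa>) x = -1"
proof -
  obtain V N3 N4 where V: "x \<in> V" and pc: "phase_chart A g f c \<sigma> Ft \<theta> I V \<kappa> (gs1 (g \<kappa>)) (gs2 (g \<kappa>)) N3 N4"
    using chart_frame[OF \<kappa> x] .
  interpret pc: phase_chart A g f c \<sigma> Ft \<theta> I V \<kappa> "gs1 (g \<kappa>)" "gs2 (g \<kappa>)" N3 N4 by (rule pc)
  define w1 where "w1 = pc.a.w1 \<sigma>"
  define w2 where "w2 = pc.a.w2 \<sigma>"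
  note forms = pc.smooth_forms[folded w1_def w2_def]
  note hat = pc.hat_metric_forms[folded w1_def w2_def]
  have nondeg: "w1 y u \<noteq> 0 \<or> w2 y u \<noteq> 0" if "y \<in> V" "u \<noteq> 0" for y u
    using pc.hat_metric_pos[OF that] unfolding hat[OF that(1)] by auto
  have s: "dd (\<lambda>z. w1 z v) y u - dd (\<lambda>z. w1 z u) y v = 0"
    "dd (\<lambda>z. w2 z v) y u - dd (\<lambda>z. w2 z u) y v = w1 y u * w2 y v - w1 y v * w2 y u" if "y \<in> V" for y u v
    unfolding w1_def w2_def by (rule pc.structure_w[OF that pc.nB_nonzero[OF that]])+
  \<comment> \<open>The connection form is w2 itself: dw1 = 0 = w2 \<and> w2 and dw2 = w1 \<and> w2
    = - w2 \<and> w1. Its derivative is therefore the area form, whence the curvature -1.\<close>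
  have K: "gauss_curvature (hat_metric c g \<sigma> f \<kappa>) x * (w1 x u * w2 x v - w1 x v * w2 x u)
    = - (dd (\<lambda>z. w2 z v) x u - dd (\<lambda>z. w2 z u) x v)" for u v
    by (rule gauss_curvature_coframe[OF pc.a.open_V V forms forms(2) hat nondeg]) (simp_all add: s)
  let ?i = "axis 1 1 :: real^2" and ?j = "axis 2 1 :: real^2"
  have "w1 x ?i * w2 x ?j - w1 x ?j * w2 x ?i \<noteq> 0"
    by (rule coframe_det_nonzero[OF smooth_form_linear[OF forms(1) V] smooth_form_linear[OF forms(2) V] nondeg[OF V]])
  moreover have "gauss_curvature (hat_metric c g \<sigma> f \<kappa>) x * (w1 x ?i * w2 x ?j - w1 x ?j * w2 x ?i)
    = (-1) * (w1 x ?i * w2 x ?j - w1 x ?j * w2 x ?i)"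
    unfolding K s[OF V] by simp
  ultimately show ?thesis using mult_right_cancel by blast
qed

text \<open>The phase is a function on M, so the affine equations in the two charts have the same
  left side. Two different values of the cotangent then match w1 and w2 separately, without any
  comparison of the frames or of B and Z.\<close>

lemma hat_metric_transition:
  assumes \<kappa>: "\<kappa> \<in> A" "\<kappa>' \<in> A" and x: "x \<in> overlap \<kappa> \<kappa>'"
  shows "hat_metric c g \<sigma> f \<kappa> x u v = hat_metric c g \<sigma> f \<kappa>' (transition \<kappa> \<kappa>' x)
    (dd (transition \<kappa> \<kappa>') x u) (dd (transition \<kappa> \<kappa>') x v)"
proof -
  define \<tau> where "\<tau> = transition \<kappa> \<kappa>'"
  have x': "\<tau> x \<in> chart_image \<kappa>'" unfolding \<tau>_def by (rule transition_image[OF \<kappa> x])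
  have xc: "x \<in> chart_image \<kappa>" using overlap_subset x by blast
  obtain V N3 N4 where V: "x \<in> V" and pc: "phase_chart A g f c \<sigma> Ft \<theta> I V \<kappa> (gs1 (g \<kappa>)) (gs2 (g \<kappa>)) N3 N4"
    using chart_frame[OF \<kappa>(1) xc] .
  obtain V' M3 M4 where V': "\<tau> x \<in> V'" and pc': "phase_chart A g f c \<sigma> Ft \<theta> I V' \<kappa>' (gs1 (g \<kappa>')) (gs2 (g \<kappa>')) M3 M4"
    using chart_frame[OF \<kappa>(2) x'] .
  interpret p: phase_chart A g f c \<sigma> Ft \<theta> I V \<kappa> "gs1 (g \<kappa>)" "gs2 (g \<kappa>)" N3 N4 by (rule pc)
  interpret p': phase_chart A g f c \<sigma> Ft \<theta> I V' \<kappa>' "gs1 (g \<kappa>')" "gs2 (g \<kappa>')" M3 M4 by (rule pc')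
  have d\<tau>: "\<tau> differentiable (at x)" unfolding \<tau>_def by (rule smooth_on_differentiable[OF smooth_transition[OF \<kappa>] x])
  have eq: "phase_cot t \<kappa> x * p.a.w1 \<sigma> x w - p.a.w2 \<sigma> x w
      = phase_cot t \<kappa> x * p'.a.w1 \<sigma> (\<tau> x) (dd \<tau> x w) - p'.a.w2 \<sigma> (\<tau> x) (dd \<tau> x w)" if t: "t \<in> I" for t w
  proof -
    have r: "phase_cot t \<kappa> z = phase_cot t \<kappa>' (\<tau> z)" if "z \<in> overlap \<kappa> \<kappa>'" for z
      unfolding \<tau>_def using rep_transition[OF \<kappa> that, of "\<theta> t"] by simp
    have "dd (phase_cot t \<kappa>) x = dd (\<lambda>z. phase_cot t \<kappa>' (\<tau> z)) x"
      by (rule dd_cong_open[OF open_overlap[OF \<kappa>] x r])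
    then have "dd (phase_cot t \<kappa>) x w = dd (phase_cot t \<kappa>') (\<tau> x) (dd \<tau> x w)"
      using dd_chain(1)[OF d\<tau> p'.phase_derivative(1)[OF t V' p'.nB_nonzero[OF V']]] by simp
    then show ?thesis
      unfolding p.phase_derivative(3)[OF t V p.nB_nonzero[OF V]] p'.phase_derivative(3)[OF t V' p'.nB_nonzero[OF V']]
      using r[OF x] by simp
  qed
  obtain q where q: "q \<in> fst \<kappa>" "q \<notin> calH_zeros c A g \<sigma> f" "x = snd \<kappa> q"
    using p.zeros_frame[OF V] p.nB_nonzero[OF V] by blast
  obtain t t' where t: "t \<in> I" "t' \<in> I" "cis (\<theta> t q) \<noteq> cis (\<theta> t' q)" using distinct_phases[OF q(2)] by blast
  have ne: "phase_cot t \<kappa> x \<noteq> phase_cot t' \<kappa> x"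
    using cot_half_injective[OF p.phase_derivative(2)[OF t(1) V p.nB_nonzero[OF V]]
        p.phase_derivative(2)[OF t(2) V p.nB_nonzero[OF V]]] t(3)
    unfolding q(3) rep_at[OF \<kappa>(1) q(1)] by blast
  have w: "p.a.w1 \<sigma> x w = p'.a.w1 \<sigma> (\<tau> x) (dd \<tau> x w)" "p.a.w2 \<sigma> x w = p'.a.w2 \<sigma> (\<tau> x) (dd \<tau> x w)" for w
  proof -
    have "(phase_cot t \<kappa> x - phase_cot t' \<kappa> x) * (p.a.w1 \<sigma> x w - p'.a.w1 \<sigma> (\<tau> x) (dd \<tau> x w)) = 0"
      using eq[OF t(1), of w] eq[OF t(2), of w] by algebra
    then show "p.a.w1 \<sigma> x w = p'.a.w1 \<sigma> (\<tau> x) (dd \<tau> x w)" using ne by simp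
    then show "p.a.w2 \<sigma> x w = p'.a.w2 \<sigma> (\<tau> x) (dd \<tau> x w)" using eq[OF t(1), of w] by simp
  qed
  show ?thesis
    unfolding \<tau>_def[symmetric] p.hat_metric_forms[OF V] p'.hat_metric_forms[OF V'] w ..
qed

lemma riemannian_metric_hat: "riemannian_metric A (hat_metric c g \<sigma> f)"
  unfolding riemannian_metric_def
proof (intro conjI ballI allI impI)
  fix \<kappa> x assume \<kappa>: "\<kappa> \<in> A" and x: "x \<in> chart_image \<kappa>"
  note ip = metric_inner_product[OF \<kappa> x]
  show "bilinear (hat_metric c g \<sigma> f \<kappa> x)"
    unfolding bilinear_def hat_metric_def
    by (auto intro!: linearI simp: inner_product_at_simps[OF ip] algebra_simps add_divide_distrib)
  show "hat_metric c g \<sigma> f \<kappa> x u v = hat_metric c g \<sigma> f \<kappa> x v u" for u v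
    unfolding hat_metric_def using inner_product_at_sym[OF ip, of u v] by simp
  obtain V N3 N4 where V: "x \<in> V" and pc: "phase_chart A g f c \<sigma> Ft \<theta> I V \<kappa> (gs1 (g \<kappa>)) (gs2 (g \<kappa>)) N3 N4"
    using chart_frame[OF \<kappa> x] .
  show "0 < hat_metric c g \<sigma> f \<kappa> x u u" if "u \<noteq> 0" for u
    by (rule phase_chart.hat_metric_pos[OF pc V that])
next
  fix \<kappa> u v assume \<kappa>: "\<kappa> \<in> A"
  show "smooth_on (chart_image \<kappa>) (\<lambda>x. hat_metric c g \<sigma> f \<kappa> x u v)"
  proof (rule smooth_on_local)
    fix x assume x: "x \<in> chart_image \<kappa>"
    obtain V N3 N4 where V: "x \<in> V" and pc: "phase_chart A g f c \<sigma> Ft \<theta> I V \<kappa> (gs1 (g \<kappa>)) (gs2 (g \<kappa>)) N3 N4"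
      using chart_frame[OF \<kappa> x] .
    interpret pc: phase_chart A g f c \<sigma> Ft \<theta> I V \<kappa> "gs1 (g \<kappa>)" "gs2 (g \<kappa>)" N3 N4 by (rule pc)
    have "smooth_on V (\<lambda>y. pc.a.w1 \<sigma> y u * pc.a.w1 \<sigma> y v + pc.a.w2 \<sigma> y u * pc.a.w2 \<sigma> y v)"
      by (intro smooth_on_add smooth_on_mult pc.a.open_V smooth_form_smooth[OF pc.smooth_forms(1)]
          smooth_form_smooth[OF pc.smooth_forms(2)])
    then have "smooth_on V (\<lambda>y. hat_metric c g \<sigma> f \<kappa> y u v)"
      by (rule smooth_on_cong[OF pc.a.open_V, rotated]) (rule pc.hat_metric_forms[symmetric])
    then show "\<exists>V. open V \<and> x \<in> V \<and> smooth_on V (\<lambda>x. hat_metric c g \<sigma> f \<kappa> x u v)"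
      using V pc.a.open_V by blast
  qed
next
  fix \<kappa> \<kappa>' x u v assume "\<kappa> \<in> A" "\<kappa>' \<in> A" "x \<in> snd \<kappa> ` (fst \<kappa> \<inter> fst \<kappa>')"
  then show "hat_metric c g \<sigma> f \<kappa> x u v = hat_metric c g \<sigma> f \<kappa>' (rep \<kappa> (snd \<kappa>') x)
      (dd (rep \<kappa> (snd \<kappa>')) x u) (dd (rep \<kappa> (snd \<kappa>')) x v)"
    using hat_metric_transition unfolding overlap_def transition_def by blast
qed

end

section \<open>From the moduli circle to two distinct phases\<close>

lemma circle_distinct_values:
  fixes \<phi> :: "real \<Rightarrow> complex"
  assumes "continuous_on UNIV \<phi>" "\<phi> 0 = 1" "\<phi> 1 \<noteq> 1"
  shows "\<exists>t\<in>{0<..<2 * pi}. \<exists>t'\<in>{0<..<2 * pi}. \<phi> t \<noteq> \<phi> t'"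
proof -
  \<comment> \<open>Continuity at 0 brings the values at small t > 0 close to 1, hence away from the
    value at 1.\<close>
  have "(\<phi> \<longlongrightarrow> 1) (at_right 0)"
    using assms(1,2) continuous_on_eq_continuous_at[of UNIV \<phi>]
    by (metis UNIV_I isContD filterlim_at_split open_UNIV)
  then have "\<forall>\<^sub>F t in at_right 0. \<phi> t \<in> - {\<phi> 1}"
    using assms(3) by (intro topological_tendstoD) auto
  moreover have "\<forall>\<^sub>F t in at_right (0::real). t \<in> {0<..<2 * pi}"
    by (rule eventually_at_right_real) simp
  ultimately have "\<forall>\<^sub>F t in at_right 0. \<phi> t \<noteq> \<phi> 1 \<and> t \<in> {0<..<2 * pi}"
    by eventually_elim simp
  then obtain t where "\<phi> t \<noteq> \<phi> 1" "t \<in> {0<..<2 * pi}"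
    using eventually_happens'[OF trivial_limit_at_right_real] by blast
  moreover have "(1::real) \<in> {0<..<2 * pi}" using pi_gt3 by simp
  ultimately show ?thesis by blast
qed

theorem corollary53:
  fixes A :: "('m::{t2_space,second_countable_topology}) chart set"
    and g :: "'m chart \<Rightarrow> coord_metric"
    and f :: "'m \<Rightarrow> real^5"
    and c \<sigma> :: real
  assumes "oriented_surface A"
    and "riemannian_metric A g"
    and "simply_connected (UNIV :: 'm set)"
    and "isometric_immersion c A g f"
    and "nonminimal c A g f"
    and "\<sigma> = 1 \<or> \<sigma> = -1"
    and "moduli_is_circle c A g \<sigma> f"
    and "\<forall>\<kappa>\<in>A. \<forall>x\<in>chart_image \<kappa>. vtension c (g \<kappa>) \<sigma> (rep \<kappa> f) x \<noteq> 0"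
  shows "riemannian_metric A (hat_metric c g \<sigma> f) \<and>
    (\<forall>\<kappa>\<in>A. \<forall>x\<in>chart_image \<kappa>. gauss_curvature (hat_metric c g \<sigma> f \<kappa>) x = -1)"
proof -
  interpret riemannian_surface A g by unfold_locales (fact assms(1,2))+
  let ?I = "{0<..<2 * pi}"
  obtain Ft \<theta> where bij: "bij_betw (\<lambda>t. iso_class c (Ft t)) {0..<2 * pi} (moduli_pm c A g \<sigma> f)"
    and \<theta>0: "\<theta> 0 = (\<lambda>_. 0 :: real)"
    and phase: "\<And>t. t \<in> ?I \<Longrightarrow> phase_of c A g \<sigma> f (Ft t) (\<theta> t)"
    and smooth: "\<And>p. p \<notin> calH_zeros c A g \<sigma> f \<Longrightarrow> smooth_on UNIV (\<lambda>t. cis (\<theta> t p))"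
    using assms(7) unfolding moduli_is_circle_def by blast
  have imm: "isometric_immersion c A g (Ft t)" if "t \<in> ?I" for t
  proof -
    have "iso_class c (Ft t) \<in> moduli_pm c A g \<sigma> f" using bij_betwE[OF bij] that by simp
    then obtain h where "isometric_immersion c A g h" "iso_class c (Ft t) = iso_class c h"
      unfolding moduli_pm_def by blast
    then show ?thesis using isometric_immersion_iso_class[OF _ _ open_image] by blast
  qed
  have "\<exists>t\<in>?I. \<exists>t'\<in>?I. cis (\<theta> t p) \<noteq> cis (\<theta> t' p)" if p: "p \<notin> calH_zeros c A g \<sigma> f" for p
  proof (rule circle_distinct_values)
    show "continuous_on UNIV (\<lambda>t. cis (\<theta> t p))" by (rule smooth_on_continuous[OF smooth[OF p]])
    show "cis (\<theta> 0 p) = 1" unfolding \<theta>0 by simp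
    \<comment> \<open>An interior parameter: its phase lies strictly between 0 and 2 pi, so
      \<open>cis\<close> of it is not 1.\<close>
    have "(1::real) \<in> ?I" using pi_gt3 by simp
    from phase[OF this] have th: "0 < \<theta> 1 p" "\<theta> 1 p < 2 * pi" using p unfolding phase_of_def by blast+
    show "cis (\<theta> 1 p) \<noteq> 1"
    proof
      assume "cis (\<theta> 1 p) = 1"
      then have "cos (\<theta> 1 p) = 1" by (simp add: complex_eq_iff)
      then have "sin (\<theta> 1 p / 2) = 0" using cos_double_sin[of "\<theta> 1 p / 2"] by simp
      then show False using half_sine_pos[OF th] by blast
    qed
  qed
  then interpret phase_family A g f c \<sigma> Ft \<theta> ?I
    using assms(4,6,8) imm phase by unfold_locales auto
  show ?thesis using riemannian_metric_hat gauss_curvature_hat by blast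
qed

end
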